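(* Let $\mathbb{T}$ be an atomic and complete geometric theory and let $\mathcal{I}=\{\phi_i(\vec{x_i}) \mid i\in I\}$ be a set of $\mathbb{T}$-complete formulae such that for every $\mathbb{T}$-complete formula $\phi(\vec{x})$ there exists a $\mathbb{T}$-provably functional formula from some $\phi_i(\vec{x_i})$ to $\phi(\vec{x})$. Let $M$ be a model of $\mathbb{T}$ in $\mathbf{Set}$ in which each $\phi_i(\vec{x_i})$ is realized and such that for any $i\in I$ and any $\vec{a},\vec{b}\in [[\vec{x_i}.\phi_i]]_M$ there exists an automorphism $f$ of $M$ with $f(\vec{a})=\vec{b}$. Let $Aut_{\mathcal{I}}(M)$ be the group of $\mathbb{T}$-model automorphisms of $M$. Then the sets $\mathcal{I}_{\vec{a}}:=\{f:M\cong M \mid f(\vec{a})=\vec{a}\}$, where $\vec{a}\in[[\vec{x_i}.\phi_i]]_M$ for some $i\in I$, form an algebraic base for $Aut_{\mathcal{I}}(M)$, and, if $Aut_{\mathcal{I}}(M)$ is endowed with the resulting topology, there is an equivalence $$\mathbf{Sh}(\mathcal{C}_{\mathbb{T}},J_{\mathbb{T}})\simeq \mathbf{Cont}(Aut_{\mathcal{I}}(M))$$ between the classifying topos of $\mathbb{T}$ and the topos of continuous $Aut_{\mathcal{I}}(M)$-sets. This equivalence restricts to an equivalence $$\mathcal{C}^{\mathcal{I}}_{\mathbb{T}}\simeq \mathbf{Cont}_{\mathcal{I}}(Aut_{\mathcal{I}}(M)),$$ where $\mathcal{C}^{\mathcal{I}}_{\mathbb{T}}$ is the full subcategory of $\mathcal{C}_{\mathbb{T}}$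 on the formulae $\phi_i(\vec{x_i})$ and $\mathbf{Cont}_{\mathcal{I}}(Aut_{\mathcal{I}}(M))$ is the full subcategory of $\mathbf{Cont}(Aut_{\mathcal{I}}(M))$ on the $Aut_{\mathcal{I}}(M)$-sets isomorphic to one of the form $Aut_{\mathcal{I}}(M)/\mathcal{I}_{\vec{a}}$; it sends each $\phi_i(\vec{x_i})$ to the set $[[\vec{x_i}.\phi_i]]_M$ with the obvious $Aut_{\mathcal{I}}(M)$-action, and a $\mathbb{T}$-provably functional formula $\theta$ from $\phi_i$ to $\phi_j$ to the $Aut_{\mathcal{I}}(M)$-equivariant map $[[\vec{x_i}.\phi_i]]_M\to[[\vec{x_j}.\phi_j]]_M$ whose graph is the interpretation $[[\theta]]_M$.
   Context: $\mathbb{T}$ is a geometric theory over a (many-sorted first-order) signature $\Sigma$. $\mathcal{C}_{\mathbb{T}}$ is its geometric syntactic category: objects are geometric formulae-in-context over $\Sigma$ (up to renaming of variables), arrows $\phi(\vec{x})\to\psi(\vec{y})$ are $\mathbb{T}$-provable equivalence classes of $\mathbb{T}$-provably functional geometric formulae $\theta(\vec{x},\vec{y})$ (i.e. $\mathbb{T}$ proves that $\theta$ is the graph of a total single-valued map from $\phi$ to $\psi$); $J_{\mathbb{T}}$ is the syntactic (geometric) topology on it, so $\mathbf{Sh}(\mathcal{C}_{\mathbb{T}},J_{\mathbb{T}})$ is the classifying topos of $\mathbb{T}$. The theory $\mathbb{T}$ is atomic and complete if its classifying topos is atomic and two-valued. A geometric formula-in-context $\phi(\vec{x})$ is $\mathbb{T}$-complete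 if $(\phi\vdash_{\vec{x}}\bot)$ is not provable in $\mathbb{T}$ but for every geometric formula $\psi(\vec{x})$ in the same context either $(\phi\vdash_{\vec{x}}\psi)$ or $(\phi\wedge\psi\vdash_{\vec{x}}\bot)$ is provable in $\mathbb{T}$. $[[\vec{x}.\phi]]_M$ is the interpretation of $\phi(\vec{x})$ in $M$; $\phi$ is realized in $M$ if it is non-empty. An algebraic base for a group $G$ is a (non-empty) collection $\mathcal{B}$ of subgroups of $G$ such that the intersection of any two members contains a member, and every conjugate of a member is a member; there is then a unique topology making $G$ a topological group with $\mathcal{B}$ a neighbourhood basis of the identity. For a topological group $G$, $\mathbf{Cont}(G)$ is the topos of continuous left $G$-actions on discrete sets and $G$-equivariant maps; $G/U$ denotes the set of left cosets of an open subgroup $U$ with its canonical action. *)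

theory Defs
  imports "HOL-Algebra.Group_Action" "HOL-Algebra.Left_Coset" "HOL-Analysis.Analysis" "HOL-Library.Equipollence"
begin

section \<open>Categories\<close>

text \<open>Hom-sets of distinct pairs of objects are disjoint, so arrows carry their domain and
  codomain; in the concrete categories below an arrow is a triple (domain, data, codomain).\<close>

record ('o, 'a) category =
  Obj :: "'o set"
  Hom :: "'o \<Rightarrow> 'o \<Rightarrow> 'a set"
  Idn :: "'o \<Rightarrow> 'a"
  Cmp :: "'a \<Rightarrow> 'a \<Rightarrow> 'a"  \<comment> \<open>\<open>Cmp C g f\<close> is \<open>g\<close> after \<open>f\<close>\<close>

definition is_category :: "('o, 'a) category \<Rightarrow> bool" where
  "is_category C \<longleftrightarrow>
     (\<forall>X\<in>Obj C. Idn C X \<in> Hom C X X) \<and>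
     (\<forall>X\<in>Obj C. \<forall>Y\<in>Obj C. \<forall>Z\<in>Obj C. \<forall>f\<in>Hom C X Y. \<forall>g\<in>Hom C Y Z. Cmp C g f \<in> Hom C X Z) \<and>
     (\<forall>X\<in>Obj C. \<forall>Y\<in>Obj C. \<forall>f\<in>Hom C X Y. Cmp C f (Idn C X) = f \<and> Cmp C (Idn C Y) f = f) \<and>
     (\<forall>W\<in>Obj C. \<forall>X\<in>Obj C. \<forall>Y\<in>Obj C. \<forall>Z\<in>Obj C. \<forall>f\<in>Hom C W X. \<forall>g\<in>Hom C X Y. \<forall>h\<in>Hom C Y Z.
        Cmp C h (Cmp C g f) = Cmp C (Cmp C h g) f) \<and>
     (\<forall>X\<in>Obj C. \<forall>Y\<in>Obj C. \<forall>X'\<in>Obj C. \<forall>Y'\<in>Obj C.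
        Hom C X Y \<inter> Hom C X' Y' \<noteq> {} \<longrightarrow> X = X' \<and> Y = Y')"

definition op_cat :: "('o, 'a) category \<Rightarrow> ('o, 'a) category" where
  "op_cat C = \<lparr>Obj = Obj C, Hom = (\<lambda>X Y. Hom C Y X), Idn = Idn C, Cmp = (\<lambda>g f. Cmp C f g)\<rparr>"

definition full_subcat :: "('o, 'a) category \<Rightarrow> 'o set \<Rightarrow> ('o, 'a) category" where
  "full_subcat C S = C\<lparr>Obj := Obj C \<inter> S\<rparr>"

definition is_inverse_pair :: "('o, 'a) category \<Rightarrow> 'o \<Rightarrow> 'o \<Rightarrow> 'a \<Rightarrow> 'a \<Rightarrow> bool" where
  "is_inverse_pair C X Y f g \<longleftrightarrow> f \<in> Hom C X Y \<and> g \<in> Hom C Y X \<and>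
     Cmp C g f = Idn C X \<and> Cmp C f g = Idn C Y"

definition is_iso :: "('o, 'a) category \<Rightarrow> 'o \<Rightarrow> 'o \<Rightarrow> 'a \<Rightarrow> bool" where
  "is_iso C X Y f \<longleftrightarrow> (\<exists>g. is_inverse_pair C X Y f g)"

definition is_mono :: "('o, 'a) category \<Rightarrow> 'o \<Rightarrow> 'o \<Rightarrow> 'a \<Rightarrow> bool" where
  "is_mono C X Y m \<longleftrightarrow> m \<in> Hom C X Y \<and>
     (\<forall>W\<in>Obj C. \<forall>f\<in>Hom C W X. \<forall>g\<in>Hom C W X. Cmp C m f = Cmp C m g \<longrightarrow> f = g)"

definition is_initial :: "('o, 'a) category \<Rightarrow> 'o \<Rightarrow> bool" where
  "is_initial C X \<longleftrightarrow> X \<in> Obj C \<and> (\<forall>Y\<in>Obj C. \<exists>!f. f \<in> Hom C X Y)"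

definition is_terminal :: "('o, 'a) category \<Rightarrow> 'o \<Rightarrow> bool" where
  "is_terminal C X \<longleftrightarrow> X \<in> Obj C \<and> (\<forall>Y\<in>Obj C. \<exists>!f. f \<in> Hom C Y X)"

record ('o, 'a, 'p, 'b) cfunctor =
  on_ob :: "'o \<Rightarrow> 'p"
  on_ar :: "'a \<Rightarrow> 'b"

definition is_functor :: "('o, 'a) category \<Rightarrow> ('p, 'b) category \<Rightarrow> ('o, 'a, 'p, 'b) cfunctor \<Rightarrow> bool" where
  "is_functor C D F \<longleftrightarrow>
     (\<forall>X\<in>Obj C. on_ob F X \<in> Obj D) \<and>
     (\<forall>X\<in>Obj C. \<forall>Y\<in>Obj C. \<forall>f\<in>Hom C X Y. on_ar F f \<in> Hom D (on_ob F X) (on_ob F Y)) \<and>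
     (\<forall>X\<in>Obj C. on_ar F (Idn C X) = Idn D (on_ob F X)) \<and>
     (\<forall>X\<in>Obj C. \<forall>Y\<in>Obj C. \<forall>Z\<in>Obj C. \<forall>f\<in>Hom C X Y. \<forall>g\<in>Hom C Y Z.
        on_ar F (Cmp C g f) = Cmp D (on_ar F g) (on_ar F f))"

definition id_functor :: "('o, 'a, 'o, 'a) cfunctor" where
  "id_functor = \<lparr>on_ob = (\<lambda>X. X), on_ar = (\<lambda>f. f)\<rparr>"

definition comp_functor ::
  "('p, 'b, 'q, 'c) cfunctor \<Rightarrow> ('o, 'a, 'p, 'b) cfunctor \<Rightarrow> ('o, 'a, 'q, 'c) cfunctor" where
  "comp_functor G F = \<lparr>on_ob = (\<lambda>X. on_ob G (on_ob F X)), on_ar = (\<lambda>f. on_ar G (on_ar F f))\<rparr>"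

definition is_nat_trans :: "('o, 'a) category \<Rightarrow> ('p, 'b) category \<Rightarrow>
    ('o, 'a, 'p, 'b) cfunctor \<Rightarrow> ('o, 'a, 'p, 'b) cfunctor \<Rightarrow> ('o \<Rightarrow> 'b) \<Rightarrow> bool" where
  "is_nat_trans C D F G \<eta> \<longleftrightarrow>
     (\<forall>X\<in>Obj C. \<eta> X \<in> Hom D (on_ob F X) (on_ob G X)) \<and>
     (\<forall>X\<in>Obj C. \<forall>Y\<in>Obj C. \<forall>f\<in>Hom C X Y. Cmp D (on_ar G f) (\<eta> X) = Cmp D (\<eta> Y) (on_ar F f))"

definition naturally_isomorphic :: "('o, 'a) category \<Rightarrow> ('p, 'b) category \<Rightarrow>
    ('o, 'a, 'p, 'b) cfunctor \<Rightarrow> ('o, 'a, 'p, 'b) cfunctor \<Rightarrow> bool" where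
  "naturally_isomorphic C D F G \<longleftrightarrow> is_functor C D F \<and> is_functor C D G \<and>
     (\<exists>\<eta>. is_nat_trans C D F G \<eta> \<and> (\<forall>X\<in>Obj C. is_iso D (on_ob F X) (on_ob G X) (\<eta> X)))"

definition is_equivalence :: "('o, 'a) category \<Rightarrow> ('p, 'b) category \<Rightarrow> ('o, 'a, 'p, 'b) cfunctor \<Rightarrow> bool" where
  "is_equivalence C D F \<longleftrightarrow> is_category C \<and> is_category D \<and> is_functor C D F \<and>
     (\<exists>G. is_functor D C G \<and>
          naturally_isomorphic C C (comp_functor G F) id_functor \<and>
          naturally_isomorphic D D (comp_functor F G) id_functor)"

definition functor_cat :: "('o, 'a) category \<Rightarrow> ('p, 'b) category \<Rightarrow>
    (('o, 'a, 'p, 'b) cfunctor,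
     ('o, 'a, 'p, 'b) cfunctor \<times> ('o \<Rightarrow> 'b) \<times> ('o, 'a, 'p, 'b) cfunctor) category" where
  "functor_cat C D =
    \<lparr>Obj = {F. is_functor C D F \<and> on_ob F \<in> extensional (Obj C) \<and>
               on_ar F \<in> extensional (\<Union>X\<in>Obj C. \<Union>Y\<in>Obj C. Hom C X Y)},
     Hom = (\<lambda>F G. {(F, \<eta>, G) | \<eta>. is_nat_trans C D F G \<eta> \<and> \<eta> \<in> extensional (Obj C)}),
     Idn = (\<lambda>F. (F, \<lambda>X\<in>Obj C. Idn D (on_ob F X), F)),
     Cmp = (\<lambda>(G, \<epsilon>, H) (F, \<eta>, G'). (F, \<lambda>X\<in>Obj C. Cmp D (\<epsilon> X) (\<eta> X), H))\<rparr>"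


section \<open>Sets, presheaves and sheaves\<close>

text \<open>Sets are modelled by the members of a collection \<open>\<U>\<close> of subsets of a type \<open>'u\<close> that is
  closed under the set-theoretic constructions indexed by a fixed type \<open>'k\<close> (later: the type of
  formulae).  Examples are all subsets of \<open>'u\<close>, if \<open>'u\<close> absorbs \<open>'k\<close>-fold powers (for instance
  \<open>'u = 'k set\<close> with \<open>'k\<close> infinite), and the elements of a Grothendieck universe that contains a
  copy of \<open>'k\<close>.\<close>

definition set_universe :: "'k itself \<Rightarrow> 'u set set \<Rightarrow> bool" where
  "set_universe TYPE('k) \<U> \<longleftrightarrow>
     (\<forall>A\<in>\<U>. \<forall>B. B \<lesssim> A \<longrightarrow> B \<in> \<U>) \<and>
     (\<exists>A\<in>\<U>. (UNIV :: 'k set) \<lesssim> A) \<and>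
     (\<forall>F :: 'k \<Rightarrow> 'u set. range F \<subseteq> \<U> \<longrightarrow> (\<Union>k. F k) \<in> \<U>) \<and>
     (\<forall>A\<in>\<U>. \<exists>B\<in>\<U>. ((UNIV :: 'k set) \<rightarrow>\<^sub>E A) \<lesssim> B)"

lemma set_universe_UNIV:
  includes cardinal_syntax
  assumes "infinite (UNIV :: 'k set)"
  shows "set_universe TYPE('k) (UNIV :: 'k set set set)"
proof -
  have "|(UNIV::'k set) \<times> (UNIV::'k set)| =o |UNIV::'k set|"
    using assms by (rule card_of_Times_same_infinite)
  then obtain h :: "'k \<times> 'k \<Rightarrow> 'k" where h: "inj h"
    unfolding card_of_ordIso[symmetric] bij_betw_def by auto
  have 1: "(UNIV :: 'k set) \<lesssim> (UNIV :: 'k set set)"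
    unfolding lepoll_def by (intro exI[of _ "\<lambda>x. {x}"]) auto
  have 2: "((UNIV :: 'k set) \<rightarrow>\<^sub>E A) \<lesssim> (UNIV :: 'k set set)" for A :: "'k set set"
    unfolding lepoll_def
  proof (intro exI conjI)
    show "inj_on (\<lambda>f. {h (k, x) | k x. x \<in> f k}) ((UNIV :: 'k set) \<rightarrow>\<^sub>E A)"
    proof (rule inj_onI, rule ext)
      fix f g k assume e: "{h (k, x) | k x. x \<in> f k} = {h (k, x) | k x. x \<in> g k}"
      have *: "x \<in> f k \<longleftrightarrow> h (k, x) \<in> {h (k, x) | k x. x \<in> f k}" for f :: "'k \<Rightarrow> 'k set" and x
        by (auto simp: inj_eq[OF h])
      show "f k = g k"
      proof (rule Set.set_eqI)
        fix x show "x \<in> f k \<longleftrightarrow> x \<in> g k" unfolding *[of x f] *[of x g] e ..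
      qed
    qed
  qed auto
  show ?thesis unfolding set_universe_def
  proof (intro conjI ballI allI impI)
    show "\<exists>A\<in>UNIV :: 'k set set set. (UNIV :: 'k set) \<lesssim> A" using 1 by (intro bexI) auto
    show "\<exists>B\<in>UNIV :: 'k set set set. ((UNIV :: 'k set) \<rightarrow>\<^sub>E A) \<lesssim> B" for A :: "'k set set"
      using 2 by (intro bexI) auto
  qed auto
qed

type_synonym 'u map = "'u set \<times> ('u \<Rightarrow> 'u) \<times> 'u set"

definition app :: "'x \<times> ('u \<Rightarrow> 'u) \<times> 'y \<Rightarrow> 'u \<Rightarrow> 'u" where
  "app m = fst (snd m)"

definition set_cat :: "'u set set \<Rightarrow> ('u set, 'u map) category" where
  "set_cat \<U> =
    \<lparr>Obj = \<U>,
     Hom = (\<lambda>A B. {(A, h, B) | h. h \<in> A \<rightarrow>\<^sub>E B}),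
     Idn = (\<lambda>A. (A, \<lambda>x\<in>A. x, A)),
     Cmp = (\<lambda>(B, k, D) (A, h, B'). (A, compose A k h, D))\<rparr>"

type_synonym ('o, 'a, 'u) presheaf = "('o, 'a, 'u set, 'u map) cfunctor"

type_synonym ('o, 'a, 'u) presheaf_map =
  "('o, 'a, 'u) presheaf \<times> ('o \<Rightarrow> 'u map) \<times> ('o, 'a, 'u) presheaf"

definition presheaf_cat :: "'u set set \<Rightarrow> ('o, 'a) category \<Rightarrow>
    (('o, 'a, 'u) presheaf, ('o, 'a, 'u) presheaf_map) category" where
  "presheaf_cat \<U> C = functor_cat (op_cat C) (set_cat \<U>)"

definition is_sieve :: "('o, 'a) category \<Rightarrow> 'o \<Rightarrow> 'a set \<Rightarrow> bool" where
  "is_sieve C X S \<longleftrightarrow> S \<subseteq> (\<Union>Y\<in>Obj C. Hom C Y X) \<and>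
     (\<forall>Y\<in>Obj C. \<forall>Z\<in>Obj C. \<forall>f\<in>S \<inter> Hom C Y X. \<forall>g\<in>Hom C Z Y. Cmp C f g \<in> S)"

definition matching_family :: "('o, 'a) category \<Rightarrow> ('o, 'a, 'u) presheaf \<Rightarrow> 'o \<Rightarrow> 'a set \<Rightarrow> ('a \<Rightarrow> 'u) \<Rightarrow> bool" where
  "matching_family C P X S x \<longleftrightarrow>
     (\<forall>Y\<in>Obj C. \<forall>f\<in>S \<inter> Hom C Y X. x f \<in> on_ob P Y) \<and>
     (\<forall>Y\<in>Obj C. \<forall>Z\<in>Obj C. \<forall>f\<in>S \<inter> Hom C Y X. \<forall>g\<in>Hom C Z Y.
        app (on_ar P g) (x f) = x (Cmp C f g))"

definition is_sheaf :: "('o, 'a) category \<Rightarrow> ('o \<Rightarrow> 'a set set) \<Rightarrow> ('o, 'a, 'u) presheaf \<Rightarrow> bool" where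
  "is_sheaf C J P \<longleftrightarrow>
     (\<forall>X\<in>Obj C. \<forall>S\<in>J X. \<forall>x. matching_family C P X S x \<longrightarrow>
        (\<exists>!y. y \<in> on_ob P X \<and> (\<forall>f\<in>S. app (on_ar P f) y = x f)))"

definition sheaf_cat :: "'u set set \<Rightarrow> ('o, 'a) category \<Rightarrow> ('o \<Rightarrow> 'a set set) \<Rightarrow>
    (('o, 'a, 'u) presheaf, ('o, 'a, 'u) presheaf_map) category" where
  "sheaf_cat \<U> C J = full_subcat (presheaf_cat \<U> C) {P. is_sheaf C J P}"

text \<open>The Yoneda embedding; \<open>code\<close> is an injective coding of the arrows of \<open>C\<close> in \<open>'u\<close>, needed
  because presheaves take subsets of \<open>'u\<close> as values.\<close>

definition yoneda :: "('a \<Rightarrow> 'u) \<Rightarrow> ('o, 'a) category \<Rightarrow>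
    ('o, 'a, ('o, 'a, 'u) presheaf, ('o, 'a, 'u) presheaf_map) cfunctor" where
  "yoneda code C =
    (let arrows = (\<Union>X\<in>Obj C. \<Union>Y\<in>Obj C. Hom C X Y);
         dec = inv_into arrows code;
         rep = (\<lambda>X. \<lparr>on_ob = (\<lambda>Z\<in>Obj C. code ` Hom C Z X),
                      on_ar = (\<lambda>g\<in>arrows. THE m. \<exists>W\<in>Obj C. \<exists>Z\<in>Obj C. g \<in> Hom C W Z \<and>
                         m = (code ` Hom C Z X,
                              \<lambda>u\<in>code ` Hom C Z X. code (Cmp C (dec u) g),
                              code ` Hom C W X))\<rparr>)
     in \<lparr>on_ob = rep,
         on_ar = (\<lambda>f. THE \<tau>. \<exists>X\<in>Obj C. \<exists>Y\<in>Obj C. f \<in> Hom C X Y \<and>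
            \<tau> = (rep X,
                 \<lambda>Z\<in>Obj C. (code ` Hom C Z X,
                             \<lambda>u\<in>code ` Hom C Z X. code (Cmp C f (dec u)),
                             code ` Hom C Z Y),
                 rep Y))\<rparr>)"


section \<open>Atomic and two-valued toposes\<close>

text \<open>\<open>X\<close> has exactly two subobjects, namely \<open>0\<close> and \<open>X\<close> itself.\<close>

definition two_subobjects :: "('o, 'a) category \<Rightarrow> 'o \<Rightarrow> bool" where
  "two_subobjects E X \<longleftrightarrow> X \<in> Obj E \<and> \<not> is_initial E X \<and>
     (\<forall>Y\<in>Obj E. \<forall>m. is_mono E Y X m \<longrightarrow> is_initial E Y \<or> is_iso E Y X m)"

definition is_atom :: "('o, 'a) category \<Rightarrow> 'o \<Rightarrow> bool" where
  "is_atom E A \<longleftrightarrow> two_subobjects E A"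

definition two_valued_topos :: "('o, 'a) category \<Rightarrow> bool" where
  "two_valued_topos E \<longleftrightarrow> (\<exists>X. is_terminal E X) \<and> (\<forall>X. is_terminal E X \<longrightarrow> two_subobjects E X)"

text \<open>The coproduct cocone is given as a set of arrows, which loses nothing here: in a topos
  coproduct injections of non-initial objects are pairwise distinct.\<close>

definition is_coproduct_cocone :: "('o, 'a) category \<Rightarrow> 'o \<Rightarrow> 'o set \<Rightarrow> 'a set \<Rightarrow> bool" where
  "is_coproduct_cocone E X As K \<longleftrightarrow>
     As \<subseteq> Obj E \<and> K \<subseteq> (\<Union>A\<in>As. Hom E A X) \<and>
     (\<forall>Y\<in>Obj E. \<forall>g. (\<forall>A\<in>As. \<forall>k\<in>K \<inter> Hom E A X. g k \<in> Hom E A Y) \<longrightarrow>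
        (\<exists>!h. h \<in> Hom E X Y \<and> (\<forall>k\<in>K. Cmp E h k = g k)))"

definition atomic_topos :: "('o, 'a) category \<Rightarrow> bool" where
  "atomic_topos E \<longleftrightarrow> (\<forall>X\<in>Obj E. \<exists>K. is_coproduct_cocone E X {A. is_atom E A} K)"


section \<open>Geometric logic\<close>

record ('s, 'f, 'r) signature =
  Sorts :: "'s set"
  Funs :: "'f set"
  Rels :: "'r set"
  fdom :: "'f \<Rightarrow> 's list"
  fcod :: "'f \<Rightarrow> 's"
  rdom :: "'r \<Rightarrow> 's list"

definition is_signature :: "('s, 'f, 'r) signature \<Rightarrow> bool" where
  "is_signature \<Sigma> \<longleftrightarrow>
     (\<forall>f\<in>Funs \<Sigma>. set (fdom \<Sigma> f) \<subseteq> Sorts \<Sigma> \<and> fcod \<Sigma> f \<in> Sorts \<Sigma>) \<and>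
     (\<forall>r\<in>Rels \<Sigma>. set (rdom \<Sigma> r) \<subseteq> Sorts \<Sigma>)"

text \<open>Variables are de Bruijn indices: in a context, i.e. a list \<open>\<Gamma>\<close> of sorts, \<open>Var n\<close> is the \<open>n\<close>-th
  variable and has sort \<open>\<Gamma> ! n\<close>, and \<open>Exi s \<phi>\<close> in context \<open>\<Gamma>\<close> binds index \<open>0\<close> of \<open>\<phi>\<close> in context
  \<open>s # \<Gamma>\<close>.  So formulae-in-context are automatically taken up to renaming of variables.
  \<open>Disj I F\<close> is the disjunction of the \<open>F i\<close> with \<open>i \<in> I\<close>; values of \<open>F\<close> outside \<open>I\<close> are
  irrelevant.\<close>

datatype 'f trm = Var nat | Fun 'f "'f trm list"

datatype ('s, 'f, 'r, 'i) form =
    Verum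
  | Eql "'f trm" "'f trm"
  | Rela 'r "'f trm list"
  | Conj "('s, 'f, 'r, 'i) form" "('s, 'f, 'r, 'i) form"
  | Disj "'i set" "'i \<Rightarrow> ('s, 'f, 'r, 'i) form"
  | Exi 's "('s, 'f, 'r, 'i) form"

definition Falsum :: "('s, 'f, 'r, 'i) form" where
  "Falsum = Disj {} (\<lambda>_. Verum)"

text \<open>Disjunctions are indexed by subsets of the type \<open>'i\<close>.  Every set-indexed disjunction of
  geometric formulae over \<open>\<Sigma>\<close> is provably equivalent to one indexed by finitary formulae over
  \<open>\<Sigma>\<close>; hence, if \<open>'i\<close> is infinite and at least as large as \<open>\<Sigma>\<close>, then up to provable
  equivalence all geometric formulae are present.\<close>

definition ample_index :: "'i itself \<Rightarrow> ('s, 'f, 'r) signature \<Rightarrow> bool" where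
  "ample_index TYPE('i) \<Sigma> \<longleftrightarrow> infinite (UNIV :: 'i set) \<and>
     Sorts \<Sigma> \<lesssim> (UNIV :: 'i set) \<and> Funs \<Sigma> \<lesssim> (UNIV :: 'i set) \<and> Rels \<Sigma> \<lesssim> (UNIV :: 'i set)"

inductive has_sort :: "('s, 'f, 'r) signature \<Rightarrow> 's list \<Rightarrow> 'f trm \<Rightarrow> 's \<Rightarrow> bool" for \<Sigma> \<Gamma> where
  "n < length \<Gamma> \<Longrightarrow> has_sort \<Sigma> \<Gamma> (Var n) (\<Gamma> ! n)"
| "f \<in> Funs \<Sigma> \<Longrightarrow> list_all2 (has_sort \<Sigma> \<Gamma>) ts (fdom \<Sigma> f) \<Longrightarrow> has_sort \<Sigma> \<Gamma> (Fun f ts) (fcod \<Sigma> f)"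

primrec wf_form :: "('s, 'f, 'r) signature \<Rightarrow> ('s, 'f, 'r, 'i) form \<Rightarrow> 's list \<Rightarrow> bool" where
  "wf_form \<Sigma> Verum \<Gamma> = True"
| "wf_form \<Sigma> (Eql t u) \<Gamma> = (\<exists>s. has_sort \<Sigma> \<Gamma> t s \<and> has_sort \<Sigma> \<Gamma> u s)"
| "wf_form \<Sigma> (Rela r ts) \<Gamma> = (r \<in> Rels \<Sigma> \<and> list_all2 (has_sort \<Sigma> \<Gamma>) ts (rdom \<Sigma> r))"
| "wf_form \<Sigma> (Conj \<phi> \<psi>) \<Gamma> = (wf_form \<Sigma> \<phi> \<Gamma> \<and> wf_form \<Sigma> \<psi> \<Gamma>)"
| "wf_form \<Sigma> (Disj I F) \<Gamma> = (\<forall>i\<in>I. wf_form \<Sigma> (F i) \<Gamma>)"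
| "wf_form \<Sigma> (Exi s \<phi>) \<Gamma> = (s \<in> Sorts \<Sigma> \<and> wf_form \<Sigma> \<phi> (s # \<Gamma>))"

type_synonym ('s, 'f, 'r, 'i) fic = "'s list \<times> ('s, 'f, 'r, 'i) form"

definition formulae_in_context :: "('s, 'f, 'r) signature \<Rightarrow> ('s, 'f, 'r, 'i) fic set" where
  "formulae_in_context \<Sigma> = {(\<Gamma>, \<phi>). set \<Gamma> \<subseteq> Sorts \<Sigma> \<and> wf_form \<Sigma> \<phi> \<Gamma>}"

primrec subst_trm :: "(nat \<Rightarrow> 'f trm) \<Rightarrow> 'f trm \<Rightarrow> 'f trm" where
  "subst_trm \<sigma> (Var n) = \<sigma> n"
| "subst_trm \<sigma> (Fun f ts) = Fun f (map (subst_trm \<sigma>) ts)"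

definition under_binder :: "(nat \<Rightarrow> 'f trm) \<Rightarrow> nat \<Rightarrow> 'f trm" where
  "under_binder \<sigma> n = (case n of 0 \<Rightarrow> Var 0 | Suc m \<Rightarrow> subst_trm (\<lambda>k. Var (Suc k)) (\<sigma> m))"

primrec subst_form :: "('s, 'f, 'r, 'i) form \<Rightarrow> (nat \<Rightarrow> 'f trm) \<Rightarrow> ('s, 'f, 'r, 'i) form" where
  "subst_form Verum \<sigma> = Verum"
| "subst_form (Eql t u) \<sigma> = Eql (subst_trm \<sigma> t) (subst_trm \<sigma> u)"
| "subst_form (Rela r ts) \<sigma> = Rela r (map (subst_trm \<sigma>) ts)"
| "subst_form (Conj \<phi> \<psi>) \<sigma> = Conj (subst_form \<phi> \<sigma>) (subst_form \<psi> \<sigma>)"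
| "subst_form (Disj I F) \<sigma> = Disj I (\<lambda>i. subst_form (F i) \<sigma>)"
| "subst_form (Exi s \<phi>) \<sigma> = Exi s (subst_form \<phi> (under_binder \<sigma>))"

definition ren :: "(nat \<Rightarrow> nat) \<Rightarrow> ('s, 'f, 'r, 'i) form \<Rightarrow> ('s, 'f, 'r, 'i) form" where
  "ren \<rho> \<phi> = subst_form \<phi> (\<lambda>n. Var (\<rho> n))"

text \<open>A sequent \<open>(\<Gamma>, \<phi>, \<psi>)\<close> stands for \<open>\<phi> \<turnstile>\<^sub>\<Gamma> \<psi>\<close>.\<close>

type_synonym ('s, 'f, 'r, 'i) sequent =
  "'s list \<times> ('s, 'f, 'r, 'i) form \<times> ('s, 'f, 'r, 'i) form"

definition is_theory :: "('s, 'f, 'r) signature \<Rightarrow> ('s, 'f, 'r, 'i) sequent set \<Rightarrow> bool" where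
  "is_theory \<Sigma> \<T> \<longleftrightarrow>
     (\<forall>(\<Gamma>, \<phi>, \<psi>)\<in>\<T>. (\<Gamma>, \<phi>) \<in> formulae_in_context \<Sigma> \<and> (\<Gamma>, \<psi>) \<in> formulae_in_context \<Sigma>)"

text \<open>Provability in the sequent calculus of geometric logic.  The context is part of the sequent
  and may only be changed by substitution, so empty sorts are treated correctly.\<close>

inductive prv :: "('s, 'f, 'r) signature \<Rightarrow> ('s, 'f, 'r, 'i) sequent set \<Rightarrow>
    's list \<Rightarrow> ('s, 'f, 'r, 'i) form \<Rightarrow> ('s, 'f, 'r, 'i) form \<Rightarrow> bool" for \<Sigma> \<T> where
  Axm: "(\<Gamma>, \<phi>, \<psi>) \<in> \<T> \<Longrightarrow> prv \<Sigma> \<T> \<Gamma> \<phi> \<psi>"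
| Ident: "(\<Gamma>, \<phi>) \<in> formulae_in_context \<Sigma> \<Longrightarrow> prv \<Sigma> \<T> \<Gamma> \<phi> \<phi>"
| Cut: "prv \<Sigma> \<T> \<Gamma> \<phi> \<psi> \<Longrightarrow> prv \<Sigma> \<T> \<Gamma> \<psi> \<delta> \<Longrightarrow> prv \<Sigma> \<T> \<Gamma> \<phi> \<delta>"
| Subst: "prv \<Sigma> \<T> \<Gamma> \<phi> \<psi> \<Longrightarrow> set \<Delta> \<subseteq> Sorts \<Sigma> \<Longrightarrow> \<forall>n<length \<Gamma>. has_sort \<Sigma> \<Delta> (\<sigma> n) (\<Gamma> ! n) \<Longrightarrow>
    prv \<Sigma> \<T> \<Delta> (subst_form \<phi> \<sigma>) (subst_form \<psi> \<sigma>)"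
| Eq_refl: "set \<Gamma> \<subseteq> Sorts \<Sigma> \<Longrightarrow> n < length \<Gamma> \<Longrightarrow> prv \<Sigma> \<T> \<Gamma> Verum (Eql (Var n) (Var n))"
| Eq_subst: "(\<Gamma>, \<phi>) \<in> formulae_in_context \<Sigma> \<Longrightarrow> m < length \<Gamma> \<Longrightarrow> n < length \<Gamma> \<Longrightarrow> \<Gamma> ! m = \<Gamma> ! n \<Longrightarrow>
    prv \<Sigma> \<T> \<Gamma> (Conj (Eql (Var m) (Var n)) \<phi>) (subst_form \<phi> (Var(m := Var n)))"
| Verum_intro: "(\<Gamma>, \<phi>) \<in> formulae_in_context \<Sigma> \<Longrightarrow> prv \<Sigma> \<T> \<Gamma> \<phi> Verum"
| Conj_left: "(\<Gamma>, Conj \<phi> \<psi>) \<in> formulae_in_context \<Sigma> \<Longrightarrow> prv \<Sigma> \<T> \<Gamma> (Conj \<phi> \<psi>) \<phi>"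
| Conj_right: "(\<Gamma>, Conj \<phi> \<psi>) \<in> formulae_in_context \<Sigma> \<Longrightarrow> prv \<Sigma> \<T> \<Gamma> (Conj \<phi> \<psi>) \<psi>"
| Conj_intro: "prv \<Sigma> \<T> \<Gamma> \<phi> \<psi> \<Longrightarrow> prv \<Sigma> \<T> \<Gamma> \<phi> \<delta> \<Longrightarrow> prv \<Sigma> \<T> \<Gamma> \<phi> (Conj \<psi> \<delta>)"
| Disj_intro: "(\<Gamma>, Disj I F) \<in> formulae_in_context \<Sigma> \<Longrightarrow> i \<in> I \<Longrightarrow> prv \<Sigma> \<T> \<Gamma> (F i) (Disj I F)"
| Disj_elim: "(\<Gamma>, \<psi>) \<in> formulae_in_context \<Sigma> \<Longrightarrow> \<forall>i\<in>I. prv \<Sigma> \<T> \<Gamma> (F i) \<psi> \<Longrightarrow> prv \<Sigma> \<T> \<Gamma> (Disj I F) \<psi>"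
| Exi_adj1: "(\<Gamma>, \<psi>) \<in> formulae_in_context \<Sigma> \<Longrightarrow> s \<in> Sorts \<Sigma> \<Longrightarrow>
    prv \<Sigma> \<T> (s # \<Gamma>) \<phi> (ren Suc \<psi>) \<Longrightarrow> prv \<Sigma> \<T> \<Gamma> (Exi s \<phi>) \<psi>"
| Exi_adj2: "prv \<Sigma> \<T> \<Gamma> (Exi s \<phi>) \<psi> \<Longrightarrow> prv \<Sigma> \<T> (s # \<Gamma>) \<phi> (ren Suc \<psi>)"
| Distributive: "(\<Gamma>, Conj \<phi> (Disj I F)) \<in> formulae_in_context \<Sigma> \<Longrightarrow>
    prv \<Sigma> \<T> \<Gamma> (Conj \<phi> (Disj I F)) (Disj I (\<lambda>i. Conj \<phi> (F i)))"
| Frobenius: "(\<Gamma>, Conj \<phi> (Exi s \<psi>)) \<in> formulae_in_context \<Sigma> \<Longrightarrow>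
    prv \<Sigma> \<T> \<Gamma> (Conj \<phi> (Exi s \<psi>)) (Exi s (Conj (ren Suc \<phi>) \<psi>))"

definition complete_formula :: "('s, 'f, 'r) signature \<Rightarrow> ('s, 'f, 'r, 'i) sequent set \<Rightarrow>
    ('s, 'f, 'r, 'i) fic \<Rightarrow> bool" where
  "complete_formula \<Sigma> \<T> = (\<lambda>(\<Gamma>, \<phi>). (\<Gamma>, \<phi>) \<in> formulae_in_context \<Sigma> \<and>
     \<not> prv \<Sigma> \<T> \<Gamma> \<phi> Falsum \<and>
     (\<forall>\<psi>. (\<Gamma>, \<psi>) \<in> formulae_in_context \<Sigma> \<longrightarrow>
        prv \<Sigma> \<T> \<Gamma> \<phi> \<psi> \<or> prv \<Sigma> \<T> \<Gamma> (Conj \<phi> \<psi>) Falsum))"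


section \<open>The geometric syntactic category\<close>

text \<open>\<open>Exis \<Delta> \<phi>\<close> binds the whole initial segment \<open>\<Delta>\<close> of the context \<open>\<Delta> @ \<Gamma>\<close> of \<open>\<phi>\<close>.\<close>

primrec Exis :: "'s list \<Rightarrow> ('s, 'f, 'r, 'i) form \<Rightarrow> ('s, 'f, 'r, 'i) form" where
  "Exis [] \<phi> = \<phi>"
| "Exis (s # \<Delta>) \<phi> = Exis \<Delta> (Exi s \<phi>)"

text \<open>The conjunction of the equations between the \<open>d\<close> variables starting at index \<open>m\<close> and the
  \<open>d\<close> variables starting at index \<open>n\<close>.\<close>

definition tuple_eq :: "nat \<Rightarrow> nat \<Rightarrow> nat \<Rightarrow> ('s, 'f, 'r, 'i) form" where
  "tuple_eq m n d = foldr (\<lambda>j. Conj (Eql (Var (m + j)) (Var (n + j)))) [0..<d] Verum"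

text \<open>\<open>\<theta>\<close> lives in the context \<open>\<Gamma> @ \<Delta>\<close> (source variables first).  The three provability
  conditions are
  \<open>\<theta>(x,y) \<turnstile> \<phi>(x) \<and> \<psi>(y)\<close>, \<open>\<theta>(x,y) \<and> \<theta>(x,y') \<turnstile> y = y'\<close> and \<open>\<phi>(x) \<turnstile> \<exists>y. \<theta>(x,y)\<close>.\<close>

definition prv_functional :: "('s, 'f, 'r) signature \<Rightarrow> ('s, 'f, 'r, 'i) sequent set \<Rightarrow>
    ('s, 'f, 'r, 'i) fic \<Rightarrow> ('s, 'f, 'r, 'i) fic \<Rightarrow> ('s, 'f, 'r, 'i) form \<Rightarrow> bool" where
  "prv_functional \<Sigma> \<T> = (\<lambda>(\<Gamma>, \<phi>) (\<Delta>, \<psi>) \<theta>.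
     let c = length \<Gamma>; d = length \<Delta> in
     (\<Gamma> @ \<Delta>, \<theta>) \<in> formulae_in_context \<Sigma> \<and>
     prv \<Sigma> \<T> (\<Gamma> @ \<Delta>) \<theta> (Conj \<phi> (ren (\<lambda>n. c + n) \<psi>)) \<and>
     prv \<Sigma> \<T> (\<Gamma> @ \<Delta> @ \<Delta>) (Conj \<theta> (ren (\<lambda>n. if n < c then n else n + d) \<theta>)) (tuple_eq c (c + d) d) \<and>
     prv \<Sigma> \<T> \<Gamma> \<phi> (Exis \<Delta> (ren (\<lambda>n. if n < c then d + n else n - c) \<theta>)))"

definition prv_class :: "('s, 'f, 'r) signature \<Rightarrow> ('s, 'f, 'r, 'i) sequent set \<Rightarrow>
    's list \<Rightarrow> ('s, 'f, 'r, 'i) form \<Rightarrow> ('s, 'f, 'r, 'i) form set" where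
  "prv_class \<Sigma> \<T> \<Gamma> \<theta> = {\<theta>'. prv \<Sigma> \<T> \<Gamma> \<theta> \<theta>' \<and> prv \<Sigma> \<T> \<Gamma> \<theta>' \<theta>}"

type_synonym ('s, 'f, 'r, 'i) syn_arrow =
  "('s, 'f, 'r, 'i) fic \<times> ('s, 'f, 'r, 'i) form set \<times> ('s, 'f, 'r, 'i) fic"

definition syn_arrow :: "('s, 'f, 'r) signature \<Rightarrow> ('s, 'f, 'r, 'i) sequent set \<Rightarrow>
    ('s, 'f, 'r, 'i) fic \<Rightarrow> ('s, 'f, 'r, 'i) fic \<Rightarrow> ('s, 'f, 'r, 'i) form \<Rightarrow>
    ('s, 'f, 'r, 'i) syn_arrow" where
  "syn_arrow \<Sigma> \<T> X Y \<theta> = (X, prv_class \<Sigma> \<T> (fst X @ fst Y) \<theta>, Y)"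

text \<open>The composite \<open>\<exists>y. \<theta>(x,y) \<and> \<gamma>(y,z)\<close> in context \<open>\<Gamma> @ \<Xi>\<close>; under the quantifiers the
  context is \<open>\<Delta> @ \<Gamma> @ \<Xi>\<close>.\<close>

definition comp_form :: "'s list \<Rightarrow> 's list \<Rightarrow>
    ('s, 'f, 'r, 'i) form \<Rightarrow> ('s, 'f, 'r, 'i) form \<Rightarrow> ('s, 'f, 'r, 'i) form" where
  "comp_form \<Gamma> \<Delta> \<theta> \<gamma> =
     (let c = length \<Gamma>; d = length \<Delta> in
      Exis \<Delta> (Conj (ren (\<lambda>n. if n < c then d + n else n - c) \<theta>)
                    (ren (\<lambda>n. if n < d then n else c + n) \<gamma>)))"

definition id_form :: "('s, 'f, 'r, 'i) fic \<Rightarrow> ('s, 'f, 'r, 'i) form" where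
  "id_form = (\<lambda>(\<Gamma>, \<phi>). Conj \<phi> (tuple_eq 0 (length \<Gamma>) (length \<Gamma>)))"

definition syn_cat :: "('s, 'f, 'r) signature \<Rightarrow> ('s, 'f, 'r, 'i) sequent set \<Rightarrow>
    (('s, 'f, 'r, 'i) fic, ('s, 'f, 'r, 'i) syn_arrow) category" where
  "syn_cat \<Sigma> \<T> =
    \<lparr>Obj = formulae_in_context \<Sigma>,
     Hom = (\<lambda>X Y. {syn_arrow \<Sigma> \<T> X Y \<theta> | \<theta>. prv_functional \<Sigma> \<T> X Y \<theta>}),
     Idn = (\<lambda>X. syn_arrow \<Sigma> \<T> X X (id_form X)),
     Cmp = (\<lambda>(Y, R, Z) (X, S, Y').
        (X, \<Union>\<theta>\<in>S. \<Union>\<gamma>\<in>R. prv_class \<Sigma> \<T> (fst X @ fst Z) (comp_form (fst X) (fst Y) \<theta> \<gamma>), Z))\<rparr>"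

text \<open>The covering sieves of the geometric topology are those containing a small family
  \<open>\<theta>\<^sub>k : \<phi>\<^sub>k(x\<^sub>k) \<rightarrow> \<phi>(x)\<close> such that \<open>\<phi> \<turnstile> \<Or>\<^sub>k \<exists>x\<^sub>k. \<theta>\<^sub>k(x\<^sub>k,x)\<close> is provable.\<close>

definition syn_topology :: "('s, 'f, 'r) signature \<Rightarrow> ('s, 'f, 'r, 'i) sequent set \<Rightarrow>
    ('s, 'f, 'r, 'i) fic \<Rightarrow> ('s, 'f, 'r, 'i) syn_arrow set set" where
  "syn_topology \<Sigma> \<T> X = {S. is_sieve (syn_cat \<Sigma> \<T>) X S \<and>
     (\<exists>(K :: 'i set) Y \<theta>.
        (\<forall>k\<in>K. Y k \<in> formulae_in_context \<Sigma> \<and> prv_functional \<Sigma> \<T> (Y k) X (\<theta> k) \<and>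
                syn_arrow \<Sigma> \<T> (Y k) X (\<theta> k) \<in> S) \<and>
        prv \<Sigma> \<T> (fst X) (snd X) (Disj K (\<lambda>k. Exis (fst (Y k)) (\<theta> k))))}"

definition classifying_topos :: "'u set set \<Rightarrow> ('s, 'f, 'r) signature \<Rightarrow> ('s, 'f, 'r, 'i) sequent set \<Rightarrow>
    ((('s, 'f, 'r, 'i) fic, ('s, 'f, 'r, 'i) syn_arrow, 'u) presheaf,
     (('s, 'f, 'r, 'i) fic, ('s, 'f, 'r, 'i) syn_arrow, 'u) presheaf_map) category" where
  "classifying_topos \<U> \<Sigma> \<T> = sheaf_cat \<U> (syn_cat \<Sigma> \<T>) (syn_topology \<Sigma> \<T>)"

definition atomic_complete_theory :: "'u set set \<Rightarrow> ('s, 'f, 'r) signature \<Rightarrow>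
    ('s, 'f, 'r, 'i) sequent set \<Rightarrow> bool" where
  "atomic_complete_theory \<U> \<Sigma> \<T> \<longleftrightarrow>
     atomic_topos (classifying_topos \<U> \<Sigma> \<T>) \<and> two_valued_topos (classifying_topos \<U> \<Sigma> \<T>)"


section \<open>Models in Set\<close>

record ('s, 'f, 'r, 'u) interp =
  Car :: "'s \<Rightarrow> 'u set"
  FunI :: "'f \<Rightarrow> 'u list \<Rightarrow> 'u"
  RelI :: "'r \<Rightarrow> 'u list set"

definition tuples :: "('s, 'f, 'r, 'u) interp \<Rightarrow> 's list \<Rightarrow> 'u list set" where
  "tuples M \<Gamma> = {a. list_all2 (\<lambda>x s. x \<in> Car M s) a \<Gamma>}"

definition is_structure :: "'u set set \<Rightarrow> ('s, 'f, 'r) signature \<Rightarrow> ('s, 'f, 'r, 'u) interp \<Rightarrow> bool" where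
  "is_structure \<U> \<Sigma> M \<longleftrightarrow>
     (\<forall>s\<in>Sorts \<Sigma>. Car M s \<in> \<U>) \<and>
     (\<forall>f\<in>Funs \<Sigma>. \<forall>a\<in>tuples M (fdom \<Sigma> f). FunI M f a \<in> Car M (fcod \<Sigma> f)) \<and>
     (\<forall>r\<in>Rels \<Sigma>. RelI M r \<subseteq> tuples M (rdom \<Sigma> r))"

primrec eval :: "('s, 'f, 'r, 'u) interp \<Rightarrow> 'u list \<Rightarrow> 'f trm \<Rightarrow> 'u" where
  "eval M a (Var n) = a ! n"
| "eval M a (Fun f ts) = FunI M f (map (eval M a) ts)"

primrec sat :: "('s, 'f, 'r, 'u) interp \<Rightarrow> ('s, 'f, 'r, 'i) form \<Rightarrow> 'u list \<Rightarrow> bool" where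
  "sat M Verum a = True"
| "sat M (Eql t u) a = (eval M a t = eval M a u)"
| "sat M (Rela r ts) a = (map (eval M a) ts \<in> RelI M r)"
| "sat M (Conj \<phi> \<psi>) a = (sat M \<phi> a \<and> sat M \<psi> a)"
| "sat M (Disj I F) a = (\<exists>i\<in>I. sat M (F i) a)"
| "sat M (Exi s \<phi>) a = (\<exists>x\<in>Car M s. sat M \<phi> (x # a))"

definition ext :: "('s, 'f, 'r, 'u) interp \<Rightarrow> ('s, 'f, 'r, 'i) fic \<Rightarrow> 'u list set" where
  "ext M = (\<lambda>(\<Gamma>, \<phi>). {a \<in> tuples M \<Gamma>. sat M \<phi> a})"

definition is_model :: "'u set set \<Rightarrow> ('s, 'f, 'r) signature \<Rightarrow> ('s, 'f, 'r, 'i) sequent set \<Rightarrow>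
    ('s, 'f, 'r, 'u) interp \<Rightarrow> bool" where
  "is_model \<U> \<Sigma> \<T> M \<longleftrightarrow> is_structure \<U> \<Sigma> M \<and> (\<forall>(\<Gamma>, \<phi>, \<psi>)\<in>\<T>. ext M (\<Gamma>, \<phi>) \<subseteq> ext M (\<Gamma>, \<psi>))"

text \<open>The action of a sort-indexed family of maps on tuples of sorts \<open>\<Gamma>\<close>.\<close>

definition tup_map :: "'s list \<Rightarrow> ('s \<Rightarrow> 'u \<Rightarrow> 'u) \<Rightarrow> 'u list \<Rightarrow> 'u list" where
  "tup_map \<Gamma> f a = map2 f \<Gamma> a"

definition automorphisms :: "('s, 'f, 'r) signature \<Rightarrow> ('s, 'f, 'r, 'u) interp \<Rightarrow> ('s \<Rightarrow> 'u \<Rightarrow> 'u) set" where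
  "automorphisms \<Sigma> M = {f \<in> (\<Pi>\<^sub>E s\<in>Sorts \<Sigma>. Bij (Car M s)).
     (\<forall>g\<in>Funs \<Sigma>. \<forall>a\<in>tuples M (fdom \<Sigma> g).
        f (fcod \<Sigma> g) (FunI M g a) = FunI M g (tup_map (fdom \<Sigma> g) f a)) \<and>
     (\<forall>r\<in>Rels \<Sigma>. \<forall>a\<in>tuples M (rdom \<Sigma> r). a \<in> RelI M r \<longleftrightarrow> tup_map (rdom \<Sigma> r) f a \<in> RelI M r)}"

definition Aut :: "('s, 'f, 'r) signature \<Rightarrow> ('s, 'f, 'r, 'u) interp \<Rightarrow> ('s \<Rightarrow> 'u \<Rightarrow> 'u) monoid" where
  "Aut \<Sigma> M =
    \<lparr>carrier = automorphisms \<Sigma> M,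
     monoid.mult = (\<lambda>g f. \<lambda>s\<in>Sorts \<Sigma>. compose (Car M s) (g s) (f s)),
     one = (\<lambda>s\<in>Sorts \<Sigma>. \<lambda>x\<in>Car M s. x)\<rparr>"

definition tuple_stabilizer :: "('s, 'f, 'r) signature \<Rightarrow> ('s, 'f, 'r, 'u) interp \<Rightarrow>
    's list \<Rightarrow> 'u list \<Rightarrow> ('s \<Rightarrow> 'u \<Rightarrow> 'u) set" where
  "tuple_stabilizer \<Sigma> M \<Gamma> a = {f \<in> automorphisms \<Sigma> M. tup_map \<Gamma> f a = a}"

definition stabilizer_base :: "('s, 'f, 'r) signature \<Rightarrow> ('s, 'f, 'r, 'u) interp \<Rightarrow>
    ('s, 'f, 'r, 'i) fic set \<Rightarrow> ('s \<Rightarrow> 'u \<Rightarrow> 'u) set set" where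
  "stabilizer_base \<Sigma> M \<I> = {tuple_stabilizer \<Sigma> M \<Gamma> a | \<Gamma> \<phi> a. (\<Gamma>, \<phi>) \<in> \<I> \<and> a \<in> ext M (\<Gamma>, \<phi>)}"


section \<open>Topological groups and continuous actions\<close>

definition topological_group :: "('g, 'm) monoid_scheme \<Rightarrow> 'g topology \<Rightarrow> bool" where
  "topological_group G \<tau> \<longleftrightarrow> group G \<and> topspace \<tau> = carrier G \<and>
     continuous_map (prod_topology \<tau> \<tau>) \<tau> (\<lambda>(x, y). x \<otimes>\<^bsub>G\<^esub> y) \<and>
     continuous_map \<tau> \<tau> (\<lambda>x. inv\<^bsub>G\<^esub> x)"

definition algebraic_base :: "('g, 'm) monoid_scheme \<Rightarrow> 'g set set \<Rightarrow> bool" where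
  "algebraic_base G \<B> \<longleftrightarrow> group G \<and> \<B> \<noteq> {} \<and> (\<forall>H\<in>\<B>. subgroup H G) \<and>
     (\<forall>H\<in>\<B>. \<forall>K\<in>\<B>. \<exists>L\<in>\<B>. L \<subseteq> H \<inter> K) \<and>
     (\<forall>H\<in>\<B>. \<forall>g\<in>carrier G. (\<lambda>h. g \<otimes>\<^bsub>G\<^esub> h \<otimes>\<^bsub>G\<^esub> inv\<^bsub>G\<^esub> g) ` H \<in> \<B>)"

definition nbhd_basis_at :: "'g topology \<Rightarrow> 'g \<Rightarrow> 'g set set \<Rightarrow> bool" where
  "nbhd_basis_at \<tau> x \<B> \<longleftrightarrow>
     (\<forall>B\<in>\<B>. \<exists>U. openin \<tau> U \<and> x \<in> U \<and> U \<subseteq> B) \<and>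
     (\<forall>U. openin \<tau> U \<and> x \<in> U \<longrightarrow> (\<exists>B\<in>\<B>. B \<subseteq> U))"

definition base_topology :: "('g, 'm) monoid_scheme \<Rightarrow> 'g set set \<Rightarrow> 'g topology" where
  "base_topology G \<B> = (THE \<tau>. topological_group G \<tau> \<and> nbhd_basis_at \<tau> \<one>\<^bsub>G\<^esub> \<B>)"

type_synonym ('g, 'x) gset = "'x set \<times> ('g \<Rightarrow> 'x \<Rightarrow> 'x)"

definition continuous_gset :: "('g, 'm) monoid_scheme \<Rightarrow> 'g topology \<Rightarrow> ('g, 'x) gset \<Rightarrow> bool" where
  "continuous_gset G \<tau> = (\<lambda>(X, \<alpha>). group_action G X \<alpha> \<and>
     continuous_map (prod_topology \<tau> (discrete_topology X)) (discrete_topology X) (\<lambda>(g, x). \<alpha> g x))"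

definition equivariant :: "('g, 'm) monoid_scheme \<Rightarrow> ('g, 'x) gset \<Rightarrow> ('g, 'y) gset \<Rightarrow> ('x \<Rightarrow> 'y) \<Rightarrow> bool" where
  "equivariant G = (\<lambda>(X, \<alpha>) (Y, \<beta>) h. h \<in> X \<rightarrow> Y \<and> (\<forall>g\<in>carrier G. \<forall>x\<in>X. h (\<alpha> g x) = \<beta> g (h x)))"

definition gset_iso :: "('g, 'm) monoid_scheme \<Rightarrow> ('g, 'x) gset \<Rightarrow> ('g, 'y) gset \<Rightarrow> bool" where
  "gset_iso G A B \<longleftrightarrow> (\<exists>h. equivariant G A B h \<and> bij_betw h (fst A) (fst B))"

definition coset_gset :: "('g, 'm) monoid_scheme \<Rightarrow> 'g set \<Rightarrow> ('g, 'g set) gset" where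
  "coset_gset G H = (lcosets\<^bsub>G\<^esub> H, \<lambda>g\<in>carrier G. \<lambda>c\<in>lcosets\<^bsub>G\<^esub> H. g <#\<^bsub>G\<^esub> c)"

definition Cont :: "'u set set \<Rightarrow> ('g, 'm) monoid_scheme \<Rightarrow> 'g topology \<Rightarrow>
    (('g, 'u) gset, ('g, 'u) gset \<times> ('u \<Rightarrow> 'u) \<times> ('g, 'u) gset) category" where
  "Cont \<U> G \<tau> =
    \<lparr>Obj = {(X, \<alpha>). X \<in> \<U> \<and> \<alpha> \<in> extensional (carrier G) \<and> continuous_gset G \<tau> (X, \<alpha>)},
     Hom = (\<lambda>A B. {(A, h, B) | h. h \<in> extensional (fst A) \<and> equivariant G A B h}),
     Idn = (\<lambda>A. (A, \<lambda>x\<in>fst A. x, A)),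
     Cmp = (\<lambda>(B, k, D) (A, h, B'). (A, compose (fst A) k h, D))\<rparr>"

definition Cont_I :: "'u set set \<Rightarrow> ('s, 'f, 'r) signature \<Rightarrow> ('s, 'f, 'r, 'u) interp \<Rightarrow>
    ('s, 'f, 'r, 'i) fic set \<Rightarrow> ('s \<Rightarrow> 'u \<Rightarrow> 'u) topology \<Rightarrow>
    (('s \<Rightarrow> 'u \<Rightarrow> 'u, 'u) gset,
     ('s \<Rightarrow> 'u \<Rightarrow> 'u, 'u) gset \<times> ('u \<Rightarrow> 'u) \<times> ('s \<Rightarrow> 'u \<Rightarrow> 'u, 'u) gset) category" where
  "Cont_I \<U> \<Sigma> M \<I> \<tau> = full_subcat (Cont \<U> (Aut \<Sigma> M) \<tau>)
     {A. \<exists>H\<in>stabilizer_base \<Sigma> M \<I>. gset_iso (Aut \<Sigma> M) A (coset_gset (Aut \<Sigma> M) H)}"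

text \<open>The set \<open>[[x. \<phi>]]\<^sub>M\<close> with the evident action of the automorphism group; \<open>tup\<close> is an
  injective coding of tuples over \<open>'u\<close> as elements of \<open>'u\<close>.\<close>

definition ext_gset :: "('u list \<Rightarrow> 'u) \<Rightarrow> ('s, 'f, 'r) signature \<Rightarrow> ('s, 'f, 'r, 'u) interp \<Rightarrow>
    ('s, 'f, 'r, 'i) fic \<Rightarrow> ('s \<Rightarrow> 'u \<Rightarrow> 'u, 'u) gset" where
  "ext_gset tup \<Sigma> M X =
     (tup ` ext M X, \<lambda>f\<in>automorphisms \<Sigma> M. \<lambda>u\<in>tup ` ext M X. tup (tup_map (fst X) f (inv_into UNIV tup u)))"

end

theory Submission
 imports Defs
begin

text \<open>Derivability from countably many sequents has countermodels by a tableau argument, so syntactic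
 reasoning can be replaced by reasoning in a filter of set models along which exactly the provable
 sequents are eventually valid. In this filter the arrows of the syntactic category are relations
 between sets.

 Representables are sheaves. Decomposing them into atoms shows that every formula is covered by
 complete formulae, and two-valuedness makes validity in \<open>M\<close> coincide with provability. Hence
 \<open>X \<mapsto> [[X]]\<^sub>M\<close> is a fully faithful functor from the syntactic category to
 \<open>Aut(M)\<close>-sets, and covering sieves are the jointly surjective ones.

 From this alone the nerve functor, which sends a continuous \<open>Aut(M)\<close>-set \<open>A\<close> to the sheaf
 \<open>X \<mapsto> Hom([[X]]\<^sub>M, A)\<close>, is fully faithful and essentially surjective: any two points of
 fibres are images of a point of a homogeneous fibre, and a sheaf is the nerve of its colimit over
 the category of elements of the fibres.\<close>

section \<open>Substitution and derived rules\<close>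

text \<open>A consistent theory with uncountably many infinitary sequents may have no model in sets
  (for instance the theory of a surjection from the natural numbers onto an uncountable set), so the
  models of \<T> cannot detect provability by themselves; interpretations that validate only part of
  the provable sequents stand in for them. The price of a filter is closure under finite
  intersections only: eventual inclusions, one for each member of a cover, cannot be combined. Every
  such argument returns to the calculus and the rule \<open>Disj_elim\<close>, which is the content
  of \<open>rel_split\<close> and \<open>ext_split\<close>, and all relations involved must
  therefore be exhibited by formulae. Once \<open>M_complete\<close> is available, \<open>M\<close>
  takes the place of the filter. The second obstacle is size. Arrows, tuples, equivariant maps and
  equivalence classes live in various types, whereas presheaves take subsets of \<open>'u\<close> as
  values. Everything is coded there, and the smallness of a set of equivariant maps has to be
  derived from a bound on the number of orbits.\<close>

lemma subst_trm_Var [simp]: "subst_trm Var t = t"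
 by (induction t) (auto intro: map_idI)

lemma subst_trm_comp: "subst_trm \<sigma> (subst_trm \<rho> t) = subst_trm (\<lambda>n. subst_trm \<sigma> (\<rho> n)) t"
 by (induction t) auto

lemma under_binder_simps [simp]:
 "under_binder \<sigma> 0 = Var 0" "under_binder \<sigma> (Suc n) = subst_trm (\<lambda>k. Var (Suc k)) (\<sigma> n)"
 by (simp_all add: under_binder_def)

lemma under_binder_Var [simp]: "under_binder Var = Var"
proof
 show "under_binder Var n = Var n" for n by (cases n) auto
qed

lemma under_binder_comp:
 "(\<lambda>n. subst_trm (under_binder \<sigma>) (under_binder \<rho> n)) = under_binder (\<lambda>n. subst_trm \<sigma> (\<rho> n))"
proof
 show "subst_trm (under_binder \<sigma>) (under_binder \<rho> n) = under_binder (\<lambda>n. subst_trm \<sigma> (\<rho> n)) n" for n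
  by (cases n) (auto simp: subst_trm_comp)
qed

lemma subst_form_Var [simp]: "subst_form \<phi> Var = \<phi>"
 by (induction \<phi>) (auto intro: map_idI)

lemma subst_form_comp:
 "subst_form (subst_form \<phi> \<rho>) \<sigma> = subst_form \<phi> (\<lambda>n. subst_trm \<sigma> (\<rho> n))"
 by (induction \<phi> arbitrary: \<rho> \<sigma>) (auto simp: subst_trm_comp under_binder_comp)

lemma has_sort_Var_iff [simp]: "has_sort \<Sigma> \<Gamma> (Var n) s \<longleftrightarrow> n < length \<Gamma> \<and> \<Gamma> ! n = s"
 by (auto elim: has_sort.cases intro: has_sort.intros)

lemma has_sort_Fun_iff [simp]:
 "has_sort \<Sigma> \<Gamma> (Fun f ts) s \<longleftrightarrow> f \<in> Funs \<Sigma> \<and> list_all2 (has_sort \<Sigma> \<Gamma>) ts (fdom \<Sigma> f) \<and> s = fcod \<Sigma> f"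
 by (auto elim: has_sort.cases intro: has_sort.intros)

lemma has_sort_subst:
 assumes "has_sort \<Sigma> \<Gamma> t s" "\<forall>n<length \<Gamma>. has_sort \<Sigma> \<Delta> (\<sigma> n) (\<Gamma> ! n)"
 shows "has_sort \<Sigma> \<Delta> (subst_trm \<sigma> t) s"
 using assms(1)
proof induction
 case (1 n) then show ?case using assms(2) by auto
next
 case (2 f ts)
 then show ?case by (auto simp: list_all2_conv_all_nth)
qed

lemma has_sort_subst_list:
 assumes "list_all2 (has_sort \<Sigma> \<Gamma>) ts ss" "\<forall>n<length \<Gamma>. has_sort \<Sigma> \<Delta> (\<sigma> n) (\<Gamma> ! n)"
 shows "list_all2 (has_sort \<Sigma> \<Delta>) (map (subst_trm \<sigma>) ts) ss"
 using assms by (auto simp: list_all2_conv_all_nth intro: has_sort_subst)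

lemma has_sort_under_binder:
 assumes "\<forall>n<length \<Gamma>. has_sort \<Sigma> \<Delta> (\<sigma> n) (\<Gamma> ! n)"
 shows "\<forall>n<length (s # \<Gamma>). has_sort \<Sigma> (s # \<Delta>) (under_binder \<sigma> n) ((s # \<Gamma>) ! n)"
proof (intro allI impI)
 fix n assume n: "n < length (s # \<Gamma>)"
 show "has_sort \<Sigma> (s # \<Delta>) (under_binder \<sigma> n) ((s # \<Gamma>) ! n)"
 proof (cases n)
  case (Suc m)
  then have "has_sort \<Sigma> \<Delta> (\<sigma> m) (\<Gamma> ! m)" using assms n by auto
  then show ?thesis using Suc by (auto intro!: has_sort_subst)
 qed auto
qed

lemma wf_subst:
 assumes "wf_form \<Sigma> \<phi> \<Gamma>" "\<forall>n<length \<Gamma>. has_sort \<Sigma> \<Delta> (\<sigma> n) (\<Gamma> ! n)"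
 shows "wf_form \<Sigma> (subst_form \<phi> \<sigma>) \<Delta>"
 using assms
proof (induction \<phi> arbitrary: \<Gamma> \<Delta> \<sigma>)
 case (Eql t u)
 then show ?case by simp (blast intro: has_sort_subst)
next
 case (Disj I F)
 then show ?case by simp blast
next
 case (Exi s \<phi>)
 then show ?case using has_sort_under_binder by (metis subst_form.simps(6) wf_form.simps(6))
qed (auto intro: has_sort_subst_list)

lemma wf_ren:
 assumes "wf_form \<Sigma> \<phi> \<Gamma>" "\<And>n. n < length \<Gamma> ==> \<rho> n < length \<Delta> \<and> \<Delta> ! \<rho> n = \<Gamma> ! n"
 shows "wf_form \<Sigma> (ren \<rho> \<phi>) \<Delta>"
 unfolding ren_def using assms by (auto intro!: wf_subst)

lemma wf_append: "wf_form \<Sigma> \<phi> \<Gamma> ==> wf_form \<Sigma> \<phi> (\<Gamma> @ \<Delta>)"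
 using wf_subst[of \<Sigma> \<phi> \<Gamma> "\<Gamma> @ \<Delta>" Var] by (auto simp: nth_append)

lemma wf_Falsum [simp]: "wf_form \<Sigma> Falsum \<Gamma>"
 by (simp add: Falsum_def)

lemma fic_iff: "(\<Gamma>, \<phi>) \<in> formulae_in_context \<Sigma> \<longleftrightarrow> set \<Gamma> \<subseteq> Sorts \<Sigma> \<and> wf_form \<Sigma> \<phi> \<Gamma>"
 by (simp add: formulae_in_context_def)

section \<open>Derived rules of geometric logic\<close>

locale geometric_theory =
 fixes \<Sigma> :: "('s, 'f, 'r) signature" and \<T> :: "('s, 'f, 'r, 'i) sequent set"
 assumes sig: "is_signature \<Sigma>" and thy: "is_theory \<Sigma> \<T>"
begin

lemma has_sort_Sorts: "has_sort \<Sigma> \<Gamma> t s ==> set \<Gamma> \<subseteq> Sorts \<Sigma> ==> s \<in> Sorts \<Sigma>"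
 using sig by (cases t) (auto simp: is_signature_def)

abbreviation "fics \<equiv> formulae_in_context \<Sigma> :: ('s, 'f, 'r, 'i) fic set"
abbreviation "pv \<equiv> prv \<Sigma> \<T>"
abbreviation "wff \<equiv> wf_form \<Sigma> :: ('s, 'f, 'r, 'i) form => _"
abbreviation "hs \<equiv> has_sort \<Sigma>"
abbreviation "cfm \<equiv> complete_formula \<Sigma> \<T>"
abbreviation "\<J> \<equiv> syn_topology \<Sigma> \<T>"

text \<open>The side conditions of the rules are just strong enough for this. In
  \<open>Disj_elim\<close> the conclusion has to be assumed well-formed, since for
  \<open>I = {}\<close> no premise mentions it.\<close>

lemma prv_wf:
 assumes "pv \<Gamma> \<phi> \<psi>"
 shows "(\<Gamma>, \<phi>) \<in> fics \<and> (\<Gamma>, \<psi>) \<in> fics"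
 using assms
proof induction
 case (Axm \<Gamma> \<phi> \<psi>) then show ?case using thy by (auto simp: is_theory_def)
next
 case (Subst \<Gamma> \<phi> \<psi> \<Delta> \<sigma>) then show ?case by (auto simp: fic_iff intro: wf_subst)
next
 case (Eq_subst \<Gamma> \<phi> m n) then show ?case
  by (auto simp: fic_iff intro!: wf_subst[of _ _ \<Gamma> \<Gamma>])
next
 case (Exi_adj2 \<Gamma> s \<phi> \<psi>) then show ?case by (auto simp: fic_iff intro!: wf_ren[of _ _ \<Gamma>])
next
 case (Frobenius \<Gamma> \<phi> s \<psi>) then show ?case by (auto simp: fic_iff intro!: wf_ren[of _ _ \<Gamma>])
qed (auto simp: fic_iff Falsum_def)

lemma prv_Disj_intro:
 "pv \<Gamma> \<phi> (F i) ==> i \<in> I ==> \<forall>i\<in>I. wff (F i) \<Gamma> ==> pv \<Gamma> \<phi> (Disj I F)"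
 using prv_wf by (metis Cut Disj_intro fic_iff wf_form.simps(5))

lemma prv_Conj_mono:
 "pv \<Gamma> \<phi> \<phi>' ==> pv \<Gamma> \<psi> \<psi>' ==> pv \<Gamma> (Conj \<phi> \<psi>) (Conj \<phi>' \<psi>')"
 by (meson Conj_intro Conj_left Conj_right Cut fic_iff prv_wf wf_form.simps(4))

text \<open>The rule \<open>Disj_elim\<close> admits no side hypothesis \<omega>; the distributive
  law moves \<omega> into the disjuncts first.\<close>

lemma prv_Disj_elim:
 assumes "pv \<Gamma> \<omega> (Disj I F)" "\<And>i. i \<in> I ==> pv \<Gamma> (Conj \<omega> (F i)) \<psi>" "(\<Gamma>, \<psi>) \<in> fics"
 shows "pv \<Gamma> \<omega> \<psi>"
proof -
 have wf: "(\<Gamma>, \<omega>) \<in> fics" "(\<Gamma>, Disj I F) \<in> fics" using prv_wf[OF assms(1)] by auto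
 have "pv \<Gamma> \<omega> (Conj \<omega> (Disj I F))" by (intro Conj_intro Ident assms wf)
 moreover have "pv \<Gamma> (Conj \<omega> (Disj I F)) (Disj I (\<lambda>i. Conj \<omega> (F i)))"
  by (rule Distributive) (use wf in \<open>auto simp: fic_iff\<close>)
 moreover have "pv \<Gamma> (Disj I (\<lambda>i. Conj \<omega> (F i))) \<psi>"
  by (rule Disj_elim) (use assms in auto)
 ultimately show ?thesis by (meson Cut)
qed

lemma prv_weaken: "pv \<Gamma> \<phi> \<psi> ==> set \<Delta> \<subseteq> Sorts \<Sigma> ==> pv (\<Gamma> @ \<Delta>) \<phi> \<psi>"
 using Subst[of \<Sigma> \<T> \<Gamma> \<phi> \<psi> "\<Gamma> @ \<Delta>" Var] prv_wf[of \<Gamma> \<phi> \<psi>] by (auto simp: nth_append fic_iff)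

text \<open>The two sides need not be equal, since a disjunction \<^term>\<open>Disj I F\<close> also carries the values of
 \<^term>\<open>F\<close> outside \<^term>\<open>I\<close>, to which the substitutions are applied as well.\<close>

lemma prv_subst_cong:
 assumes "wff \<phi> \<Gamma>" "set \<Delta> \<subseteq> Sorts \<Sigma>" "\<forall>n<length \<Gamma>. \<sigma> n = \<rho> n"
  "\<forall>n<length \<Gamma>. hs \<Delta> (\<sigma> n) (\<Gamma> ! n)"
 shows "pv \<Delta> (subst_form \<phi> \<sigma>) (subst_form \<phi> \<rho>)"
 using assms
proof (induction \<phi> arbitrary: \<Gamma> \<Delta> \<sigma> \<rho>)
 case Verum
 then show ?case by (auto intro!: Ident simp: fic_iff)
next
 case (Eql t u)
 have "hs \<Gamma> t s ==> subst_trm \<sigma> t = subst_trm \<rho> t" for t s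
  by (induction rule: has_sort.induct) (use Eql in \<open>auto simp: list_all2_conv_all_nth in_set_conv_nth\<close>)
 then have "subst_form (Eql t u) \<sigma> = subst_form (Eql t u) \<rho>" using Eql by auto
 then show ?case using Eql by (metis Ident fic_iff wf_subst)
next
 case (Rela r ts)
 have "hs \<Gamma> t s ==> subst_trm \<sigma> t = subst_trm \<rho> t" for t s
  by (induction rule: has_sort.induct) (use Rela in \<open>auto simp: list_all2_conv_all_nth in_set_conv_nth\<close>)
 then have "subst_form (Rela r ts) \<sigma> = subst_form (Rela r ts) \<rho>"
  using Rela by (auto simp: list_all2_conv_all_nth in_set_conv_nth) blast
 then show ?case using Rela by (metis Ident fic_iff wf_subst)
next
 case (Conj \<phi>1 \<phi>2)
 then show ?case by (auto intro!: prv_Conj_mono)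
next
 case (Disj I F)
 have "\<forall>n<length \<Gamma>. hs \<Delta> (\<rho> n) (\<Gamma> ! n)" using Disj.prems by auto
 then have wf: "\<forall>i\<in>I. wff (subst_form (F i) \<rho>) \<Delta>"
  using Disj.prems by (auto intro: wf_subst)
 show ?case unfolding subst_form.simps
 proof (rule Disj_elim)
  show "(\<Delta>, Disj I (\<lambda>i. subst_form (F i) \<rho>)) \<in> fics" using wf Disj.prems by (auto simp: fic_iff)
  show "\<forall>i\<in>I. pv \<Delta> (subst_form (F i) \<sigma>) (Disj I (\<lambda>i. subst_form (F i) \<rho>))"
  proof
   fix i assume i: "i \<in> I"
   have "pv \<Delta> (subst_form (F i) \<sigma>) (subst_form (F i) \<rho>)"
    by (rule Disj.IH) (use Disj.prems i in auto)
   then show "pv \<Delta> (subst_form (F i) \<sigma>) (Disj I (\<lambda>i. subst_form (F i) \<rho>))"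
    by (rule prv_Disj_intro) (use wf i in auto)
  qed
 qed
next
 case (Exi s \<phi>)
 have s: "s \<in> Sorts \<Sigma>" "wff \<phi> (s # \<Gamma>)" using Exi.prems by auto
 have eq: "\<forall>n<length (s # \<Gamma>). under_binder \<sigma> n = under_binder \<rho> n"
  using Exi.prems(3) by (auto simp: less_Suc_eq_0_disj)
 have 1: "pv (s # \<Delta>) (subst_form \<phi> (under_binder \<sigma>)) (subst_form \<phi> (under_binder \<rho>))"
  by (rule Exi.IH[OF s(2)]) (use s Exi.prems(2) eq has_sort_under_binder[OF Exi.prems(4)] in auto)
 have wf: "(\<Delta>, Exi s (subst_form \<phi> (under_binder \<rho>))) \<in> fics"
  using Exi.prems wf_subst[of \<Sigma> "Exi s \<phi>" \<Gamma> \<Delta> \<rho>] by (auto simp: fic_iff)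
 then have "pv (s # \<Delta>) (subst_form \<phi> (under_binder \<rho>)) (ren Suc (Exi s (subst_form \<phi> (under_binder \<rho>))))"
  by (intro Exi_adj2 Ident)
 with 1 show ?case unfolding subst_form.simps by (intro Exi_adj1 wf s) (rule Cut)
qed

definition inst :: "'f trm => nat => 'f trm" where
 "inst t n = (case n of 0 => t | Suc m => Var m)"

lemma inst_simps [simp]: "inst t 0 = t" "inst t (Suc n) = Var n"
 by (auto simp: inst_def)

text \<open>The fresh variable is the last one of the context, of index
  \<open>length \<Delta>\<close>, as the tableau requires, whereas the calculus binds index 0. The
  context is rotated, and the Frobenius rule carries \<omega> under the quantifier.\<close>

lemma prv_Exi_elim:
 assumes "pv \<Delta> \<omega> (Exi s \<phi>)"
  "pv (\<Delta> @ [s]) (Conj \<omega> (subst_form \<phi> (inst (Var (length \<Delta>))))) \<psi>"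
  "(\<Delta>, \<psi>) \<in> fics"
 shows "pv \<Delta> \<omega> \<psi>"
proof -
 \<comment> \<open>\<rho> moves the last variable to index 0 and shifts the others up. The results
   agree with \<open>ren Suc\<close> only up to provable equivalence, whence the uses of
   \<open>prv_subst_cong\<close>.\<close>
 define \<rho> where "\<rho> n = (if n = length \<Delta> then Var 0 else Var (Suc n) :: 'f trm)" for n
 have wf: "(\<Delta>, \<omega>) \<in> fics" "s \<in> Sorts \<Sigma>" "wff \<phi> (s # \<Delta>)"
  using prv_wf[OF assms(1)] by (auto simp: fic_iff)
 then have \<Delta>: "set (s # \<Delta>) \<subseteq> Sorts \<Sigma>" by (auto simp: fic_iff)
 have "pv (s # \<Delta>) (subst_form (Conj \<omega> (subst_form \<phi> (inst (Var (length \<Delta>))))) \<rho>) (subst_form \<psi> \<rho>)"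
  by (rule Subst[OF assms(2) \<Delta>]) (auto simp: \<rho>_def nth_append)
 moreover have "pv (s # \<Delta>) (subst_form \<psi> \<rho>) (ren Suc \<psi>)" unfolding ren_def
  by (rule prv_subst_cong[of \<psi> \<Delta>]) (use assms(3) \<Delta> in \<open>auto simp: fic_iff \<rho>_def\<close>)
 moreover have "pv (s # \<Delta>) (ren Suc \<omega>) (subst_form \<omega> \<rho>)" unfolding ren_def
  by (rule prv_subst_cong[of \<omega> \<Delta>]) (use wf \<Delta> in \<open>auto simp: fic_iff \<rho>_def\<close>)
 moreover have "pv (s # \<Delta>) (subst_form \<phi> Var) (subst_form (subst_form \<phi> (inst (Var (length \<Delta>)))) \<rho>)"
  unfolding subst_form_comp
  by (rule prv_subst_cong[of \<phi> "s # \<Delta>"])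
   (use wf \<Delta> in \<open>auto simp: fic_iff \<rho>_def inst_def split: nat.split\<close>)
 ultimately have "pv (s # \<Delta>) (Conj (ren Suc \<omega>) \<phi>) (ren Suc \<psi>)"
  by (simp, meson Cut prv_Conj_mono)
 then have "pv \<Delta> (Exi s (Conj (ren Suc \<omega>) \<phi>)) \<psi>" by (intro Exi_adj1 assms wf)
 moreover have "pv \<Delta> (Conj \<omega> (Exi s \<phi>)) (Exi s (Conj (ren Suc \<omega>) \<phi>))"
  by (rule Frobenius) (use wf in \<open>auto simp: fic_iff\<close>)
 moreover have "pv \<Delta> \<omega> (Conj \<omega> (Exi s \<phi>))" by (intro Conj_intro Ident assms wf)
 ultimately show ?thesis by (meson Cut)
qed

text \<open>The unit of the adjunction, obtained from \<open>Exi_adj2\<close> and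
  \<open>Ident\<close>, is instantiated at \<open>t\<close>.\<close>

lemma prv_Exi_intro:
 assumes "pv \<Delta> \<omega> (subst_form \<phi> (inst t))" "wff (Exi s \<phi>) \<Delta>" "hs \<Delta> t s"
 shows "pv \<Delta> \<omega> (Exi s \<phi>)"
proof -
 have \<Delta>: "set \<Delta> \<subseteq> Sorts \<Sigma>" using prv_wf[OF assms(1)] by (auto simp: fic_iff)
 then have "pv (s # \<Delta>) \<phi> (ren Suc (Exi s \<phi>))"
  by (intro Exi_adj2 Ident) (use assms in \<open>auto simp: fic_iff\<close>)
 then have "pv \<Delta> (subst_form \<phi> (inst t)) (subst_form (ren Suc (Exi s \<phi>)) (inst t))"
  by (rule Subst) (use \<Delta> assms in \<open>auto simp: less_Suc_eq_0_disj\<close>)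
 then have "pv \<Delta> (subst_form \<phi> (inst t)) (Exi s \<phi>)"
  unfolding ren_def subst_form_comp by simp
 with assms(1) show ?thesis by (rule Cut)
qed

text \<open>\<open>Eq_subst\<close> exchanges variables only. It is applied to \<alpha> with a
  second variable of sort \<open>s\<close> inserted, and the two variables are then instantiated by
  \<open>t\<close> and \<open>u\<close>.\<close>

lemma prv_Leibniz:
 assumes eq: "pv \<Delta> \<omega> (Eql t u)" and t: "hs \<Delta> t s" "hs \<Delta> u s"
  and \<alpha>: "wff \<alpha> (s # \<Delta>)"
  and 1: "pv \<Delta> \<omega> (subst_form \<alpha> (inst t))"
 shows "pv \<Delta> \<omega> (subst_form \<alpha> (inst u))"
proof -
 \<comment> \<open>\<rho> skips index 1 to make room for the second variable; \<sigma> sends 0 to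
   \<open>t\<close> and 1 to \<open>u\<close> and lowers the remaining indices by two.\<close>
 define \<rho> where "\<rho> n = (case n of 0 => Var 0 | Suc n => (Var (Suc (Suc n)) :: 'f trm))" for n
 define \<sigma> where "\<sigma> n = (case n of 0 => t | Suc n => inst u n)" for n
 let ?\<beta> = "subst_form \<alpha> \<rho>"
 have \<Delta>: "set \<Delta> \<subseteq> Sorts \<Sigma>" using prv_wf[OF 1] by (auto simp: fic_iff)
 have s: "s \<in> Sorts \<Sigma>" using has_sort_Sorts[OF t(1) \<Delta>] .
 have \<beta>: "wff ?\<beta> (s # s # \<Delta>)"
  by (rule wf_subst[OF \<alpha>]) (auto simp: \<rho>_def less_Suc_eq_0_disj)
 have "pv (s # s # \<Delta>) (Conj (Eql (Var 0) (Var 1)) ?\<beta>) (subst_form ?\<beta> (Var(0 := Var 1)))"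
  by (rule Eq_subst) (use \<beta> \<Delta> s in \<open>auto simp: fic_iff\<close>)
 then have "pv \<Delta> (subst_form (Conj (Eql (Var 0) (Var 1)) ?\<beta>) \<sigma>)
   (subst_form (subst_form ?\<beta> (Var(0 := Var 1))) \<sigma>)"
  by (rule Subst) (use \<Delta> t in \<open>auto simp: \<sigma>_def less_Suc_eq_0_disj\<close>)
 moreover have "subst_form ?\<beta> \<sigma> = subst_form \<alpha> (inst t)" unfolding subst_form_comp
  by (rule arg_cong[where f = "subst_form \<alpha>"]) (auto simp: \<rho>_def \<sigma>_def inst_def split: nat.split)
 moreover have "subst_form (subst_form ?\<beta> (Var(0 := Var 1))) \<sigma> = subst_form \<alpha> (inst u)"
  unfolding subst_form_comp
  by (rule arg_cong[where f = "subst_form \<alpha>"]) (auto simp: \<rho>_def \<sigma>_def inst_def split: nat.split)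
 ultimately have "pv \<Delta> (Conj (Eql t u) (subst_form \<alpha> (inst t))) (subst_form \<alpha> (inst u))"
  by (simp add: \<sigma>_def)
 with eq 1 show ?thesis by (meson Conj_intro Cut)
qed

end

section \<open>Set-valued counterexamples to unprovable sequents\<close>

definition valid :: "('s, 'f, 'r, 'u) interp => ('s, 'f, 'r, 'i) sequent => bool" where
 "valid N = (\<lambda>(\<Gamma>, \<phi>, \<psi>). ext N (\<Gamma>, \<phi>) \<subseteq> ext N (\<Gamma>, \<psi>))"

text \<open>Conjunctions are taken apart as soon as they are asserted, so that only disjunctions and
  existential formulae call for a decision.\<close>

fun comps :: "('s, 'f, 'r, 'i) form => ('s, 'f, 'r, 'i) form list" where
 "comps (Conj \<phi> \<psi>) = comps \<phi> @ comps \<psi>"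
| "comps \<phi> = [\<phi>]"

definition vinst :: "nat list => nat => 'f trm" where
 "vinst vs n = Var (vs ! n)"

text \<open>The classical tableau argument: a decreasing sequence of stages \<open>\<omega>\<^sub>n(\<Delta>\<^sub>n)\<close>, none of which proves
 \<open>\<psi>0\<close>, that decides one asserted disjunction or existential formula at a time.  Along one branch only
 countably many formulae are ever asserted, however large the disjunctions are, so every asserted
 formula gets its turn.  New variables are appended at the end of the context, so that formulae of
 earlier stages need no renaming.\<close>

locale henkin = geometric_theory \<Sigma> \<T>
 for \<Sigma> :: "('s, 'f, 'r) signature" and \<T> :: "('s, 'f, 'r, 'i) sequent set" +
 fixes S :: "('s, 'f, 'r, 'i) sequent set"
  and \<Gamma>0 :: "'s list" and \<phi>0 \<psi>0 :: "('s, 'f, 'r, 'i) form"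
 assumes countable_S: "countable S"
  and prv_S: "(\<Gamma>, \<phi>, \<psi>) \<in> S ==> pv \<Gamma> \<phi> \<psi>"
  and \<phi>0: "(\<Gamma>0, \<phi>0) \<in> fics" and \<psi>0: "(\<Gamma>0, \<psi>0) \<in> fics"
  and not_prv: "\<not> pv \<Gamma>0 \<phi>0 \<psi>0"
begin

text \<open>The formulae that the countermodel has to make true once they are forced: the components
  of the instances at variables of \<phi>0 and of the conclusions of \<open>S\<close>. The sequent
  \<open>(\<Gamma>0, \<phi>0, \<phi>0)\<close> is there to include \<phi>0. Instances at arbitrary
  terms would destroy countability, as there may be uncountably many function symbols.\<close>

definition base :: "('s, 'f, 'r, 'i) form set" where
 "base = (\<Union>(\<Gamma>, \<phi>, \<psi>)\<in>insert (\<Gamma>0, \<phi>0, \<phi>0) S. \<Union>vs. set (comps (subst_form \<psi> (vinst vs))))"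

text \<open>In the number \<open>n\<close> the first component of the pair names a formula of
  \<open>base\<close> or an entry of the agenda, and the second is free, so that each formula is
  proposed at arbitrarily late stages. While the agenda is too short, \<open>Verum\<close> is
  proposed, which leaves the stage unchanged.\<close>

definition task :: "('s, 'f, 'r, 'i) form list => nat => ('s, 'f, 'r, 'i) form" where
 "task L n = (case sum_decode (fst (prod_decode n)) of
   Inl j => from_nat_into base j | Inr j => if j < length L then L ! j else Verum)"

text \<open>A formula is decided only if the stage already proves it; otherwise it waits for a later
  turn. The disjunct is chosen so that \<psi>0 stays unprovable.\<close>

definition advance where
 "advance = (\<lambda>(\<Delta>, \<omega>, L) \<xi>. if pv \<Delta> \<omega> \<xi> then
   (case \<xi> of
    Disj I F => (let i = SOME i. i \<in> I \<and> \<not> pv \<Delta> (Conj \<omega> (F i)) \<psi>0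
           in (\<Delta>, Conj \<omega> (F i), L @ comps (F i)))
   | Exi s \<phi> => (let \<phi>' = subst_form \<phi> (inst (Var (length \<Delta>)))
           in (\<Delta> @ [s], Conj \<omega> \<phi>', L @ comps \<phi>'))
   | _ => (\<Delta>, \<omega>, L)) else (\<Delta>, \<omega>, L))"

primrec stage :: "nat => 's list \<times> ('s, 'f, 'r, 'i) form \<times> ('s, 'f, 'r, 'i) form list" where
 "stage 0 = (\<Gamma>0, \<phi>0, [])"
| "stage (Suc n) = advance (stage n) (task (snd (snd (stage n))) n)"

abbreviation "ctx n \<equiv> fst (stage n)"
abbreviation "hyp n \<equiv> fst (snd (stage n))"
abbreviation "agenda n \<equiv> snd (snd (stage n))"

lemma base_countable: "countable base"
proof -
 have "countable (\<Union>vs. set (comps (subst_form \<psi> (vinst vs))))" for \<psi> :: "('s, 'f, 'r, 'i) form"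
  by (intro countable_UN countableI_type) (simp add: countable_finite)
 then show ?thesis unfolding base_def using countable_S
  by (intro countable_UN countable_insert) (simp_all add: split_beta)
qed

text \<open>The condition on the prefix \<Gamma>0 keeps \<psi>0 well-formed at every stage.\<close>

definition good :: "'s list => ('s, 'f, 'r, 'i) form => bool" where
 "good \<Delta> \<omega> \<longleftrightarrow> (\<Delta>, \<omega>) \<in> fics \<and> (\<exists>\<Xi>. \<Delta> = \<Gamma>0 @ \<Xi>) \<and> \<not> pv \<Delta> \<omega> \<psi>0"

lemma good_\<psi>0: "good \<Delta> \<omega> ==> (\<Delta>, \<psi>0) \<in> fics"
 using \<psi>0 by (auto simp: good_def fic_iff intro: wf_append)

text \<open>Otherwise every branch, and hence the stage itself, would prove \<psi>0.\<close>

lemma good_Disj: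
 assumes "good \<Delta> \<omega>" "pv \<Delta> \<omega> (Disj I F)"
 shows "\<exists>i. i \<in> I \<and> \<not> pv \<Delta> (Conj \<omega> (F i)) \<psi>0"
 using prv_Disj_elim[OF assms(2), of \<psi>0] good_\<psi>0[OF assms(1)] assms(1) by (auto simp: good_def)

lemma advance_Disj:
 assumes "good \<Delta> \<omega>" "pv \<Delta> \<omega> (Disj I F)"
 shows "\<exists>i\<in>I. advance (\<Delta>, \<omega>, L) (Disj I F) = (\<Delta>, Conj \<omega> (F i), L @ comps (F i)) \<and> good \<Delta> (Conj \<omega> (F i))"
proof -
 define i where "i = (SOME i. i \<in> I \<and> \<not> pv \<Delta> (Conj \<omega> (F i)) \<psi>0)"
 have i: "i \<in> I \<and> \<not> pv \<Delta> (Conj \<omega> (F i)) \<psi>0"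
  unfolding i_def using good_Disj[OF assms] by (rule someI_ex)
 have "advance (\<Delta>, \<omega>, L) (Disj I F) = (\<Delta>, Conj \<omega> (F i), L @ comps (F i))"
  using assms(2) by (simp add: advance_def i_def Let_def)
 moreover have "good \<Delta> (Conj \<omega> (F i))"
  using assms i prv_wf[OF assms(2)] by (auto simp: good_def fic_iff)
 ultimately show ?thesis using i by blast
qed

lemma advance_Exi:
 assumes "good \<Delta> \<omega>" "pv \<Delta> \<omega> (Exi s \<phi>)"
 defines "\<phi>' \<equiv> subst_form \<phi> (inst (Var (length \<Delta>)))"
 shows "advance (\<Delta>, \<omega>, L) (Exi s \<phi>) = (\<Delta> @ [s], Conj \<omega> \<phi>', L @ comps \<phi>') \<and> good (\<Delta> @ [s]) (Conj \<omega> \<phi>')"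
proof -
 have "wff \<phi>' (\<Delta> @ [s])" unfolding \<phi>'_def
  by (rule wf_subst[of _ _ "s # \<Delta>"])
   (use prv_wf[OF assms(2)] in \<open>auto simp: fic_iff nth_append inst_def split: nat.split\<close>)
 moreover have "\<not> pv (\<Delta> @ [s]) (Conj \<omega> \<phi>') \<psi>0"
  using prv_Exi_elim[OF assms(2), of \<psi>0] good_\<psi>0[OF assms(1)] assms(1) by (auto simp: good_def \<phi>'_def)
 ultimately have "good (\<Delta> @ [s]) (Conj \<omega> \<phi>')"
  using assms prv_wf[OF assms(2)] by (auto simp: good_def fic_iff intro: wf_append)
 then show ?thesis using assms(2) by (simp add: advance_def \<phi>'_def Let_def)
qed

lemma advance_cases:
 assumes "good \<Delta> \<omega>"
 shows "\<exists>\<Xi> \<omega>' L'. advance (\<Delta>, \<omega>, L) \<xi> = (\<Delta> @ \<Xi>, \<omega>', L @ L') \<and> good (\<Delta> @ \<Xi>) \<omega>' \<and> pv (\<Delta> @ \<Xi>) \<omega>' \<omega>"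
proof -
 have triv: ?thesis if "advance (\<Delta>, \<omega>, L) \<xi> = (\<Delta>, \<omega>, L)"
  using that assms by (intro exI[of _ "[]"] exI[of _ \<omega>]) (auto intro!: Ident simp: good_def)
 show ?thesis
 proof (cases "pv \<Delta> \<omega> \<xi>")
  case False
  then show ?thesis by (intro triv) (simp add: advance_def)
 next
  case True
  show ?thesis
  proof (cases \<xi>)
   case (Disj I F)
   from advance_Disj[OF assms True[unfolded Disj], of L] obtain i where
    i: "advance (\<Delta>, \<omega>, L) (Disj I F) = (\<Delta>, Conj \<omega> (F i), L @ comps (F i))" "good \<Delta> (Conj \<omega> (F i))"
    by blast
   show ?thesis unfolding Disj i(1)
    by (rule exI[of _ "[]"]) (use i(2) in \<open>auto simp: good_def intro: Conj_left\<close>)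
  next
   case (Exi s \<phi>)
   note * = advance_Exi[OF assms True[unfolded Exi], of L]
   show ?thesis unfolding Exi conjunct1[OF *]
    by (rule exI[of _ "[s]"]) (use * in \<open>auto simp: good_def intro: Conj_left\<close>)
  qed (rule triv; simp add: advance_def)+
 qed
qed

lemma good_stage: "good (ctx n) (hyp n)"
proof (induction n)
 case 0 then show ?case using \<phi>0 not_prv by (auto simp: good_def)
next
 case (Suc n)
 then show ?case using advance_cases[of "ctx n" "hyp n" "agenda n" "task (agenda n) n"] by auto
qed

lemma stage_Suc:
 "\<exists>\<Xi> L'. ctx (Suc n) = ctx n @ \<Xi> \<and> agenda (Suc n) = agenda n @ L' \<and> pv (ctx (Suc n)) (hyp (Suc n)) (hyp n)"
 using advance_cases[OF good_stage, of n "agenda n" "task (agenda n) n"] by auto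

lemma stage_mono:
 assumes "m \<le> n"
 shows "\<exists>\<Xi> L'. ctx n = ctx m @ \<Xi> \<and> agenda n = agenda m @ L' \<and> pv (ctx n) (hyp n) (hyp m)"
 using assms
proof (induction rule: dec_induct)
 case base
 then show ?case using good_stage[of m] by (auto simp: good_def intro: Ident)
next
 case (step n)
 from step.IH obtain \<Xi> L' where 1: "ctx n = ctx m @ \<Xi>" "agenda n = agenda m @ L'"
  "pv (ctx n) (hyp n) (hyp m)" by blast
 from stage_Suc[of n] obtain \<Xi>' L'' where 2: "ctx (Suc n) = ctx n @ \<Xi>'" "agenda (Suc n) = agenda n @ L''"
  "pv (ctx (Suc n)) (hyp (Suc n)) (hyp n)" by blast
 have "set \<Xi>' \<subseteq> Sorts \<Sigma>" using prv_wf[OF 2(3)] 2(1) by (auto simp: fic_iff)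
 then have "pv (ctx (Suc n)) (hyp n) (hyp m)" using prv_weaken[OF 1(3)] 2(1) by auto
 then have "pv (ctx (Suc n)) (hyp (Suc n)) (hyp m)" using 2(3) by (rule Cut[rotated])
 then show ?case using 1 2 by auto
qed

lemma has_sort_mono: "m \<le> n ==> hs (ctx m) t s ==> hs (ctx n) t s"
 using stage_mono[of m n] has_sort_subst[of \<Sigma> "ctx m" t s "ctx n" Var]
 by (auto simp: nth_append)

lemma ctx_sorts: "set (ctx n) \<subseteq> Sorts \<Sigma>"
 using good_stage[of n] by (auto simp: good_def fic_iff)

section \<open>Formulae forced along the branch, and forced equality\<close>

definition forced :: "('s, 'f, 'r, 'i) form => bool" where
 "forced \<xi> \<longleftrightarrow> (\<exists>n. pv (ctx n) (hyp n) \<xi>)"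

lemma prv_mono: "m \<le> n ==> pv (ctx m) (hyp m) \<xi> ==> pv (ctx n) (hyp n) \<xi>"
 using stage_mono[of m n] prv_weaken ctx_sorts[of n] by (metis Cut le_sup_iff set_append)

text \<open>Allows several forced formulae and finitely many sorting judgements to be treated at one
  common stage.\<close>

lemma forced_from: "forced \<xi> ==> \<exists>n\<ge>m. pv (ctx n) (hyp n) \<xi>"
 unfolding forced_def by (metis nat_le_linear prv_mono)

definition tsort :: "'f trm => 's => bool" where
 "tsort t s \<longleftrightarrow> (\<exists>n. hs (ctx n) t s)"

lemma tsort_list:
 "list_all2 tsort ts ss ==> \<exists>n. list_all2 (hs (ctx n)) ts ss"
proof (induction rule: list_all2_induct)
 case (Cons t ts s ss)
 then obtain m n where mn: "hs (ctx m) t s" "list_all2 (hs (ctx n)) ts ss"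
  by (auto simp: tsort_def)
 have "list_all2 (hs (ctx (max m n))) ts ss"
  by (rule list_all2_mono[OF mn(2)]) (auto intro: has_sort_mono[of n])
 then show ?case using has_sort_mono[OF _ mn(1), of "max m n"] by auto
qed auto

lemma forced_Cut: "forced \<phi> ==> (\<And>n. n \<ge> m ==> pv (ctx n) \<phi> \<psi>) ==> forced \<psi>"
 using forced_from[of \<phi> m] unfolding forced_def by (meson Cut)

lemma forced_wf: "forced \<phi> ==> \<exists>n. wff \<phi> (ctx n)"
 unfolding forced_def using prv_wf by (auto simp: fic_iff)

lemma forced_Conj: "forced (Conj \<phi> \<psi>) \<longleftrightarrow> forced \<phi> \<and> forced \<psi>"
proof
 assume "forced (Conj \<phi> \<psi>)"
 then obtain n where n: "pv (ctx n) (hyp n) (Conj \<phi> \<psi>)" by (auto simp: forced_def)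
 then have "pv (ctx n) (hyp n) \<phi>" "pv (ctx n) (hyp n) \<psi>"
  using prv_wf[OF n] by (meson Cut Conj_left Conj_right)+
 then show "forced \<phi> \<and> forced \<psi>" by (auto simp: forced_def)
next
 assume "forced \<phi> \<and> forced \<psi>"
 then obtain m where m: "pv (ctx m) (hyp m) \<phi>" by (auto simp: forced_def)
 from \<open>forced \<phi> \<and> forced \<psi>\<close> obtain n where n: "n \<ge> m" "pv (ctx n) (hyp n) \<psi>"
  using forced_from by blast
 then have "pv (ctx n) (hyp n) (Conj \<phi> \<psi>)" by (intro Conj_intro prv_mono[OF n(1) m])
 then show "forced (Conj \<phi> \<psi>)" by (auto simp: forced_def)
qed

lemma forced_Leibniz:
 assumes eq: "forced (Eql t u)" and t: "tsort t s" "tsort u s"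
  and \<alpha>: "wff \<alpha> (s # ctx k)" and 1: "forced (subst_form \<alpha> (inst t))"
 shows "forced (subst_form \<alpha> (inst u))"
proof -
 from eq 1 have "forced (Conj (Eql t u) (subst_form \<alpha> (inst t)))" by (simp add: forced_Conj)
 moreover obtain a b where ab: "hs (ctx a) t s" "hs (ctx b) u s" using t by (auto simp: tsort_def)
 ultimately obtain n where n: "n \<ge> max k (max a b)" "pv (ctx n) (hyp n) (Conj (Eql t u) (subst_form \<alpha> (inst t)))"
  using forced_from by blast
 have s: "hs (ctx n) t s" "hs (ctx n) u s"
  using has_sort_mono[OF _ ab(1), of n] has_sort_mono[OF _ ab(2), of n] n(1) by auto
 obtain \<Xi> where \<Xi>: "ctx n = ctx k @ \<Xi>" using stage_mono[of k n] n(1) by auto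
 have "wff \<alpha> (s # ctx n)" using wf_append[OF \<alpha>, of \<Xi>] \<Xi> by auto
 moreover have "pv (ctx n) (hyp n) (Eql t u)" "pv (ctx n) (hyp n) (subst_form \<alpha> (inst t))"
  using prv_wf[OF n(2)] n(2) by (meson Cut Conj_left Conj_right)+
 ultimately have "pv (ctx n) (hyp n) (subst_form \<alpha> (inst u))"
  by (intro prv_Leibniz[OF _ s])
 then show ?thesis by (auto simp: forced_def)
qed

text \<open>The class of a term without a sort is empty, because a forced equation is well-formed at
  some stage; equality of classes is therefore read off by \<open>cls_eq_iff\<close> for sorted
  terms only.\<close>

definition cls :: "'f trm => 'f trm set" where
 "cls t = {u. forced (Eql t u)}"

lemma forced_refl: "tsort t s ==> forced (Eql t t)"
proof -
 assume "tsort t s"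
 then obtain n where n: "hs (ctx n) t s" by (auto simp: tsort_def)
 have s: "s \<in> Sorts \<Sigma>" using has_sort_Sorts[OF n ctx_sorts] .
 have "pv [s] Verum (Eql (Var 0) (Var 0))" using s by (intro Eq_refl) auto
 then have "pv (ctx n) (subst_form Verum (inst t)) (subst_form (Eql (Var 0) (Var 0)) (inst t))"
  by (rule Subst) (use n ctx_sorts in auto)
 moreover have "pv (ctx n) (hyp n) Verum"
  by (rule Verum_intro) (use good_stage[of n] in \<open>auto simp: good_def\<close>)
 ultimately have "pv (ctx n) (hyp n) (Eql t t)" by simp (rule Cut)
 then show ?thesis by (auto simp: forced_def)
qed

lemma forced_Eql_sorts: "forced (Eql t u) ==> \<exists>s. tsort t s \<and> tsort u s"
 using forced_wf[of "Eql t u"] by (auto simp: tsort_def)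

abbreviation shift :: "'f trm => 'f trm" where
 "shift \<equiv> subst_trm (\<lambda>k. Var (Suc k))"

lemma shift_inst [simp]: "subst_trm (inst t) (shift u) = u"
 by (simp add: subst_trm_comp)

lemma map_shift_inst [simp]: "map (subst_trm (inst t) \<circ> shift) us = us"
 by (auto intro: map_idI)

lemma has_sort_shift: "hs \<Delta> t s ==> hs (s' # \<Delta>) (shift t) s"
 by (erule has_sort_subst) auto

lemma has_sort_shift_list:
 "list_all2 (hs \<Delta>) ts ss ==> list_all2 (hs (s' # \<Delta>)) (map shift ts) ss"
 by (erule has_sort_subst_list) auto

lemma forced_sym: "forced (Eql t u) ==> forced (Eql u t)"
proof -
 assume eq: "forced (Eql t u)"
 then obtain s where s: "tsort t s" "tsort u s" using forced_Eql_sorts by blast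
 then obtain n where n: "hs (ctx n) t s" by (auto simp: tsort_def)
 have "forced (subst_form (Eql (Var 0) (shift t)) (inst u))"
  by (rule forced_Leibniz[OF eq s, of _ n]) (use n forced_refl[OF s(1)] in \<open>auto intro: has_sort_shift\<close>)
 then show ?thesis by simp
qed

lemma forced_trans: "forced (Eql t u) ==> forced (Eql u v) ==> forced (Eql t v)"
proof -
 assume eq: "forced (Eql t u)" "forced (Eql u v)"
 then obtain s where s: "tsort u s" "tsort v s" using forced_Eql_sorts by blast
 obtain n s' where n: "hs (ctx n) t s'" "hs (ctx n) u s'"
  using forced_wf[OF eq(1)] by auto
 obtain m where m: "hs (ctx m) u s" using s by (auto simp: tsort_def)
 have "hs (ctx (max m n)) u s" "hs (ctx (max m n)) u s'"
  using has_sort_mono[OF _ m] has_sort_mono[OF _ n(2)] by auto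
 then have "s' = s" by (cases u) auto
 have "forced (subst_form (Eql (shift t) (Var 0)) (inst v))"
  by (rule forced_Leibniz[OF eq(2) s, of _ n]) (use n eq \<open>s' = s\<close> in \<open>auto intro: has_sort_shift\<close>)
 then show ?thesis by simp
qed

lemma cls_eq_iff: "tsort t s ==> tsort u s' ==> cls t = cls u \<longleftrightarrow> forced (Eql t u)"
 unfolding cls_def using forced_refl[of u] forced_refl[of t] by (auto intro: forced_trans forced_sym)

text \<open>The arguments are replaced one at a time by \<open>forced_Leibniz\<close>;
  \<open>pre\<close> collects those already treated, and the induction runs over the rest.\<close>

lemma forced_Rela_cong:
 assumes "list_all2 (\<lambda>t u. forced (Eql t u)) ts us" "forced (Rela r (pre @ ts))"
  "list_all2 tsort (pre @ us) ss"
 shows "forced (Rela r (pre @ us))"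
 using assms
proof (induction arbitrary: pre rule: list_all2_induct)
 case (Cons t ts u us)
 obtain s where s: "tsort t s" "tsort u s" using forced_Eql_sorts[OF Cons.hyps(1)] by blast
 obtain n where wf: "list_all2 (hs (ctx n)) (pre @ t # ts) (rdom \<Sigma> r)" "r \<in> Rels \<Sigma>"
  using forced_wf[OF Cons.prems(1)] by auto
 then obtain ss1 s' ss2 where ss: "rdom \<Sigma> r = ss1 @ s' # ss2" "list_all2 (hs (ctx n)) pre ss1"
  "hs (ctx n) t s'" "list_all2 (hs (ctx n)) ts ss2" "r \<in> Rels \<Sigma>"
  by (auto simp: list_all2_append1 list_all2_Cons1)
 obtain m where m: "hs (ctx m) t s" using s by (auto simp: tsort_def)
 have "hs (ctx (max m n)) t s" "hs (ctx (max m n)) t s'"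
  using has_sort_mono[OF _ m] has_sort_mono[OF _ ss(3)] by auto
 then have "s' = s" by (cases t) auto
 have "forced (subst_form (Rela r (map shift pre @ Var 0 # map shift ts)) (inst u))"
  by (rule forced_Leibniz[OF Cons.hyps(1) s, of _ n])
   (use ss \<open>s' = s\<close> Cons.prems in \<open>auto intro!: list_all2_appendI has_sort_shift_list\<close>)
 then have "forced (Rela r ((pre @ [u]) @ ts))" by simp
 from Cons.IH[OF this] Cons.prems(2) show ?case by simp
qed auto

text \<open>As in \<open>forced_Rela_cong\<close>, one argument at a time. The left-hand side
  \<open>Fun f xs\<close> stays fixed, so that reflexivity can start the chain.\<close>

lemma forced_Fun_cong:
 assumes "list_all2 (\<lambda>t u. forced (Eql t u)) ts us" "forced (Eql (Fun f xs) (Fun f (pre @ ts)))"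
 shows "forced (Eql (Fun f xs) (Fun f (pre @ us)))"
 using assms
proof (induction arbitrary: pre rule: list_all2_induct)
 case (Cons t ts u us)
 obtain s where s: "tsort t s" "tsort u s" using forced_Eql_sorts[OF Cons.hyps(1)] by blast
 obtain n where wf: "list_all2 (hs (ctx n)) (pre @ t # ts) (fdom \<Sigma> f)" "f \<in> Funs \<Sigma>"
  "list_all2 (hs (ctx n)) xs (fdom \<Sigma> f)"
  using forced_wf[OF Cons.prems(1)] by auto
 then obtain ss1 s' ss2 where ss: "fdom \<Sigma> f = ss1 @ s' # ss2" "list_all2 (hs (ctx n)) pre ss1"
  "hs (ctx n) t s'" "list_all2 (hs (ctx n)) ts ss2" "f \<in> Funs \<Sigma>"
  "list_all2 (hs (ctx n)) xs (fdom \<Sigma> f)"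
  by (auto simp: list_all2_append1 list_all2_Cons1)
 obtain m where m: "hs (ctx m) t s" using s by (auto simp: tsort_def)
 have "hs (ctx (max m n)) t s" "hs (ctx (max m n)) t s'"
  using has_sort_mono[OF _ m] has_sort_mono[OF _ ss(3)] by auto
 then have "s' = s" by (cases t) auto
 have "forced (subst_form (Eql (Fun f (map shift xs)) (Fun f (map shift pre @ Var 0 # map shift ts))) (inst u))"
  by (rule forced_Leibniz[OF Cons.hyps(1) s, of _ n])
   (use ss \<open>s' = s\<close> Cons.prems has_sort_shift_list[OF ss(6), of s] in
    \<open>auto intro!: list_all2_appendI has_sort_shift_list\<close>)
 then have "forced (Eql (Fun f xs) (Fun f ((pre @ [u]) @ ts)))" by simp
 from Cons.IH[OF this] show ?case by simp
qed auto

definition vsort :: "nat => 's => bool" where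
 "vsort v s \<longleftrightarrow> tsort (Var v) s"

text \<open>The carriers consist of classes of variables alone: the tableau supplies variables as
  witnesses, and \<open>base\<close> lists instances at variables. A value of \<open>FunI\<close> is
  the class of a compound term and may lie outside the carriers, so \<N> need not be a structure;
  the truth lemmas quantify over variables only. The union over all representatives in
  \<open>FunI\<close> avoids choosing one.\<close>

definition \<N> :: "('s, 'f, 'r, 'f trm set) interp" where
 "\<N> = \<lparr>Car = (\<lambda>s. {cls (Var v) | v. vsort v s}),
   FunI = (\<lambda>f as. {u. \<exists>ts. as = map cls ts \<and> list_all2 tsort ts (fdom \<Sigma> f) \<and> forced (Eql (Fun f ts) u)}),
   RelI = (\<lambda>r. {map cls ts | ts. forced (Rela r ts)})\<rparr>"

lemma RelI_\<N>: "as \<in> RelI \<N> r \<longleftrightarrow> (\<exists>ts. as = map cls ts \<and> forced (Rela r ts))"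
 by (simp add: \<N>_def)

lemma cls_list_eq:
 assumes "map cls ts = map cls us" "list_all2 tsort ts ss" "list_all2 tsort us ss'"
 shows "list_all2 (\<lambda>t u. forced (Eql t u)) ts us"
 unfolding list_all2_conv_all_nth
proof (intro conjI allI impI)
 show l: "length ts = length us" using assms(1) map_eq_imp_length_eq by blast
 fix i assume i: "i < length ts"
 then have "cls (ts ! i) = cls (us ! i)" using assms(1) l by (metis nth_map)
 moreover have "tsort (ts ! i) (ss ! i)" "tsort (us ! i) (ss' ! i)"
  using assms(2,3) i l by (auto simp: list_all2_conv_all_nth)
 ultimately show "forced (Eql (ts ! i) (us ! i))" using cls_eq_iff by blast
qed

lemma tsort_Fun:
 assumes "f \<in> Funs \<Sigma>" "list_all2 tsort ts (fdom \<Sigma> f)"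
 shows "tsort (Fun f ts) (fcod \<Sigma> f)"
 using tsort_list[OF assms(2)] assms(1) by (auto simp: tsort_def)

lemma FunI_\<N>:
 assumes f: "f \<in> Funs \<Sigma>" and ts: "list_all2 tsort ts (fdom \<Sigma> f)"
 shows "FunI \<N> f (map cls ts) = cls (Fun f ts)"
proof (rule Set.set_eqI)
 fix u
 have "forced (Eql (Fun f ts) u)" if us: "map cls ts = map cls us" "list_all2 tsort us (fdom \<Sigma> f)"
  "forced (Eql (Fun f us) u)" for us
 proof -
  have "forced (Eql (Fun f ts) (Fun f ([] @ us)))"
   by (rule forced_Fun_cong[OF cls_list_eq[OF us(1) ts us(2)]]) (use forced_refl[OF tsort_Fun[OF f ts]] in auto)
  then show ?thesis using us(3) by (auto intro: forced_trans)
 qed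
 then show "u \<in> FunI \<N> f (map cls ts) \<longleftrightarrow> u \<in> cls (Fun f ts)"
  using ts by (auto simp: \<N>_def cls_def)
qed

abbreviation "val vs \<equiv> map (\<lambda>v. cls (Var v)) vs"

lemma tsort_vinst:
 assumes "list_all2 vsort vs \<Gamma>" "hs \<Gamma> t s"
 shows "tsort (subst_trm (vinst vs) t) s"
proof -
 have "list_all2 tsort (map Var vs) \<Gamma>" using assms(1) by (simp add: list_all2_map1 vsort_def[abs_def])
 then obtain n where n: "list_all2 (hs (ctx n)) (map Var vs) \<Gamma>" using tsort_list by blast
 have "hs (ctx n) (subst_trm (vinst vs) t) s"
  by (rule has_sort_subst[OF assms(2)]) (use n in \<open>auto simp: list_all2_conv_all_nth vinst_def\<close>)
 then show ?thesis by (auto simp: tsort_def)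
qed

lemma eval_\<N>:
 assumes "hs \<Gamma> t s" and vs: "list_all2 vsort vs \<Gamma>"
 shows "eval \<N> (val vs) t = cls (subst_trm (vinst vs) t)"
 using assms(1)
proof induction
 case (1 n) then show ?case using vs by (auto simp: vinst_def list_all2_conv_all_nth)
next
 case (2 f ts)
 have "map (eval \<N> (val vs)) ts = map cls (map (subst_trm (vinst vs)) ts)"
  using 2(2) by (auto simp: list_all2_conv_all_nth in_set_conv_nth)
 moreover have "list_all2 tsort (map (subst_trm (vinst vs)) ts) (fdom \<Sigma> f)"
  using 2(2) tsort_vinst[OF vs] by (auto simp: list_all2_conv_all_nth)
 ultimately show ?case unfolding eval.simps subst_trm.simps by (simp only: FunI_\<N>[OF 2(1)])
qed

lemma map_eval_\<N>:
 assumes "list_all2 (hs \<Gamma>) ts ss" and vs: "list_all2 vsort vs \<Gamma>"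
 shows "map (eval \<N> (val vs)) ts = map cls (map (subst_trm (vinst vs)) ts)"
 using assms(1) by (induction rule: list_all2_induct) (simp_all add: eval_\<N>[OF _ vs])

lemma ctx_vs:
 assumes "list_all2 vsort vs \<Gamma>"
 shows "\<exists>n. \<forall>k<length \<Gamma>. hs (ctx n) (vinst vs k) (\<Gamma> ! k)"
proof -
 have "list_all2 tsort (map Var vs) \<Gamma>" using assms(1) by (simp add: list_all2_map1 vsort_def[abs_def])
 then obtain n where n: "list_all2 (hs (ctx n)) (map Var vs) \<Gamma>" using tsort_list by blast
 then show ?thesis by (intro exI[of _ n]) (auto simp: list_all2_conv_all_nth vinst_def)
qed

lemma vinst_Cons: "(\<lambda>n. subst_trm (inst (Var v)) (under_binder (vinst vs) n)) = vinst (v # vs)"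
proof
 show "subst_trm (inst (Var v)) (under_binder (vinst vs) n) = vinst (v # vs) n" for n
  by (cases n) (auto simp: vinst_def)
qed

text \<open>This half of the truth lemma holds for every formula: a true disjunct or a witness, once
  forced, proves the whole formula.\<close>

lemma sat_forced:
 assumes "wff \<phi> \<Gamma>" "list_all2 vsort vs \<Gamma>" "sat \<N> \<phi> (val vs)"
 shows "forced (subst_form \<phi> (vinst vs))"
 using assms
proof (induction \<phi> arbitrary: \<Gamma> vs)
 case Verum
 have "pv (ctx 0) (hyp 0) Verum" using \<phi>0 by (auto intro: Verum_intro)
 then show ?case unfolding forced_def subst_form.simps by blast
next
 case (Eql t u)
 then show ?case by (auto simp: eval_\<N> cls_eq_iff[OF tsort_vinst tsort_vinst])
next
 case (Rela r ts)
 have "map (eval \<N> (val vs)) ts = map cls (map (subst_trm (vinst vs)) ts)"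
  using Rela.prems map_eval_\<N> by auto
 then obtain us where us: "map cls (map (subst_trm (vinst vs)) ts) = map cls us" "forced (Rela r us)"
  using Rela.prems(3) unfolding sat.simps RelI_\<N> by metis
 have ts: "list_all2 tsort (map (subst_trm (vinst vs)) ts) (rdom \<Sigma> r)"
  using Rela.prems tsort_vinst by (auto simp: list_all2_conv_all_nth)
 have "list_all2 tsort us (rdom \<Sigma> r)"
  using forced_wf[OF us(2)] by (auto simp: list_all2_conv_all_nth tsort_def)
 from cls_list_eq[OF us(1) ts this] have "list_all2 (\<lambda>t u. forced (Eql t u)) us (map (subst_trm (vinst vs)) ts)"
  by (auto simp: list_all2_conv_all_nth intro: forced_sym)
 from forced_Rela_cong[OF this, of r "[]"] us(2) ts show ?case by simp
next
 case (Conj \<phi>1 \<phi>2)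
 then show ?case by (auto simp: forced_Conj)
next
 case (Disj I F)
 then obtain i where i: "i \<in> I" "sat \<N> (F i) (val vs)" by auto
 then have "forced (subst_form (F i) (vinst vs))" using Disj.IH[of "F i" \<Gamma> vs] Disj.prems by auto
 then obtain n m where n: "pv (ctx n) (hyp n) (subst_form (F i) (vinst vs))" "n \<ge> m"
  "\<forall>k<length \<Gamma>. hs (ctx m) (vinst vs k) (\<Gamma> ! k)"
  using ctx_vs[OF Disj.prems(2)] forced_from by meson
 have "\<forall>i\<in>I. wff (subst_form (F i) (vinst vs)) (ctx n)"
  using Disj.prems(1) n(2,3) by (auto intro!: wf_subst has_sort_mono[OF n(2)])
 then have "pv (ctx n) (hyp n) (subst_form (Disj I F) (vinst vs))"
  using prv_Disj_intro[where F = "\<lambda>i. subst_form (F i) (vinst vs)", OF n(1) i(1)] by simp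
 then show ?case unfolding forced_def by blast
next
 case (Exi s \<phi>)
 then obtain v where v: "vsort v s" "sat \<N> \<phi> (val (v # vs))" by (auto simp: \<N>_def)
 then have 1: "forced (subst_form \<phi> (vinst (v # vs)))" using Exi.IH[of "s # \<Gamma>" "v # vs"] Exi.prems by auto
 obtain m where m: "\<forall>k<length (s # \<Gamma>). hs (ctx m) (vinst (v # vs) k) ((s # \<Gamma>) ! k)"
  using ctx_vs[of "v # vs" "s # \<Gamma>"] v Exi.prems by auto
 obtain n where n: "pv (ctx n) (hyp n) (subst_form \<phi> (vinst (v # vs)))" "n \<ge> m"
  using forced_from[OF 1] by blast
 have hs: "hs (ctx n) (Var v) s"
  using has_sort_mono[OF n(2), of "Var v" s] m[rule_format, of 0] by (auto simp: vinst_def)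
 have "\<forall>k<length \<Gamma>. hs (ctx n) (vinst vs k) (\<Gamma> ! k)"
 proof (intro allI impI)
  fix k assume "k < length \<Gamma>"
  then have "hs (ctx m) (vinst vs k) (\<Gamma> ! k)" using m[rule_format, of "Suc k"] by (auto simp: vinst_def)
  then show "hs (ctx n) (vinst vs k) (\<Gamma> ! k)" by (rule has_sort_mono[OF n(2)])
 qed
 then have wf: "wff (subst_form (Exi s \<phi>) (vinst vs)) (ctx n)" by (rule wf_subst[OF Exi.prems(1)])
 have "pv (ctx n) (hyp n) (Exi s (subst_form \<phi> (under_binder (vinst vs))))"
  by (rule prv_Exi_intro[OF _ _ hs]) (use n(1) wf in \<open>auto simp: subst_form_comp vinst_Cons\<close>)
 then show ?case unfolding forced_def by auto
qed

text \<open>The formulae that are sure to be proposed as a task after they have become forced, by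
  \<open>listed_task\<close>.\<close>

definition listed :: "('s, 'f, 'r, 'i) form set" where
 "listed = base \<union> (\<Union>n. set (agenda n))"

lemma listed_task:
 assumes "\<xi> \<in> listed" "forced \<xi>"
 shows "\<exists>n. task (agenda n) n = \<xi> \<and> pv (ctx n) (hyp n) \<xi>"
proof -
 obtain m where m: "pv (ctx m) (hyp m) \<xi>" using assms(2) by (auto simp: forced_def)
 from assms(1) consider "\<xi> \<in> base" | k where "\<xi> \<in> set (agenda k)" by (auto simp: listed_def)
 then show ?thesis
 proof cases
  case 1
  then obtain j where j: "from_nat_into base j = \<xi>" using base_countable
   by (metis from_nat_into_surj)
  \<comment> \<open>The free component is \<open>m\<close>, so that \<open>m \<le> ?n\<close> and
    the formula is already proved when its turn comes.\<close>
  let ?n = "prod_encode (sum_encode (Inl j), m)"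
  have "task (agenda ?n) ?n = \<xi>" by (simp add: task_def j)
  moreover have "m \<le> ?n" by (rule le_prod_encode_2)
  ultimately show ?thesis using prv_mono[OF _ m] by blast
 next
  case (2 k)
  then obtain j where j: "j < length (agenda k)" "agenda k ! j = \<xi>" by (auto simp: in_set_conv_nth)
  \<comment> \<open>At least \<open>k\<close>, so that entry \<open>j\<close> of the agenda exists,
    and at least \<open>m\<close>, so that the formula is already proved.\<close>
  let ?n = "prod_encode (sum_encode (Inr j), max k m)"
  have n: "max k m \<le> ?n" by (rule le_prod_encode_2)
  then obtain L' where "agenda ?n = agenda k @ L'" using stage_mono[of k ?n] by auto
  then have "task (agenda ?n) ?n = \<xi>" using j by (simp add: task_def nth_append)
  then show ?thesis using prv_mono[OF _ m, of ?n] n by auto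
 qed
qed

lemma listed_Disj:
 assumes "Disj I F \<in> listed" "forced (Disj I F)"
 shows "\<exists>i\<in>I. forced (F i) \<and> set (comps (F i)) \<subseteq> listed"
proof -
 obtain n where n: "task (agenda n) n = Disj I F" "pv (ctx n) (hyp n) (Disj I F)"
  using listed_task[OF assms] by blast
 obtain i where i: "i \<in> I" "advance (ctx n, hyp n, agenda n) (Disj I F) = (ctx n, Conj (hyp n) (F i), agenda n @ comps (F i))"
  "good (ctx n) (Conj (hyp n) (F i))"
  using advance_Disj[OF good_stage n(2), of "agenda n"] by blast
 have st: "stage (Suc n) = (ctx n, Conj (hyp n) (F i), agenda n @ comps (F i))" using i n by simp
 then have "pv (ctx (Suc n)) (hyp (Suc n)) (F i)"
  using i(3) by (auto simp: good_def simp del: stage.simps intro: Conj_right)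
 moreover have "set (comps (F i)) \<subseteq> set (agenda (Suc n))" using st by (simp del: stage.simps)
 ultimately show ?thesis using i(1) unfolding forced_def listed_def by blast
qed

lemma listed_Exi:
 assumes "Exi s \<phi> \<in> listed" "forced (Exi s \<phi>)"
 shows "\<exists>v. vsort v s \<and> forced (subst_form \<phi> (inst (Var v))) \<and> set (comps (subst_form \<phi> (inst (Var v)))) \<subseteq> listed"
proof -
 obtain n where n: "task (agenda n) n = Exi s \<phi>" "pv (ctx n) (hyp n) (Exi s \<phi>)"
  using listed_task[OF assms] by blast
 let ?v = "length (ctx n)" let ?\<phi> = "subst_form \<phi> (inst (Var ?v))"
 have i: "advance (ctx n, hyp n, agenda n) (Exi s \<phi>) = (ctx n @ [s], Conj (hyp n) ?\<phi>, agenda n @ comps ?\<phi>)"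
  "good (ctx n @ [s]) (Conj (hyp n) ?\<phi>)"
  using advance_Exi[OF good_stage n(2), of "agenda n"] by blast+
 have st: "stage (Suc n) = (ctx n @ [s], Conj (hyp n) ?\<phi>, agenda n @ comps ?\<phi>)" using i n by simp
 then have "pv (ctx (Suc n)) (hyp (Suc n)) ?\<phi>"
  using i(2) by (auto simp: good_def simp del: stage.simps intro: Conj_right)
 moreover have "set (comps ?\<phi>) \<subseteq> set (agenda (Suc n))" using st by (simp del: stage.simps)
 moreover have "hs (ctx (Suc n)) (Var ?v) s" using st by (simp del: stage.simps)
 ultimately show ?thesis unfolding forced_def listed_def vsort_def tsort_def by blast
qed

text \<open>For this half the components must be listed: a forced disjunction or existential formula
  acquires a forced disjunct or witness only when its turn comes.\<close>

lemma forced_sat: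
 assumes "wff \<phi> \<Gamma>" "list_all2 vsort vs \<Gamma>" "forced (subst_form \<phi> (vinst vs))"
  "set (comps (subst_form \<phi> (vinst vs))) \<subseteq> listed"
 shows "sat \<N> \<phi> (val vs)"
 using assms
proof (induction \<phi> arbitrary: \<Gamma> vs)
 case (Eql t u)
 then obtain s where s: "hs \<Gamma> t s" "hs \<Gamma> u s" by auto
 note v = \<open>list_all2 vsort vs \<Gamma>\<close>
 show ?case using Eql.prems(3) cls_eq_iff[OF tsort_vinst[OF v s(1)] tsort_vinst[OF v s(2)]]
  by (simp add: eval_\<N>[OF s(1) v] eval_\<N>[OF s(2) v])
next
 case (Rela r ts)
 have "map (eval \<N> (val vs)) ts = map cls (map (subst_trm (vinst vs)) ts)"
  using Rela.prems map_eval_\<N> by auto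
 then show ?case using Rela.prems(3) unfolding sat.simps RelI_\<N> subst_form.simps by blast
next
 case (Conj \<phi>1 \<phi>2)
 then show ?case by (auto simp: forced_Conj)
next
 case (Disj I F)
 then obtain i where "i \<in> I" "forced (subst_form (F i) (vinst vs))" "set (comps (subst_form (F i) (vinst vs))) \<subseteq> listed"
  using listed_Disj[of I "\<lambda>i. subst_form (F i) (vinst vs)"] by auto
 then show ?case using Disj.IH[of "F i" \<Gamma> vs] Disj.prems by auto
next
 case (Exi s \<phi>)
 then obtain v where v: "vsort v s" "forced (subst_form \<phi> (vinst (v # vs)))"
  "set (comps (subst_form \<phi> (vinst (v # vs)))) \<subseteq> listed"
  using listed_Exi[of s "subst_form \<phi> (under_binder (vinst vs))"] by (auto simp: subst_form_comp vinst_Cons)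
 then have "sat \<N> \<phi> (val (v # vs))" using Exi.IH[of "s # \<Gamma>" "v # vs"] Exi.prems by auto
 then show ?case using v(1) by (auto simp: \<N>_def)
qed auto

lemma tuples_\<N>: "a \<in> tuples \<N> \<Gamma> \<longleftrightarrow> (\<exists>vs. list_all2 vsort vs \<Gamma> \<and> a = val vs)"
proof
 assume "a \<in> tuples \<N> \<Gamma>"
 then have "list_all2 (\<lambda>x s. \<exists>v. vsort v s \<and> x = cls (Var v)) a \<Gamma>"
  by (auto simp: tuples_def \<N>_def elim!: list_all2_mono)
 then show "\<exists>vs. list_all2 vsort vs \<Gamma> \<and> a = val vs"
 proof (induction rule: list_all2_induct)
  case (Cons x xs y ys)
  then obtain v vs where "vsort v y \<and> x = cls (Var v)" "list_all2 vsort vs ys \<and> xs = val vs" by auto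
  then show ?case by (intro exI[of _ "v # vs"]) auto
 qed auto
qed (auto simp: tuples_def \<N>_def list_all2_conv_all_nth)

text \<open>Truth of \<phi> becomes forcing by \<open>sat_forced\<close>, provability carries it to
  \<psi>, and \<open>forced_sat\<close> leads back to truth because the instances of \<psi> at
  variables belong to \<open>base\<close>.\<close>

lemma valid_\<N>:
 assumes "(\<Gamma>, \<phi>, \<psi>) \<in> insert (\<Gamma>0, \<phi>0, \<phi>0) S"
 shows "valid \<N> (\<Gamma>, \<phi>, \<psi>)"
proof -
 have prv: "pv \<Gamma> \<phi> \<psi>" using assms prv_S \<phi>0 by (auto intro: Ident)
 have wf: "wff \<phi> \<Gamma>" "wff \<psi> \<Gamma>" using prv_wf[OF prv] by (auto simp: fic_iff)
 have "sat \<N> \<psi> (val vs)" if vs: "list_all2 vsort vs \<Gamma>" and s: "sat \<N> \<phi> (val vs)" for vs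
 proof (rule forced_sat[OF wf(2) vs])
  obtain m where m: "\<forall>k<length \<Gamma>. hs (ctx m) (vinst vs k) (\<Gamma> ! k)" using ctx_vs[OF vs] by blast
  show "forced (subst_form \<psi> (vinst vs))"
   by (rule forced_Cut[OF sat_forced[OF wf(1) vs s], of m], rule Subst[OF prv ctx_sorts])
    (use m in \<open>auto intro: has_sort_mono\<close>)
  show "set (comps (subst_form \<psi> (vinst vs))) \<subseteq> listed" using assms by (force simp: listed_def base_def)
 qed
 then show ?thesis by (auto simp: valid_def ext_def tuples_\<N>)
qed

lemma vsort_\<Gamma>0: "list_all2 vsort [0..<length \<Gamma>0] \<Gamma>0"
proof -
 have "tsort (Var n) (\<Gamma>0 ! n)" if "n < length \<Gamma>0" for n
  unfolding tsort_def by (rule exI[of _ 0]) (use that in auto)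
 then show ?thesis by (auto simp: list_all2_conv_all_nth vsort_def)
qed

text \<open>The list \<open>[0..<length \<Gamma>0]\<close> names each variable by itself only below
  \<open>length \<Gamma>0\<close>, so the two formulae are provably equivalent at each stage but
  possibly different.\<close>

lemma forced_\<Gamma>0:
 assumes "wff \<phi> \<Gamma>0"
 shows "forced (subst_form \<phi> (vinst [0..<length \<Gamma>0])) \<longleftrightarrow> forced \<phi>"
proof -
 have \<Gamma>: "\<exists>\<Xi>. ctx n = \<Gamma>0 @ \<Xi>" for n using stage_mono[of 0 n] by auto
 have h: "\<forall>k<length \<Gamma>0. hs (ctx n) (Var k) (\<Gamma>0 ! k)" for n using \<Gamma>[of n] by (auto simp: nth_append)
 have eq: "\<forall>k<length \<Gamma>0. vinst [0..<length \<Gamma>0] k = Var k" by (auto simp: vinst_def)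
 have h': "\<forall>k<length \<Gamma>0. hs (ctx n) (vinst [0..<length \<Gamma>0] k) (\<Gamma>0 ! k)" for n
  using h[of n] eq by metis
 have 1: "pv (ctx n) (subst_form \<phi> (vinst [0..<length \<Gamma>0])) (subst_form \<phi> Var)" for n
  by (rule prv_subst_cong[OF assms ctx_sorts]) (use h' eq in simp_all)
 have 2: "pv (ctx n) (subst_form \<phi> Var) (subst_form \<phi> (vinst [0..<length \<Gamma>0]))" for n
  by (rule prv_subst_cong[OF assms ctx_sorts _ h]) (use eq in metis)
 from 1 2 show ?thesis by (auto intro: forced_Cut)
qed

lemma countermodel: "(\<forall>s\<in>S. valid \<N> s) \<and> \<not> valid \<N> (\<Gamma>0, \<phi>0, \<psi>0)"
proof (intro conjI ballI notI)
 show "valid \<N> s" if "s \<in> S" for s using that valid_\<N> by (cases s) auto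
 assume v: "valid \<N> (\<Gamma>0, \<phi>0, \<psi>0)"
 let ?vs = "[0..<length \<Gamma>0]"
 have wf: "wff \<phi>0 \<Gamma>0" "wff \<psi>0 \<Gamma>0" using \<phi>0 \<psi>0 by (auto simp: fic_iff)
 have "pv (ctx 0) (hyp 0) \<phi>0" using \<phi>0 by (auto intro: Ident)
 then have "forced \<phi>0" unfolding forced_def by blast
 then have "forced (subst_form \<phi>0 (vinst ?vs))" using forced_\<Gamma>0[OF wf(1)] by blast
 then have "sat \<N> \<phi>0 (val ?vs)"
  by (rule forced_sat[OF wf(1) vsort_\<Gamma>0]) (force simp: listed_def base_def)
 then have "sat \<N> \<psi>0 (val ?vs)"
  using v vsort_\<Gamma>0 unfolding valid_def ext_def tuples_\<N> by auto
 then have "forced \<psi>0" using sat_forced[OF wf(2) vsort_\<Gamma>0] forced_\<Gamma>0[OF wf(2)] by blast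
 then show False using good_stage by (auto simp: forced_def good_def)
qed

end

section \<open>Completeness and the filter of interpretations\<close>

context geometric_theory
begin

theorem prv_by_models:
 assumes "countable S" "\<And>\<Gamma> \<phi> \<psi>. (\<Gamma>, \<phi>, \<psi>) \<in> S ==> pv \<Gamma> \<phi> \<psi>"
  and "(\<Gamma>, \<phi>) \<in> fics" "(\<Gamma>, \<psi>) \<in> fics"
  and "\<And>N :: ('s, 'f, 'r, 'f trm set) interp. (\<And>s. s \<in> S ==> valid N s) ==> valid N (\<Gamma>, \<phi>, \<psi>)"
 shows "pv \<Gamma> \<phi> \<psi>"
proof (rule ccontr)
 assume "\<not> pv \<Gamma> \<phi> \<psi>"
 then interpret henkin \<Sigma> \<T> S \<Gamma> \<phi> \<psi> using assms by unfold_locales auto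
 show False using countermodel assms(5) by blast
qed

text \<open>The interpretations are not restricted to structures, because \<N> need not be one. The
  filter is improper exactly if \<open>Verum\<close> proves \<open>Falsum\<close> in the empty
  context.\<close>

definition gen_models :: "('s, 'f, 'r, 'f trm set) interp filter" where
 "gen_models = (INF s\<in>{(\<Gamma>, \<phi>, \<psi>). pv \<Gamma> \<phi> \<psi>}. principal {N. valid N s})"

abbreviation eventually_model (binder "EV " 10) where "eventually_model P \<equiv> eventually P gen_models"

lemma eventually_valid: "pv \<Gamma> \<phi> \<psi> ==> EV N. valid N (\<Gamma>, \<phi>, \<psi>)"
 unfolding gen_models_def by (rule eventually_INF1) (auto simp: eventually_principal)

text \<open>An event of the filter depends on finitely many provable sequents only, and
  \<open>prv_by_models\<close> applies to such a finite set.\<close>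

theorem prv_iff_eventually:
 assumes "(\<Gamma>, \<phi>) \<in> fics" "(\<Gamma>, \<psi>) \<in> fics"
 shows "pv \<Gamma> \<phi> \<psi> \<longleftrightarrow> (EV N. valid N (\<Gamma>, \<phi>, \<psi>))"
proof
 let ?P = "{(\<Gamma>, \<phi>, \<psi>). pv \<Gamma> \<phi> \<psi>}"
 assume "EV N. valid N (\<Gamma>, \<phi>, \<psi>)"
 then have "\<exists>S\<subseteq>?P. finite S \<and> (\<forall>\<^sub>F N :: ('s, 'f, 'r, 'f trm set) interp in (INF s\<in>S. principal {N. valid N s}). valid N (\<Gamma>, \<phi>, \<psi>))"
  unfolding gen_models_def by (rule iffD1[OF eventually_INF])
 then obtain S where S: "S \<subseteq> ?P" "finite S"
  "\<forall>\<^sub>F N :: ('s, 'f, 'r, 'f trm set) interp in (INF s\<in>S. principal {N. valid N s}). valid N (\<Gamma>, \<phi>, \<psi>)"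
  by (elim exE conjE)
 have "(INF s\<in>S. principal {N :: ('s, 'f, 'r, 'f trm set) interp. valid N s}) = principal (\<Inter>s\<in>S. {N. valid N s})"
  using S(2) by (rule INF_principal_finite)
 then have *: "valid N (\<Gamma>, \<phi>, \<psi>)" if "\<And>s. s \<in> S ==> valid N s" for N :: "('s, 'f, 'r, 'f trm set) interp"
  using S(3) that by (simp add: eventually_principal)
 show "pv \<Gamma> \<phi> \<psi>"
  by (rule prv_by_models[of S]) (use S assms * in \<open>auto intro: countable_finite\<close>)
qed (rule eventually_valid)

end

section \<open>Definable relations and the syntactic category\<close>

lemma eval_subst:
 assumes "has_sort \<Sigma> \<Gamma> t s" "\<forall>n<length \<Gamma>. eval N a (\<sigma> n) = b ! n"
 shows "eval N a (subst_trm \<sigma> t) = eval N b t"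
 using assms(1)
proof induction
 case (2 f ts)
 then have "map (eval N a \<circ> subst_trm \<sigma>) ts = map (eval N b) ts"
  by (auto simp: list_all2_conv_all_nth in_set_conv_nth)
 then show ?case by (simp only: eval.simps subst_trm.simps map_map)
qed (use assms(2) in auto)

lemma eval_shift: "eval N (x # a) (subst_trm (\<lambda>k. Var (Suc k)) t) = eval N a t"
proof (induction t)
 case (Fun f ts)
 then have "map (eval N (x # a) \<circ> subst_trm (\<lambda>k. Var (Suc k))) ts = map (eval N a) ts" by auto
 then show ?case by (simp only: eval.simps subst_trm.simps map_map)
qed simp

lemma sat_subst:
 assumes "wf_form \<Sigma> \<phi> \<Gamma>" "\<forall>n<length \<Gamma>. eval N a (\<sigma> n) = b ! n"
 shows "sat N (subst_form \<phi> \<sigma>) a \<longleftrightarrow> sat N \<phi> b"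
 using assms
proof (induction \<phi> arbitrary: \<Gamma> \<sigma> a b)
 case (Eql t u)
 then obtain s where "has_sort \<Sigma> \<Gamma> t s" "has_sort \<Sigma> \<Gamma> u s" by auto
 then show ?case using eval_subst[of \<Sigma> \<Gamma>, OF _ Eql.prems(2)] by simp
next
 case (Rela r ts)
 then have "map (eval N a \<circ> subst_trm \<sigma>) ts = map (eval N b) ts"
  using eval_subst[of \<Sigma> \<Gamma>, OF _ Rela.prems(2)] by (force simp: list_all2_conv_all_nth in_set_conv_nth)
 then show ?case by (simp only: sat.simps subst_form.simps map_map)
next
 case (Conj \<phi>1 \<phi>2)
 then show ?case by simp blast
next
 case (Disj I F)
 then have "sat N (subst_form (F i) \<sigma>) a \<longleftrightarrow> sat N (F i) b" if "i \<in> I" for i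
  using that Disj.IH[of "F i" \<Gamma> a \<sigma> b] by auto
 then show ?case by auto
next
 case (Exi s \<phi>)
 have "sat N (subst_form \<phi> (under_binder \<sigma>)) (x # a) \<longleftrightarrow> sat N \<phi> (x # b)" for x
 proof (rule Exi.IH[of "s # \<Gamma>"])
  show "\<forall>n<length (s # \<Gamma>). eval N (x # a) (under_binder \<sigma> n) = (x # b) ! n"
   using Exi.prems(2) by (auto simp: less_Suc_eq_0_disj eval_shift)
 qed (use Exi.prems in auto)
 then show ?case by simp
qed simp

lemma sat_ren:
 assumes "wf_form \<Sigma> \<phi> \<Gamma>" "\<And>n. n < length \<Gamma> ==> a ! \<rho> n = b ! n"
 shows "sat N (ren \<rho> \<phi>) a \<longleftrightarrow> sat N \<phi> b"
 unfolding ren_def by (rule sat_subst[OF assms(1)]) (use assms(2) in auto)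

lemma sat_append:
 assumes "wf_form \<Sigma> \<phi> \<Gamma>" "length a = length \<Gamma>"
 shows "sat N \<phi> (a @ b) \<longleftrightarrow> sat N \<phi> a"
 using sat_subst[OF assms(1), of N "a @ b" Var a] assms(2) by (auto simp: nth_append)

lemma sat_Falsum [simp]: "\<not> sat N Falsum a"
 by (simp add: Falsum_def)

lemma tuples_length: "a \<in> tuples N \<Gamma> ==> length a = length \<Gamma>"
 by (auto simp: tuples_def list_all2_lengthD)

lemma tuples_Nil [simp]: "tuples N [] = {[]}"
 by (auto simp: tuples_def)

lemma tuples_append_iff:
 "length a = length \<Gamma> ==> a @ b \<in> tuples N (\<Gamma> @ \<Delta>) \<longleftrightarrow> a \<in> tuples N \<Gamma> \<and> b \<in> tuples N \<Delta>"
 by (auto simp: tuples_def list_all2_append)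

lemma tuples_appendE:
 assumes "c \<in> tuples N (\<Gamma> @ \<Delta>)"
 obtains a b where "c = a @ b" "a \<in> tuples N \<Gamma>" "b \<in> tuples N \<Delta>"
 using assms by (auto simp: tuples_def list_all2_append2)

lemma ext_iff: "a \<in> ext N (\<Gamma>, \<phi>) \<longleftrightarrow> a \<in> tuples N \<Gamma> \<and> sat N \<phi> a"
 by (simp add: ext_def)

lemma ext_length: "a \<in> ext N X ==> length a = length (fst X)"
 by (cases X) (auto simp: ext_iff tuples_length)

text \<open>Truth in a split context is recorded as a relation, so that identities between composite
  formulae become relation algebra.\<close>

definition rel :: "('s, 'f, 'r, 'u) interp => 's list => 's list => ('s, 'f, 'r, 'i) form => 'u list rel" where
 "rel N \<Gamma> \<Delta> \<theta> = {(a, b). a \<in> tuples N \<Gamma> \<and> b \<in> tuples N \<Delta> \<and> sat N \<theta> (a @ b)}"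

lemma rel_iff: "(a, b) \<in> rel N \<Gamma> \<Delta> \<theta> \<longleftrightarrow> a \<in> tuples N \<Gamma> \<and> b \<in> tuples N \<Delta> \<and> sat N \<theta> (a @ b)"
 by (simp add: rel_def)

lemma rel_Disj: "rel N \<Gamma> \<Delta> (Disj I F) = (\<Union>i\<in>I. rel N \<Gamma> \<Delta> (F i))"
 by (auto simp: rel_iff)

lemma rel_Conj: "rel N \<Gamma> \<Delta> (Conj \<theta> \<theta>') = rel N \<Gamma> \<Delta> \<theta> \<inter> rel N \<Gamma> \<Delta> \<theta>'"
 by (auto simp: rel_iff)

lemma append_in_ext_iff:
 "length a = length \<Gamma> ==> a @ b \<in> ext N (\<Gamma> @ \<Delta>, \<theta>) \<longleftrightarrow> (a, b) \<in> rel N \<Gamma> \<Delta> \<theta>"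
 by (auto simp: ext_iff rel_iff tuples_append_iff)

lemma valid_rel: "valid N (\<Gamma> @ \<Delta>, \<theta>, \<theta>') \<longleftrightarrow> rel N \<Gamma> \<Delta> \<theta> \<subseteq> rel N \<Gamma> \<Delta> \<theta>'"
proof
 assume "valid N (\<Gamma> @ \<Delta>, \<theta>, \<theta>')"
 then have *: "ext N (\<Gamma> @ \<Delta>, \<theta>) \<subseteq> ext N (\<Gamma> @ \<Delta>, \<theta>')" by (simp add: valid_def)
 show "rel N \<Gamma> \<Delta> \<theta> \<subseteq> rel N \<Gamma> \<Delta> \<theta>'"
 proof clarify
  fix a b assume ab: "(a, b) \<in> rel N \<Gamma> \<Delta> \<theta>"
  then have l: "length a = length \<Gamma>" by (auto simp: rel_iff dest: tuples_length)
  show "(a, b) \<in> rel N \<Gamma> \<Delta> \<theta>'" using ab * unfolding append_in_ext_iff[OF l, symmetric] by blast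
 qed
next
 assume *: "rel N \<Gamma> \<Delta> \<theta> \<subseteq> rel N \<Gamma> \<Delta> \<theta>'"
 show "valid N (\<Gamma> @ \<Delta>, \<theta>, \<theta>')" unfolding valid_def
 proof clarify
  fix c assume "c \<in> ext N (\<Gamma> @ \<Delta>, \<theta>)"
  moreover from this obtain a b where "c = a @ b" "a \<in> tuples N \<Gamma>" "b \<in> tuples N \<Delta>"
   by (auto simp: ext_iff elim: tuples_appendE)
  ultimately show "c \<in> ext N (\<Gamma> @ \<Delta>, \<theta>')" using * by (auto simp: append_in_ext_iff tuples_length)
 qed
qed

lemma valid_iff: "valid N (\<Gamma>, \<phi>, \<psi>) \<longleftrightarrow> ext N (\<Gamma>, \<phi>) \<subseteq> ext N (\<Gamma>, \<psi>)"
 by (simp add: valid_def)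

lemma tuples_Cons: "tuples N (s # \<Delta>) = {x # b | x b. x \<in> Car N s \<and> b \<in> tuples N \<Delta>}"
 by (auto simp: tuples_def list_all2_Cons2)

lemma sat_Exis: "sat N (Exis \<Delta> \<phi>) a \<longleftrightarrow> (\<exists>b\<in>tuples N \<Delta>. sat N \<phi> (b @ a))"
proof (induction \<Delta> arbitrary: \<phi>)
 case (Cons s \<Delta>)
 then show ?case by (force simp: tuples_Cons)
qed simp

lemma wf_Exis:
 "set \<Delta> \<subseteq> Sorts \<Sigma> ==> wf_form \<Sigma> (Exis \<Delta> \<phi>) \<Gamma> \<longleftrightarrow> wf_form \<Sigma> \<phi> (\<Delta> @ \<Gamma>)"
 by (induction \<Delta> arbitrary: \<phi>) auto

lemma sat_foldr_Eql:
 "sat N (foldr (\<lambda>j. Conj (Eql (Var (f j)) (Var (g j)))) js \<phi>) a \<longleftrightarrow>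
  (\<forall>j\<in>set js. a ! f j = a ! g j) \<and> sat N \<phi> a"
 by (induction js) auto

lemma wf_foldr_Eql:
 assumes "wf_form \<Sigma> \<phi> \<Gamma>" "\<And>j. j \<in> set js ==> f j < length \<Gamma> \<and> g j < length \<Gamma> \<and> \<Gamma> ! f j = \<Gamma> ! g j"
 shows "wf_form \<Sigma> (foldr (\<lambda>j. Conj (Eql (Var (f j)) (Var (g j)))) js \<phi>) \<Gamma>"
 using assms by (induction js) auto

lemma sat_tuple_eq: "sat N (tuple_eq m n d) a \<longleftrightarrow> (\<forall>j<d. a ! (m + j) = a ! (n + j))"
 unfolding tuple_eq_def sat_foldr_Eql by auto

lemma wf_tuple_eq:
 assumes "\<And>j. j < d ==> m + j < length \<Gamma> \<and> n + j < length \<Gamma> \<and> \<Gamma> ! (m + j) = \<Gamma> ! (n + j)"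
 shows "wf_form \<Sigma> (tuple_eq m n d) \<Gamma>"
 unfolding tuple_eq_def by (rule wf_foldr_Eql) (use assms in auto)

text \<open>The renaming is the one in \<open>prv_functional\<close> and \<open>comp_form\<close>:
  it exchanges the two blocks of the context, and the formula defines the converse relation.\<close>

definition conv_form :: "'s list => 's list => ('s, 'f, 'r, 'i) form => ('s, 'f, 'r, 'i) form" where
 "conv_form \<Gamma> \<Delta> = ren (\<lambda>n. if n < length \<Gamma> then length \<Delta> + n else n - length \<Gamma>)"

lemma wf_conv_form: "wf_form \<Sigma> \<theta> (\<Gamma> @ \<Delta>) ==> wf_form \<Sigma> (conv_form \<Gamma> \<Delta> \<theta>) (\<Delta> @ \<Gamma>)"
 unfolding conv_form_def by (erule wf_ren) (auto simp: nth_append)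

lemma sat_conv_form:
 assumes "wf_form \<Sigma> \<theta> (\<Gamma> @ \<Delta>)" "length a = length \<Gamma>" "length b = length \<Delta>"
 shows "sat N (conv_form \<Gamma> \<Delta> \<theta>) (b @ a @ c) \<longleftrightarrow> sat N \<theta> (a @ b)"
 unfolding conv_form_def by (rule sat_ren[OF assms(1)]) (use assms in \<open>auto simp: nth_append\<close>)

lemma rel_conv_form:
 assumes "wf_form \<Sigma> \<theta> (\<Gamma> @ \<Delta>)"
 shows "rel N \<Delta> \<Gamma> (conv_form \<Gamma> \<Delta> \<theta>) = (rel N \<Gamma> \<Delta> \<theta>)\<inverse>"
proof -
 have "sat N (conv_form \<Gamma> \<Delta> \<theta>) (b @ a) \<longleftrightarrow> sat N \<theta> (a @ b)" if "a \<in> tuples N \<Gamma>" "b \<in> tuples N \<Delta>" for a b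
  using sat_conv_form[OF assms tuples_length tuples_length, OF that, of N "[]"] by simp
 then show ?thesis by (auto simp: rel_iff)
qed

lemma wf_comp_form:
 assumes "wf_form \<Sigma> \<theta> (\<Gamma> @ \<Delta>)" "wf_form \<Sigma> \<gamma> (\<Delta> @ \<Xi>)" "set \<Delta> \<subseteq> Sorts \<Sigma>"
 shows "wf_form \<Sigma> (comp_form \<Gamma> \<Delta> \<theta> \<gamma>) (\<Gamma> @ \<Xi>)"
 unfolding comp_form_def Let_def using assms
 by (auto simp: wf_Exis nth_append intro!: wf_ren[OF assms(1)] wf_ren[OF assms(2)])

lemma rel_comp_form:
 assumes "wf_form \<Sigma> \<theta> (\<Gamma> @ \<Delta>)" "wf_form \<Sigma> \<gamma> (\<Delta> @ \<Xi>)"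
 shows "rel N \<Gamma> \<Xi> (comp_form \<Gamma> \<Delta> \<theta> \<gamma>) = rel N \<Gamma> \<Delta> \<theta> O rel N \<Delta> \<Xi> \<gamma>"
proof -
 have 1: "sat N (ren (\<lambda>n. if n < length \<Gamma> then length \<Delta> + n else n - length \<Gamma>) \<theta>) (b @ a @ c) \<longleftrightarrow> sat N \<theta> (a @ b)"
  if "length a = length \<Gamma>" "length b = length \<Delta>" for a b c
  by (rule sat_ren[OF assms(1)]) (use that in \<open>auto simp: nth_append\<close>)
 have 2: "sat N (ren (\<lambda>n. if n < length \<Delta> then n else length \<Gamma> + n) \<gamma>) (b @ a @ c) \<longleftrightarrow> sat N \<gamma> (b @ c)"
  if "length a = length \<Gamma>" "length b = length \<Delta>" for a b c
  by (rule sat_ren[OF assms(2)]) (use that in \<open>auto simp: nth_append\<close>)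
 show ?thesis unfolding comp_form_def Let_def
  by (auto simp: rel_iff relcomp_unfold sat_Exis 1 2 tuples_length) blast
qed

lemma rel_id_form:
 fixes N :: "('s, 'f, 'r, 'u) interp"
 assumes "wf_form \<Sigma> (snd X) (fst X)"
 shows "rel N (fst X) (fst X) (id_form X) = Id_on (ext N X)"
proof (cases X)
 case (Pair \<Gamma> \<phi>)
 have "sat N (id_form X) (a @ b) \<longleftrightarrow> sat N \<phi> a \<and> a = b" if "a \<in> tuples N \<Gamma>" "b \<in> tuples N \<Gamma>" for a b
 proof -
  have l: "length a = length \<Gamma>" "length b = length \<Gamma>" using that by (auto dest: tuples_length)
  have "sat N \<phi> (a @ b) \<longleftrightarrow> sat N \<phi> a" using sat_append[of \<Sigma> \<phi> \<Gamma>] assms l Pair by auto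
  moreover have "(a @ b) ! j = a ! j" "(a @ b) ! (length \<Gamma> + j) = b ! j" if "j < length \<Gamma>" for j
   using nth_append_length_plus[of a b j] nth_append_left[of j a b] l that by auto
  moreover have "(\<forall>j<length \<Gamma>. (a @ b) ! j = (a @ b) ! (length \<Gamma> + j)) \<longleftrightarrow> (\<forall>j<length \<Gamma>. a ! j = b ! j)"
   using calculation by simp
  moreover have "(\<forall>j<length \<Gamma>. a ! j = b ! j) \<longleftrightarrow> a = b" using l by (metis nth_equalityI)
  ultimately show ?thesis by (simp add: Pair id_form_def sat_tuple_eq)
 qed
 then show ?thesis using Pair by (auto simp: rel_iff ext_iff Id_on_iff)
qed

lemma wf_id_form: "wf_form \<Sigma> (snd X) (fst X) ==> wf_form \<Sigma> (id_form X) (fst X @ fst X)"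
 by (cases X) (auto simp: id_form_def nth_append intro!: wf_append wf_tuple_eq)

text \<open>The graph of the projection of \<open>\<phi>(x)\<close> to the coordinates listed in \<open>js\<close>.\<close>

definition proj_form :: "'s list => ('s, 'f, 'r, 'i) form => nat list => ('s, 'f, 'r, 'i) form" where
 "proj_form \<Gamma> \<phi> js = foldr (\<lambda>j. Conj (Eql (Var (js ! j)) (Var (length \<Gamma> + j)))) [0..<length js] \<phi>"

lemma wf_proj_form:
 assumes "wf_form \<Sigma> \<phi> \<Gamma>" "set js \<subseteq> {..<length \<Gamma>}"
 shows "wf_form \<Sigma> (proj_form \<Gamma> \<phi> js) (\<Gamma> @ map ((!) \<Gamma>) js)"
proof -
 have js: "js ! j < length \<Gamma>" if "j < length js" for j using assms(2) that nth_mem by auto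
 show ?thesis unfolding proj_form_def
  by (rule wf_foldr_Eql) (use assms js in \<open>auto simp: nth_append trans_less_add1 intro: wf_append\<close>)
qed

lemma rel_proj_form:
 assumes "wf_form \<Sigma> \<phi> \<Gamma>" "set js \<subseteq> {..<length \<Gamma>}"
 shows "rel N \<Gamma> (map ((!) \<Gamma>) js) (proj_form \<Gamma> \<phi> js) = {(a, map ((!) a) js) | a. a \<in> ext N (\<Gamma>, \<phi>)}"
proof -
 have js: "js ! j < length \<Gamma>" if "j < length js" for j using assms(2) that nth_mem by auto
 have sat: "sat N (proj_form \<Gamma> \<phi> js) (a @ b) \<longleftrightarrow> b = map ((!) a) js \<and> sat N \<phi> a"
  if l: "length a = length \<Gamma>" "length b = length js" for a b
 proof -
  have "(a @ b) ! (js ! j) = a ! (js ! j)" "(a @ b) ! (length \<Gamma> + j) = b ! j" if "j < length js" for j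
   using js[OF that] nth_append_length_plus[of a b j] l by (auto simp: nth_append)
  then have "sat N (proj_form \<Gamma> \<phi> js) (a @ b) \<longleftrightarrow> (\<forall>j<length js. a ! (js ! j) = b ! j) \<and> sat N \<phi> (a @ b)"
   unfolding proj_form_def sat_foldr_Eql by auto
  moreover have "(\<forall>j<length js. a ! (js ! j) = b ! j) \<longleftrightarrow> b = map ((!) a) js"
   using l by (metis length_map nth_equalityI nth_map)
  ultimately show ?thesis using sat_append[OF assms(1) l(1)] by simp
 qed
 have tup: "map ((!) a) js \<in> tuples N (map ((!) \<Gamma>) js)" if "a \<in> tuples N \<Gamma>" for a
  using that js by (auto simp: tuples_def list_all2_conv_all_nth)
 show ?thesis using tup sat by (auto simp: rel_iff ext_iff tuples_length)
qed

definition fun_rel :: "'a set => 'b set => ('a \<times> 'b) set => bool" where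
 "fun_rel A B r \<longleftrightarrow> r \<subseteq> A \<times> B \<and> single_valued r \<and> A \<subseteq> Domain r"

lemma fun_rel_comp: "fun_rel A B r ==> fun_rel B C s ==> fun_rel A C (r O s)"
 unfolding fun_rel_def by (auto intro: single_valued_relcomp) blast

lemma fun_rel_Id_on: "fun_rel A A (Id_on A)"
 by (auto simp: fun_rel_def single_valued_def)

lemma fun_rel_eq: "fun_rel A B r ==> fun_rel A B s ==> r \<subseteq> s ==> r = s"
 by (auto simp: fun_rel_def single_valued_def) blast

abbreviation arel :: "('s, 'f, 'r, 'u) interp => ('s, 'f, 'r, 'i) fic => ('s, 'f, 'r, 'i) fic =>
  ('s, 'f, 'r, 'i) form => 'u list rel" where
 "arel N X Y \<equiv> rel N (fst X) (fst Y)"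

section \<open>The syntactic category in terms of relations\<close>

context geometric_theory
begin

lemma fic_fst_snd: "X \<in> fics \<longleftrightarrow> set (fst X) \<subseteq> Sorts \<Sigma> \<and> wff (snd X) (fst X)"
 by (cases X) (simp add: fic_iff)

text \<open>The three sequents of \<open>prv_functional\<close> say, in this order, that the
  relation lies in the product, is single-valued and is total (\<open>v1\<close>, \<open>v2\<close>,
  \<open>v3\<close>). Each corresponds to an event, and a filter admits the conjunction of three
  events.\<close>

lemma prv_functional_iff:
 assumes "X \<in> fics" "Y \<in> fics"
 shows "prv_functional \<Sigma> \<T> X Y \<theta> \<longleftrightarrow> wff \<theta> (fst X @ fst Y) \<and>
  (EV N. fun_rel (ext N X) (ext N Y) (arel N X Y \<theta>))"
proof (cases "wff \<theta> (fst X @ fst Y)")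
 case False
 then show ?thesis by (auto simp: prv_functional_def split_beta Let_def fic_iff)
next
 case True
 obtain \<Gamma> \<phi> \<Delta> \<psi> where XY: "X = (\<Gamma>, \<phi>)" "Y = (\<Delta>, \<psi>)" by (cases X, cases Y)
 have wf: "set \<Gamma> \<subseteq> Sorts \<Sigma>" "set \<Delta> \<subseteq> Sorts \<Sigma>" "wff \<phi> \<Gamma>" "wff \<psi> \<Delta>" "wff \<theta> (\<Gamma> @ \<Delta>)"
  using assms XY True by (auto simp: fic_iff)
 let ?c = "length \<Gamma>" let ?d = "length \<Delta>"
 let ?f1 = "Conj \<phi> (ren (\<lambda>n. ?c + n) \<psi>)"
 let ?f2 = "Conj \<theta> (ren (\<lambda>n. if n < ?c then n else n + ?d) \<theta>)"
 let ?eq = "tuple_eq ?c (?c + ?d) ?d :: ('s, 'f, 'r, 'i) form"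
 let ?f3 = "Exis \<Delta> (ren (\<lambda>n. if n < ?c then ?d + n else n - ?c) \<theta>)"
 have f: "(\<Gamma> @ \<Delta>, ?f1) \<in> fics" "(\<Gamma> @ \<Delta> @ \<Delta>, ?f2) \<in> fics" "(\<Gamma> @ \<Delta> @ \<Delta>, tuple_eq ?c (?c + ?d) ?d) \<in> fics"
  "(\<Gamma>, ?f3) \<in> fics" "(\<Gamma> @ \<Delta>, \<theta>) \<in> fics" "(\<Gamma>, \<phi>) \<in> fics"
  using wf wf_append[OF wf(5), of \<Delta>]
  by (auto simp: fic_iff wf_Exis nth_append intro!: wf_append wf_ren[OF wf(4)] wf_ren[OF wf(5)] wf_tuple_eq)
 have v1: "valid N (\<Gamma> @ \<Delta>, \<theta>, ?f1) \<longleftrightarrow> rel N \<Gamma> \<Delta> \<theta> \<subseteq> ext N X \<times> ext N Y" for N :: "('s, 'f, 'r, 'f trm set) interp"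
 proof -
  have "sat N (ren (\<lambda>n. ?c + n) \<psi>) (a @ b) \<longleftrightarrow> sat N \<psi> b" if "length a = ?c" for a b
   by (rule sat_ren[OF wf(4)]) (use that nth_append_length_plus[of a b] in simp)
  then have "sat N ?f1 (a @ b) \<longleftrightarrow> sat N \<phi> a \<and> sat N \<psi> b" if "a \<in> tuples N \<Gamma>" for a b
   using sat_append[OF wf(3), of a N b] tuples_length[OF that] by simp
  then have "rel N \<Gamma> \<Delta> ?f1 = ext N X \<times> ext N Y"
   by (auto simp del: sat.simps simp: rel_iff XY ext_iff)
  then show ?thesis by (simp add: valid_rel)
 qed
 have v2: "valid N (\<Gamma> @ \<Delta> @ \<Delta>, ?f2, ?eq) \<longleftrightarrow> single_valued (rel N \<Gamma> \<Delta> \<theta>)"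
  for N :: "('s, 'f, 'r, 'f trm set) interp"
 proof -
  have 1: "sat N (ren (\<lambda>n. if n < ?c then n else n + ?d) \<theta>) (a @ b @ c) \<longleftrightarrow> sat N \<theta> (a @ c)"
   if "length a = ?c" "length b = ?d" for a b c
   by (rule sat_ren[OF wf(5)]) (use that in \<open>auto simp: nth_append\<close>)
  have 2: "sat N \<theta> (a @ b @ c) \<longleftrightarrow> sat N \<theta> (a @ b)" if "length a = ?c" "length b = ?d" for a b c
   using sat_append[OF wf(5), of "a @ b" N c] that by auto
  have 3: "sat N (?eq) (a @ b @ c) \<longleftrightarrow> b = c"
   if l: "length a = ?c" "length b = ?d" "length c = ?d" for a b c
  proof -
   have "(a @ b @ c) ! (?c + j) = b ! j" "(a @ b @ c) ! (?c + ?d + j) = c ! j" if "j < ?d" for j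
    using that l nth_append_length_plus[of a "b @ c" j] nth_append_length_plus[of "a @ b" c j] nth_append_left[of j b c]
    by simp_all
   then have "sat N (?eq) (a @ b @ c) \<longleftrightarrow> (\<forall>j<?d. b ! j = c ! j)"
    unfolding sat_tuple_eq by simp
   then show ?thesis using l by (metis nth_equalityI)
  qed
  \<comment> \<open>Read with source \<Gamma> and target \<open>\<Delta> @ \<Delta>\<close>, the
    hypothesis of the second sequent relates \<open>a\<close> to the pairs of its images.\<close>
  have f2: "(a, b @ c) \<in> rel N \<Gamma> (\<Delta> @ \<Delta>) ?f2 \<longleftrightarrow> (a, b) \<in> rel N \<Gamma> \<Delta> \<theta> \<and> (a, c) \<in> rel N \<Gamma> \<Delta> \<theta>"
   if t: "a \<in> tuples N \<Gamma>" "b \<in> tuples N \<Delta>" "c \<in> tuples N \<Delta>" for a b c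
  proof -
   note l = tuples_length[OF t(1)] tuples_length[OF t(2)]
   show ?thesis unfolding rel_iff sat.simps 1[OF l] 2[OF l] tuples_append_iff[OF l(2)] using t by blast
  qed
  have eq: "(a, b @ c) \<in> rel N \<Gamma> (\<Delta> @ \<Delta>) ?eq \<longleftrightarrow> b = c"
   if t: "a \<in> tuples N \<Gamma>" "b \<in> tuples N \<Delta>" "c \<in> tuples N \<Delta>" for a b c
  proof -
   note l = tuples_length[OF t(1)] tuples_length[OF t(2)] tuples_length[OF t(3)]
   show ?thesis unfolding rel_iff 3[OF l] tuples_append_iff[OF l(2)] using t by blast
  qed
  show ?thesis unfolding valid_rel
  proof
   assume *: "rel N \<Gamma> (\<Delta> @ \<Delta>) ?f2 \<subseteq> rel N \<Gamma> (\<Delta> @ \<Delta>) ?eq"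
   show "single_valued (rel N \<Gamma> \<Delta> \<theta>)"
   proof (rule single_valuedI)
    fix a b c assume r: "(a, b) \<in> rel N \<Gamma> \<Delta> \<theta>" "(a, c) \<in> rel N \<Gamma> \<Delta> \<theta>"
    then have t: "a \<in> tuples N \<Gamma>" "b \<in> tuples N \<Delta>" "c \<in> tuples N \<Delta>" by (simp_all add: rel_iff)
    show "b = c" using subsetD[OF *, of "(a, b @ c)"] r unfolding f2[OF t] eq[OF t] by blast
   qed
  next
   assume *: "single_valued (rel N \<Gamma> \<Delta> \<theta>)"
   show "rel N \<Gamma> (\<Delta> @ \<Delta>) ?f2 \<subseteq> rel N \<Gamma> (\<Delta> @ \<Delta>) ?eq"
   proof (rule subrelI)
    fix a d assume ad: "(a, d) \<in> rel N \<Gamma> (\<Delta> @ \<Delta>) ?f2"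
    then have "d \<in> tuples N (\<Delta> @ \<Delta>)" "a \<in> tuples N \<Gamma>" by (simp_all add: rel_iff)
    then obtain b c where d: "d = b @ c" and t: "a \<in> tuples N \<Gamma>" "b \<in> tuples N \<Delta>" "c \<in> tuples N \<Delta>"
     by (auto elim: tuples_appendE)
    show "(a, d) \<in> rel N \<Gamma> (\<Delta> @ \<Delta>) ?eq"
     using ad single_valuedD[OF *] unfolding d f2[OF t] eq[OF t] by blast
   qed
  qed
 qed
 have v3: "valid N (\<Gamma>, \<phi>, ?f3) \<longleftrightarrow> ext N X \<subseteq> Domain (rel N \<Gamma> \<Delta> \<theta>)" for N :: "('s, 'f, 'r, 'f trm set) interp"
 proof -
  have "sat N (ren (\<lambda>n. if n < ?c then ?d + n else n - ?c) \<theta>) (b @ a) \<longleftrightarrow> sat N \<theta> (a @ b)"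
   if "a \<in> tuples N \<Gamma>" "b \<in> tuples N \<Delta>" for a b
   by (rule sat_ren[OF wf(5)]) (use tuples_length[OF that(1)] tuples_length[OF that(2)] in \<open>auto simp: nth_append\<close>)
  then have "ext N (\<Gamma>, ?f3) = Domain (rel N \<Gamma> \<Delta> \<theta>)"
   by (auto simp: ext_iff sat_Exis rel_iff Domain_iff) blast
  then show ?thesis by (simp add: valid_iff XY)
 qed
 have "prv_functional \<Sigma> \<T> X Y \<theta> \<longleftrightarrow> pv (\<Gamma> @ \<Delta>) \<theta> ?f1 \<and>
   pv (\<Gamma> @ \<Delta> @ \<Delta>) ?f2 (tuple_eq ?c (?c + ?d) ?d) \<and> pv \<Gamma> \<phi> ?f3"
  using f by (simp add: prv_functional_def XY Let_def)
 also have "\<dots> \<longleftrightarrow> (EV N. fun_rel (ext N X) (ext N Y) (arel N X Y \<theta>))"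
  unfolding prv_iff_eventually[OF f(5,1)] prv_iff_eventually[OF f(2,3)] prv_iff_eventually[OF f(6,4)]
   v1 v2 v3 fun_rel_def eventually_conj_iff by (simp add: XY)
 finally show ?thesis using True by simp
qed

lemma prv_rel_iff:
 assumes "set (\<Gamma> @ \<Delta>) \<subseteq> Sorts \<Sigma>" "wff \<theta> (\<Gamma> @ \<Delta>)" "wff \<theta>' (\<Gamma> @ \<Delta>)"
 shows "pv (\<Gamma> @ \<Delta>) \<theta> \<theta>' \<longleftrightarrow> (EV N. rel N \<Gamma> \<Delta> \<theta> \<subseteq> rel N \<Gamma> \<Delta> \<theta>')"
 using prv_iff_eventually[of "\<Gamma> @ \<Delta>" \<theta> \<theta>'] assms by (simp add: fic_iff valid_rel)

lemma prv_ext_iff: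
 assumes "(\<Gamma>, \<phi>) \<in> fics" "(\<Gamma>, \<psi>) \<in> fics"
 shows "pv \<Gamma> \<phi> \<psi> \<longleftrightarrow> (EV N. ext N (\<Gamma>, \<phi>) \<subseteq> ext N (\<Gamma>, \<psi>))"
 using prv_iff_eventually[of \<Gamma> \<phi> \<psi>] assms by (simp add: valid_iff)

abbreviation "\<C> \<equiv> syn_cat \<Sigma> \<T>"
abbreviation "arr \<equiv> syn_arrow \<Sigma> \<T>"
abbreviation "fnl \<equiv> prv_functional \<Sigma> \<T>"

lemma fnl_wf: "X \<in> fics ==> Y \<in> fics ==> fnl X Y \<theta> ==> wff \<theta> (fst X @ fst Y)"
 by (simp add: prv_functional_iff)

lemma fnl_eventually:
 "X \<in> fics ==> Y \<in> fics ==> fnl X Y \<theta> ==> EV N. fun_rel (ext N X) (ext N Y) (arel N X Y \<theta>)"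
 by (simp add: prv_functional_iff)

lemma prv_class_eq_iff:
 assumes "set (\<Gamma> @ \<Delta>) \<subseteq> Sorts \<Sigma>" "wff \<theta> (\<Gamma> @ \<Delta>)" "wff \<theta>' (\<Gamma> @ \<Delta>)"
 shows "prv_class \<Sigma> \<T> (\<Gamma> @ \<Delta>) \<theta> = prv_class \<Sigma> \<T> (\<Gamma> @ \<Delta>) \<theta>' \<longleftrightarrow>
  (EV N. rel N \<Gamma> \<Delta> \<theta> = rel N \<Gamma> \<Delta> \<theta>')"
proof -
 have "(\<Gamma> @ \<Delta>, \<theta>) \<in> fics" using assms by (auto simp: fic_iff)
 then have "pv (\<Gamma> @ \<Delta>) \<theta> \<theta>" by (rule Ident)
 then have "prv_class \<Sigma> \<T> (\<Gamma> @ \<Delta>) \<theta> = prv_class \<Sigma> \<T> (\<Gamma> @ \<Delta>) \<theta>' \<longleftrightarrow>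
   pv (\<Gamma> @ \<Delta>) \<theta> \<theta>' \<and> pv (\<Gamma> @ \<Delta>) \<theta>' \<theta>"
  unfolding prv_class_def by (auto intro: Cut)
 then show ?thesis using assms
  by (auto simp: prv_rel_iff eventually_conj_iff[symmetric] set_eq_subset simp del: eventually_conj_iff)
qed

lemma arr_eq_iff:
 assumes "X \<in> fics" "Y \<in> fics" "fnl X Y \<theta>" "fnl X Y \<theta>'"
 shows "arr X Y \<theta> = arr X Y \<theta>' \<longleftrightarrow> (EV N. arel N X Y \<theta> = arel N X Y \<theta>')"
 unfolding syn_arrow_def using prv_class_eq_iff[of "fst X" "fst Y" \<theta> \<theta>'] assms fnl_wf[of X Y]
 by (auto simp: fic_fst_snd)

text \<open>One inclusion suffices, since both relations are eventually graphs of total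
  functions.\<close>

lemma arr_eqI:
 assumes "X \<in> fics" "Y \<in> fics" "fnl X Y \<theta>" "fnl X Y \<theta>'"
  "EV N. arel N X Y \<theta> \<subseteq> arel N X Y \<theta>'"
 shows "arr X Y \<theta> = arr X Y \<theta>'"
 unfolding arr_eq_iff[OF assms(1-4)]
 using assms(5) fnl_eventually[OF assms(1,2,3)] fnl_eventually[OF assms(1,2,4)]
 by eventually_elim (rule fun_rel_eq)

lemma Obj_C [simp]: "Obj \<C> = fics"
 by (simp add: syn_cat_def)

lemma Hom_C: "f \<in> Hom \<C> X Y \<longleftrightarrow> (\<exists>\<theta>. f = arr X Y \<theta> \<and> fnl X Y \<theta>)"
 by (auto simp: syn_cat_def)

lemma Hom_C_I: "fnl X Y \<theta> ==> arr X Y \<theta> \<in> Hom \<C> X Y"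
 by (auto simp: Hom_C)

lemma arel_comp_form:
 assumes "X \<in> fics" "Y \<in> fics" "Z \<in> fics" "fnl X Y \<theta>" "fnl Y Z \<gamma>"
 shows "arel N X Z (comp_form (fst X) (fst Y) \<theta> \<gamma>) = arel N X Y \<theta> O arel N Y Z \<gamma>"
 by (rule rel_comp_form) (use assms in \<open>auto intro: fnl_wf\<close>)

lemma fnl_comp:
 assumes "X \<in> fics" "Y \<in> fics" "Z \<in> fics" "fnl X Y \<theta>" "fnl Y Z \<gamma>"
 shows "fnl X Z (comp_form (fst X) (fst Y) \<theta> \<gamma>)"
 unfolding prv_functional_iff[OF assms(1,3)] arel_comp_form[OF assms]
proof
 show "wff (comp_form (fst X) (fst Y) \<theta> \<gamma>) (fst X @ fst Z)"
  using wf_comp_form[OF fnl_wf[OF assms(1,2,4)] fnl_wf[OF assms(2,3,5)]] assms(2) by (simp add: fic_fst_snd)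
 show "EV N. fun_rel (ext N X) (ext N Z) (arel N X Y \<theta> O arel N Y Z \<gamma>)"
  using fnl_eventually[OF assms(1,2,4)] fnl_eventually[OF assms(2,3,5)]
  by eventually_elim (rule fun_rel_comp)
qed

text \<open>\<open>Cmp\<close> takes a union over all representatives of both classes. By the
  relational description all their composites are provably equivalent, so that the union is a single
  class.\<close>

lemma Cmp_arr:
 assumes "X \<in> fics" "Y \<in> fics" "Z \<in> fics" "fnl X Y \<theta>" "fnl Y Z \<gamma>"
 shows "Cmp \<C> (arr Y Z \<gamma>) (arr X Y \<theta>) = arr X Z (comp_form (fst X) (fst Y) \<theta> \<gamma>)"
proof -
 have s: "set (fst X @ fst Y) \<subseteq> Sorts \<Sigma>" "set (fst Y @ fst Z) \<subseteq> Sorts \<Sigma>" "set (fst X @ fst Z) \<subseteq> Sorts \<Sigma>"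
  using assms by (auto simp: fic_fst_snd)
 have *: "prv_class \<Sigma> \<T> (fst X @ fst Z) (comp_form (fst X) (fst Y) \<theta>' \<gamma>') =
   prv_class \<Sigma> \<T> (fst X @ fst Z) (comp_form (fst X) (fst Y) \<theta> \<gamma>)"
  if "\<theta>' \<in> prv_class \<Sigma> \<T> (fst X @ fst Y) \<theta>" "\<gamma>' \<in> prv_class \<Sigma> \<T> (fst Y @ fst Z) \<gamma>" for \<theta>' \<gamma>'
 proof -
  have prv: "pv (fst X @ fst Y) \<theta> \<theta>'" "pv (fst X @ fst Y) \<theta>' \<theta>"
   "pv (fst Y @ fst Z) \<gamma> \<gamma>'" "pv (fst Y @ fst Z) \<gamma>' \<gamma>"
   using that by (auto simp: prv_class_def)
  have wf: "wff \<theta>' (fst X @ fst Y)" "wff \<gamma>' (fst Y @ fst Z)"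
   using prv_wf[OF prv(1)] prv_wf[OF prv(3)] by (auto simp: fic_iff)
  have wf': "wff \<theta> (fst X @ fst Y)" "wff \<gamma> (fst Y @ fst Z)"
   using assms by (auto intro: fnl_wf)
  have "EV N. arel N X Y \<theta>' O arel N Y Z \<gamma>' = arel N X Y \<theta> O arel N Y Z \<gamma>"
   using prv(1-2)[unfolded prv_rel_iff[OF s(1) wf'(1) wf(1)] prv_rel_iff[OF s(1) wf(1) wf'(1)]]
    prv(3-4)[unfolded prv_rel_iff[OF s(2) wf'(2) wf(2)] prv_rel_iff[OF s(2) wf(2) wf'(2)]]
   by eventually_elim blast
  then show ?thesis using wf wf' s
   by (subst prv_class_eq_iff) (auto intro!: wf_comp_form simp: rel_comp_form[OF wf] rel_comp_form[OF wf'])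
 qed
 have "\<theta> \<in> prv_class \<Sigma> \<T> (fst X @ fst Y) \<theta>" "\<gamma> \<in> prv_class \<Sigma> \<T> (fst Y @ fst Z) \<gamma>"
  using s assms unfolding prv_class_def by (auto intro!: Ident simp: fic_iff fnl_wf)
 then have "(\<Union>\<theta>'\<in>prv_class \<Sigma> \<T> (fst X @ fst Y) \<theta>. \<Union>\<gamma>'\<in>prv_class \<Sigma> \<T> (fst Y @ fst Z) \<gamma>.
   prv_class \<Sigma> \<T> (fst X @ fst Z) (comp_form (fst X) (fst Y) \<theta>' \<gamma>')) =
   prv_class \<Sigma> \<T> (fst X @ fst Z) (comp_form (fst X) (fst Y) \<theta> \<gamma>)"
  using * by blast
 then show ?thesis by (simp add: syn_cat_def syn_arrow_def)
qed

lemma fnl_id: "X \<in> fics ==> fnl X X (id_form X)"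
 by (simp add: prv_functional_iff wf_id_form rel_id_form[of \<Sigma> X] fun_rel_Id_on) (simp add: fic_fst_snd wf_id_form rel_id_form[of \<Sigma> X] fun_rel_Id_on)

lemma Idn_C: "Idn \<C> X = arr X X (id_form X)"
 by (simp add: syn_cat_def)

lemma arr_eqI':
 assumes "X \<in> fics" "Y \<in> fics" "fnl X Y \<theta>" "fnl X Y \<theta>'"
  "\<And>N :: ('s, 'f, 'r, 'f trm set) interp. fun_rel (ext N X) (ext N Y) (arel N X Y \<theta>) ==>
   fun_rel (ext N X) (ext N Y) (arel N X Y \<theta>') ==> arel N X Y \<theta> \<subseteq> arel N X Y \<theta>'"
 shows "arr X Y \<theta> = arr X Y \<theta>'"
proof (rule arr_eqI[OF assms(1-4)])
 show "EV N. arel N X Y \<theta> \<subseteq> arel N X Y \<theta>'"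
  using fnl_eventually[OF assms(1,2,3)] fnl_eventually[OF assms(1,2,4)] by eventually_elim (rule assms(5))
qed

text \<open>Each law is a law of relational composition in every interpretation, and equality of
  relations is equality of arrows.\<close>

lemma is_category_C: "is_category \<C>"
 unfolding is_category_def Obj_C
proof (intro conjI ballI impI)
 fix X assume X: "X \<in> fics"
 show "Idn \<C> X \<in> Hom \<C> X X" unfolding Idn_C using fnl_id[OF X] by (rule Hom_C_I)
next
 fix X Y Z f g assume *: "X \<in> fics" "Y \<in> fics" "Z \<in> fics" "f \<in> Hom \<C> X Y" "g \<in> Hom \<C> Y Z"
 then obtain \<theta> \<gamma> where "f = arr X Y \<theta>" "fnl X Y \<theta>" "g = arr Y Z \<gamma>" "fnl Y Z \<gamma>" by (auto simp: Hom_C)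
 then show "Cmp \<C> g f \<in> Hom \<C> X Z" using * by (auto simp: Cmp_arr intro!: Hom_C_I fnl_comp)
next
 fix X Y f assume *: "X \<in> fics" "Y \<in> fics" "f \<in> Hom \<C> X Y"
 then obtain \<theta> where \<theta>: "f = arr X Y \<theta>" "fnl X Y \<theta>" by (auto simp: Hom_C)
 have i: "fnl X X (id_form X)" "fnl Y Y (id_form Y)" using * fnl_id by auto
 have "arel N X X (id_form X) = Id_on (ext N X)" "arel N Y Y (id_form Y) = Id_on (ext N Y)"
  for N :: "('s, 'f, 'r, 'f trm set) interp"
  using * rel_id_form[of \<Sigma> X N] rel_id_form[of \<Sigma> Y N] by (simp_all add: fic_fst_snd)
 then have r: "arel N X Y (comp_form (fst X) (fst X) (id_form X) \<theta>) = Id_on (ext N X) O arel N X Y \<theta>"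
  "arel N X Y (comp_form (fst X) (fst Y) \<theta> (id_form Y)) = arel N X Y \<theta> O Id_on (ext N Y)"
  for N :: "('s, 'f, 'r, 'f trm set) interp"
  using arel_comp_form[OF *(1,1,2) i(1) \<theta>(2), of N] arel_comp_form[OF *(1,2,2) \<theta>(2) i(2), of N] by simp_all
 show "Cmp \<C> f (Idn \<C> X) = f"
  unfolding Idn_C \<theta>(1) Cmp_arr[OF *(1,1,2) i(1) \<theta>(2)]
  by (rule arr_eqI'[OF *(1,2) fnl_comp[OF *(1,1,2) i(1) \<theta>(2)] \<theta>(2)]) (auto simp: r)
 show "Cmp \<C> (Idn \<C> Y) f = f"
  unfolding Idn_C \<theta>(1) Cmp_arr[OF *(1,2,2) \<theta>(2) i(2)]
  by (rule arr_eqI'[OF *(1,2) fnl_comp[OF *(1,2,2) \<theta>(2) i(2)] \<theta>(2)]) (auto simp: r)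
next
 fix W X Y Z f g h
 assume *: "W \<in> fics" "X \<in> fics" "Y \<in> fics" "Z \<in> fics" "f \<in> Hom \<C> W X" "g \<in> Hom \<C> X Y" "h \<in> Hom \<C> Y Z"
 then obtain \<theta> \<gamma> \<delta> where e: "f = arr W X \<theta>" "fnl W X \<theta>" "g = arr X Y \<gamma>" "fnl X Y \<gamma>" "h = arr Y Z \<delta>" "fnl Y Z \<delta>"
  by (auto simp: Hom_C)
 show "Cmp \<C> h (Cmp \<C> g f) = Cmp \<C> (Cmp \<C> h g) f"
  unfolding e using * e fnl_comp[of W X Y \<theta> \<gamma>] fnl_comp[of X Y Z \<gamma> \<delta>]
  by (auto simp: Cmp_arr arel_comp_form O_assoc intro!: arr_eqI' fnl_comp)
next
 fix X Y X' Y' assume "Hom \<C> X Y \<inter> Hom \<C> X' Y' \<noteq> {}"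
 then show "X = X'" "Y = Y'" by (auto simp: Hom_C syn_arrow_def)
qed

end

section \<open>Categories, presheaves and sheaves\<close>

definition arrows :: "('o, 'a) category => 'a set" where
 "arrows C = (\<Union>X\<in>Obj C. \<Union>Y\<in>Obj C. Hom C X Y)"

definition cdom :: "('o, 'a) category => 'a => 'o" where
 "cdom C f = (THE X. X \<in> Obj C \<and> (\<exists>Y\<in>Obj C. f \<in> Hom C X Y))"

definition ccod :: "('o, 'a) category => 'a => 'o" where
 "ccod C f = (THE Y. Y \<in> Obj C \<and> (\<exists>X\<in>Obj C. f \<in> Hom C X Y))"

lemma arrowsI: "X \<in> Obj C ==> Y \<in> Obj C ==> f \<in> Hom C X Y ==> f \<in> arrows C"
 by (auto simp: arrows_def)

locale cat =
 fixes C :: "('o, 'a) category"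
 assumes is_cat: "is_category C"
begin

lemma Idn [intro]: "X \<in> Obj C ==> Idn C X \<in> Hom C X X"
 using is_cat by (simp add: is_category_def)

lemma Cmp [intro]:
 "X \<in> Obj C ==> Y \<in> Obj C ==> Z \<in> Obj C ==> f \<in> Hom C X Y ==> g \<in> Hom C Y Z ==> Cmp C g f \<in> Hom C X Z"
 using is_cat by (auto simp: is_category_def)

lemma Cmp_Idn: "X \<in> Obj C ==> Y \<in> Obj C ==> f \<in> Hom C X Y ==> Cmp C f (Idn C X) = f"
 and Idn_Cmp: "X \<in> Obj C ==> Y \<in> Obj C ==> f \<in> Hom C X Y ==> Cmp C (Idn C Y) f = f"
 using is_cat by (auto simp: is_category_def)

lemma assoc:
 "W \<in> Obj C ==> X \<in> Obj C ==> Y \<in> Obj C ==> Z \<in> Obj C ==> f \<in> Hom C W X ==> g \<in> Hom C X Y ==> h \<in> Hom C Y Z ==>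
  Cmp C h (Cmp C g f) = Cmp C (Cmp C h g) f"
 using is_cat unfolding is_category_def by blast

lemma Hom_disj:
 "X \<in> Obj C ==> Y \<in> Obj C ==> X' \<in> Obj C ==> Y' \<in> Obj C ==> f \<in> Hom C X Y ==> f \<in> Hom C X' Y' ==> X = X' \<and> Y = Y'"
 using is_cat unfolding is_category_def by blast

lemma cdom_eq: "X \<in> Obj C ==> Y \<in> Obj C ==> f \<in> Hom C X Y ==> cdom C f = X"
 unfolding cdom_def using Hom_disj by blast

lemma ccod_eq: "X \<in> Obj C ==> Y \<in> Obj C ==> f \<in> Hom C X Y ==> ccod C f = Y"
 unfolding ccod_def using Hom_disj by blast

end

lemma full_subcat_simps [simp]:
 "Obj (full_subcat C S) = Obj C \<inter> S" "Hom (full_subcat C S) = Hom C"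
 "Idn (full_subcat C S) = Idn C" "Cmp (full_subcat C S) = Cmp C"
 by (simp_all add: full_subcat_def)

lemma op_cat_simps [simp]:
 "Obj (op_cat C) = Obj C" "Hom (op_cat C) X Y = Hom C Y X"
 "Idn (op_cat C) = Idn C" "Cmp (op_cat C) g f = Cmp C f g"
 by (simp_all add: op_cat_def)

lemma set_cat_simps [simp]:
 "Obj (set_cat \<U>) = \<U>" "Hom (set_cat \<U>) A B = {(A, h, B) | h. h \<in> A \<rightarrow>\<^sub>E B}"
 "Idn (set_cat \<U>) A = (A, \<lambda>x\<in>A. x, A)"
 "Cmp (set_cat \<U>) (B, k, D) (A, h, B') = (A, compose A k h, D)"
 by (simp_all add: set_cat_def)

lemma is_category_op:
 assumes "is_category C"
 shows "is_category (op_cat C)"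
proof -
 interpret cat C using assms by unfold_locales
 show ?thesis unfolding is_category_def op_cat_simps
 proof (intro conjI ballI impI)
  fix W X Y Z f g h
  assume "W \<in> Obj C" "X \<in> Obj C" "Y \<in> Obj C" "Z \<in> Obj C" "f \<in> Hom C X W" "g \<in> Hom C Y X" "h \<in> Hom C Z Y"
  then show "Cmp C (Cmp C f g) h = Cmp C f (Cmp C g h)" by (intro assoc[symmetric])
 next
  fix X Y X' Y' assume *: "X \<in> Obj C" "Y \<in> Obj C" "X' \<in> Obj C" "Y' \<in> Obj C" "Hom C Y X \<inter> Hom C Y' X' \<noteq> {}"
  then show "X = X'" "Y = Y'" using Hom_disj by blast+
 qed (auto simp: Cmp_Idn Idn_Cmp)
qed

lemma is_category_full_subcat:
 assumes "is_category C"
 shows "is_category (full_subcat C S)"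
proof -
 interpret cat C using assms by unfold_locales
 show ?thesis unfolding is_category_def full_subcat_simps
 proof (intro conjI ballI impI)
  fix W X Y Z f g h
  assume "W \<in> Obj C \<inter> S" "X \<in> Obj C \<inter> S" "Y \<in> Obj C \<inter> S" "Z \<in> Obj C \<inter> S"
   "f \<in> Hom C W X" "g \<in> Hom C X Y" "h \<in> Hom C Y Z"
  then show "Cmp C h (Cmp C g f) = Cmp C (Cmp C h g) f" by (intro assoc) auto
 next
  fix X Y X' Y' assume *: "X \<in> Obj C \<inter> S" "Y \<in> Obj C \<inter> S" "X' \<in> Obj C \<inter> S" "Y' \<in> Obj C \<inter> S" "Hom C X Y \<inter> Hom C X' Y' \<noteq> {}"
  then show "X = X'" "Y = Y'" using Hom_disj by blast+
 qed (auto simp: Cmp_Idn Idn_Cmp)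
qed

lemma is_category_set_cat: "is_category (set_cat \<U>)"
 unfolding is_category_def set_cat_def
 by (auto simp: compose_assoc Id_compose compose_Id PiE_iff extensional_def compose_def intro!: ext)

lemma functor_cat_simps:
 "Obj (functor_cat C D) = {F. is_functor C D F \<and> on_ob F \<in> extensional (Obj C) \<and> on_ar F \<in> extensional (arrows C)}"
 "Hom (functor_cat C D) F G = {(F, \<eta>, G) | \<eta>. is_nat_trans C D F G \<eta> \<and> \<eta> \<in> extensional (Obj C)}"
 "Idn (functor_cat C D) F = (F, \<lambda>X\<in>Obj C. Idn D (on_ob F X), F)"
 "Cmp (functor_cat C D) (G, \<epsilon>, H) (F, \<eta>, G') = (F, \<lambda>X\<in>Obj C. Cmp D (\<epsilon> X) (\<eta> X), H)"
 by (simp_all add: functor_cat_def arrows_def)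

lemma is_functorD:
 assumes "is_functor C D F"
 shows "X \<in> Obj C ==> on_ob F X \<in> Obj D"
  "X \<in> Obj C ==> Y \<in> Obj C ==> f \<in> Hom C X Y ==> on_ar F f \<in> Hom D (on_ob F X) (on_ob F Y)"
  "X \<in> Obj C ==> on_ar F (Idn C X) = Idn D (on_ob F X)"
  "X \<in> Obj C ==> Y \<in> Obj C ==> Z \<in> Obj C ==> f \<in> Hom C X Y ==> g \<in> Hom C Y Z ==>
   on_ar F (Cmp C g f) = Cmp D (on_ar F g) (on_ar F f)"
 using assms unfolding is_functor_def by blast+

lemma is_nat_transD:
 assumes "is_nat_trans C D F G \<eta>"
 shows "X \<in> Obj C ==> \<eta> X \<in> Hom D (on_ob F X) (on_ob G X)"
  "X \<in> Obj C ==> Y \<in> Obj C ==> f \<in> Hom C X Y ==> Cmp D (on_ar G f) (\<eta> X) = Cmp D (\<eta> Y) (on_ar F f)"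
 using assms unfolding is_nat_trans_def by blast+

lemma nat_trans_comp:
 assumes D: "is_category D" and F: "is_functor C D F" "is_functor C D G" "is_functor C D H"
  and \<eta>: "is_nat_trans C D F G \<eta>" "is_nat_trans C D G H \<epsilon>"
 shows "is_nat_trans C D F H (\<lambda>X\<in>Obj C. Cmp D (\<epsilon> X) (\<eta> X))"
 unfolding is_nat_trans_def
proof (intro conjI ballI)
 interpret D: cat D using D by unfold_locales
 fix X assume X: "X \<in> Obj C"
 note ob = is_functorD(1)[OF F(1)] is_functorD(1)[OF F(2)] is_functorD(1)[OF F(3)]
 show "(\<lambda>X\<in>Obj C. Cmp D (\<epsilon> X) (\<eta> X)) X \<in> Hom D (on_ob F X) (on_ob H X)"
  using X ob D.Cmp[OF _ _ _ is_nat_transD(1)[OF \<eta>(1)] is_nat_transD(1)[OF \<eta>(2)]] by simp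
 fix Y f assume Y: "Y \<in> Obj C" and f: "f \<in> Hom C X Y"
 have "Cmp D (on_ar H f) (Cmp D (\<epsilon> X) (\<eta> X)) = Cmp D (Cmp D (on_ar H f) (\<epsilon> X)) (\<eta> X)"
  by (rule D.assoc[OF ob(1)[OF X] ob(2)[OF X] ob(3)[OF X] ob(3)[OF Y]
   is_nat_transD(1)[OF \<eta>(1) X] is_nat_transD(1)[OF \<eta>(2) X] is_functorD(2)[OF F(3) X Y f]])
 also have "\<dots> = Cmp D (Cmp D (\<epsilon> Y) (on_ar G f)) (\<eta> X)" using is_nat_transD(2)[OF \<eta>(2) X Y f] by simp
 also have "\<dots> = Cmp D (\<epsilon> Y) (Cmp D (on_ar G f) (\<eta> X))"
  by (rule D.assoc[OF ob(1)[OF X] ob(2)[OF X] ob(2)[OF Y] ob(3)[OF Y]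
   is_nat_transD(1)[OF \<eta>(1) X] is_functorD(2)[OF F(2) X Y f] is_nat_transD(1)[OF \<eta>(2) Y], symmetric])
 also have "\<dots> = Cmp D (\<epsilon> Y) (Cmp D (\<eta> Y) (on_ar F f))" using is_nat_transD(2)[OF \<eta>(1) X Y f] by simp
 also have "\<dots> = Cmp D (Cmp D (\<epsilon> Y) (\<eta> Y)) (on_ar F f)"
  by (rule D.assoc[OF ob(1)[OF X] ob(1)[OF Y] ob(2)[OF Y] ob(3)[OF Y]
   is_functorD(2)[OF F(1) X Y f] is_nat_transD(1)[OF \<eta>(1) Y] is_nat_transD(1)[OF \<eta>(2) Y]])
 finally show "Cmp D (on_ar H f) ((\<lambda>X\<in>Obj C. Cmp D (\<epsilon> X) (\<eta> X)) X) = Cmp D ((\<lambda>X\<in>Obj C. Cmp D (\<epsilon> X) (\<eta> X)) Y) (on_ar F f)"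
  using X Y by simp
qed

lemma is_category_functor_cat:
 assumes "is_category C" "is_category D"
 shows "is_category (functor_cat C D)" (is "is_category ?F")
proof -
 interpret D: cat D using assms by unfold_locales
 show ?thesis unfolding is_category_def
 proof (intro conjI ballI impI)
  fix F assume "F \<in> Obj ?F"
  then have F: "is_functor C D F" by (simp add: functor_cat_simps)
  have "is_nat_trans C D F F (\<lambda>X\<in>Obj C. Idn D (on_ob F X))" unfolding is_nat_trans_def
   using is_functorD[OF F] by (auto simp: D.Idn_Cmp[OF is_functorD(1,1,2)[OF F]] D.Cmp_Idn[OF is_functorD(1,1,2)[OF F]])
  then show "Idn ?F F \<in> Hom ?F F F" by (simp add: functor_cat_simps)
 next
  fix F G H \<eta> \<epsilon> assume *: "F \<in> Obj ?F" "G \<in> Obj ?F" "H \<in> Obj ?F"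
   "\<eta> \<in> Hom ?F F G" "\<epsilon> \<in> Hom ?F G H"
  then show "Cmp ?F \<epsilon> \<eta> \<in> Hom ?F F H"
   using nat_trans_comp[OF assms(2)] by (auto simp: functor_cat_simps)
 next
  fix F G \<eta> assume *: "F \<in> Obj ?F" "G \<in> Obj ?F" "\<eta> \<in> Hom ?F F G"
  then obtain \<eta>' where e: "\<eta> = (F, \<eta>', G)" "is_nat_trans C D F G \<eta>'" "\<eta>' \<in> extensional (Obj C)"
   and F: "is_functor C D F" "is_functor C D G" by (auto simp: functor_cat_simps)
  have "Cmp D (\<eta>' X) (Idn D (on_ob F X)) = \<eta>' X" "Cmp D (Idn D (on_ob G X)) (\<eta>' X) = \<eta>' X" if "X \<in> Obj C" for X
   using that is_functorD(1)[OF F(1) that] is_functorD(1)[OF F(2) that] is_nat_transD(1)[OF e(2) that]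
   by (simp_all add: D.Cmp_Idn D.Idn_Cmp)
  then show "Cmp ?F \<eta> (Idn ?F F) = \<eta>" "Cmp ?F (Idn ?F G) \<eta> = \<eta>"
   using e(3) unfolding e(1) by (auto simp: functor_cat_simps extensional_def restrict_def fun_eq_iff)
 next
  fix F G H K f g h
  assume *: "F \<in> Obj ?F" "G \<in> Obj ?F" "H \<in> Obj ?F" "K \<in> Obj ?F"
   "f \<in> Hom ?F F G" "g \<in> Hom ?F G H" "h \<in> Hom ?F H K"
  then obtain f' g' h' where e: "f = (F, f', G)" "is_nat_trans C D F G f'" "g = (G, g', H)" "is_nat_trans C D G H g'"
   "h = (H, h', K)" "is_nat_trans C D H K h'"
   and F: "is_functor C D F" "is_functor C D G" "is_functor C D H" "is_functor C D K" by (auto simp: functor_cat_simps)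
  have "Cmp D (h' X) (Cmp D (g' X) (f' X)) = Cmp D (Cmp D (h' X) (g' X)) (f' X)" if "X \<in> Obj C" for X
   by (rule D.assoc[OF is_functorD(1)[OF F(1)] is_functorD(1)[OF F(2)] is_functorD(1)[OF F(3)] is_functorD(1)[OF F(4)]
    is_nat_transD(1)[OF e(2)] is_nat_transD(1)[OF e(4)] is_nat_transD(1)[OF e(6)]]) (rule that)+
  then show "Cmp ?F h (Cmp ?F g f) = Cmp ?F (Cmp ?F h g) f"
   unfolding e by (auto simp: functor_cat_simps restrict_def fun_eq_iff)
 next
  fix F G F' G' assume "Hom ?F F G \<inter> Hom ?F F' G' \<noteq> {}"
  then show "F = F'" "G = G'" by (auto simp: functor_cat_simps)
 qed
qed

text \<open>Builds a presheaf from plain functions: the restriction to extensional functions and the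
  domains and codomains demanded by the encoding are added here once and for all.\<close>

definition mkpsh :: "('o, 'a) category => ('o => 'u set) => ('a => 'u => 'u) => ('o, 'a, 'u) presheaf" where
 "mkpsh C ob ar = \<lparr>on_ob = (\<lambda>X\<in>Obj C. ob X),
   on_ar = (\<lambda>g\<in>arrows C. (ob (ccod C g), \<lambda>s\<in>ob (ccod C g). ar g s, ob (cdom C g)))\<rparr>"

definition tapp :: "('o, 'a, 'u) presheaf_map => 'o => 'u => 'u" where
 "tapp \<tau> Z s = app (fst (snd \<tau>) Z) s"

definition mkmap :: "('o, 'a) category => ('o, 'a, 'u) presheaf => ('o, 'a, 'u) presheaf =>
  ('o => 'u => 'u) => ('o, 'a, 'u) presheaf_map" where
 "mkmap C P Q t = (P, \<lambda>Z\<in>Obj C. (on_ob P Z, \<lambda>s\<in>on_ob P Z. t Z s, on_ob Q Z), Q)"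

locale site = cat C for C :: "('o, 'a) category" +
 fixes J :: "'o => 'a set set" and \<U> :: "'u set set"
 assumes \<U>_lepoll: "A \<in> \<U> ==> B \<lesssim> A ==> B \<in> \<U>"
begin

abbreviation "PSh \<equiv> presheaf_cat \<U> C"
abbreviation "Sh \<equiv> sheaf_cat \<U> C J"
abbreviation res :: "('o, 'a, 'u) presheaf => 'a => 'u => 'u" where "res P g \<equiv> app (on_ar P g)"

lemma PSh_Obj: "P \<in> Obj PSh \<longleftrightarrow> is_functor (op_cat C) (set_cat \<U>) P \<and> on_ob P \<in> extensional (Obj C) \<and>
  on_ar P \<in> extensional (arrows C)"
proof -
 have "arrows (op_cat C) = arrows C" by (auto simp: arrows_def)
 then show ?thesis by (simp add: presheaf_cat_def functor_cat_simps)
qed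

lemma Sh_Obj: "P \<in> Obj Sh \<longleftrightarrow> P \<in> Obj PSh \<and> is_sheaf C J P"
 by (auto simp: sheaf_cat_def)

lemma Sh_simps: "Hom Sh = Hom PSh" "Idn Sh = Idn PSh" "Cmp Sh = Cmp PSh"
 by (simp_all add: sheaf_cat_def)

lemma is_category_PSh: "is_category PSh"
 unfolding presheaf_cat_def by (intro is_category_functor_cat is_category_op is_cat is_category_set_cat)

lemma is_category_Sh: "is_category Sh"
 unfolding sheaf_cat_def by (intro is_category_full_subcat is_category_PSh)

lemma res_eq:
 assumes "P \<in> Obj PSh" "W \<in> Obj C" "Z \<in> Obj C" "g \<in> Hom C W Z"
 shows "on_ar P g = (on_ob P Z, res P g, on_ob P W)" "res P g \<in> on_ob P Z \<rightarrow>\<^sub>E on_ob P W"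
proof -
 have "is_functor (op_cat C) (set_cat \<U>) P" using assms(1) by (simp add: PSh_Obj)
 from is_functorD(2)[OF this, of Z W g] assms have "on_ar P g \<in> Hom (set_cat \<U>) (on_ob P Z) (on_ob P W)" by simp
 then show "on_ar P g = (on_ob P Z, res P g, on_ob P W)" "res P g \<in> on_ob P Z \<rightarrow>\<^sub>E on_ob P W"
  by (auto simp: app_def)
qed

lemma res_in:
 assumes "P \<in> Obj PSh" "W \<in> Obj C" "Z \<in> Obj C" "g \<in> Hom C W Z" "s \<in> on_ob P Z"
 shows "res P g s \<in> on_ob P W"
 using res_eq(2)[OF assms(1-4)] assms(5) by auto

lemma ob_U: "P \<in> Obj PSh ==> X \<in> Obj C ==> on_ob P X \<in> \<U>"
 using is_functorD(1)[of "op_cat C" "set_cat \<U>" P X] by (simp add: PSh_Obj)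

lemma res_Idn:
 assumes "P \<in> Obj PSh" "X \<in> Obj C" "s \<in> on_ob P X"
 shows "res P (Idn C X) s = s"
 using is_functorD(3)[of "op_cat C" "set_cat \<U>" P X] assms by (simp add: PSh_Obj app_def)

lemma res_Cmp:
 assumes "P \<in> Obj PSh" "V \<in> Obj C" "W \<in> Obj C" "Z \<in> Obj C" "g \<in> Hom C W Z" "h \<in> Hom C V W" "s \<in> on_ob P Z"
 shows "res P (Cmp C g h) s = res P h (res P g s)"
proof -
 have "is_functor (op_cat C) (set_cat \<U>) P" using assms(1) by (simp add: PSh_Obj)
 from is_functorD(4)[OF this, of Z W V g h] assms
 have "on_ar P (Cmp C g h) = Cmp (set_cat \<U>) (on_ar P h) (on_ar P g)" by simp
 also have "\<dots> = (on_ob P Z, compose (on_ob P Z) (res P h) (res P g), on_ob P V)"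
  by (subst (1) res_eq(1)[OF assms(1,2,3,6)], subst (1) res_eq(1)[OF assms(1,3,4,5)]) simp
 finally show ?thesis using assms(7) by (simp add: app_def compose_def)
qed

lemma on_ob_mkpsh: "X \<in> Obj C ==> on_ob (mkpsh C ob ar) X = ob X"
 by (simp add: mkpsh_def)

lemma on_ar_mkpsh:
 assumes "W \<in> Obj C" "Z \<in> Obj C" "g \<in> Hom C W Z"
 shows "on_ar (mkpsh C ob ar) g = (ob Z, \<lambda>s\<in>ob Z. ar g s, ob W)"
 using assms arrowsI[of W C Z g] cdom_eq ccod_eq by (simp add: mkpsh_def)

lemma res_mkpsh:
 assumes "W \<in> Obj C" "Z \<in> Obj C" "g \<in> Hom C W Z" "s \<in> ob Z"
 shows "res (mkpsh C ob ar) g s = ar g s"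
 using assms by (simp add: on_ar_mkpsh app_def)

lemma mkpsh_PSh:
 assumes U: "\<And>X. X \<in> Obj C ==> ob X \<in> \<U>"
  and ar: "\<And>W Z g s. W \<in> Obj C ==> Z \<in> Obj C ==> g \<in> Hom C W Z ==> s \<in> ob Z ==> ar g s \<in> ob W"
  and id: "\<And>X s. X \<in> Obj C ==> s \<in> ob X ==> ar (Idn C X) s = s"
  and cmp: "\<And>V W Z g h s. V \<in> Obj C ==> W \<in> Obj C ==> Z \<in> Obj C ==> g \<in> Hom C W Z ==> h \<in> Hom C V W ==> s \<in> ob Z ==>
   ar (Cmp C g h) s = ar h (ar g s)"
 shows "mkpsh C ob ar \<in> Obj PSh"
 unfolding PSh_Obj is_functor_def
proof (intro conjI ballI)
 let ?P = "mkpsh C ob ar"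
 show "on_ob ?P X \<in> Obj (set_cat \<U>)" if "X \<in> Obj (op_cat C)" for X
  using that U by (simp add: on_ob_mkpsh)
 show "on_ar ?P f \<in> Hom (set_cat \<U>) (on_ob ?P X) (on_ob ?P Y)"
  if "X \<in> Obj (op_cat C)" "Y \<in> Obj (op_cat C)" "f \<in> Hom (op_cat C) X Y" for X Y f
  using that ar by (auto simp: on_ob_mkpsh on_ar_mkpsh)
 show "on_ar ?P (Idn (op_cat C) X) = Idn (set_cat \<U>) (on_ob ?P X)" if "X \<in> Obj (op_cat C)" for X
  using that id by (auto simp: on_ob_mkpsh on_ar_mkpsh[OF _ _ Idn] intro!: restrict_ext)
 show "on_ar ?P (Cmp (op_cat C) g f) = Cmp (set_cat \<U>) (on_ar ?P g) (on_ar ?P f)"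
  if "X \<in> Obj (op_cat C)" "Y \<in> Obj (op_cat C)" "Z \<in> Obj (op_cat C)" "f \<in> Hom (op_cat C) X Y" "g \<in> Hom (op_cat C) Y Z"
  for X Y Z f g
  using that Cmp[of Z Y X g f] ar[of Y X f] cmp[of Z Y X f g]
  by (auto simp: on_ob_mkpsh on_ar_mkpsh compose_def fun_eq_iff)
 show "on_ob ?P \<in> extensional (Obj C)" "on_ar ?P \<in> extensional (arrows C)" by (auto simp: mkpsh_def)
qed

lemma PSh_Hom: "\<tau> \<in> Hom PSh P Q \<longleftrightarrow> (\<exists>\<eta>. \<tau> = (P, \<eta>, Q) \<and> is_nat_trans (op_cat C) (set_cat \<U>) P Q \<eta> \<and> \<eta> \<in> extensional (Obj C))"
 by (simp add: presheaf_cat_def functor_cat_simps)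

lemma tapp_eq:
 assumes "\<tau> \<in> Hom PSh P Q" "Z \<in> Obj C"
 shows "fst (snd \<tau>) Z = (on_ob P Z, tapp \<tau> Z, on_ob Q Z)" "tapp \<tau> Z \<in> on_ob P Z \<rightarrow>\<^sub>E on_ob Q Z"
proof -
 from assms obtain \<eta> where \<eta>: "\<tau> = (P, \<eta>, Q)" "is_nat_trans (op_cat C) (set_cat \<U>) P Q \<eta>" by (auto simp: PSh_Hom)
 from is_nat_transD(1)[OF \<eta>(2), of Z] assms(2)
 show "fst (snd \<tau>) Z = (on_ob P Z, tapp \<tau> Z, on_ob Q Z)" "tapp \<tau> Z \<in> on_ob P Z \<rightarrow>\<^sub>E on_ob Q Z"
  by (auto simp: \<eta>(1) tapp_def[abs_def] app_def)
qed

lemma tapp_in: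
 assumes "\<tau> \<in> Hom PSh P Q" "Z \<in> Obj C" "s \<in> on_ob P Z"
 shows "tapp \<tau> Z s \<in> on_ob Q Z"
 using tapp_eq(2)[OF assms(1,2)] assms(3) by auto

lemma tapp_natural:
 assumes \<tau>: "\<tau> \<in> Hom PSh P Q" and PQ: "P \<in> Obj PSh" "Q \<in> Obj PSh"
  and g: "W \<in> Obj C" "Z \<in> Obj C" "g \<in> Hom C W Z" and s: "s \<in> on_ob P Z"
 shows "tapp \<tau> W (res P g s) = res Q g (tapp \<tau> Z s)"
proof -
 from \<tau> obtain \<eta> where \<eta>: "\<tau> = (P, \<eta>, Q)" "is_nat_trans (op_cat C) (set_cat \<U>) P Q \<eta>" by (auto simp: PSh_Hom)
 from is_nat_transD(2)[OF \<eta>(2), of Z W g] g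
 have "Cmp (set_cat \<U>) (on_ar Q g) (fst (snd \<tau>) Z) = Cmp (set_cat \<U>) (fst (snd \<tau>) W) (on_ar P g)"
  by (simp add: \<eta>(1))
 note nat = this
 obtain p q where p: "p = res P g" and q: "q = res Q g" by blast
 have "on_ar P g = (on_ob P Z, p, on_ob P W)" unfolding p by (rule res_eq(1)[OF PQ(1) g])
 moreover have "on_ar Q g = (on_ob Q Z, q, on_ob Q W)" unfolding q by (rule res_eq(1)[OF PQ(2) g])
 ultimately have "Cmp (set_cat \<U>) (on_ob Q Z, q, on_ob Q W) (on_ob P Z, tapp \<tau> Z, on_ob Q Z) =
   Cmp (set_cat \<U>) (on_ob P W, tapp \<tau> W, on_ob Q W) (on_ob P Z, p, on_ob P W)"
  using nat by (simp only: tapp_eq(1)[OF \<tau> g(1)] tapp_eq(1)[OF \<tau> g(2)])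
 then have "compose (on_ob P Z) (res Q g) (tapp \<tau> Z) = compose (on_ob P Z) (tapp \<tau> W) (res P g)"
  by (simp add: p q)
 from fun_cong[OF this, of s] s show ?thesis by (simp add: compose_def)
qed

lemma PSh_Hom_eqI:
 assumes "\<tau> \<in> Hom PSh P Q" "\<tau>' \<in> Hom PSh P Q" "\<And>Z s. Z \<in> Obj C ==> s \<in> on_ob P Z ==> tapp \<tau> Z s = tapp \<tau>' Z s"
 shows "\<tau> = \<tau>'"
proof -
 obtain \<eta> \<eta>' where e: "\<tau> = (P, \<eta>, Q)" "\<eta> \<in> extensional (Obj C)" "\<tau>' = (P, \<eta>', Q)" "\<eta>' \<in> extensional (Obj C)"
  using assms(1,2) by (auto simp: PSh_Hom)
 have "\<eta> Z = \<eta>' Z" if Z: "Z \<in> Obj C" for Z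
 proof -
  have "tapp \<tau> Z = tapp \<tau>' Z"
   using tapp_eq(2)[OF assms(1) Z] tapp_eq(2)[OF assms(2) Z] assms(3)[OF Z] by (rule PiE_ext)
  then show ?thesis using tapp_eq(1)[OF assms(1) Z] tapp_eq(1)[OF assms(2) Z] e by simp
 qed
 then have "\<eta> = \<eta>'" using e by (auto intro: extensionalityI)
 then show ?thesis using e by simp
qed

lemma mkmap_Hom:
 assumes PQ: "P \<in> Obj PSh" "Q \<in> Obj PSh"
  and t: "\<And>Z s. Z \<in> Obj C ==> s \<in> on_ob P Z ==> t Z s \<in> on_ob Q Z"
  and nat: "\<And>W Z g s. W \<in> Obj C ==> Z \<in> Obj C ==> g \<in> Hom C W Z ==> s \<in> on_ob P Z ==>
   t W (res P g s) = res Q g (t Z s)"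
 shows "mkmap C P Q t \<in> Hom PSh P Q"
 unfolding PSh_Hom mkmap_def is_nat_trans_def
proof (intro exI[of _ "\<lambda>Z\<in>Obj C. (on_ob P Z, \<lambda>s\<in>on_ob P Z. t Z s, on_ob Q Z)"] conjI ballI)
 let ?\<eta> = "\<lambda>Z\<in>Obj C. (on_ob P Z, \<lambda>s\<in>on_ob P Z. t Z s, on_ob Q Z)"
 show "?\<eta> X \<in> Hom (set_cat \<U>) (on_ob P X) (on_ob Q X)" if "X \<in> Obj (op_cat C)" for X
  using that t by auto
 show "Cmp (set_cat \<U>) (on_ar Q g) (?\<eta> Z) = Cmp (set_cat \<U>) (?\<eta> W) (on_ar P g)"
  if Z: "Z \<in> Obj (op_cat C)" and W: "W \<in> Obj (op_cat C)" and g: "g \<in> Hom (op_cat C) Z W" for Z W g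
 proof -
  have g': "W \<in> Obj C" "Z \<in> Obj C" "g \<in> Hom C W Z" using Z W g by simp_all
  have "compose (on_ob P Z) (res Q g) (\<lambda>s\<in>on_ob P Z. t Z s) = compose (on_ob P Z) (\<lambda>s\<in>on_ob P W. t W s) (res P g)"
   using res_in[OF PQ(1) g'] nat[OF g'] by (auto simp: compose_def fun_eq_iff)
  then show ?thesis
   by (subst (1) res_eq(1)[OF PQ(1) g'], subst (1) res_eq(1)[OF PQ(2) g']) (use g' in simp)
 qed
qed (rule refl restrict_extensional)+

lemma tapp_mkmap: "Z \<in> Obj C ==> s \<in> on_ob P Z ==> tapp (mkmap C P Q t) Z s = t Z s"
 by (simp add: mkmap_def tapp_def app_def)

lemma tapp_Idn: "Z \<in> Obj C ==> s \<in> on_ob P Z ==> tapp (Idn PSh P) Z s = s"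
 by (simp add: presheaf_cat_def functor_cat_simps tapp_def app_def)

lemma tapp_Cmp:
 assumes "\<tau> \<in> Hom PSh P Q" "\<sigma> \<in> Hom PSh Q R" "Z \<in> Obj C" "s \<in> on_ob P Z"
 shows "tapp (Cmp PSh \<sigma> \<tau>) Z s = tapp \<sigma> Z (tapp \<tau> Z s)"
proof -
 obtain \<eta> \<epsilon> where e: "\<tau> = (P, \<eta>, Q)" "\<sigma> = (Q, \<epsilon>, R)" using assms by (auto simp: PSh_Hom)
 have "fst (snd (Cmp PSh \<sigma> \<tau>)) Z = Cmp (set_cat \<U>) (fst (snd \<sigma>) Z) (fst (snd \<tau>) Z)"
  using assms(3) by (simp add: e presheaf_cat_def functor_cat_simps)
 also have "\<dots> = (on_ob P Z, compose (on_ob P Z) (tapp \<sigma> Z) (tapp \<tau> Z), on_ob R Z)"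
  by (simp only: tapp_eq(1)[OF assms(1,3)] tapp_eq(1)[OF assms(2,3)] set_cat_simps)
 finally show ?thesis using assms(4) by (simp add: tapp_def[of "Cmp PSh \<sigma> \<tau>"] app_def compose_def)
qed

lemma mkmap_iso:
 assumes PQ: "P \<in> Obj PSh" "Q \<in> Obj PSh"
  and t: "\<And>Z. Z \<in> Obj C ==> bij_betw (t Z) (on_ob P Z) (on_ob Q Z)"
  and nat: "\<And>W Z g s. W \<in> Obj C ==> Z \<in> Obj C ==> g \<in> Hom C W Z ==> s \<in> on_ob P Z ==>
   t W (res P g s) = res Q g (t Z s)"
 shows "is_iso PSh P Q (mkmap C P Q t)"
proof -
 interpret PSh: cat PSh using is_category_PSh by unfold_locales
 have tin: "t Z s \<in> on_ob Q Z" if "Z \<in> Obj C" "s \<in> on_ob P Z" for Z s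
  using t[OF that(1)] that(2) by (auto simp: bij_betw_def)
 let ?i = "\<lambda>Z. inv_into (on_ob P Z) (t Z)"
 have i: "?i Z q \<in> on_ob P Z" "t Z (?i Z q) = q" if "Z \<in> Obj C" "q \<in> on_ob Q Z" for Z q
  using t[OF that(1)] that(2) by (auto simp: bij_betw_def inv_into_into f_inv_into_f)
 have i': "?i Z (t Z s) = s" if "Z \<in> Obj C" "s \<in> on_ob P Z" for Z s
  using t[OF that(1)] that(2) by (auto simp: bij_betw_def)
 have f: "mkmap C P Q t \<in> Hom PSh P Q" by (rule mkmap_Hom[OF PQ tin nat])
 have g: "mkmap C Q P ?i \<in> Hom PSh Q P"
 proof (rule mkmap_Hom[OF PQ(2,1) i(1)])
  fix W Z g q assume *: "W \<in> Obj C" "Z \<in> Obj C" "g \<in> Hom C W Z" "q \<in> on_ob Q Z"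
  have "?i W (res Q g q) = ?i W (res Q g (t Z (?i Z q)))" using i * by simp
  also have "\<dots> = ?i W (t W (res P g (?i Z q)))" using nat[OF *(1-3) i(1)[OF *(2,4)]] by simp
  also have "\<dots> = res P g (?i Z q)" using * by (intro i' res_in[OF PQ(1) *(1-3)] i(1))
  finally show "?i W (res Q g q) = res P g (?i Z q)" .
 qed
 have "Cmp PSh (mkmap C Q P ?i) (mkmap C P Q t) = Idn PSh P"
  by (rule PSh_Hom_eqI[OF PSh.Cmp[OF PQ(1,2,1) f g] PSh.Idn[OF PQ(1)]])
   (simp add: tapp_Cmp[OF f g] tapp_Idn tapp_mkmap tin i')
 moreover have "Cmp PSh (mkmap C P Q t) (mkmap C Q P ?i) = Idn PSh Q"
  by (rule PSh_Hom_eqI[OF PSh.Cmp[OF PQ(2,1,2) g f] PSh.Idn[OF PQ(2)]])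
   (simp add: tapp_Cmp[OF g f] tapp_Idn tapp_mkmap i)
 ultimately show ?thesis using f g unfolding is_iso_def is_inverse_pair_def by blast
qed

lemma is_iso_Sh: "is_iso Sh P Q f \<longleftrightarrow> is_iso PSh P Q f"
 by (simp add: is_iso_def is_inverse_pair_def Sh_simps)

section \<open>Subsheaves cut out by predicates\<close>

definition subpsh :: "('o, 'a, 'u) presheaf => ('o => 'u => bool) => ('o, 'a, 'u) presheaf" where
 "subpsh P R = mkpsh C (\<lambda>X. {s \<in> on_ob P X. R X s}) (res P)"

lemma on_ob_subpsh: "X \<in> Obj C ==> on_ob (subpsh P R) X = {s \<in> on_ob P X. R X s}"
 by (simp add: subpsh_def on_ob_mkpsh)

lemma res_subpsh:
 "W \<in> Obj C ==> Z \<in> Obj C ==> g \<in> Hom C W Z ==> s \<in> on_ob P Z ==> R Z s ==> res (subpsh P R) g s = res P g s"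
 by (simp add: subpsh_def res_mkpsh)

definition incl :: "('o, 'a, 'u) presheaf => ('o => 'u => bool) => ('o, 'a, 'u) presheaf_map" where
 "incl P R = mkmap C (subpsh P R) P (\<lambda>Z s. s)"

context
 fixes P R
 assumes P: "P \<in> Obj PSh"
  and stable: "\<And>W Z g s. W \<in> Obj C ==> Z \<in> Obj C ==> g \<in> Hom C W Z ==> s \<in> on_ob P Z ==> R Z s ==> R W (res P g s)"
begin

lemma subpsh_PSh: "subpsh P R \<in> Obj PSh"
 unfolding subpsh_def
proof (rule mkpsh_PSh)
 show "{s \<in> on_ob P X. R X s} \<in> \<U>" if "X \<in> Obj C" for X
  by (rule \<U>_lepoll[OF ob_U[OF P that]]) (auto intro: subset_imp_lepoll)
qed (use stable res_in[OF P] res_Idn[OF P] res_Cmp[OF P] in auto)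

lemma incl_Hom: "incl P R \<in> Hom PSh (subpsh P R) P"
 unfolding incl_def by (rule mkmap_Hom[OF subpsh_PSh P]) (auto simp: on_ob_subpsh res_subpsh)

lemma tapp_incl: "Z \<in> Obj C ==> s \<in> on_ob P Z ==> R Z s ==> tapp (incl P R) Z s = s"
 unfolding incl_def by (rule tapp_mkmap) (auto simp: on_ob_subpsh)

lemma incl_mono: "is_mono Sh (subpsh P R) P (incl P R)"
 unfolding is_mono_def Sh_simps
proof (intro conjI ballI impI incl_Hom)
 fix Q f g assume *: "Q \<in> Obj Sh" "f \<in> Hom PSh Q (subpsh P R)" "g \<in> Hom PSh Q (subpsh P R)"
  "Cmp PSh (incl P R) f = Cmp PSh (incl P R) g"
 show "f = g"
 proof (rule PSh_Hom_eqI[OF *(2,3)])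
  fix Z s assume Zs: "Z \<in> Obj C" "s \<in> on_ob Q Z"
  have "tapp (incl P R) Z (tapp f Z s) = tapp (incl P R) Z (tapp g Z s)"
   using arg_cong[OF *(4), of "\<lambda>h. tapp h Z s"] Zs by (simp add: tapp_Cmp[OF *(2) incl_Hom] tapp_Cmp[OF *(3) incl_Hom])
  then show "tapp f Z s = tapp g Z s"
   using tapp_in[OF *(2) Zs] tapp_in[OF *(3) Zs] Zs(1) by (simp add: on_ob_subpsh tapp_incl)
 qed
qed

text \<open>The inverse sends \<open>s\<close> to a section that satisfies \<open>R\<close> and that
  the inclusion sends back to \<open>s\<close>. This is how a statement about subobjects becomes one
  about predicates on sections.\<close>

lemma incl_iso:
 assumes "is_iso Sh (subpsh P R) P (incl P R)" "Z \<in> Obj C" "s \<in> on_ob P Z"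
 shows "R Z s"
proof -
 from assms(1) obtain g where g: "g \<in> Hom PSh P (subpsh P R)" "Cmp PSh (incl P R) g = Idn PSh P"
  by (auto simp: is_iso_def is_inverse_pair_def Sh_simps)
 have "tapp (Cmp PSh (incl P R) g) Z s = s" unfolding g(2) using assms(2,3) by (rule tapp_Idn)
 then have "tapp (incl P R) Z (tapp g Z s) = s" by (simp add: tapp_Cmp[OF g(1) incl_Hom assms(2,3)])
 then show ?thesis using tapp_in[OF g(1) assms(2,3)] assms(2) by (auto simp: on_ob_subpsh tapp_incl)
qed

text \<open>The amalgamation is formed in \<open>P\<close>, and the locality condition
  \<open>loc\<close> places it in the sub-presheaf.\<close>

lemma subpsh_Sh:
 assumes sheaf: "is_sheaf C J P" and sieve: "\<And>X S. X \<in> Obj C ==> S \<in> J X ==> is_sieve C X S"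
  and loc: "\<And>Z S s. Z \<in> Obj C ==> S \<in> J Z ==> s \<in> on_ob P Z ==>
   (\<And>Y f. Y \<in> Obj C ==> f \<in> S ==> f \<in> Hom C Y Z ==> R Y (res P f s)) ==> R Z s"
 shows "subpsh P R \<in> Obj Sh"
 unfolding Sh_Obj is_sheaf_def
proof (intro conjI subpsh_PSh ballI allI impI)
 fix X S x assume X: "X \<in> Obj C" and S: "S \<in> J X" and m: "matching_family C (subpsh P R) X S x"
 have S': "S \<subseteq> (\<Union>Y\<in>Obj C. Hom C Y X)" using sieve[OF X S] by (simp add: is_sieve_def)
 have x: "x f \<in> on_ob P Y" "R Y (x f)" if "Y \<in> Obj C" "f \<in> S" "f \<in> Hom C Y X" for Y f
  using m that by (auto simp: matching_family_def on_ob_subpsh)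
 have "matching_family C P X S x"
  unfolding matching_family_def
 proof (intro conjI ballI)
  show "x f \<in> on_ob P Y" if "Y \<in> Obj C" "f \<in> S \<inter> Hom C Y X" for Y f using x that by auto
  show "res P g (x f) = x (Cmp C f g)" if "Y \<in> Obj C" "Z \<in> Obj C" "f \<in> S \<inter> Hom C Y X" "g \<in> Hom C Z Y" for Y Z f g
   using m that x[of Y f] res_subpsh[of Z Y g "x f" P R] by (auto simp: matching_family_def)
 qed
 with sheaf X S have ex: "\<exists>!y. y \<in> on_ob P X \<and> (\<forall>f\<in>S. res P f y = x f)" by (auto simp: is_sheaf_def)
 then obtain y where y: "y \<in> on_ob P X" "\<And>f. f \<in> S ==> res P f y = x f" by blast
 have Ry: "R X y" by (rule loc[OF X S y(1)]) (use y(2) x in auto)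
 have eq: "res (subpsh P R) f z = res P f z" if "f \<in> S" "z \<in> on_ob P X" "R X z" for f z
 proof -
  from S' that(1) obtain Y where "Y \<in> Obj C" "f \<in> Hom C Y X" by auto
  then show ?thesis using X that by (intro res_subpsh)
 qed
 show "\<exists>!y. y \<in> on_ob (subpsh P R) X \<and> (\<forall>f\<in>S. res (subpsh P R) f y = x f)"
 proof (rule ex1I[of _ y])
  show "y \<in> on_ob (subpsh P R) X \<and> (\<forall>f\<in>S. res (subpsh P R) f y = x f)"
   using y Ry X eq by (auto simp: on_ob_subpsh)
  show "z = y" if "z \<in> on_ob (subpsh P R) X \<and> (\<forall>f\<in>S. res (subpsh P R) f z = x f)" for z
  proof -
   have "z \<in> on_ob P X \<and> (\<forall>f\<in>S. res P f z = x f)" using that X eq by (auto simp: on_ob_subpsh)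
   then show "z = y" using ex y by blast
  qed
 qed
qed

end

end

section \<open>Small sets and the Yoneda embedding\<close>

locale universe =
 fixes K :: "'k itself" and \<U> :: "'u set set"
 assumes univ: "set_universe TYPE('k) \<U>"
  and two: "\<exists>x y :: 'k. x \<noteq> y"
begin

text \<open>Stated for sets of any type, as arrows, tuples, functions and equivalence classes all
  have to be counted; \<open>cod\<close> then moves a small set into \<U>.\<close>

definition small :: "'a set => bool" where
 "small S \<longleftrightarrow> (\<exists>A\<in>\<U>. S \<lesssim> A)"

definition cod :: "'a set => 'a => 'u" where
 "cod S = (SOME c. inj_on c S \<and> c ` S \<in> \<U>)"

lemma U_lepoll: "A \<in> \<U> ==> B \<lesssim> A ==> B \<in> \<U>"
 using univ by (simp add: set_universe_def)

lemma cod: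
 assumes "small S"
 shows "inj_on (cod S) S" "cod S ` S \<in> \<U>"
proof -
 obtain A c where A: "A \<in> \<U>" "inj_on c S" "c ` S \<subseteq> A" using assms by (auto simp: small_def lepoll_def)
 have "c ` S \<in> \<U>" by (rule U_lepoll[OF A(1)]) (rule subset_imp_lepoll[OF A(3)])
 with A have "\<exists>c. inj_on c S \<and> c ` S \<in> \<U>" by blast
 then have "inj_on (cod S) S \<and> cod S ` S \<in> \<U>" unfolding cod_def by (rule someI_ex)
 then show "inj_on (cod S) S" "cod S ` S \<in> \<U>" by auto
qed

lemma small_lepoll: "small A ==> B \<lesssim> A ==> small B"
 unfolding small_def using lepoll_trans by blast

lemma small_U: "A \<in> \<U> ==> small A"
 unfolding small_def by (auto intro: lepoll_refl)

lemma U_iff_small: "A \<in> \<U> \<longleftrightarrow> small A" for A :: "'u set"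
 using U_lepoll by (auto simp: small_def intro: lepoll_refl)

lemma small_image: "small A ==> small (f ` A)"
 by (rule small_lepoll[OF _ image_lepoll])

lemma small_subset: "small A ==> B \<subseteq> A ==> small B"
 by (rule small_lepoll[OF _ subset_imp_lepoll])

lemma small_index: "I \<lesssim> (UNIV :: 'k set) ==> small I"
 using univ unfolding set_universe_def small_def using lepoll_trans by blast

lemma U_UN: "range F \<subseteq> \<U> ==> (\<Union>k. F k) \<in> \<U>" for F :: "'k => 'u set"
 using univ by (simp add: set_universe_def)

text \<open>A binary union is a union indexed by \<open>'k\<close>, because \<open>'k\<close> has
  two elements.\<close>

lemma union_U: "A \<in> \<U> ==> B \<in> \<U> ==> A \<union> B \<in> \<U>"
proof -
 assume AB: "A \<in> \<U>" "B \<in> \<U>"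
 obtain x y :: 'k where "x \<noteq> y" using two by blast
 then have "A \<union> B = (\<Union>k. if k = x then A else B)" by (auto split: if_splits)
 moreover have "(\<Union>k :: 'k. if k = x then A else B) \<in> \<U>"
  using AB by (intro U_UN) auto
 ultimately show ?thesis by simp
qed

lemma small_UN:
 assumes "I \<lesssim> (UNIV :: 'k set)" "\<And>i. i \<in> I ==> A i \<in> \<U>"
 shows "(\<Union>i\<in>I. A i) \<in> \<U>"
proof (cases "I = {}")
 case True
 obtain B where "B \<in> \<U>" using univ by (auto simp: set_universe_def)
 then show ?thesis using True by (auto intro: U_lepoll)
next
 case False
 then obtain j where j: "j \<in> I" by blast
 obtain e :: "_ => 'k" where e: "inj_on e I" using assms(1) by (auto simp: lepoll_def)
 \<comment> \<open>Indices outside the image of \<open>e\<close> repeat the member at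
   \<open>j\<close>.\<close>
 let ?F = "\<lambda>k :: 'k. A (if k \<in> e ` I then inv_into I e k else j)"
 have "range ?F \<subseteq> \<U>" using assms(2) j by (auto simp: inv_into_into)
 then have "(\<Union>k. ?F k) \<in> \<U>" by (rule U_UN)
 moreover have "(\<Union>i\<in>I. A i) \<subseteq> (\<Union>k. ?F k)"
 proof
  fix x assume "x \<in> (\<Union>i\<in>I. A i)"
  then obtain i where i: "i \<in> I" "x \<in> A i" by blast
  then have "x \<in> ?F (e i)" using e by simp
  then show "x \<in> (\<Union>k. ?F k)" by blast
 qed
 ultimately show ?thesis by (blast intro: U_lepoll subset_imp_lepoll)
qed

text \<open>Provides the set that contains the default value \<open>d\<close> in
  \<open>small_funs\<close>.\<close>

lemma nonempty_U: "\<exists>A\<in>\<U>. B \<in> \<U> --> B \<subseteq> A \<and> A \<noteq> {}"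
proof -
 obtain A0 where A0: "A0 \<in> \<U>" "(UNIV :: 'k set) \<lesssim> A0" using univ by (auto simp: set_universe_def)
 then have "A0 \<noteq> {}" by (auto simp: lepoll_def)
 then show ?thesis using A0 union_U[of B A0] by blast
qed

lemma small_power:
 assumes "A \<in> \<U>"
 shows "small ((UNIV :: 'k set) \<rightarrow>\<^sub>E A)"
 using univ assms by (auto simp: set_universe_def small_def)

text \<open>A function on \<open>I\<close> is coded as a function on \<open>'k\<close>, with the
  value \<open>d\<close> outside the image of \<open>I\<close>.\<close>

lemma small_funs:
 assumes "I \<lesssim> (UNIV :: 'k set)" "small A"
 shows "small (I \<rightarrow>\<^sub>E A)"
proof -
 obtain B a where B: "B \<in> \<U>" "inj_on a A" "a ` A \<subseteq> B" using assms(2) by (auto simp: small_def lepoll_def)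
 obtain B' where B': "B' \<in> \<U>" "B \<subseteq> B'" "B' \<noteq> {}" using nonempty_U[of B] B(1) by blast
 obtain d where d: "d \<in> B'" using B' by blast
 obtain e :: "_ => 'k" where e: "inj_on e I" using assms(1) by (auto simp: lepoll_def)
 let ?F = "\<lambda>f. \<lambda>k :: 'k. if k \<in> e ` I then a (f (inv_into I e k)) else d"
 have "inj_on ?F (I \<rightarrow>\<^sub>E A)"
 proof (rule inj_onI)
  fix f g assume f: "f \<in> I \<rightarrow>\<^sub>E A" and g: "g \<in> I \<rightarrow>\<^sub>E A" and eq: "?F f = ?F g"
  show "f = g"
  proof (rule PiE_ext[OF f g])
   fix i assume i: "i \<in> I"
   have "a (f i) = a (g i)" using fun_cong[OF eq, of "e i"] i e by simp
   then show "f i = g i" using inj_onD[OF B(2)] f g i by auto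
  qed
 qed
 moreover have "?F ` (I \<rightarrow>\<^sub>E A) \<subseteq> (UNIV :: 'k set) \<rightarrow>\<^sub>E B'"
  using d B' B(3) by (auto simp: inv_into_into PiE_mem) (metis B(3) PiE_mem image_subset_iff inv_into_into imageI subsetD)+
 ultimately have "(I \<rightarrow>\<^sub>E A) \<lesssim> ((UNIV :: 'k set) \<rightarrow>\<^sub>E B')" by (auto simp: lepoll_def)
 then show ?thesis using small_power[OF B'(1)] small_lepoll by blast
qed

text \<open>A pair is coded as the function with its first component at \<open>x\<close> and its
  second component everywhere else.\<close>

lemma small_times:
 assumes "small A" "small B"
 shows "small (A \<times> B)"
proof -
 obtain A' a where A': "A' \<in> \<U>" "inj_on a A" "a ` A \<subseteq> A'" using assms(1) by (auto simp: small_def lepoll_def)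
 obtain B' b where B': "B' \<in> \<U>" "inj_on b B" "b ` B \<subseteq> B'" using assms(2) by (auto simp: small_def lepoll_def)
 obtain x y :: 'k where xy: "x \<noteq> y" using two by blast
 let ?F = "\<lambda>p. \<lambda>k :: 'k. if k = x then a (fst p) else b (snd p)"
 have "inj_on ?F (A \<times> B)"
 proof (rule inj_onI)
  fix p q assume p: "p \<in> A \<times> B" and q: "q \<in> A \<times> B" and eq: "?F p = ?F q"
  have "a (fst p) = a (fst q)" "b (snd p) = b (snd q)" using fun_cong[OF eq, of x] fun_cong[OF eq, of y] xy by auto
  then show "p = q" using inj_onD[OF A'(2)] inj_onD[OF B'(2)] p q by (auto simp: prod_eq_iff)
 qed
 moreover have "?F ` (A \<times> B) \<subseteq> (UNIV :: 'k set) \<rightarrow>\<^sub>E (A' \<union> B')" using A'(3) B'(3) by (auto simp: image_subset_iff)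
 ultimately have "(A \<times> B) \<lesssim> ((UNIV :: 'k set) \<rightarrow>\<^sub>E (A' \<union> B'))" by (auto simp: lepoll_def)
 then show ?thesis using small_power[OF union_U[OF A'(1) B'(1)]] small_lepoll by blast
qed

lemma small_Sigma:
 assumes "I \<lesssim> (UNIV :: 'k set)" "\<And>i. i \<in> I ==> small (F i)"
 shows "small (Sigma I F)"
proof -
 have "\<forall>i\<in>I. \<exists>A g. A \<in> \<U> \<and> inj_on g (F i) \<and> g ` F i \<subseteq> A" using assms(2) unfolding small_def lepoll_def by blast
 then obtain A g where A: "\<And>i. i \<in> I ==> A i \<in> \<U> \<and> inj_on (g i) (F i) \<and> g i ` F i \<subseteq> A i" by metis
 have "small (I \<times> (\<Union>i\<in>I. A i))"
  using A by (intro small_times small_index[OF assms(1)] small_U small_UN[OF assms(1)]) blast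
 moreover have "Sigma I F \<lesssim> I \<times> (\<Union>i\<in>I. A i)" unfolding lepoll_def
 proof (intro exI conjI)
  show "inj_on (\<lambda>(i, x). (i, g i x)) (Sigma I F)" using A by (auto simp: inj_on_def)
  show "(\<lambda>(i, x). (i, g i x)) ` Sigma I F \<subseteq> I \<times> (\<Union>i\<in>I. A i)"
  proof (rule image_subsetI)
   fix p assume "p \<in> Sigma I F"
   then obtain i x where p: "p = (i, x)" "i \<in> I" "x \<in> F i" by blast
   then have "g i x \<in> A i" using A[of i] by blast
   then show "(case p of (i, x) => (i, g i x)) \<in> I \<times> (\<Union>i\<in>I. A i)" using p by auto
  qed
 qed
 ultimately show ?thesis using small_lepoll by blast
qed

end

context site
begin

text \<open>The representable presheaf in the form of \<open>mkpsh\<close>, to which the general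
  lemmas apply; \<open>on_ob_yoneda\<close> and \<open>on_ar_yoneda\<close> identify it with the
  values of \<open>yoneda\<close>.\<close>

definition yob :: "('a => 'u) => 'o => ('o, 'a, 'u) presheaf" where
 "yob code X = mkpsh C (\<lambda>Z. code ` Hom C Z X) (\<lambda>g u. code (Cmp C (inv_into (arrows C) code u) g))"

definition yar :: "('a => 'u) => 'o => 'o => 'a => ('o, 'a, 'u) presheaf_map" where
 "yar code X Y f = mkmap C (yob code X) (yob code Y) (\<lambda>Z u. code (Cmp C f (inv_into (arrows C) code u)))"

context
 fixes code :: "'a => 'u"
 assumes inj_code: "inj_on code (arrows C)"
begin

lemma dec: "X \<in> Obj C ==> Y \<in> Obj C ==> f \<in> Hom C X Y ==> inv_into (arrows C) code (code f) = f"
 using inj_code by (intro inv_into_f_f) (auto intro: arrowsI)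

lemma on_ob_yob: "Z \<in> Obj C ==> on_ob (yob code X) Z = code ` Hom C Z X"
 by (simp add: yob_def on_ob_mkpsh)

lemma res_yob:
 assumes "X \<in> Obj C" "W \<in> Obj C" "Z \<in> Obj C" "g \<in> Hom C W Z" "f \<in> Hom C Z X"
 shows "res (yob code X) g (code f) = code (Cmp C f g)"
 using assms unfolding yob_def by (subst res_mkpsh[OF assms(2,3,4)]) (auto simp: dec[OF assms(3,1,5)])

text \<open>Domain and codomain of an arrow are unique because Hom-sets are disjoint; this resolves
  the definite description in \<open>yoneda\<close>.\<close>

lemma on_ob_yoneda:
 assumes "X \<in> Obj C"
 shows "on_ob (yoneda code C) X = yob code X"
proof -
 let ?dec = "inv_into (arrows C) code"
 have "(THE m. \<exists>W\<in>Obj C. \<exists>Z\<in>Obj C. g \<in> Hom C W Z \<and>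
   m = (code ` Hom C Z X, \<lambda>u\<in>code ` Hom C Z X. code (Cmp C (?dec u) g), code ` Hom C W X)) =
   (code ` Hom C (ccod C g) X, \<lambda>u\<in>code ` Hom C (ccod C g) X. code (Cmp C (?dec u) g), code ` Hom C (cdom C g) X)"
  if "g \<in> arrows C" for g
 proof -
  from that obtain W Z where g: "W \<in> Obj C" "Z \<in> Obj C" "g \<in> Hom C W Z" by (auto simp: arrows_def)
  then have e: "cdom C g = W" "ccod C g = Z" by (simp_all add: cdom_eq[OF g] ccod_eq[OF g])
  show ?thesis unfolding e
  proof (rule the_equality)
   fix m assume "\<exists>W\<in>Obj C. \<exists>Z\<in>Obj C. g \<in> Hom C W Z \<and>
    m = (code ` Hom C Z X, \<lambda>u\<in>code ` Hom C Z X. code (Cmp C (?dec u) g), code ` Hom C W X)"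
   then obtain W' Z' where *: "W' \<in> Obj C" "Z' \<in> Obj C" "g \<in> Hom C W' Z'"
    "m = (code ` Hom C Z' X, \<lambda>u\<in>code ` Hom C Z' X. code (Cmp C (?dec u) g), code ` Hom C W' X)" by blast
   then have "W' = W" "Z' = Z" using Hom_disj[OF *(1,2) g(1,2) *(3) g(3)] by auto
   with * show "m = (code ` Hom C Z X, \<lambda>u\<in>code ` Hom C Z X. code (Cmp C (?dec u) g), code ` Hom C W X)" by simp
  qed (use g in blast)
 qed
 then show ?thesis
  by (auto simp: yoneda_def Let_def yob_def mkpsh_def arrows_def[symmetric] intro!: restrict_ext)
qed

lemma on_ar_yoneda:
 assumes "X \<in> Obj C" "Y \<in> Obj C" "f \<in> Hom C X Y"
 shows "on_ar (yoneda code C) f = yar code X Y f"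
proof -
 let ?dec = "inv_into (arrows C) code"
 have "on_ar (yoneda code C) f = (THE \<tau>. \<exists>X\<in>Obj C. \<exists>Y\<in>Obj C. f \<in> Hom C X Y \<and>
   \<tau> = (on_ob (yoneda code C) X, \<lambda>Z\<in>Obj C. (code ` Hom C Z X, \<lambda>u\<in>code ` Hom C Z X. code (Cmp C f (?dec u)),
    code ` Hom C Z Y), on_ob (yoneda code C) Y))"
  by (simp add: yoneda_def Let_def arrows_def[symmetric])
 also have "\<dots> = (on_ob (yoneda code C) X, \<lambda>Z\<in>Obj C. (code ` Hom C Z X, \<lambda>u\<in>code ` Hom C Z X. code (Cmp C f (?dec u)),
    code ` Hom C Z Y), on_ob (yoneda code C) Y)"
 proof (rule the_equality)
  show "\<tau> = (on_ob (yoneda code C) X, \<lambda>Z\<in>Obj C. (code ` Hom C Z X, \<lambda>u\<in>code ` Hom C Z X. code (Cmp C f (?dec u)),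
    code ` Hom C Z Y), on_ob (yoneda code C) Y)"
   if \<tau>: "\<exists>X\<in>Obj C. \<exists>Y\<in>Obj C. f \<in> Hom C X Y \<and>
   \<tau> = (on_ob (yoneda code C) X, \<lambda>Z\<in>Obj C. (code ` Hom C Z X, \<lambda>u\<in>code ` Hom C Z X. code (Cmp C f (?dec u)),
    code ` Hom C Z Y), on_ob (yoneda code C) Y)" for \<tau>
  proof -
   from \<tau> obtain X' Y' where *: "X' \<in> Obj C" "Y' \<in> Obj C" "f \<in> Hom C X' Y'"
    "\<tau> = (on_ob (yoneda code C) X', \<lambda>Z\<in>Obj C. (code ` Hom C Z X', \<lambda>u\<in>code ` Hom C Z X'. code (Cmp C f (?dec u)),
    code ` Hom C Z Y'), on_ob (yoneda code C) Y')" by blast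
   then have "X' = X" "Y' = Y" using Hom_disj assms by blast+
   with * show ?thesis by simp
  qed
 qed (use assms in blast)
 also have "\<dots> = yar code X Y f"
  using assms by (auto simp: on_ob_yoneda yar_def mkmap_def on_ob_yob intro!: restrict_ext)
 finally show ?thesis .
qed

lemma yob_PSh:
 assumes "X \<in> Obj C" "\<And>Z. Z \<in> Obj C ==> code ` Hom C Z X \<in> \<U>"
 shows "yob code X \<in> Obj PSh"
 unfolding yob_def
proof (rule mkpsh_PSh)
 have "code (Cmp C (inv_into (arrows C) code (code f)) (Idn C Z)) = code f" if "Z \<in> Obj C" "f \<in> Hom C Z X" for Z f
  using that assms(1) by (simp add: dec[OF that(1) assms(1) that(2)] Cmp_Idn[OF that(1) assms(1) that(2)])
 then show "code (Cmp C (inv_into (arrows C) code s) (Idn C Z)) = s" if "Z \<in> Obj C" "s \<in> code ` Hom C Z X" for Z s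
  using that by auto
next
 fix V W Z g h s assume *: "V \<in> Obj C" "W \<in> Obj C" "Z \<in> Obj C" "g \<in> Hom C W Z" "h \<in> Hom C V W" "s \<in> code ` Hom C Z X"
 then obtain f where f: "f \<in> Hom C Z X" "s = code f" by blast
 have fg: "Cmp C f g \<in> Hom C W X" by (rule Cmp[OF *(2,3) assms(1) *(4) f(1)])
 then show "code (Cmp C (inv_into (arrows C) code s) (Cmp C g h)) =
   code (Cmp C (inv_into (arrows C) code (code (Cmp C (inv_into (arrows C) code s) g))) h)"
  by (simp add: f(2) dec[OF *(3) assms(1) f(1)] dec[OF *(2) assms(1) fg] assoc[OF *(1,2,3) assms(1) *(5,4) f(1)])
next
 fix W Z g s assume *: "W \<in> Obj C" "Z \<in> Obj C" "g \<in> Hom C W Z" "s \<in> code ` Hom C Z X"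
 then obtain f where f: "f \<in> Hom C Z X" "s = code f" by blast
 show "code (Cmp C (inv_into (arrows C) code s) g) \<in> code ` Hom C W X"
  unfolding f(2) dec[OF *(2) assms(1) f(1)] by (intro imageI Cmp[OF *(1,2) assms(1) *(3) f(1)])
qed (rule assms(2))

lemma yar_Hom:
 assumes XY: "X \<in> Obj C" "Y \<in> Obj C" and PSh: "yob code X \<in> Obj PSh" "yob code Y \<in> Obj PSh" and f: "f \<in> Hom C X Y"
 shows "yar code X Y f \<in> Hom PSh (yob code X) (yob code Y)"
 unfolding yar_def
proof (rule mkmap_Hom[OF PSh])
 show "code (Cmp C f (inv_into (arrows C) code s)) \<in> on_ob (yob code Y) Z" if "Z \<in> Obj C" "s \<in> on_ob (yob code X) Z" for Z s
 proof -
  from that obtain h where h: "h \<in> Hom C Z X" "s = code h" by (auto simp: on_ob_yob)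
  show ?thesis unfolding on_ob_yob[OF that(1)] h(2) dec[OF that(1) XY(1) h(1)]
   by (intro imageI Cmp[OF that(1) XY h(1) f])
 qed
 fix W Z g s assume *: "W \<in> Obj C" "Z \<in> Obj C" "g \<in> Hom C W Z" "s \<in> on_ob (yob code X) Z"
 then obtain h where h: "h \<in> Hom C Z X" "s = code h" by (auto simp: on_ob_yob)
 have fh: "Cmp C f h \<in> Hom C Z Y" by (rule Cmp[OF *(2) XY h(1) f])
 have hg: "Cmp C h g \<in> Hom C W X" by (rule Cmp[OF *(1,2) XY(1) *(3) h(1)])
 then show "code (Cmp C f (inv_into (arrows C) code (res (yob code X) g s))) =
   res (yob code Y) g (code (Cmp C f (inv_into (arrows C) code s)))"
  unfolding h(2) res_yob[OF XY(1) *(1,2,3) h(1)] dec[OF *(2) XY(1) h(1)] dec[OF *(1) XY(1) hg]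
   res_yob[OF XY(2) *(1,2,3) fh] assoc[OF *(1,2) XY *(3) h(1) f] by simp
qed

lemma tapp_yar:
 assumes "X \<in> Obj C" "Z \<in> Obj C" "h \<in> Hom C Z X"
 shows "tapp (yar code X Y f) Z (code h) = code (Cmp C f h)"
 using assms by (simp add: yar_def tapp_mkmap on_ob_yob dec[OF assms(2,1,3)])

end

end

section \<open>The syntactic site\<close>

lemma ext_Exis: "ext N (\<Gamma>, Exis \<Delta> \<theta>) = Range (rel N \<Delta> \<Gamma> \<theta>)"
 by (auto simp: ext_iff sat_Exis rel_iff Range_iff)

lemma ext_Disj: "ext N (\<Gamma>, Disj I F) = (\<Union>i\<in>I. ext N (\<Gamma>, F i))"
 by (auto simp: ext_iff)

definition prod_form :: "('s, 'f, 'r, 'i) fic => ('s, 'f, 'r, 'i) fic => ('s, 'f, 'r, 'i) form" where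
 "prod_form X Y = Conj (snd X) (ren (\<lambda>n. length (fst X) + n) (snd Y))"

lemma rel_prod_form:
 assumes "wf_form \<Sigma> (snd X) (fst X)" "wf_form \<Sigma> (snd Y) (fst Y)"
 shows "rel N (fst X) (fst Y) (prod_form X Y) = ext N X \<times> ext N Y"
proof -
 obtain \<Gamma> \<phi> \<Delta> \<psi> where XY: "X = (\<Gamma>, \<phi>)" "Y = (\<Delta>, \<psi>)" by (cases X, cases Y)
 have "sat N (prod_form X Y) (a @ b) \<longleftrightarrow> sat N \<phi> a \<and> sat N \<psi> b" if "a \<in> tuples N \<Gamma>" for a b
 proof -
  have l: "length a = length \<Gamma>" using that by (rule tuples_length)
  have "sat N (ren (\<lambda>n. length \<Gamma> + n) \<psi>) (a @ b) \<longleftrightarrow> sat N \<psi> b"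
   by (rule sat_ren[of \<Sigma> \<psi> \<Delta>]) (use assms XY l nth_append_length_plus[of a b] in auto)
  moreover have "sat N \<phi> (a @ b) \<longleftrightarrow> sat N \<phi> a" using sat_append[of \<Sigma> \<phi> \<Gamma> a N b] assms XY l by simp
  ultimately show ?thesis by (simp add: prod_form_def XY)
 qed
 then show ?thesis by (auto simp: rel_iff XY ext_iff)
qed

lemma wf_prod_form:
 assumes "wf_form \<Sigma> (snd X) (fst X)" "wf_form \<Sigma> (snd Y) (fst Y)"
 shows "wf_form \<Sigma> (prod_form X Y) (fst X @ fst Y)"
 using assms by (auto simp: prod_form_def nth_append intro!: wf_append wf_ren[OF assms(2)])

lemma map_nth_append:
 "map ((!) (a @ b)) [0..<length a] = a" "map ((!) (a @ b)) [length a..<length a + length b] = b"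
 by (rule nth_equalityI; simp add: nth_append)+

section \<open>Covers in the geometric topology, and gluing along them\<close>

context geometric_theory
begin

text \<open>The possibly infinitely many events in \<open>2\<close> may have no common refinement in
  the filter, but the corresponding sequents are combined by \<open>Disj_elim\<close>.\<close>

lemma rel_split:
 fixes \<omega> \<psi> :: "('s, 'f, 'r, 'i) form" and K :: "'i set" and H :: "'i => ('s, 'f, 'r, 'i) form"
 assumes "set (\<Gamma> @ \<Delta>) \<subseteq> Sorts \<Sigma>" "wff \<omega> (\<Gamma> @ \<Delta>)" "wff \<psi> (\<Gamma> @ \<Delta>)"
  and H: "\<And>k. k \<in> K ==> wff (H k) (\<Gamma> @ \<Delta>)"
  and 1: "EV N. rel N \<Gamma> \<Delta> \<omega> \<subseteq> (\<Union>k\<in>K. rel N \<Gamma> \<Delta> (H k))"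
  and 2: "\<And>k. k \<in> K ==> EV N. rel N \<Gamma> \<Delta> (H k) \<subseteq> rel N \<Gamma> \<Delta> \<psi>"
 shows "EV N. rel N \<Gamma> \<Delta> \<omega> \<subseteq> rel N \<Gamma> \<Delta> \<psi>"
proof -
 have "pv (\<Gamma> @ \<Delta>) \<omega> (Disj K H)"
  using prv_rel_iff[of \<Gamma> \<Delta> \<omega> "Disj K H"] assms(1,2) H 1 by (simp add: rel_Disj)
 moreover have "pv (\<Gamma> @ \<Delta>) (Disj K H) \<psi>"
 proof (rule Disj_elim)
  show "(\<Gamma> @ \<Delta>, \<psi>) \<in> fics" using assms by (simp add: fic_iff)
  show "\<forall>k\<in>K. pv (\<Gamma> @ \<Delta>) (H k) \<psi>"
   using prv_rel_iff[OF assms(1) H assms(3)] 2 by blast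
 qed
 ultimately have "pv (\<Gamma> @ \<Delta>) \<omega> \<psi>" by (rule Cut)
 then show ?thesis using prv_rel_iff[OF assms(1-3)] by blast
qed

lemma ext_split:
 fixes \<omega> \<psi> :: "('s, 'f, 'r, 'i) form" and K :: "'i set" and H :: "'i => ('s, 'f, 'r, 'i) form"
 assumes "(\<Gamma>, \<omega>) \<in> fics" "(\<Gamma>, \<psi>) \<in> fics" "\<And>k. k \<in> K ==> (\<Gamma>, H k) \<in> fics"
  and 1: "EV N. ext N (\<Gamma>, \<omega>) \<subseteq> (\<Union>k\<in>K. ext N (\<Gamma>, H k))"
  and 2: "\<And>k. k \<in> K ==> EV N. ext N (\<Gamma>, H k) \<subseteq> ext N (\<Gamma>, \<psi>)"
 shows "pv \<Gamma> \<omega> \<psi>"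
proof -
 have "(\<Gamma>, Disj K H) \<in> fics" using assms by (auto simp: fic_iff)
 then have "pv \<Gamma> \<omega> (Disj K H)" using prv_ext_iff[OF assms(1)] 1 by (simp add: ext_Disj)
 moreover have "pv \<Gamma> (Disj K H) \<psi>"
  by (rule Disj_elim) (use assms prv_ext_iff[OF assms(3) assms(2)] in auto)
 ultimately show ?thesis by (rule Cut)
qed

definition cover :: "('s, 'f, 'r, 'i) fic => 'i set => ('i => ('s, 'f, 'r, 'i) fic) => ('i => ('s, 'f, 'r, 'i) form) => bool" where
 "cover Z K Y \<theta> \<longleftrightarrow> (\<forall>k\<in>K. Y k \<in> fics \<and> fnl (Y k) Z (\<theta> k)) \<and>
   pv (fst Z) (snd Z) (Disj K (\<lambda>k. Exis (fst (Y k)) (\<theta> k)))"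

lemma J_iff:
 "S \<in> \<J> Z \<longleftrightarrow> is_sieve \<C> Z S \<and>
  (\<exists>K Y \<theta>. cover Z K Y \<theta> \<and> (\<forall>k\<in>K. arr (Y k) Z (\<theta> k) \<in> S))"
 unfolding syn_topology_def cover_def by blast

lemma coverD:
 assumes "cover Z K Y \<theta>" "k \<in> K"
 shows "Y k \<in> fics" "fnl (Y k) Z (\<theta> k)"
 using assms by (auto simp: cover_def)

lemma Exis_fics:
 assumes "Z \<in> fics" "Y \<in> fics" "wff \<theta> (fst Y @ fst Z)"
 shows "(fst Z, Exis (fst Y) \<theta>) \<in> fics"
 using assms by (simp add: fic_fst_snd wf_Exis)

lemma cover_iff:
 assumes "Z \<in> fics"
 shows "cover Z K Y \<theta> \<longleftrightarrow> (\<forall>k\<in>K. Y k \<in> fics \<and> fnl (Y k) Z (\<theta> k)) \<and>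
  (EV N. ext N Z \<subseteq> (\<Union>k\<in>K. Range (arel N (Y k) Z (\<theta> k))))"
proof -
 have "pv (fst Z) (snd Z) (Disj K (\<lambda>k. Exis (fst (Y k)) (\<theta> k))) \<longleftrightarrow>
  (EV N. ext N Z \<subseteq> (\<Union>k\<in>K. Range (arel N (Y k) Z (\<theta> k))))"
  if "\<forall>k\<in>K. Y k \<in> fics \<and> fnl (Y k) Z (\<theta> k)"
 proof -
  have "(fst Z, Disj K (\<lambda>k. Exis (fst (Y k)) (\<theta> k))) \<in> fics"
   using that Exis_fics[OF assms] fnl_wf[OF _ assms] assms by (simp add: fic_iff fic_fst_snd)
  then show ?thesis using prv_ext_iff[of "fst Z" "snd Z"] assms by (simp add: ext_Disj ext_Exis)
 qed
 then show ?thesis by (auto simp: cover_def)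
qed

lemma wf_comp:
 assumes "Y \<in> fics" "wff \<theta> (fst X @ fst Y)" "wff \<gamma> (fst Y @ fst Z)"
 shows "wff (comp_form (fst X) (fst Y) \<theta> \<gamma>) (fst X @ fst Z)"
 using assms by (intro wf_comp_form) (auto simp: fic_fst_snd)

lemma sorts2: "X \<in> fics ==> Y \<in> fics ==> set (fst X @ fst Y) \<subseteq> Sorts \<Sigma>"
 by (simp add: fic_fst_snd)

text \<open>The usual fibre product, with variables \<open>v @ y\<close> and the formula
  \<open>\<exists>z. \<eta>(v,z) \<and> \<theta>(y,z)\<close>. In place of the universal property,
  the last conclusion records what gluing consumes: pairs with the same image in \<open>Z\<close>
  come from a point of \<open>P\<close>.\<close>

lemma pullback:
 assumes V: "V \<in> fics" and Y: "Y \<in> fics" and Z: "Z \<in> fics" and \<eta>: "fnl V Z \<eta>" and \<theta>: "fnl Y Z \<theta>"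
 obtains P p q where "P \<in> fics" "fnl P V p" "fnl P Y q" "Cmp \<C> (arr V Z \<eta>) (arr P V p) = Cmp \<C> (arr Y Z \<theta>) (arr P Y q)"
  "EV N. arel N V Z \<eta> O (arel N Y Z \<theta>)\<inverse> \<subseteq> (arel N P V p)\<inverse> O arel N P Y q"
proof -
 note wf = fnl_wf[OF V Z \<eta>] fnl_wf[OF Y Z \<theta>]
 note wfc = wf_conv_form[OF wf(2)]
 define \<phi> where "\<phi> = comp_form (fst V) (fst Z) \<eta> (conv_form (fst Y) (fst Z) \<theta>)"
 have w\<phi>: "wff \<phi> (fst V @ fst Y)" unfolding \<phi>_def by (rule wf_comp[OF Z wf(1) wfc])
 have r\<phi>: "rel N (fst V) (fst Y) \<phi> = arel N V Z \<eta> O (arel N Y Z \<theta>)\<inverse>" for N :: "('s, 'f, 'r, 'f trm set) interp"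
  unfolding \<phi>_def rel_comp_form[OF wf(1) wfc] rel_conv_form[OF wf(2)] ..
 define P where "P = (fst V @ fst Y, \<phi>)"
 have P: "P \<in> fics" using w\<phi> V Y by (simp add: P_def fic_iff fic_fst_snd)
 let ?c = "length (fst V)" let ?d = "length (fst Y)"
 define p where "p = proj_form (fst P) \<phi> [0..<?c]"
 define q where "q = proj_form (fst P) \<phi> [?c..<?c + ?d]"
 have extP: "ext N P = {v @ y | v y. (v, y) \<in> arel N V Z \<eta> O (arel N Y Z \<theta>)\<inverse>}"
  for N :: "('s, 'f, 'r, 'f trm set) interp"
 proof -
  have "c \<in> ext N P \<longleftrightarrow> (\<exists>v y. c = v @ y \<and> (v, y) \<in> rel N (fst V) (fst Y) \<phi>)" for c
   by (auto simp: P_def ext_iff rel_iff tuples_append_iff tuples_length elim!: tuples_appendE)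
  then show ?thesis unfolding r\<phi> by blast
 qed
 have set: "set [0..<?c] \<subseteq> {..<length (fst P)}" "set [?c..<?c + ?d] \<subseteq> {..<length (fst P)}"
  by (auto simp: P_def)
 have w\<phi>': "wff \<phi> (fst P)" using w\<phi> by (simp add: P_def)
 have m: "map ((!) (fst P)) [0..<?c] = fst V" "map ((!) (fst P)) [?c..<?c + ?d] = fst Y"
  by (simp_all only: P_def fst_conv map_nth_append)
 have wp: "wff p (fst P @ fst V)" "wff q (fst P @ fst Y)"
  using wf_proj_form[OF w\<phi>' set(1)] wf_proj_form[OF w\<phi>' set(2)] unfolding m p_def q_def by simp_all
 have len: "length v = ?c" "length y = ?d" if "(v, y) \<in> arel N V Z \<eta> O (arel N Y Z \<theta>)\<inverse>"
  for v y and N :: "('s, 'f, 'r, 'f trm set) interp"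
  using that by (auto simp: rel_iff dest: tuples_length)
 have proj: "map ((!) (v @ y)) [0..<?c] = v" "map ((!) (v @ y)) [?c..<?c + ?d] = y"
  if "length v = ?c" "length y = ?d" for v y :: "'f trm set list"
  using map_nth_append[of v y] that by simp_all
 have rp: "arel N P V p = {(v @ y, v) | v y. (v, y) \<in> arel N V Z \<eta> O (arel N Y Z \<theta>)\<inverse>}"
  and rq: "arel N P Y q = {(v @ y, y) | v y. (v, y) \<in> arel N V Z \<eta> O (arel N Y Z \<theta>)\<inverse>}"
  for N :: "('s, 'f, 'r, 'f trm set) interp"
 proof -
  have P': "P = (fst P, \<phi>)" by (simp add: P_def)
  have "arel N P V p = {(a, map ((!) a) [0..<?c]) | a. a \<in> ext N P}"
   using rel_proj_form[OF w\<phi>' set(1), of N] unfolding m p_def P'[symmetric] .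
  moreover have "arel N P Y q = {(a, map ((!) a) [?c..<?c + ?d]) | a. a \<in> ext N P}"
   using rel_proj_form[OF w\<phi>' set(2), of N] unfolding m q_def P'[symmetric] .
  moreover have "{(a, g a) | a. a \<in> ext N P} = {(v @ y, g (v @ y)) | v y. (v, y) \<in> arel N V Z \<eta> O (arel N Y Z \<theta>)\<inverse>}"
   for g :: "'f trm set list => 'f trm set list" unfolding extP by blast
  ultimately have e: "arel N P V p = {(v @ y, map ((!) (v @ y)) [0..<?c]) | v y. (v, y) \<in> arel N V Z \<eta> O (arel N Y Z \<theta>)\<inverse>}"
   "arel N P Y q = {(v @ y, map ((!) (v @ y)) [?c..<?c + ?d]) | v y. (v, y) \<in> arel N V Z \<eta> O (arel N Y Z \<theta>)\<inverse>}"
   by simp_all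
  have *: "{(v @ y, g (v @ y)) | v y. (v, y) \<in> R} = {(v @ y, h v y) | v y. (v, y) \<in> R}"
   if "\<And>v y. (v, y) \<in> R ==> g (v @ y) = h v y"
   for R :: "('f trm set list) rel" and g :: "'f trm set list => 'f trm set list" and h
  proof (intro Collect_cong ex_cong1)
   show "w = (v @ y, g (v @ y)) \<and> (v, y) \<in> R \<longleftrightarrow> w = (v @ y, h v y) \<and> (v, y) \<in> R" for w v y
    using that[of v y] by auto
  qed
  show "arel N P V p = {(v @ y, v) | v y. (v, y) \<in> arel N V Z \<eta> O (arel N Y Z \<theta>)\<inverse>}"
   unfolding e(1) by (rule *) (rule proj(1)[OF len])
  show "arel N P Y q = {(v @ y, y) | v y. (v, y) \<in> arel N V Z \<eta> O (arel N Y Z \<theta>)\<inverse>}"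
   unfolding e(2) by (rule *) (rule proj(2)[OF len])
 qed
 have sv: "v = v' \<and> y = y'" if "v @ y = v' @ y'" "(v, y) \<in> arel N V Z \<eta> O (arel N Y Z \<theta>)\<inverse>"
  "(v', y') \<in> arel N V Z \<eta> O (arel N Y Z \<theta>)\<inverse>" for v y v' y' and N :: "('s, 'f, 'r, 'f trm set) interp"
  using that len(1)[OF that(2)] len(1)[OF that(3)] by simp
 have fp: "fnl P V p" unfolding prv_functional_iff[OF P V]
 proof
  show "EV N. fun_rel (ext N P) (ext N V) (arel N P V p)"
   using fnl_eventually[OF V Z \<eta>]
  proof eventually_elim
   case (elim N)
   have "single_valued (arel N P V p)" unfolding rp by (rule single_valuedI) (use sv[of _ _ _ _ N] in blast)
   then show ?case using elim unfolding fun_rel_def by (auto simp: rp extP)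
  qed
 qed (rule wp)
 have fq: "fnl P Y q" unfolding prv_functional_iff[OF P Y]
 proof
  show "EV N. fun_rel (ext N P) (ext N Y) (arel N P Y q)"
   using fnl_eventually[OF Y Z \<theta>]
  proof eventually_elim
   case (elim N)
   have "single_valued (arel N P Y q)" unfolding rq by (rule single_valuedI) (use sv[of _ _ _ _ N] in blast)
   then show ?case using elim unfolding fun_rel_def by (auto simp: rq extP)
  qed
 qed (rule wp)
 show ?thesis
 proof (rule that[OF P fp fq])
  show "Cmp \<C> (arr V Z \<eta>) (arr P V p) = Cmp \<C> (arr Y Z \<theta>) (arr P Y q)"
   unfolding Cmp_arr[OF P V Z fp \<eta>] Cmp_arr[OF P Y Z fq \<theta>]
  proof (rule arr_eqI[OF P Z fnl_comp[OF P V Z fp \<eta>] fnl_comp[OF P Y Z fq \<theta>]])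
   show "EV N. arel N P Z (comp_form (fst P) (fst V) p \<eta>) \<subseteq> arel N P Z (comp_form (fst P) (fst Y) q \<theta>)"
    using fnl_eventually[OF V Z \<eta>]
   proof eventually_elim
    case (elim N)
    show ?case unfolding arel_comp_form[OF P V Z fp \<eta>] arel_comp_form[OF P Y Z fq \<theta>]
    proof (rule subrelI)
     fix w z assume "(w, z) \<in> arel N P V p O arel N V Z \<eta>"
     then obtain v y z' where w: "w = v @ y" "(v, z') \<in> arel N V Z \<eta>" "(y, z') \<in> arel N Y Z \<theta>" "(v, z) \<in> arel N V Z \<eta>"
      unfolding rp by blast
     then have "z' = z" using elim by (auto simp: fun_rel_def single_valued_def)
     then show "(w, z) \<in> arel N P Y q O arel N Y Z \<theta>" using w unfolding rq by blast
    qed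
   qed
  qed
  have "arel N V Z \<eta> O (arel N Y Z \<theta>)\<inverse> \<subseteq> (arel N P V p)\<inverse> O arel N P Y q" for N :: "('s, 'f, 'r, 'f trm set) interp"
  proof (rule subrelI)
   fix v y assume "(v, y) \<in> arel N V Z \<eta> O (arel N Y Z \<theta>)\<inverse>"
   then have "(v @ y, v) \<in> arel N P V p" "(v @ y, y) \<in> arel N P Y q" unfolding rp rq by blast+
   then show "(v, y) \<in> (arel N P V p)\<inverse> O arel N P Y q" by blast
  qed
  then show "EV N. arel N V Z \<eta> O (arel N Y Z \<theta>)\<inverse> \<subseteq> (arel N P V p)\<inverse> O arel N P Y q" by simp
 qed
qed

text \<open>\<gamma> is covered by its restrictions to the images of the \<open>\<theta> k\<close>,
  and each restriction is contained in \<gamma>'.\<close>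

lemma cover_sep:
 assumes Z: "Z \<in> fics" and X: "X \<in> fics" and cov: "cover Z K Y \<theta>" and \<gamma>: "fnl Z X \<gamma>" and \<gamma>': "fnl Z X \<gamma>'"
  and eq: "\<And>k. k \<in> K ==> Cmp \<C> (arr Z X \<gamma>) (arr (Y k) Z (\<theta> k)) = Cmp \<C> (arr Z X \<gamma>') (arr (Y k) Z (\<theta> k))"
 shows "arr Z X \<gamma> = arr Z X \<gamma>'"
proof (rule arr_eqI[OF Z X \<gamma> \<gamma>'])
 note Y = coverD(1)[OF cov] and \<theta> = coverD(2)[OF cov]
 \<comment> \<open>\<open>H k\<close> defines \<gamma> on the image of \<open>\<theta> k\<close>:
   back along \<open>\<theta> k\<close>, forth again, and then along \<gamma>. In the last two steps
   \<gamma> may be exchanged for \<gamma>', by \<open>eq\<close>.\<close>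
 define H where "H k = comp_form (fst Z) (fst (Y k)) (conv_form (fst (Y k)) (fst Z) (\<theta> k)) (comp_form (fst (Y k)) (fst Z) (\<theta> k) \<gamma>)" for k
 have wc: "wff (conv_form (fst (Y k)) (fst Z) (\<theta> k)) (fst Z @ fst (Y k))" if "k \<in> K" for k
  by (rule wf_conv_form[OF fnl_wf[OF Y[OF that] Z \<theta>[OF that]]])
 have rH: "rel N (fst Z) (fst X) (H k) = (arel N (Y k) Z (\<theta> k))\<inverse> O (arel N (Y k) Z (\<theta> k) O arel N Z X \<gamma>)" if k: "k \<in> K" for k N
  unfolding H_def rel_comp_form[OF wc[OF k] fnl_wf[OF Y[OF k] X fnl_comp[OF Y[OF k] Z X \<theta>[OF k] \<gamma>]]]
   rel_conv_form[OF fnl_wf[OF Y[OF k] Z \<theta>[OF k]]] arel_comp_form[OF Y[OF k] Z X \<theta>[OF k] \<gamma>] ..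
 show "EV N. arel N Z X \<gamma> \<subseteq> arel N Z X \<gamma>'"
 proof (rule rel_split[OF sorts2[OF Z X] fnl_wf[OF Z X \<gamma>] fnl_wf[OF Z X \<gamma>'], of K H])
  fix k assume k: "k \<in> K"
  note Yk = Y[OF k] and \<theta>k = \<theta>[OF k]
  show "wff (H k) (fst Z @ fst X)" unfolding H_def
   by (rule wf_comp[OF Yk wc[OF k] fnl_wf[OF Yk X fnl_comp[OF Yk Z X \<theta>k \<gamma>]]])
  have "EV N. arel N (Y k) Z (\<theta> k) O arel N Z X \<gamma> = arel N (Y k) Z (\<theta> k) O arel N Z X \<gamma>'"
   using eq[OF k] unfolding Cmp_arr[OF Yk Z X \<theta>k \<gamma>] Cmp_arr[OF Yk Z X \<theta>k \<gamma>']
    arr_eq_iff[OF Yk X fnl_comp[OF Yk Z X \<theta>k \<gamma>] fnl_comp[OF Yk Z X \<theta>k \<gamma>']]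
    arel_comp_form[OF Yk Z X \<theta>k \<gamma>] arel_comp_form[OF Yk Z X \<theta>k \<gamma>'] .
  then show "EV N. rel N (fst Z) (fst X) (H k) \<subseteq> arel N Z X \<gamma>'"
   using fnl_eventually[OF Yk Z \<theta>k]
  proof eventually_elim
   case (elim N)
   have "(arel N (Y k) Z (\<theta> k))\<inverse> O arel N (Y k) Z (\<theta> k) \<subseteq> Id"
    using elim(2) by (auto simp: fun_rel_def single_valued_def)
   then have "((arel N (Y k) Z (\<theta> k))\<inverse> O arel N (Y k) Z (\<theta> k)) O arel N Z X \<gamma>' \<subseteq> Id O arel N Z X \<gamma>'"
    by (rule relcomp_mono) simp
   then show ?case unfolding rH[OF k] elim(1) by (simp add: O_assoc)
  qed
 next
  show "EV N. arel N Z X \<gamma> \<subseteq> (\<Union>k\<in>K. rel N (fst Z) (fst X) (H k))"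
   using cov[unfolded cover_iff[OF Z], THEN conjunct2] fnl_eventually[OF Z X \<gamma>]
  proof eventually_elim
   case (elim N)
   show ?case
   proof (rule subrelI)
    fix z x assume zx: "(z, x) \<in> arel N Z X \<gamma>"
    then have "z \<in> ext N Z" using elim(2) by (auto simp: fun_rel_def)
    then obtain k y where "k \<in> K" "(y, z) \<in> arel N (Y k) Z (\<theta> k)" using elim(1) by blast
    then show "(z, x) \<in> (\<Union>k\<in>K. rel N (fst Z) (fst X) (H k))" using zx rH by blast
   qed
  qed
 qed
qed

text \<open>The glued map sends the image of a point under \<open>\<theta> k\<close> to its image
  under \<open>d k\<close>; as a formula it is a disjunction over \<open>K\<close>. The assumption
  \<open>compat\<close> says, without mentioning pullbacks, that points of \<open>Y k\<close> and
  \<open>Y l\<close> over the same point of \<open>Z\<close> have the same image in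
  \<open>X\<close>.\<close>

lemma cover_glue:
 assumes Z: "Z \<in> fics" and X: "X \<in> fics" and cov: "cover Z K Y \<theta>"
  and d: "\<And>k. k \<in> K ==> fnl (Y k) X (d k)"
  and compat: "\<And>k l. k \<in> K ==> l \<in> K ==> \<forall>\<^sub>F N in gen_models.
   arel N (Y k) Z (\<theta> k) O (arel N (Y l) Z (\<theta> l))\<inverse> O arel N (Y l) X (d l) \<subseteq> arel N (Y k) X (d k)"
 obtains \<gamma> where "fnl Z X \<gamma>"
  "\<And>N :: ('s, 'f, 'r, 'f trm set) interp. rel N (fst Z) (fst X) \<gamma> = (\<Union>k\<in>K. (arel N (Y k) Z (\<theta> k))\<inverse> O arel N (Y k) X (d k))"
proof -
 note Y = coverD(1)[OF cov] and \<theta> = coverD(2)[OF cov]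
 note w\<theta> = fnl_wf[OF Y Z \<theta>] and wd = fnl_wf[OF Y X d]
 define G where "G k = comp_form (fst Z) (fst (Y k)) (conv_form (fst (Y k)) (fst Z) (\<theta> k)) (d k)" for k
 define \<gamma> where "\<gamma> = Disj K G"
 have wG: "wff (G k) (fst Z @ fst X)" if "k \<in> K" for k
  unfolding G_def by (rule wf_comp[OF Y wf_conv_form[OF w\<theta>] wd]) (rule that)+
 then have w\<gamma>: "wff \<gamma> (fst Z @ fst X)" by (simp add: \<gamma>_def)
 have rG: "rel N (fst Z) (fst X) (G k) = (arel N (Y k) Z (\<theta> k))\<inverse> O arel N (Y k) X (d k)" if "k \<in> K" for k and N :: "('s, 'f, 'r, 'f trm set) interp"
  unfolding G_def rel_comp_form[OF wf_conv_form[OF w\<theta>[OF that that]] wd[OF that that]] rel_conv_form[OF w\<theta>[OF that that]] ..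
 then have r\<gamma>: "rel N (fst Z) (fst X) \<gamma> = (\<Union>k\<in>K. (arel N (Y k) Z (\<theta> k))\<inverse> O arel N (Y k) X (d k))" for N :: "('s, 'f, 'r, 'f trm set) interp"
  by (simp add: \<gamma>_def rel_Disj)
 have wZX: "wff (snd Z) (fst Z)" "wff (snd X) (fst X)" using Z X by (simp_all add: fic_fst_snd)
 have a: "EV N. rel N (fst Z) (fst X) \<gamma> \<subseteq> ext N Z \<times> ext N X"
  unfolding rel_prod_form[OF wZX, symmetric]
 proof (rule rel_split[OF sorts2[OF Z X] w\<gamma> wf_prod_form[OF wZX] wG])
  show "EV N. rel N (fst Z) (fst X) \<gamma> \<subseteq> (\<Union>k\<in>K. rel N (fst Z) (fst X) (G k))"
   by (simp add: \<gamma>_def rel_Disj)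
  fix k assume k: "k \<in> K"
  show "EV N. rel N (fst Z) (fst X) (G k) \<subseteq> rel N (fst Z) (fst X) (prod_form Z X)"
   using fnl_eventually[OF Y[OF k] Z \<theta>[OF k]] fnl_eventually[OF Y[OF k] X d[OF k]]
   by eventually_elim (auto simp: rG[OF k] rel_prod_form[OF wZX] fun_rel_def)
 qed
 \<comment> \<open>After \<open>\<theta> k\<close> the glued relation stays inside
   \<open>d k\<close>: this is \<open>compat\<close>, one disjunct \<open>l\<close> at a
   time.\<close>
 have b: "EV N. arel N (Y k) Z (\<theta> k) O rel N (fst Z) (fst X) \<gamma> \<subseteq> arel N (Y k) X (d k)" if k: "k \<in> K" for k
 proof -
  have r: "rel N (fst (Y k)) (fst X) (comp_form (fst (Y k)) (fst Z) (\<theta> k) \<gamma>) = arel N (Y k) Z (\<theta> k) O rel N (fst Z) (fst X) \<gamma>"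
   "l \<in> K ==> rel N (fst (Y k)) (fst X) (comp_form (fst (Y k)) (fst Z) (\<theta> k) (G l)) = arel N (Y k) Z (\<theta> k) O rel N (fst Z) (fst X) (G l)"
   for N :: "('s, 'f, 'r, 'f trm set) interp" and l
   by (rule rel_comp_form[OF w\<theta>[OF k k] w\<gamma>], rule rel_comp_form[OF w\<theta>[OF k k] wG])
  show ?thesis unfolding r[symmetric]
  proof (rule rel_split[OF sorts2[OF Y[OF k] X] wf_comp[OF Z w\<theta>[OF k k] w\<gamma>] wd[OF k k], of K "\<lambda>l. comp_form (fst (Y k)) (fst Z) (\<theta> k) (G l)"])
   show "wff (comp_form (fst (Y k)) (fst Z) (\<theta> k) (G l)) (fst (Y k) @ fst X)" if "l \<in> K" for l
    by (rule wf_comp[OF Z w\<theta>[OF k k] wG[OF that]])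
   have "rel N (fst (Y k)) (fst X) (comp_form (fst (Y k)) (fst Z) (\<theta> k) \<gamma>)
     \<subseteq> (\<Union>l\<in>K. rel N (fst (Y k)) (fst X) (comp_form (fst (Y k)) (fst Z) (\<theta> k) (G l)))" for N :: "('s, 'f, 'r, 'f trm set) interp"
    unfolding r using r(2) by (auto simp: \<gamma>_def rel_Disj relcomp_unfold)
   then show "EV N. rel N (fst (Y k)) (fst X) (comp_form (fst (Y k)) (fst Z) (\<theta> k) \<gamma>)
     \<subseteq> (\<Union>l\<in>K. rel N (fst (Y k)) (fst X) (comp_form (fst (Y k)) (fst Z) (\<theta> k) (G l)))" by simp
   show "EV N. rel N (fst (Y k)) (fst X) (comp_form (fst (Y k)) (fst Z) (\<theta> k) (G l)) \<subseteq> arel N (Y k) X (d k)"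
    if l: "l \<in> K" for l
    unfolding r(2)[OF l] rG[OF l] by (rule compat[OF k l])
  qed
 qed
 \<comment> \<open>Single-valuedness is an inclusion of the converse of \<gamma> followed by
   \<gamma> in the diagonal, hence accessible to \<open>rel_split\<close>. Over the image of
   \<open>\<theta> k\<close> both values come from the single-valued \<open>d k\<close>, by
   \<open>b\<close>.\<close>
 have c: "EV N. single_valued (rel N (fst Z) (fst X) \<gamma>)"
 proof -
  define R where "R \<delta> = comp_form (fst X) (fst Z) (conv_form (fst Z) (fst X) \<delta>) \<delta>" for \<delta> :: "('s, 'f, 'r, 'i) form"
  define H where "H k = comp_form (fst X) (fst (Y k)) (conv_form (fst (Y k)) (fst X) (comp_form (fst (Y k)) (fst Z) (\<theta> k) \<gamma>))
   (comp_form (fst (Y k)) (fst Z) (\<theta> k) \<gamma>)" for k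
  have wk: "wff (comp_form (fst (Y k)) (fst Z) (\<theta> k) \<gamma>) (fst (Y k) @ fst X)" if "k \<in> K" for k
   by (rule wf_comp[OF Z w\<theta>[OF that that] w\<gamma>])
  have rR: "rel N (fst X) (fst X) (R \<gamma>) = (rel N (fst Z) (fst X) \<gamma>)\<inverse> O rel N (fst Z) (fst X) \<gamma>" for N :: "('s, 'f, 'r, 'f trm set) interp"
   unfolding R_def rel_comp_form[OF wf_conv_form[OF w\<gamma>] w\<gamma>] rel_conv_form[OF w\<gamma>] ..
  have rH: "rel N (fst X) (fst X) (H k) = (arel N (Y k) Z (\<theta> k) O rel N (fst Z) (fst X) \<gamma>)\<inverse> O (arel N (Y k) Z (\<theta> k) O rel N (fst Z) (fst X) \<gamma>)"
   if "k \<in> K" for k N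
   unfolding H_def rel_comp_form[OF wf_conv_form[OF wk[OF that]] wk[OF that]] rel_conv_form[OF wk[OF that]]
    rel_comp_form[OF w\<theta>[OF that that] w\<gamma>] ..
  have "EV N. rel N (fst X) (fst X) (R \<gamma>) \<subseteq> rel N (fst X) (fst X) (id_form X)"
  proof (rule rel_split[OF sorts2[OF X X] _ wf_id_form[OF wZX(2)], of _ K H])
   show "wff (R \<gamma>) (fst X @ fst X)" unfolding R_def by (rule wf_comp[OF Z wf_conv_form[OF w\<gamma>] w\<gamma>])
   show "wff (H k) (fst X @ fst X)" if "k \<in> K" for k
    unfolding H_def by (rule wf_comp[OF Y[OF that] wf_conv_form[OF wk[OF that]] wk[OF that]])
   show "EV N. rel N (fst X) (fst X) (R \<gamma>) \<subseteq> (\<Union>k\<in>K. rel N (fst X) (fst X) (H k))"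
    using cov[unfolded cover_iff[OF Z], THEN conjunct2] a
   proof eventually_elim
    case (elim N)
    show ?case unfolding rR
    proof (rule subrelI)
     fix x x' assume "(x, x') \<in> (rel N (fst Z) (fst X) \<gamma>)\<inverse> O rel N (fst Z) (fst X) \<gamma>"
     then obtain z where z: "(z, x) \<in> rel N (fst Z) (fst X) \<gamma>" "(z, x') \<in> rel N (fst Z) (fst X) \<gamma>" by blast
     then have "z \<in> ext N Z" using elim(2) by blast
     then obtain k y where "k \<in> K" "(y, z) \<in> arel N (Y k) Z (\<theta> k)" using elim(1) by blast
     then show "(x, x') \<in> (\<Union>k\<in>K. rel N (fst X) (fst X) (H k))" using z rH by blast
    qed
   qed
   show "EV N. rel N (fst X) (fst X) (H k) \<subseteq> rel N (fst X) (fst X) (id_form X)" if k: "k \<in> K" for k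
    using b[OF k] fnl_eventually[OF Y[OF k] X d[OF k]]
   proof eventually_elim
    case (elim N)
    have "rel N (fst X) (fst X) (H k) \<subseteq> (arel N (Y k) X (d k))\<inverse> O arel N (Y k) X (d k)"
     unfolding rH[OF k] using elim(1) by blast
    also have "\<dots> \<subseteq> Id_on (ext N X)" using elim(2) by (auto simp: fun_rel_def single_valued_def)
    finally show ?case unfolding rel_id_form[OF wZX(2)] .
   qed
  qed
  then show ?thesis by eventually_elim (auto simp: rR rel_id_form[OF wZX(2)] intro!: single_valuedI)
 qed
 \<comment> \<open>The image of each \<open>\<theta> k\<close> lies in the domain of \<gamma>, since
   \<open>d k\<close> is total.\<close>
 have e: "EV N. ext N Z \<subseteq> Domain (rel N (fst Z) (fst X) \<gamma>)"
 proof -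
  define D where "D = Exis (fst X) (conv_form (fst Z) (fst X) \<gamma>)"
  have D: "(fst Z, D) \<in> fics" unfolding D_def by (rule Exis_fics[OF Z X wf_conv_form[OF w\<gamma>]])
  have eD: "ext N (fst Z, D) = Domain (rel N (fst Z) (fst X) \<gamma>)" for N :: "('s, 'f, 'r, 'f trm set) interp"
   unfolding D_def ext_Exis rel_conv_form[OF w\<gamma>] by simp
  have "pv (fst Z) (snd Z) D"
  proof (rule ext_split[OF _ D, of _ K "\<lambda>k. Exis (fst (Y k)) (\<theta> k)"])
   show "(fst Z, snd Z) \<in> fics" using Z by simp
   show "(fst Z, Exis (fst (Y k)) (\<theta> k)) \<in> fics" if "k \<in> K" for k
    by (rule Exis_fics[OF Z Y[OF that] w\<theta>[OF that that]])
   show "EV N. ext N (fst Z, snd Z) \<subseteq> (\<Union>k\<in>K. ext N (fst Z, Exis (fst (Y k)) (\<theta> k)))"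
    using cov[unfolded cover_iff[OF Z], THEN conjunct2] by (simp add: ext_Exis)
   show "EV N. ext N (fst Z, Exis (fst (Y k)) (\<theta> k)) \<subseteq> ext N (fst Z, D)" if k: "k \<in> K" for k
    using fnl_eventually[OF Y[OF k] Z \<theta>[OF k]] fnl_eventually[OF Y[OF k] X d[OF k]]
   proof eventually_elim
    case (elim N)
    show ?case unfolding eD ext_Exis
    proof
     fix z assume "z \<in> Range (arel N (Y k) Z (\<theta> k))"
     then obtain y where y: "(y, z) \<in> arel N (Y k) Z (\<theta> k)" by blast
     then have "y \<in> ext N (Y k)" using elim(1) by (auto simp: fun_rel_def)
     then obtain x where "(y, x) \<in> arel N (Y k) X (d k)" using elim(2) by (auto simp: fun_rel_def)
     then show "z \<in> Domain (rel N (fst Z) (fst X) \<gamma>)" using y k unfolding r\<gamma> by blast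
    qed
   qed
  qed
  then show ?thesis using prv_ext_iff[of "fst Z" "snd Z" D] Z D by (simp add: eD)
 qed
 have "fnl Z X \<gamma>" unfolding prv_functional_iff[OF Z X]
  using w\<gamma> a c e by (simp add: fun_rel_def eventually_conj_iff)
 then show ?thesis using r\<gamma> by (rule that)
qed

end

section \<open>Atoms of the classifying topos\<close>

lemma inj_pair:
 includes cardinal_syntax
 assumes "infinite (UNIV :: 'a set)"
 shows "\<exists>h :: 'a \<times> 'a => 'a. inj h"
proof -
 have "|(UNIV :: 'a set) \<times> (UNIV :: 'a set)| =o |UNIV :: 'a set|"
  using assms by (rule card_of_Times_same_infinite)
 then show ?thesis unfolding card_of_ordIso[symmetric] bij_betw_def by auto
qed

context geometric_theory
begin

text \<open>A point of \<open>W\<close> whose image in \<open>Z\<close> lies in the image of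
  \<open>\<theta> k\<close> comes from the pullback \<open>P k\<close>, by the last conclusion of
  \<open>pullback\<close>.\<close>

lemma cover_pullback:
 assumes Z: "Z \<in> fics" and W: "W \<in> fics" and cov: "cover Z K Y \<theta>" and \<eta>: "fnl W Z \<eta>"
 obtains P p q where "cover W K P p"
  "\<And>k. k \<in> K ==> fnl (P k) (Y k) (q k) \<and>
   Cmp \<C> (arr W Z \<eta>) (arr (P k) W (p k)) = Cmp \<C> (arr (Y k) Z (\<theta> k)) (arr (P k) (Y k) (q k))"
proof -
 note Y = coverD(1)[OF cov] and \<theta> = coverD(2)[OF cov]
 have "\<forall>k\<in>K. \<exists>P p q. P \<in> fics \<and> fnl P W p \<and> fnl P (Y k) q \<and>
   Cmp \<C> (arr W Z \<eta>) (arr P W p) = Cmp \<C> (arr (Y k) Z (\<theta> k)) (arr P (Y k) q) \<and>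
   (EV N. arel N W Z \<eta> O (arel N (Y k) Z (\<theta> k))\<inverse> \<subseteq> (arel N P W p)\<inverse> O arel N P (Y k) q)"
 proof
  fix k assume k: "k \<in> K"
  show "\<exists>P p q. P \<in> fics \<and> fnl P W p \<and> fnl P (Y k) q \<and>
   Cmp \<C> (arr W Z \<eta>) (arr P W p) = Cmp \<C> (arr (Y k) Z (\<theta> k)) (arr P (Y k) q) \<and>
   (EV N. arel N W Z \<eta> O (arel N (Y k) Z (\<theta> k))\<inverse> \<subseteq> (arel N P W p)\<inverse> O arel N P (Y k) q)"
   by (rule pullback[OF W Y[OF k] Z \<eta> \<theta>[OF k]]) blast
 qed
 from bchoice[OF this] obtain P where "\<forall>k\<in>K. \<exists>p q. P k \<in> fics \<and> fnl (P k) W p \<and> fnl (P k) (Y k) q \<and>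
   Cmp \<C> (arr W Z \<eta>) (arr (P k) W p) = Cmp \<C> (arr (Y k) Z (\<theta> k)) (arr (P k) (Y k) q) \<and>
   (EV N. arel N W Z \<eta> O (arel N (Y k) Z (\<theta> k))\<inverse> \<subseteq> (arel N (P k) W p)\<inverse> O arel N (P k) (Y k) q)" ..
 from bchoice[OF this] obtain p where "\<forall>k\<in>K. \<exists>q. P k \<in> fics \<and> fnl (P k) W (p k) \<and> fnl (P k) (Y k) q \<and>
   Cmp \<C> (arr W Z \<eta>) (arr (P k) W (p k)) = Cmp \<C> (arr (Y k) Z (\<theta> k)) (arr (P k) (Y k) q) \<and>
   (EV N. arel N W Z \<eta> O (arel N (Y k) Z (\<theta> k))\<inverse> \<subseteq> (arel N (P k) W (p k))\<inverse> O arel N (P k) (Y k) q)" ..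
 from bchoice[OF this] obtain q where q: "\<forall>k\<in>K. P k \<in> fics \<and> fnl (P k) W (p k) \<and> fnl (P k) (Y k) (q k) \<and>
   Cmp \<C> (arr W Z \<eta>) (arr (P k) W (p k)) = Cmp \<C> (arr (Y k) Z (\<theta> k)) (arr (P k) (Y k) (q k)) \<and>
   (EV N. arel N W Z \<eta> O (arel N (Y k) Z (\<theta> k))\<inverse> \<subseteq> (arel N (P k) W (p k))\<inverse> O arel N (P k) (Y k) (q k))" ..
 note wc = wf_conv_form[OF fnl_wf[OF Y Z \<theta>]]
 \<comment> \<open>\<open>C k\<close> relates points of \<open>W\<close> and \<open>Y k\<close> over
   the same point of \<open>Z\<close>; the domains of these relations cover
   \<open>W\<close>.\<close>
 define C where "C k = comp_form (fst W) (fst Z) \<eta> (conv_form (fst (Y k)) (fst Z) (\<theta> k))" for k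
 have wC: "wff (C k) (fst W @ fst (Y k))" if "k \<in> K" for k
  unfolding C_def by (rule wf_comp[OF Z fnl_wf[OF W Z \<eta>] wc[OF that that]])
 have rC: "rel N (fst W) (fst (Y k)) (C k) = arel N W Z \<eta> O (arel N (Y k) Z (\<theta> k))\<inverse>" if "k \<in> K"
  for k and N :: "('s, 'f, 'r, 'f trm set) interp"
  unfolding C_def rel_comp_form[OF fnl_wf[OF W Z \<eta>] wc[OF that that]] rel_conv_form[OF fnl_wf[OF Y Z \<theta>, OF that that]] ..
 have "pv (fst W) (snd W) (Disj K (\<lambda>k. Exis (fst (P k)) (p k)))"
 proof (rule ext_split[of _ _ _ K "\<lambda>k. Exis (fst (Y k)) (conv_form (fst W) (fst (Y k)) (C k))"])
  have wE: "(fst W, Exis (fst (P k)) (p k)) \<in> fics" if "k \<in> K" for k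
   using q that W by (intro Exis_fics fnl_wf) auto
  show "(fst W, snd W) \<in> fics" using W by simp
  show "(fst W, Disj K (\<lambda>k. Exis (fst (P k)) (p k))) \<in> fics" using W wE by (auto simp: fic_iff fic_fst_snd)
  show "(fst W, Exis (fst (Y k)) (conv_form (fst W) (fst (Y k)) (C k))) \<in> fics" if "k \<in> K" for k
   by (rule Exis_fics[OF W Y[OF that] wf_conv_form[OF wC[OF that]]])
  have e: "ext N (fst W, Exis (fst (Y k)) (conv_form (fst W) (fst (Y k)) (C k))) = Domain (arel N W Z \<eta> O (arel N (Y k) Z (\<theta> k))\<inverse>)"
   if "k \<in> K" for k and N :: "('s, 'f, 'r, 'f trm set) interp"
   unfolding ext_Exis rel_conv_form[OF wC[OF that]] rC[OF that] by simp
  show "EV N. ext N (fst W, snd W) \<subseteq> (\<Union>k\<in>K. ext N (fst W, Exis (fst (Y k)) (conv_form (fst W) (fst (Y k)) (C k))))"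
   using cov[unfolded cover_iff[OF Z], THEN conjunct2] fnl_eventually[OF W Z \<eta>]
  proof eventually_elim
   case (elim N)
   show ?case
   proof
    fix w assume "w \<in> ext N (fst W, snd W)"
    then obtain z where z: "(w, z) \<in> arel N W Z \<eta>" using elim(2) by (auto simp: fun_rel_def)
    then have "z \<in> ext N Z" using elim(2) by (auto simp: fun_rel_def)
    then obtain k y where k: "k \<in> K" "(y, z) \<in> arel N (Y k) Z (\<theta> k)" using elim(1) by blast
    with z have "w \<in> ext N (fst W, Exis (fst (Y k)) (conv_form (fst W) (fst (Y k)) (C k)))"
     unfolding e[OF k(1)] by blast
    with k(1) show "w \<in> (\<Union>k\<in>K. ext N (fst W, Exis (fst (Y k)) (conv_form (fst W) (fst (Y k)) (C k))))" by blast
   qed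
  qed
  show "EV N. ext N (fst W, Exis (fst (Y k)) (conv_form (fst W) (fst (Y k)) (C k))) \<subseteq>
    ext N (fst W, Disj K (\<lambda>k. Exis (fst (P k)) (p k)))" if k: "k \<in> K" for k
  proof -
   have "EV N. arel N W Z \<eta> O (arel N (Y k) Z (\<theta> k))\<inverse> \<subseteq> (arel N (P k) W (p k))\<inverse> O arel N (P k) (Y k) (q k)"
    using q k by blast
   then show ?thesis
   proof eventually_elim
    case (elim N)
    have "Domain (arel N W Z \<eta> O (arel N (Y k) Z (\<theta> k))\<inverse>) \<subseteq> Domain ((arel N (P k) W (p k))\<inverse> O arel N (P k) (Y k) (q k))"
     using elim by (rule Domain_mono)
    also have "\<dots> \<subseteq> Range (arel N (P k) W (p k))" by auto
    also have "\<dots> \<subseteq> (\<Union>k\<in>K. Range (arel N (P k) W (p k)))" using k by (rule UN_upper)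
    finally show ?case unfolding e[OF k] unfolding ext_Disj ext_Exis .
   qed
  qed
 qed
 then have "cover W K P p" using q by (simp add: cover_def)
 then show ?thesis by (rule that[of P p q]) (use q in blast)
qed

lemma cover_id:
 assumes "Z \<in> fics"
 shows "cover Z {i} (\<lambda>_. Z) (\<lambda>_. id_form Z)"
proof -
 have "rel N (fst Z) (fst Z) (id_form Z) = Id_on (ext N Z)" for N :: "('s, 'f, 'r, 'f trm set) interp"
  by (rule rel_id_form[of \<Sigma>]) (use assms in \<open>simp add: fic_fst_snd\<close>)
 then show ?thesis unfolding cover_iff[OF assms] using assms fnl_id[OF assms] by auto
qed

text \<open>Covers are indexed by sets of elements of \<open>'i\<close>. The pairs
  \<open>(k, m)\<close> are coded there by \<open>h\<close>, which exists because \<open>'i\<close>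
  is infinite.\<close>

lemma cover_trans:
 assumes inf: "infinite (UNIV :: 'i set)" and Z: "Z \<in> fics" and cov: "cover Z K Y \<theta>"
  and cov': "\<And>k. k \<in> K ==> cover (Y k) (K' k) (Y' k) (\<theta>' k)"
 obtains L V \<xi> where "cover Z L V \<xi>"
  "\<And>l. l \<in> L ==> \<exists>k\<in>K. \<exists>m\<in>K' k. V l = Y' k m \<and> \<xi> l = comp_form (fst (Y' k m)) (fst (Y k)) (\<theta>' k m) (\<theta> k)"
proof -
 note Y = coverD(1)[OF cov] and \<theta> = coverD(2)[OF cov]
 note Y' = coverD(1)[OF cov'] and \<theta>' = coverD(2)[OF cov']
 obtain h :: "'i \<times> 'i => 'i" where h: "inj h" using inj_pair[OF inf] by blast
 define L where "L = h ` Sigma K K'"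
 define V where "V l = (case inv_into UNIV h l of (k, m) => Y' k m)" for l
 define \<xi> where "\<xi> l = (case inv_into UNIV h l of (k, m) => comp_form (fst (Y' k m)) (fst (Y k)) (\<theta>' k m) (\<theta> k))" for l
 have V: "V (h (k, m)) = Y' k m" "\<xi> (h (k, m)) = comp_form (fst (Y' k m)) (fst (Y k)) (\<theta>' k m) (\<theta> k)" for k m
  by (simp_all add: V_def \<xi>_def inv_f_f[OF h])
 have LE: "\<exists>k\<in>K. \<exists>m\<in>K' k. l = h (k, m)" if "l \<in> L" for l
  using that by (auto simp: L_def)
 have f: "V l \<in> fics \<and> fnl (V l) Z (\<xi> l)" if "l \<in> L" for l
 proof -
  from LE[OF that] obtain k m where km: "k \<in> K" "m \<in> K' k" "l = h (k, m)" by blast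
  then show ?thesis using Y'[OF km(1,2)] fnl_comp[OF Y'[OF km(1,2)] Y[OF km(1)] Z \<theta>'[OF km(1,2)] \<theta>[OF km(1)]]
   by (simp add: V)
 qed
 have "pv (fst Z) (snd Z) (Disj L (\<lambda>l. Exis (fst (V l)) (\<xi> l)))"
 proof (rule ext_split[of _ _ _ K "\<lambda>k. Exis (fst (Y k)) (\<theta> k)"])
  show "(fst Z, snd Z) \<in> fics" using Z by simp
  have "(fst Z, Exis (fst (V l)) (\<xi> l)) \<in> fics" if "l \<in> L" for l
   using f[OF that] Z by (intro Exis_fics fnl_wf) auto
  then show "(fst Z, Disj L (\<lambda>l. Exis (fst (V l)) (\<xi> l))) \<in> fics" using Z by (auto simp: fic_iff fic_fst_snd)
  show "(fst Z, Exis (fst (Y k)) (\<theta> k)) \<in> fics" if "k \<in> K" for k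
   by (rule Exis_fics[OF Z Y[OF that] fnl_wf[OF Y[OF that] Z \<theta>[OF that]]])
  show "EV N. ext N (fst Z, snd Z) \<subseteq> (\<Union>k\<in>K. ext N (fst Z, Exis (fst (Y k)) (\<theta> k)))"
   using cov[unfolded cover_iff[OF Z], THEN conjunct2] by (simp add: ext_Exis)
  show "EV N. ext N (fst Z, Exis (fst (Y k)) (\<theta> k)) \<subseteq> ext N (fst Z, Disj L (\<lambda>l. Exis (fst (V l)) (\<xi> l)))"
   if k: "k \<in> K" for k
   using cov'[OF k, unfolded cover_iff[OF Y[OF k]], THEN conjunct2] fnl_eventually[OF Y[OF k] Z \<theta>[OF k]]
  proof eventually_elim
   case (elim N)
   show ?case unfolding ext_Exis ext_Disj
   proof
    fix z assume "z \<in> Range (arel N (Y k) Z (\<theta> k))"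
    then obtain y where y: "(y, z) \<in> arel N (Y k) Z (\<theta> k)" by blast
    then have "y \<in> ext N (Y k)" using elim(2) by (auto simp: fun_rel_def)
    then obtain m v where m: "m \<in> K' k" "(v, y) \<in> arel N (Y' k m) (Y k) (\<theta>' k m)" using elim(1) by blast
    have "(v, z) \<in> arel N (V (h (k, m))) Z (\<xi> (h (k, m)))"
     unfolding V arel_comp_form[OF Y'[OF k m(1)] Y[OF k] Z \<theta>'[OF k m(1)] \<theta>[OF k]] using y m by blast
    moreover have "h (k, m) \<in> L" using k m by (auto simp: L_def)
    ultimately show "z \<in> (\<Union>l\<in>L. Range (arel N (V l) Z (\<xi> l)))" by blast
   qed
  qed
 qed
 then have "cover Z L V \<xi>" using f by (simp add: cover_def)
 then show ?thesis
 proof (rule that)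
  show "\<exists>k\<in>K. \<exists>m\<in>K' k. V l = Y' k m \<and> \<xi> l = comp_form (fst (Y' k m)) (fst (Y k)) (\<theta>' k m) (\<theta> k)" if "l \<in> L" for l
   using LE[OF that] V by blast
 qed
qed

lemma J_sieve: "S \<in> \<J> Z ==> is_sieve \<C> Z S"
 by (simp add: J_iff)

lemma HomE:
 assumes "f \<in> Hom \<C> X Y"
 obtains \<theta> where "f = arr X Y \<theta>" "fnl X Y \<theta>"
 using assms by (auto simp: Hom_C)

lemma sieveE:
 assumes "is_sieve \<C> Z S" "f \<in> S"
 obtains V \<eta> where "V \<in> fics" "f = arr V Z \<eta>" "fnl V Z \<eta>" "f \<in> Hom \<C> V Z"
proof -
 from assms obtain V where V: "V \<in> fics" "f \<in> Hom \<C> V Z" by (auto simp: is_sieve_def)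
 obtain \<eta> where "f = arr V Z \<eta>" "fnl V Z \<eta>" using V(2) by (rule HomE)
 then show ?thesis using V by (intro that[of V \<eta>])
qed

lemma JE:
 assumes "S \<in> \<J> Z"
 obtains K Y \<theta> where "cover Z K Y \<theta>" "\<And>k. k \<in> K ==> arr (Y k) Z (\<theta> k) \<in> S"
 using assms by (auto simp: J_iff)

section \<open>Sentences, as preparation for subobjects of the terminal sheaf\<close>

lemma sentence_fics: "([], \<phi>) \<in> fics ==> Z \<in> fics ==> (fst Z, \<phi>) \<in> fics"
 using wf_append[of \<Sigma> \<phi> "[]" "fst Z"] by (simp add: fic_iff fic_fst_snd)

lemma sat_sentence: "([], \<phi>) \<in> fics ==> sat N \<phi> a \<longleftrightarrow> sat N \<phi> []"
 using sat_append[of \<Sigma> \<phi> "[]" "[]" N a] by (simp add: fic_iff)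

text \<open>The truth value of a sentence does not depend on the values of the variables of
  \<open>Z\<close>, but where \<open>Z\<close> has no point the sequent holds vacuously.\<close>

lemma sentence_prv_iff:
 assumes "([], \<phi>) \<in> fics" "Z \<in> fics"
 shows "pv (fst Z) (snd Z) \<phi> \<longleftrightarrow> (EV N. ext N Z \<noteq> {} --> sat N \<phi> [])"
proof -
 have "ext N (fst Z, snd Z) \<subseteq> ext N (fst Z, \<phi>) \<longleftrightarrow> (ext N Z \<noteq> {} --> sat N \<phi> [])"
  for N :: "('s, 'f, 'r, 'f trm set) interp"
  using sat_sentence[OF assms(1), of N] by (cases Z) (auto simp: ext_iff)
 then show ?thesis using prv_ext_iff[of "fst Z" "snd Z" \<phi>] sentence_fics[OF assms] assms(2) by simp
qed

lemma sentence_stable: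
 assumes "([], \<phi>) \<in> fics" "W \<in> fics" "Z \<in> fics" "g \<in> Hom \<C> W Z" "pv (fst Z) (snd Z) \<phi>"
 shows "pv (fst W) (snd W) \<phi>"
proof -
 obtain \<eta> where "fnl W Z \<eta>" using assms(4) by (rule HomE)
 from fnl_eventually[OF assms(2,3) this] assms(5) show ?thesis
  unfolding sentence_prv_iff[OF assms(1,2)] sentence_prv_iff[OF assms(1,3)]
  by eventually_elim (auto simp: fun_rel_def)
qed

lemma sentence_local:
 assumes \<phi>: "([], \<phi>) \<in> fics" and Z: "Z \<in> fics" and S: "S \<in> \<J> Z"
  and loc: "\<And>Y f. Y \<in> fics ==> f \<in> S ==> f \<in> Hom \<C> Y Z ==> pv (fst Y) (snd Y) \<phi>"
 shows "pv (fst Z) (snd Z) \<phi>"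
proof -
 obtain K Y \<theta> where cov: "cover Z K Y \<theta>" and KS: "\<And>k. k \<in> K ==> arr (Y k) Z (\<theta> k) \<in> S" using S by (rule JE) blast
 note Y = coverD(1)[OF cov] and \<theta> = coverD(2)[OF cov]
 show ?thesis
 proof (rule ext_split[of _ _ _ K "\<lambda>k. Exis (fst (Y k)) (\<theta> k)"])
  show "(fst Z, snd Z) \<in> fics" using Z by simp
  show "(fst Z, \<phi>) \<in> fics" by (rule sentence_fics[OF \<phi> Z])
  show "(fst Z, Exis (fst (Y k)) (\<theta> k)) \<in> fics" if "k \<in> K" for k
   by (rule Exis_fics[OF Z Y[OF that] fnl_wf[OF Y[OF that] Z \<theta>[OF that]]])
  show "EV N. ext N (fst Z, snd Z) \<subseteq> (\<Union>k\<in>K. ext N (fst Z, Exis (fst (Y k)) (\<theta> k)))"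
   using cov[unfolded cover_iff[OF Z], THEN conjunct2] by (simp add: ext_Exis)
  show "EV N. ext N (fst Z, Exis (fst (Y k)) (\<theta> k)) \<subseteq> ext N (fst Z, \<phi>)" if k: "k \<in> K" for k
  proof -
   have "pv (fst (Y k)) (snd (Y k)) \<phi>" by (rule loc[OF Y[OF k] KS[OF k] Hom_C_I[OF \<theta>[OF k]]])
   then show ?thesis using fnl_eventually[OF Y[OF k] Z \<theta>[OF k]] unfolding sentence_prv_iff[OF \<phi> Y[OF k]]
   proof eventually_elim
    case (elim N)
    show ?case unfolding ext_Exis
    proof
     fix z assume "z \<in> Range (arel N (Y k) Z (\<theta> k))"
     then have "ext N (Y k) \<noteq> {}" "z \<in> ext N Z" using elim(2) by (auto simp: fun_rel_def)
     then show "z \<in> ext N (fst Z, \<phi>)" using elim(1) sat_sentence[OF \<phi>, of N] by (cases Z) (auto simp: ext_iff)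
    qed
   qed
  qed
 qed
qed

end

section \<open>Representable and subterminal sheaves on the syntactic site\<close>

locale syntactic_site = geometric_theory \<Sigma> \<T> + universe "TYPE(('s, 'f, 'r, 'i) form)" \<U>
 for \<Sigma> :: "('s, 'f, 'r) signature" and \<T> :: "('s, 'f, 'r, 'i) sequent set" and \<U> :: "'u set set" +
 fixes code :: "('s, 'f, 'r, 'i) syn_arrow => 'u"
 assumes inj_code: "inj_on code (arrows (syn_cat \<Sigma> \<T>))" and infinite_index: "infinite (UNIV :: 'i set)"
begin

sublocale S: site \<C> \<J> \<U>
 by unfold_locales (rule is_category_C, rule U_lepoll)

abbreviation "y \<equiv> S.yob code"

text \<open>Arrows with given ends are classes of formulae, and the formulae form the index type of
  the universe.\<close>

lemma code_Hom_U: "code ` Hom \<C> Z X \<in> \<U>"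
proof -
 have "small (arr Z X ` UNIV)" by (intro small_image small_index lepoll_refl)
 then have "small (Hom \<C> Z X)" by (rule small_subset) (auto simp: Hom_C)
 then show ?thesis unfolding U_iff_small by (rule small_image)
qed

lemma y_PSh: "X \<in> fics ==> y X \<in> Obj S.PSh"
 using S.yob_PSh[OF inj_code, of X] code_Hom_U by simp

lemma y_ob: "Z \<in> fics ==> on_ob (y X) Z = code ` Hom \<C> Z X"
 using S.on_ob_yob[OF inj_code, of Z X] by simp

lemma y_res: "X \<in> fics ==> W \<in> fics ==> Z \<in> fics ==> g \<in> Hom \<C> W Z ==> f \<in> Hom \<C> Z X ==>
  S.res (y X) g (code f) = code (Cmp \<C> f g)"
 using S.res_yob[OF inj_code, of X W Z g f] by simp

lemma code_eqD: "X \<in> fics ==> Y \<in> fics ==> f \<in> Hom \<C> X Y ==> g \<in> Hom \<C> X Y ==> code f = code g ==> f = g"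
 by (rule inj_onD[OF inj_code]) (auto intro!: arrowsI[of X \<C> Y])

text \<open>The topology is subcanonical. The family is glued from its values \<open>d k\<close> on
  one cover contained in the sieve; as the other arrows of the sieve need not factor through that
  cover, the result is then checked on each of them (\<open>glue\<close>).\<close>

lemma y_sheaf:
 assumes X: "X \<in> fics"
 shows "is_sheaf \<C> (\<J>) (y X)"
 unfolding is_sheaf_def Obj_C
proof (intro ballI allI impI)
 fix Z S x assume Z: "Z \<in> fics" and S: "S \<in> \<J> Z" and m: "matching_family \<C> (y X) Z S x"
 have sv: "is_sieve \<C> Z S" using S by (rule J_sieve)
 obtain K Y \<theta> where cov: "cover Z K Y \<theta>" and KS: "\<And>k. k \<in> K ==> arr (Y k) Z (\<theta> k) \<in> S" using S by (rule JE) blast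
 note Y = coverD(1)[OF cov] and \<theta> = coverD(2)[OF cov]
 have val: "\<exists>\<delta>. fnl V X \<delta> \<and> x (arr V Z \<eta>) = code (arr V X \<delta>)" if "V \<in> fics" "fnl V Z \<eta>" "arr V Z \<eta> \<in> S" for V \<eta>
 proof -
  have "x (arr V Z \<eta>) \<in> on_ob (y X) V" using m that Hom_C_I[OF that(2)] by (auto simp: matching_family_def)
  then have "x (arr V Z \<eta>) \<in> code ` Hom \<C> V X" by (simp add: y_ob[OF that(1)])
  then obtain g where g: "g \<in> Hom \<C> V X" "x (arr V Z \<eta>) = code g" by blast
  obtain \<delta> where "g = arr V X \<delta>" "fnl V X \<delta>" using g(1) by (rule HomE)
  then show ?thesis using g(2) by blast
 qed
 have mat: "S.res (y X) (arr W V \<xi>) (x (arr V Z \<eta>)) = x (Cmp \<C> (arr V Z \<eta>) (arr W V \<xi>))"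
  if "V \<in> fics" "W \<in> fics" "fnl V Z \<eta>" "arr V Z \<eta> \<in> S" "fnl W V \<xi>" for V W \<eta> \<xi>
  using m that Hom_C_I[OF that(3)] Hom_C_I[OF that(5)] by (auto simp: matching_family_def)
 have "\<forall>k\<in>K. \<exists>\<delta>. fnl (Y k) X \<delta> \<and> x (arr (Y k) Z (\<theta> k)) = code (arr (Y k) X \<delta>)"
  using val[OF Y \<theta> KS] by blast
 from bchoice[OF this] obtain d where
  d: "\<And>k. k \<in> K ==> fnl (Y k) X (d k)" "\<And>k. k \<in> K ==> x (arr (Y k) Z (\<theta> k)) = code (arr (Y k) X (d k))" by blast
 \<comment> \<open>An arbitrary arrow of the sieve is compared with the member \<open>k\<close> of
   the cover on the pullback \<open>P\<close>, where matching gives that \<open>p\<close> followed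
   by \<delta> equals \<open>q\<close> followed by \<open>d k\<close>. Single-valuedness of
   \<open>p\<close> then yields the inclusion.\<close>
 have compat: "EV N. arel N V Z \<eta> O (arel N (Y k) Z (\<theta> k))\<inverse> O arel N (Y k) X (d k) \<subseteq> arel N V X \<delta>"
  if V: "V \<in> fics" and \<eta>: "fnl V Z \<eta>" and \<eta>S: "arr V Z \<eta> \<in> S" and \<delta>: "fnl V X \<delta>" and x: "x (arr V Z \<eta>) = code (arr V X \<delta>)"
   and k: "k \<in> K" for V \<eta> \<delta> k
 proof -
  obtain P p q where P: "P \<in> fics" and p: "fnl P V p" and q: "fnl P (Y k) q"
   and eq: "Cmp \<C> (arr V Z \<eta>) (arr P V p) = Cmp \<C> (arr (Y k) Z (\<theta> k)) (arr P (Y k) q)"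
   and ev: "EV N. arel N V Z \<eta> O (arel N (Y k) Z (\<theta> k))\<inverse> \<subseteq> (arel N P V p)\<inverse> O arel N P (Y k) q"
   by (rule pullback[OF V Y[OF k] Z \<eta> \<theta>[OF k]])
  have "code (Cmp \<C> (arr V X \<delta>) (arr P V p)) = S.res (y X) (arr P V p) (x (arr V Z \<eta>))"
   unfolding x by (rule y_res[OF X P V Hom_C_I[OF p] Hom_C_I[OF \<delta>], symmetric])
  also have "\<dots> = S.res (y X) (arr P (Y k) q) (x (arr (Y k) Z (\<theta> k)))"
   unfolding mat[OF V P \<eta> \<eta>S p] mat[OF Y[OF k] P \<theta>[OF k] KS[OF k] q] eq ..
  also have "\<dots> = code (Cmp \<C> (arr (Y k) X (d k)) (arr P (Y k) q))"
   unfolding d(2)[OF k] by (rule y_res[OF X P Y[OF k] Hom_C_I[OF q] Hom_C_I[OF d(1)[OF k]]])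
  finally have "code (arr P X (comp_form (fst P) (fst V) p \<delta>)) = code (arr P X (comp_form (fst P) (fst (Y k)) q (d k)))"
   unfolding Cmp_arr[OF P V X p \<delta>] Cmp_arr[OF P Y[OF k] X q d(1)[OF k]] .
  from code_eqD[OF P X Hom_C_I[OF fnl_comp[OF P V X p \<delta>]] Hom_C_I[OF fnl_comp[OF P Y[OF k] X q d(1)[OF k]]] this]
  have "EV N. arel N P V p O arel N V X \<delta> = arel N P (Y k) q O arel N (Y k) X (d k)"
   unfolding arr_eq_iff[OF P X fnl_comp[OF P V X p \<delta>] fnl_comp[OF P Y[OF k] X q d(1)[OF k]]]
    arel_comp_form[OF P V X p \<delta>] arel_comp_form[OF P Y[OF k] X q d(1)[OF k]] .
  then show ?thesis using ev fnl_eventually[OF P V p]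
  proof eventually_elim
   case (elim N)
   have "(arel N P V p)\<inverse> O arel N P V p \<subseteq> Id" using elim(3) by (auto simp: fun_rel_def single_valued_def)
   then have *: "((arel N P V p)\<inverse> O arel N P V p) O arel N V X \<delta> \<subseteq> Id O arel N V X \<delta>" by (rule relcomp_mono) simp
   have "(arel N V Z \<eta> O (arel N (Y k) Z (\<theta> k))\<inverse>) O arel N (Y k) X (d k) \<subseteq>
     ((arel N P V p)\<inverse> O arel N P (Y k) q) O arel N (Y k) X (d k)"
    using elim(2) by (rule relcomp_mono) simp
   also have "\<dots> = ((arel N P V p)\<inverse> O arel N P V p) O arel N V X \<delta>" using elim(1) by (simp add: O_assoc)
   finally show ?case using * by (simp add: O_assoc)
  qed
 qed
 obtain \<gamma> where \<gamma>: "fnl Z X \<gamma>"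
  and r\<gamma>: "\<And>N :: ('s, 'f, 'r, 'f trm set) interp. rel N (fst Z) (fst X) \<gamma> = (\<Union>k\<in>K. (arel N (Y k) Z (\<theta> k))\<inverse> O arel N (Y k) X (d k))"
 proof (rule cover_glue[OF Z X cov d(1)])
  show "EV N. arel N (Y k) Z (\<theta> k) O (arel N (Y l) Z (\<theta> l))\<inverse> O arel N (Y l) X (d l) \<subseteq> arel N (Y k) X (d k)"
   if "k \<in> K" "l \<in> K" for k l
   by (rule compat[OF Y \<theta> KS d(1) d(2)]) (rule that)+
 qed (assumption | rule that)+
 have glue: "Cmp \<C> (arr Z X \<gamma>) (arr V Z \<eta>) = arr V X \<delta>"
  if V: "V \<in> fics" and \<eta>: "fnl V Z \<eta>" and \<eta>S: "arr V Z \<eta> \<in> S" and \<delta>: "fnl V X \<delta>" and x: "x (arr V Z \<eta>) = code (arr V X \<delta>)"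
  for V \<eta> \<delta>
  unfolding Cmp_arr[OF V Z X \<eta> \<gamma>]
 proof (rule arr_eqI[OF V X fnl_comp[OF V Z X \<eta> \<gamma>] \<delta>])
  note wc = wf_conv_form[OF fnl_wf[OF Y Z \<theta>]]
  define H where "H k = comp_form (fst V) (fst Z) \<eta> (comp_form (fst Z) (fst (Y k)) (conv_form (fst (Y k)) (fst Z) (\<theta> k)) (d k))" for k
  have w1: "wff (comp_form (fst Z) (fst (Y k)) (conv_form (fst (Y k)) (fst Z) (\<theta> k)) (d k)) (fst Z @ fst X)" if "k \<in> K" for k
   by (rule wf_comp[OF Y wc fnl_wf[OF Y X d(1)]]) (rule that)+
  have wH: "wff (H k) (fst V @ fst X)" if "k \<in> K" for k
   unfolding H_def by (rule wf_comp[OF Z fnl_wf[OF V Z \<eta>] w1[OF that]])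
  have rH: "rel N (fst V) (fst X) (H k) = arel N V Z \<eta> O (arel N (Y k) Z (\<theta> k))\<inverse> O arel N (Y k) X (d k)"
   if "k \<in> K" for k and N :: "('s, 'f, 'r, 'f trm set) interp"
   unfolding H_def rel_comp_form[OF fnl_wf[OF V Z \<eta>] w1[OF that]]
    rel_comp_form[OF wc[OF that that] fnl_wf[OF Y[OF that] X d(1)[OF that]]] rel_conv_form[OF fnl_wf[OF Y Z \<theta>, OF that that]] ..
  show "EV N. arel N V X (comp_form (fst V) (fst Z) \<eta> \<gamma>) \<subseteq> arel N V X \<delta>"
  proof (rule rel_split[OF sorts2[OF V X] fnl_wf[OF V X fnl_comp[OF V Z X \<eta> \<gamma>]] fnl_wf[OF V X \<delta>] wH])
   have "arel N V X (comp_form (fst V) (fst Z) \<eta> \<gamma>) \<subseteq> (\<Union>k\<in>K. rel N (fst V) (fst X) (H k))" for N :: "('s, 'f, 'r, 'f trm set) interp"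
    unfolding arel_comp_form[OF V Z X \<eta> \<gamma>] r\<gamma> using rH[of _ N] by (simp add: relcomp_UNION_distrib)
   then show "EV N. arel N V X (comp_form (fst V) (fst Z) \<eta> \<gamma>) \<subseteq> (\<Union>k\<in>K. rel N (fst V) (fst X) (H k))" by simp
   show "EV N. rel N (fst V) (fst X) (H k) \<subseteq> arel N V X \<delta>" if k: "k \<in> K" for k
    unfolding rH[OF k] by (rule compat[OF V \<eta> \<eta>S \<delta> x k])
  qed
 qed
 have r: "S.res (y X) f (code (arr Z X \<gamma>)) = x f" if "f \<in> S" for f
 proof -
  from sv that obtain V \<eta> where V: "V \<in> fics" "f = arr V Z \<eta>" "fnl V Z \<eta>" "f \<in> Hom \<C> V Z" by (rule sieveE)
  from val[OF V(1,3)] that V(2) obtain \<delta> where \<delta>: "fnl V X \<delta>" "x f = code (arr V X \<delta>)" by blast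
  show ?thesis using y_res[OF X V(1) Z V(4) Hom_C_I[OF \<gamma>]] glue[OF V(1,3) _ \<delta>(1)] V(2) \<delta>(2) that by simp
 qed
 show "\<exists>!u. u \<in> on_ob (y X) Z \<and> (\<forall>f\<in>S. S.res (y X) f u = x f)"
 proof (rule ex1I[of _ "code (arr Z X \<gamma>)"])
  show "code (arr Z X \<gamma>) \<in> on_ob (y X) Z \<and> (\<forall>f\<in>S. S.res (y X) f (code (arr Z X \<gamma>)) = x f)"
   using r Hom_C_I[OF \<gamma>] by (simp add: y_ob[OF Z])
  fix u assume u: "u \<in> on_ob (y X) Z \<and> (\<forall>f\<in>S. S.res (y X) f u = x f)"
  then obtain g where g: "g \<in> Hom \<C> Z X" "u = code g" by (auto simp: y_ob[OF Z])
  obtain \<gamma>' where "g = arr Z X \<gamma>'" "fnl Z X \<gamma>'" using g(1) by (rule HomE)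
  with g have \<gamma>': "u = code (arr Z X \<gamma>')" "fnl Z X \<gamma>'" by auto
  have "arr Z X \<gamma>' = arr Z X \<gamma>"
  proof (rule cover_sep[OF Z X cov \<gamma>'(2) \<gamma>])
   fix k assume k: "k \<in> K"
   note Yk = Y[OF k] and \<theta>k = \<theta>[OF k]
   have "code (Cmp \<C> (arr Z X \<gamma>') (arr (Y k) Z (\<theta> k))) = x (arr (Y k) Z (\<theta> k))"
    using y_res[OF X Yk Z Hom_C_I[OF \<theta>k] Hom_C_I[OF \<gamma>'(2)]] u KS[OF k] \<gamma>'(1) by simp
   also have "\<dots> = code (Cmp \<C> (arr Z X \<gamma>) (arr (Y k) Z (\<theta> k)))"
    using y_res[OF X Yk Z Hom_C_I[OF \<theta>k] Hom_C_I[OF \<gamma>]] r[OF KS[OF k]] by simp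
   finally show "Cmp \<C> (arr Z X \<gamma>') (arr (Y k) Z (\<theta> k)) = Cmp \<C> (arr Z X \<gamma>) (arr (Y k) Z (\<theta> k))"
    by (intro code_eqD[OF Yk X]) (auto intro!: S.Cmp[of "Y k" Z X] Hom_C_I simp: Yk Z X \<theta>k \<gamma> \<gamma>'(2))
  qed
  then show "u = code (arr Z X \<gamma>)" using \<gamma>' by simp
 qed
qed

lemma y_Sh: "X \<in> fics ==> y X \<in> Obj S.Sh"
 by (simp add: S.Sh_Obj y_PSh y_sheaf)

definition ter :: "(('s, 'f, 'r, 'i) fic, ('s, 'f, 'r, 'i) syn_arrow, 'u) presheaf" where
 "ter = mkpsh \<C> (\<lambda>_. {undefined}) (\<lambda>_ s. s)"

lemma singleton_U: "{a} \<in> \<U>"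
proof -
 obtain A where A: "A \<in> \<U>" "A \<noteq> {}" using univ by (auto simp: set_universe_def lepoll_def)
 then obtain b where "b \<in> A" by blast
 then have "{a} \<lesssim> A" unfolding lepoll_def by (intro exI[of _ "\<lambda>_. b"]) auto
 with A(1) show ?thesis by (rule U_lepoll)
qed

lemma ter_ob: "Z \<in> fics ==> on_ob ter Z = {undefined}"
 using S.on_ob_mkpsh[of Z] by (simp add: ter_def)

lemma ter_PSh: "ter \<in> Obj S.PSh"
 unfolding ter_def by (rule S.mkpsh_PSh) (auto simp: singleton_U)

lemma ter_res: "W \<in> fics ==> Z \<in> fics ==> g \<in> Hom \<C> W Z ==> s \<in> on_ob ter Z ==> S.res ter g s = undefined"
 using S.res_in[OF ter_PSh, of W Z g s] by (simp add: ter_ob)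

lemma ter_sheaf: "is_sheaf \<C> (\<J>) ter"
 unfolding is_sheaf_def Obj_C
proof (intro ballI allI impI)
 fix Z S x assume Z: "Z \<in> fics" and S: "S \<in> \<J> Z" and m: "matching_family \<C> ter Z S x"
 have "S.res ter f undefined = x f" if f: "f \<in> S" for f
 proof -
  obtain V \<eta> where V: "V \<in> fics" "f = arr V Z \<eta>" "fnl V Z \<eta>" "f \<in> Hom \<C> V Z" using J_sieve[OF S] f by (rule sieveE)
  then have "x f \<in> on_ob ter V" using m f by (auto simp: matching_family_def)
  then show ?thesis using ter_res[OF V(1) Z V(4)] V(1) Z by (simp add: ter_ob)
 qed
 then show "\<exists>!u. u \<in> on_ob ter Z \<and> (\<forall>f\<in>S. S.res ter f u = x f)" by (auto simp: ter_ob[OF Z])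
qed

lemma ter_Sh: "ter \<in> Obj S.Sh"
 by (simp add: S.Sh_Obj ter_PSh ter_sheaf)

lemma ter_terminal: "is_terminal S.Sh ter"
 unfolding is_terminal_def S.Sh_simps
proof (intro conjI ter_Sh ballI)
 fix P assume "P \<in> Obj S.Sh"
 then have P: "P \<in> Obj S.PSh" by (simp add: S.Sh_Obj)
 show "\<exists>!f. f \<in> Hom S.PSh P ter"
 proof (rule ex1I)
  show "mkmap \<C> P ter (\<lambda>_ _. undefined) \<in> Hom S.PSh P ter"
   by (rule S.mkmap_Hom[OF P ter_PSh]) (auto simp: ter_ob ter_res)
  then show "f = mkmap \<C> P ter (\<lambda>_ _. undefined)" if "f \<in> Hom S.PSh P ter" for f
   using that S.tapp_in[OF that] by (intro S.PSh_Hom_eqI[OF that]) (auto simp: ter_ob S.tapp_mkmap)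
 qed
qed

text \<open>Cuts out of the terminal sheaf the subterminal sheaf of the sentence \<phi>, which has a
  section exactly over those \<open>Z\<close> that prove \<phi>.\<close>

definition holds :: "('s, 'f, 'r, 'i) form => ('s, 'f, 'r, 'i) fic => 'u => bool" where
 "holds \<phi> Z s \<longleftrightarrow> pv (fst Z) (snd Z) \<phi>"

abbreviation "sentence_sheaf \<phi> \<equiv> S.subpsh ter (holds \<phi>)"

lemma holds_stable:
 assumes "([], \<phi>) \<in> fics" "W \<in> Obj \<C>" "Z \<in> Obj \<C>" "g \<in> Hom \<C> W Z" "s \<in> on_ob ter Z" "holds \<phi> Z s"
 shows "holds \<phi> W (S.res ter g s)"
 using sentence_stable[OF assms(1), of W Z g] assms by (simp add: holds_def)

lemma sentence_sheaf_Sh: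
 assumes "([], \<phi>) \<in> fics"
 shows "sentence_sheaf \<phi> \<in> Obj S.Sh"
 by (rule S.subpsh_Sh[where R = "holds \<phi>", OF ter_PSh holds_stable[OF assms] ter_sheaf J_sieve])
  (use assms in \<open>auto simp: holds_def intro: sentence_local\<close>)

text \<open>An initial sheaf maps to the subterminal sheaf of \<open>Falsum\<close>, which has
  sections over provably empty objects only. No explicit construction of the initial sheaf is
  involved.\<close>

lemma initial_empty:
 assumes "is_initial S.Sh P" "Z \<in> fics" "s \<in> on_ob P Z"
 shows "pv (fst Z) (snd Z) Falsum"
proof -
 have "([], Falsum) \<in> fics" by (simp add: fic_iff)
 then have "sentence_sheaf Falsum \<in> Obj S.Sh" by (rule sentence_sheaf_Sh)
 then obtain f where "f \<in> Hom S.PSh P (sentence_sheaf Falsum)"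
  using assms(1) unfolding is_initial_def S.Sh_simps by blast
 from S.tapp_in[OF this _ assms(3)] assms(2) show ?thesis by (simp add: S.on_ob_subpsh holds_def)
qed

end

section \<open>Complete formulae from atoms, decided sentences from two-valuedness\<close>

context syntactic_site
begin

text \<open>The sections of \<open>y X\<close> that come from atoms locally form a subsheaf
  \<open>?U\<close> through which the coproduct cocone factors. By the universal property the
  identity of \<open>y X\<close> factors through \<open>?U\<close> as well, so the generic section
  \<open>code (Idn \<C> X)\<close> lies in it; unfolded, this is a cover of \<open>X\<close> by
  arrows that come from atoms.\<close>

lemma atom_cover:
 assumes at: "atomic_topos S.Sh" and X: "X \<in> fics"
 obtains K Y \<theta> where "cover X K Y \<theta>"
  "\<And>k. k \<in> K ==> \<exists>A \<kappa> a. is_atom S.Sh A \<and> \<kappa> \<in> Hom S.PSh A (y X) \<and> a \<in> on_ob A (Y k) \<and>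
   tapp \<kappa> (Y k) a = code (arr (Y k) X (\<theta> k))"
proof -
 interpret Sh: cat S.Sh using S.is_category_Sh by unfold_locales
 interpret PSh: cat S.PSh using S.is_category_PSh by unfold_locales
 obtain K where K: "is_coproduct_cocone S.Sh (y X) {A. is_atom S.Sh A} K"
  using at y_Sh[OF X] by (auto simp: atomic_topos_def)
 have atom_Sh: "A \<in> Obj S.Sh" if "is_atom S.Sh A" for A
  using that by (simp add: is_atom_def two_subobjects_def)
 have atom_PSh: "A \<in> Obj S.PSh" if "is_atom S.Sh A" for A
  using atom_Sh[OF that] by (simp add: S.Sh_Obj)
 define inK where "inK f V \<longleftrightarrow> (\<exists>A \<kappa> a. is_atom S.Sh A \<and> \<kappa> \<in> K \<and> \<kappa> \<in> Hom S.PSh A (y X) \<and> a \<in> on_ob A V \<and> tapp \<kappa> V a = code f)" for f V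
 have inK_comp: "inK (Cmp \<C> f g) W" if "inK f V" "V \<in> fics" "W \<in> fics" "f \<in> Hom \<C> V X" "g \<in> Hom \<C> W V" for f g V W
 proof -
  from that(1) obtain A \<kappa> a where A: "is_atom S.Sh A" "\<kappa> \<in> K" "\<kappa> \<in> Hom S.PSh A (y X)" "a \<in> on_ob A V" "tapp \<kappa> V a = code f"
   by (auto simp: inK_def)
  have "S.res A g a \<in> on_ob A W" using S.res_in[OF atom_PSh[OF A(1)], of W V g a] that A(4) by simp
  moreover have "tapp \<kappa> W (S.res A g a) = code (Cmp \<C> f g)"
   using S.tapp_natural[OF A(3) atom_PSh[OF A(1)] y_PSh[OF X], of W V g a] that A(4,5) y_res[OF X that(3,2,5,4)] by simp
  ultimately show ?thesis using A unfolding inK_def by blast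
 qed
 \<comment> \<open>The closure of \<open>inK\<close> under covers, without which the predicate need
   not define a sheaf.\<close>
 define R where "R Z u \<longleftrightarrow> (\<exists>f\<in>Hom \<C> Z X. u = code f \<and>
  (\<exists>L Y \<theta>. cover Z L Y \<theta> \<and> (\<forall>l\<in>L. inK (Cmp \<C> f (arr (Y l) Z (\<theta> l))) (Y l))))" for Z u
 have stable: "R W (S.res (y X) g u)"
  if "W \<in> Obj \<C>" "Z \<in> Obj \<C>" and g: "g \<in> Hom \<C> W Z" and "u \<in> on_ob (y X) Z" and Ru: "R Z u" for W Z g u
 proof -
  have W: "W \<in> fics" and Z: "Z \<in> fics" using that by simp_all
  from Ru obtain f L Y \<theta> where f: "f \<in> Hom \<C> Z X" "u = code f" and cov: "cover Z L Y \<theta>"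
   and inK: "\<forall>l\<in>L. inK (Cmp \<C> f (arr (Y l) Z (\<theta> l))) (Y l)" by (auto simp: R_def)
  note Y = coverD(1)[OF cov] and \<theta> = coverD(2)[OF cov]
  obtain \<eta> where \<eta>: "g = arr W Z \<eta>" "fnl W Z \<eta>" using g by (rule HomE)
  obtain P p q where P: "cover W L P p" and eq: "\<And>l. l \<in> L ==> fnl (P l) (Y l) (q l) \<and>
   Cmp \<C> (arr W Z \<eta>) (arr (P l) W (p l)) = Cmp \<C> (arr (Y l) Z (\<theta> l)) (arr (P l) (Y l) (q l))"
   by (rule cover_pullback[OF Z W cov \<eta>(2)]) (rule that)
  have fg: "Cmp \<C> f g \<in> Hom \<C> W X" using S.Cmp[of W Z X g f] W Z X f g by simp
  have "inK (Cmp \<C> (Cmp \<C> f g) (arr (P l) W (p l))) (P l)" if l: "l \<in> L" for l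
  proof -
   have Pl: "P l \<in> fics" "arr (P l) W (p l) \<in> Hom \<C> (P l) W" "arr (P l) (Y l) (q l) \<in> Hom \<C> (P l) (Y l)"
    "arr (Y l) Z (\<theta> l) \<in> Hom \<C> (Y l) Z"
    using coverD[OF P l] eq[OF l] \<theta>[OF l] by (auto intro: Hom_C_I)
   have "Cmp \<C> (Cmp \<C> f g) (arr (P l) W (p l)) = Cmp \<C> f (Cmp \<C> g (arr (P l) W (p l)))"
    using S.assoc[of "P l" W Z X "arr (P l) W (p l)" g f] Pl W Z X g f by simp
   also have "\<dots> = Cmp \<C> f (Cmp \<C> (arr (Y l) Z (\<theta> l)) (arr (P l) (Y l) (q l)))"
    using eq[OF l] \<eta>(1) by simp
   also have "\<dots> = Cmp \<C> (Cmp \<C> f (arr (Y l) Z (\<theta> l))) (arr (P l) (Y l) (q l))"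
    using S.assoc[of "P l" "Y l" Z X "arr (P l) (Y l) (q l)" "arr (Y l) Z (\<theta> l)" f] Pl Y[OF l] Z X f by simp
   finally show ?thesis
    using inK_comp[of "Cmp \<C> f (arr (Y l) Z (\<theta> l))" "Y l" "P l" "arr (P l) (Y l) (q l)"] inK l Pl Y[OF l]
     S.Cmp[of "Y l" Z X "arr (Y l) Z (\<theta> l)" f] Z X f by simp
  qed
  moreover have "S.res (y X) g u = code (Cmp \<C> f g)" using y_res[OF X W Z g f(1)] f(2) by simp
  ultimately show ?thesis unfolding R_def using fg P by blast
 qed
 \<comment> \<open>Covers of the members of a cover combine to a cover, by
   \<open>cover_trans\<close>.\<close>
 have loc: "R Z u" if "Z \<in> Obj \<C>" and S: "S \<in> \<J> Z" and u: "u \<in> on_ob (y X) Z"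
  and loc: "\<And>Y f. Y \<in> Obj \<C> ==> f \<in> S ==> f \<in> Hom \<C> Y Z ==> R Y (S.res (y X) f u)" for Z S u
 proof -
  have Z: "Z \<in> fics" using that by simp
  obtain L Y \<theta> where cov: "cover Z L Y \<theta>" and LS: "\<And>l. l \<in> L ==> arr (Y l) Z (\<theta> l) \<in> S" using S by (rule JE) blast
  note Y = coverD(1)[OF cov] and \<theta> = coverD(2)[OF cov]
  from u obtain f where f: "f \<in> Hom \<C> Z X" "u = code f" by (auto simp: y_ob[OF Z])
  have "\<exists>L' Y' \<theta>'. cover (Y l) L' Y' \<theta>' \<and> (\<forall>m\<in>L'. inK (Cmp \<C> (Cmp \<C> f (arr (Y l) Z (\<theta> l))) (arr (Y' m) (Y l) (\<theta>' m))) (Y' m))"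
   if l: "l \<in> L" for l
  proof -
   have h: "arr (Y l) Z (\<theta> l) \<in> Hom \<C> (Y l) Z" using \<theta>[OF l] by (rule Hom_C_I)
   have fh: "Cmp \<C> f (arr (Y l) Z (\<theta> l)) \<in> Hom \<C> (Y l) X" using S.Cmp[of "Y l" Z X] Y[OF l] Z X h f by simp
   have "R (Y l) (code (Cmp \<C> f (arr (Y l) Z (\<theta> l))))"
    using loc[of "Y l", OF _ LS[OF l] h] Y[OF l] y_res[OF X Y[OF l] Z h f(1)] f(2) by simp
   then obtain f' where f': "f' \<in> Hom \<C> (Y l) X" "code (Cmp \<C> f (arr (Y l) Z (\<theta> l))) = code f'"
    "\<exists>L' Y' \<theta>'. cover (Y l) L' Y' \<theta>' \<and> (\<forall>m\<in>L'. inK (Cmp \<C> f' (arr (Y' m) (Y l) (\<theta>' m))) (Y' m))"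
    unfolding R_def by blast
   have "Cmp \<C> f (arr (Y l) Z (\<theta> l)) = f'" by (rule code_eqD[OF Y[OF l] X fh f'(1,2)])
   with f'(3) show ?thesis by simp
  qed
  then have "\<forall>l\<in>L. \<exists>L' Y' \<theta>'. cover (Y l) L' Y' \<theta>' \<and> (\<forall>m\<in>L'. inK (Cmp \<C> (Cmp \<C> f (arr (Y l) Z (\<theta> l))) (arr (Y' m) (Y l) (\<theta>' m))) (Y' m))" by blast
  from bchoice[OF this] obtain L' where "\<forall>l\<in>L. \<exists>Y' \<theta>'. cover (Y l) (L' l) Y' \<theta>' \<and> (\<forall>m\<in>L' l. inK (Cmp \<C> (Cmp \<C> f (arr (Y l) Z (\<theta> l))) (arr (Y' m) (Y l) (\<theta>' m))) (Y' m))" ..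
  from bchoice[OF this] obtain Y' where "\<forall>l\<in>L. \<exists>\<theta>'. cover (Y l) (L' l) (Y' l) \<theta>' \<and> (\<forall>m\<in>L' l. inK (Cmp \<C> (Cmp \<C> f (arr (Y l) Z (\<theta> l))) (arr (Y' l m) (Y l) (\<theta>' m))) (Y' l m))" ..
  from bchoice[OF this] obtain \<theta>' where *: "\<forall>l\<in>L. cover (Y l) (L' l) (Y' l) (\<theta>' l) \<and> (\<forall>m\<in>L' l. inK (Cmp \<C> (Cmp \<C> f (arr (Y l) Z (\<theta> l))) (arr (Y' l m) (Y l) (\<theta>' l m))) (Y' l m))" ..
  then have cov': "\<And>l. l \<in> L ==> cover (Y l) (L' l) (Y' l) (\<theta>' l)" by blast
  obtain M V \<xi> where cov'': "cover Z M V \<xi>"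
   and M: "\<And>m. m \<in> M ==> \<exists>k\<in>L. \<exists>n\<in>L' k. V m = Y' k n \<and> \<xi> m = comp_form (fst (Y' k n)) (fst (Y k)) (\<theta>' k n) (\<theta> k)"
  proof (rule cover_trans[OF infinite_index Z cov])
   show "cover (Y l) (L' l) (Y' l) (\<theta>' l)" if "l \<in> L" for l by (rule cov'[OF that])
  qed (rule that)
  have "inK (Cmp \<C> f (arr (V m) Z (\<xi> m))) (V m)" if m: "m \<in> M" for m
  proof -
   from M[OF m] obtain k n where k: "k \<in> L" "n \<in> L' k" "V m = Y' k n" "\<xi> m = comp_form (fst (Y' k n)) (fst (Y k)) (\<theta>' k n) (\<theta> k)"
    by blast
   have Y': "Y' k n \<in> fics" "fnl (Y' k n) (Y k) (\<theta>' k n)" using coverD[OF cov'[OF k(1)] k(2)] by auto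
   have "Cmp \<C> f (arr (V m) Z (\<xi> m)) = Cmp \<C> f (Cmp \<C> (arr (Y k) Z (\<theta> k)) (arr (Y' k n) (Y k) (\<theta>' k n)))"
    unfolding k(3,4) Cmp_arr[OF Y'(1) Y[OF k(1)] Z Y'(2) \<theta>[OF k(1)]] ..
   also have "\<dots> = Cmp \<C> (Cmp \<C> f (arr (Y k) Z (\<theta> k))) (arr (Y' k n) (Y k) (\<theta>' k n))"
    using S.assoc[of "Y' k n" "Y k" Z X "arr (Y' k n) (Y k) (\<theta>' k n)" "arr (Y k) Z (\<theta> k)" f]
     Y' Y[OF k(1)] Z X f Hom_C_I[OF Y'(2)] Hom_C_I[OF \<theta>[OF k(1)]] by simp
   finally show ?thesis using * k by simp
  qed
  then show ?thesis unfolding R_def using f cov'' by blast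
 qed
 let ?U = "S.subpsh (y X) R" and ?i = "S.incl (y X) R"
 have U: "?U \<in> Obj S.Sh" by (rule S.subpsh_Sh[where R = R, OF y_PSh[OF X] stable y_sheaf[OF X] J_sieve loc])
 then have U': "?U \<in> Obj S.PSh" by (simp add: S.Sh_Obj)
 have i: "?i \<in> Hom S.PSh ?U (y X)" by (rule S.incl_Hom[where R = R, OF y_PSh[OF X] stable])
 have RK: "R Z (tapp \<kappa> Z a)" if A: "is_atom S.Sh A" and \<kappa>: "\<kappa> \<in> K" "\<kappa> \<in> Hom S.PSh A (y X)" and Z: "Z \<in> fics" and a: "a \<in> on_ob A Z" for A \<kappa> Z a
 proof -
  have "tapp \<kappa> Z a \<in> on_ob (y X) Z" using S.tapp_in[OF \<kappa>(2)] Z a by simp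
  then obtain f where f: "f \<in> Hom \<C> Z X" "tapp \<kappa> Z a = code f" by (auto simp: y_ob[OF Z])
  have "inK f Z" unfolding inK_def using A \<kappa> a f by blast
  moreover have "Cmp \<C> f (arr Z Z (id_form Z)) = f" using S.Cmp_Idn[of Z X f] Z X f by (simp add: Idn_C)
  moreover note cover_id[OF Z]
  ultimately show ?thesis unfolding R_def f(2) using f(1) by fastforce
 qed
 \<comment> \<open>The corestriction of \<kappa> to \<open>?U\<close>. Its domain is read off
   \<kappa> itself, since in \<open>is_coproduct_cocone\<close> the second cocone is a function of
   the arrow alone.\<close>
 define g where "g \<kappa> = mkmap \<C> (fst \<kappa>) ?U (tapp \<kappa>)" for \<kappa>
 have gH: "g \<kappa> \<in> Hom S.PSh A ?U" and gi: "Cmp S.PSh ?i (g \<kappa>) = \<kappa>"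
  if A: "is_atom S.Sh A" and \<kappa>: "\<kappa> \<in> K" "\<kappa> \<in> Hom S.PSh A (y X)" for A \<kappa>
 proof -
  have A': "A \<in> Obj S.PSh" by (rule atom_PSh[OF A])
  have fA: "fst \<kappa> = A" using \<kappa>(2) by (auto simp: S.PSh_Hom)
  have t: "tapp \<kappa> Z s \<in> on_ob (y X) Z" "R Z (tapp \<kappa> Z s)" if "Z \<in> Obj \<C>" "s \<in> on_ob A Z" for Z s
   using S.tapp_in[OF \<kappa>(2) that] RK[OF A \<kappa>, of Z s] that by auto
  show gH: "g \<kappa> \<in> Hom S.PSh A ?U" unfolding g_def fA
  proof (rule S.mkmap_Hom[OF A' U'])
   show "tapp \<kappa> Z s \<in> on_ob ?U Z" if "Z \<in> Obj \<C>" "s \<in> on_ob A Z" for Z s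
    using t[OF that] that by (simp add: S.on_ob_subpsh)
   show "tapp \<kappa> W (S.res A h s) = S.res ?U h (tapp \<kappa> Z s)"
    if "W \<in> Obj \<C>" "Z \<in> Obj \<C>" "h \<in> Hom \<C> W Z" "s \<in> on_ob A Z" for W Z h s
    using S.tapp_natural[OF \<kappa>(2) A' y_PSh[OF X] that] S.res_subpsh[of W Z h "tapp \<kappa> Z s" "y X" R, OF that(1-3) t[OF that(2,4)]] by simp
  qed
  show "Cmp S.PSh ?i (g \<kappa>) = \<kappa>"
  proof (rule S.PSh_Hom_eqI[OF PSh.Cmp[OF A' U' y_PSh[OF X] gH i] \<kappa>(2)])
   fix Z s assume Z: "Z \<in> Obj \<C>" "s \<in> on_ob A Z"
   have "tapp (g \<kappa>) Z s = tapp \<kappa> Z s" unfolding g_def fA by (rule S.tapp_mkmap[OF Z])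
   then show "tapp (Cmp S.PSh ?i (g \<kappa>)) Z s = tapp \<kappa> Z s"
    using S.tapp_Cmp[OF gH i Z] S.tapp_incl[where R = R, OF y_PSh[OF X] stable Z(1) t[OF Z]] by simp
  qed
 qed
 have coprod: "\<exists>!h. h \<in> Hom S.PSh (y X) Q \<and> (\<forall>k\<in>K. Cmp S.PSh h k = g' k)"
  if "Q \<in> Obj S.Sh" "\<And>A k. is_atom S.Sh A ==> k \<in> K ==> k \<in> Hom S.PSh A (y X) ==> g' k \<in> Hom S.PSh A Q" for Q g'
 proof -
  have "\<forall>Y\<in>Obj S.Sh. \<forall>g. (\<forall>A\<in>{A. is_atom S.Sh A}. \<forall>k\<in>K \<inter> Hom S.PSh A (y X). g k \<in> Hom S.PSh A Y) -->
   (\<exists>!h. h \<in> Hom S.PSh (y X) Y \<and> (\<forall>k\<in>K. Cmp S.PSh h k = g k))"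
   using K unfolding is_coproduct_cocone_def S.Sh_simps by blast
  from this[rule_format, of Q g'] show ?thesis using that by blast
 qed
 have Kat: "\<exists>A. is_atom S.Sh A \<and> k \<in> Hom S.PSh A (y X)" if "k \<in> K" for k
  using K that unfolding is_coproduct_cocone_def S.Sh_simps by blast
 obtain h where h: "h \<in> Hom S.PSh (y X) ?U" "\<And>k. k \<in> K ==> Cmp S.PSh h k = g k"
 proof -
  have "\<exists>!h. h \<in> Hom S.PSh (y X) ?U \<and> (\<forall>k\<in>K. Cmp S.PSh h k = g k)"
   by (rule coprod[OF U]) (rule gH)
  then show thesis using that by blast
 qed
 have ih: "Cmp S.PSh ?i h \<in> Hom S.PSh (y X) (y X)" by (rule PSh.Cmp[OF y_PSh[OF X] U' y_PSh[OF X] h(1) i])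
 have "Cmp S.PSh (Cmp S.PSh ?i h) k = k" if k: "k \<in> K" for k
 proof -
  obtain A where A: "is_atom S.Sh A" "k \<in> Hom S.PSh A (y X)" using Kat[OF k] by blast
  show ?thesis using PSh.assoc[OF atom_PSh[OF A(1)] y_PSh[OF X] U' y_PSh[OF X] A(2) h(1) i] h(2)[OF k] gi[OF A(1) k A(2)] by simp
 qed
 moreover have "Cmp S.PSh (Idn S.PSh (y X)) k = k" if k: "k \<in> K" for k
 proof -
  obtain A where A: "is_atom S.Sh A" "k \<in> Hom S.PSh A (y X)" using Kat[OF k] by blast
  show ?thesis by (rule PSh.Idn_Cmp[OF atom_PSh[OF A(1)] y_PSh[OF X] A(2)])
 qed
 \<comment> \<open>Both sides composed with any \<open>k\<close> in \<open>K\<close> give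
   \<open>k\<close>, so the uniqueness half of the universal property applies.\<close>
 ultimately have eq: "Cmp S.PSh ?i h = Idn S.PSh (y X)"
  using coprod[OF y_Sh[OF X], of "\<lambda>k. k"] ih PSh.Idn[OF y_PSh[OF X]] by blast
 let ?u = "code (Idn \<C> X)"
 have u: "?u \<in> on_ob (y X) X" using S.Idn[of X] X by (simp add: y_ob[OF X])
 have X': "X \<in> Obj \<C>" using X by simp
 have hu: "tapp h X ?u \<in> on_ob (y X) X" "R X (tapp h X ?u)"
  using S.tapp_in[OF h(1) X' u] by (simp_all add: S.on_ob_subpsh[OF X'])
 have "?u = tapp (Cmp S.PSh ?i h) X ?u" unfolding eq by (rule S.tapp_Idn[OF X' u, symmetric])
 also have "\<dots> = tapp h X ?u"
  using S.tapp_Cmp[OF h(1) i X' u] S.tapp_incl[where R = R, OF y_PSh[OF X] stable X' hu] by simp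
 finally have "R X ?u" using hu(2) by simp
 then obtain f L Y \<theta> where f: "f \<in> Hom \<C> X X" "?u = code f" and cov: "cover X L Y \<theta>"
  and inK: "\<forall>l\<in>L. inK (Cmp \<C> f (arr (Y l) X (\<theta> l))) (Y l)" by (auto simp: R_def)
 have "f = Idn \<C> X" using code_eqD[OF X X _ f(1) f(2)] S.Idn[of X] X by simp
 then have "inK (arr (Y l) X (\<theta> l)) (Y l)" if "l \<in> L" for l
  using inK that S.Idn_Cmp[of "Y l" X "arr (Y l) X (\<theta> l)"] coverD[OF cov that] X Hom_C_I by auto
 then show ?thesis using cov unfolding inK_def by (intro that[OF cov]) blast
qed

text \<open>The sections of \<open>A\<close> whose image in \<open>y X\<close> factors through
  \<psi> form a subsheaf of the atom \<open>A\<close>, which is all of \<open>A\<close> or initial.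
  In the first case the image of \<theta> lies in \<psi>; in the second the part of \<open>Y\<close>
  that \<theta> maps into \<psi> carries a section of an initial sheaf and is therefore
  empty.\<close>

lemma atom_dichotomy:
 assumes X: "X \<in> fics" and Y: "Y \<in> fics" and \<theta>: "fnl Y X \<theta>"
  and A: "is_atom S.Sh A" and \<kappa>: "\<kappa> \<in> Hom S.PSh A (y X)" and a: "a \<in> on_ob A Y" and \<kappa>a: "tapp \<kappa> Y a = code (arr Y X \<theta>)"
  and \<psi>: "(fst X, \<psi>) \<in> fics"
 shows "pv (fst X) (Exis (fst Y) \<theta>) \<psi> \<or> pv (fst X) (Conj (Exis (fst Y) \<theta>) \<psi>) Falsum"
proof -
 have ASh: "A \<in> Obj S.Sh" using A by (simp add: is_atom_def two_subobjects_def)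
 then have A': "A \<in> Obj S.PSh" and Asheaf: "is_sheaf \<C> (\<J>) A" by (simp_all add: S.Sh_Obj)
 define R where "R Z s \<longleftrightarrow> (\<exists>\<gamma>. fnl Z X \<gamma> \<and> tapp \<kappa> Z s = code (arr Z X \<gamma>) \<and>
  (EV N. Range (arel N Z X \<gamma>) \<subseteq> ext N (fst X, \<psi>)))" for Z s
 have stable: "R W (S.res A g s)" if "W \<in> Obj \<C>" "Z \<in> Obj \<C>" and g: "g \<in> Hom \<C> W Z" and s: "s \<in> on_ob A Z" and R: "R Z s" for W Z g s
 proof -
  have W: "W \<in> fics" and Z: "Z \<in> fics" using that by simp_all
  obtain \<gamma> where \<gamma>: "fnl Z X \<gamma>" "tapp \<kappa> Z s = code (arr Z X \<gamma>)"
   "EV N. Range (arel N Z X \<gamma>) \<subseteq> ext N (fst X, \<psi>)" using R by (auto simp: R_def)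
  obtain \<eta> where \<eta>: "g = arr W Z \<eta>" "fnl W Z \<eta>" using g by (rule HomE)
  have "tapp \<kappa> W (S.res A g s) = code (Cmp \<C> (arr Z X \<gamma>) g)"
   using S.tapp_natural[OF \<kappa> A' y_PSh[OF X] that(1,2) g s] \<gamma>(2) y_res[OF X W Z g Hom_C_I[OF \<gamma>(1)]] by simp
  also have "\<dots> = code (arr W X (comp_form (fst W) (fst Z) \<eta> \<gamma>))" unfolding \<eta>(1) Cmp_arr[OF W Z X \<eta>(2) \<gamma>(1)] ..
  finally have "tapp \<kappa> W (S.res A g s) = code (arr W X (comp_form (fst W) (fst Z) \<eta> \<gamma>))" .
  moreover have "EV N. Range (arel N W X (comp_form (fst W) (fst Z) \<eta> \<gamma>)) \<subseteq> ext N (fst X, \<psi>)"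
   using \<gamma>(3) by eventually_elim (auto simp: arel_comp_form[OF W Z X \<eta>(2) \<gamma>(1)])
  ultimately show ?thesis unfolding R_def using fnl_comp[OF W Z X \<eta>(2) \<gamma>(1)] by blast
 qed
 \<comment> \<open>The arrow named by \<open>s\<close> lands in \<psi> because its restrictions
   along a cover do; \<open>ext_split\<close> combines the pieces.\<close>
 have loc: "R Z s" if "Z \<in> Obj \<C>" and S: "S \<in> \<J> Z" and s: "s \<in> on_ob A Z"
  and loc: "\<And>V f. V \<in> Obj \<C> ==> f \<in> S ==> f \<in> Hom \<C> V Z ==> R V (S.res A f s)" for Z S s
 proof -
  have Z: "Z \<in> fics" using that by simp
  obtain L V \<xi> where cov: "cover Z L V \<xi>" and LS: "\<And>l. l \<in> L ==> arr (V l) Z (\<xi> l) \<in> S" using S by (rule JE) blast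
  note V = coverD(1)[OF cov] and \<xi> = coverD(2)[OF cov]
  have "tapp \<kappa> Z s \<in> on_ob (y X) Z" by (rule S.tapp_in[OF \<kappa> that(1) s])
  then obtain f where f: "f \<in> Hom \<C> Z X" "tapp \<kappa> Z s = code f" by (auto simp: y_ob[OF Z])
  obtain \<gamma> where \<gamma>: "f = arr Z X \<gamma>" "fnl Z X \<gamma>" using f(1) by (rule HomE)
  have ev: "EV N. Range (arel N (V l) Z (\<xi> l) O arel N Z X \<gamma>) \<subseteq> ext N (fst X, \<psi>)" if l: "l \<in> L" for l
  proof -
   note c = fnl_comp[OF V[OF l] Z X \<xi>[OF l] \<gamma>(2)]
   have "R (V l) (S.res A (arr (V l) Z (\<xi> l)) s)" by (rule loc) (use V[OF l] LS[OF l] Hom_C_I[OF \<xi>[OF l]] in auto)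
   then obtain \<delta> where \<delta>: "fnl (V l) X \<delta>" "tapp \<kappa> (V l) (S.res A (arr (V l) Z (\<xi> l)) s) = code (arr (V l) X \<delta>)"
    "EV N. Range (arel N (V l) X \<delta>) \<subseteq> ext N (fst X, \<psi>)" by (auto simp: R_def)
   have "code (arr (V l) X \<delta>) = code (Cmp \<C> (arr Z X \<gamma>) (arr (V l) Z (\<xi> l)))"
    using S.tapp_natural[OF \<kappa> A' y_PSh[OF X], of "V l" Z "arr (V l) Z (\<xi> l)" s] \<delta>(2) V[OF l] Z s Hom_C_I[OF \<xi>[OF l]]
     y_res[OF X V[OF l] Z Hom_C_I[OF \<xi>[OF l]] Hom_C_I[OF \<gamma>(2)]] f(2) \<gamma>(1) by simp
   then have "code (arr (V l) X \<delta>) = code (arr (V l) X (comp_form (fst (V l)) (fst Z) (\<xi> l) \<gamma>))"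
    unfolding Cmp_arr[OF V[OF l] Z X \<xi>[OF l] \<gamma>(2)] .
   then have "arr (V l) X \<delta> = arr (V l) X (comp_form (fst (V l)) (fst Z) (\<xi> l) \<gamma>)"
    by (rule code_eqD[OF V[OF l] X Hom_C_I[OF \<delta>(1)] Hom_C_I[OF c]])
   then have "EV N. arel N (V l) X \<delta> = arel N (V l) Z (\<xi> l) O arel N Z X \<gamma>"
    unfolding arr_eq_iff[OF V[OF l] X \<delta>(1) c] arel_comp_form[OF V[OF l] Z X \<xi>[OF l] \<gamma>(2)] .
   then show ?thesis using \<delta>(3) by eventually_elim simp
  qed
  have "pv (fst X) (Exis (fst Z) \<gamma>) \<psi>"
  proof (rule ext_split[OF _ \<psi>, of _ L "\<lambda>l. Exis (fst (V l)) (comp_form (fst (V l)) (fst Z) (\<xi> l) \<gamma>)"])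
   show "(fst X, Exis (fst Z) \<gamma>) \<in> fics" by (rule Exis_fics[OF X Z fnl_wf[OF Z X \<gamma>(2)]])
   show "(fst X, Exis (fst (V l)) (comp_form (fst (V l)) (fst Z) (\<xi> l) \<gamma>)) \<in> fics" if "l \<in> L" for l
    by (rule Exis_fics[OF X V[OF that] fnl_wf[OF V[OF that] X fnl_comp[OF V[OF that] Z X \<xi>[OF that] \<gamma>(2)]]])
   have e: "ext N (fst X, Exis (fst (V l)) (comp_form (fst (V l)) (fst Z) (\<xi> l) \<gamma>)) = Range (arel N (V l) Z (\<xi> l) O arel N Z X \<gamma>)"
    if "l \<in> L" for l and N :: "('s, 'f, 'r, 'f trm set) interp"
    unfolding ext_Exis arel_comp_form[OF V[OF that] Z X \<xi>[OF that] \<gamma>(2)] ..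
   show "EV N. ext N (fst X, Exis (fst (V l)) (comp_form (fst (V l)) (fst Z) (\<xi> l) \<gamma>)) \<subseteq> ext N (fst X, \<psi>)"
    if "l \<in> L" for l
    unfolding e[OF that] by (rule ev[OF that])
   show "EV N. ext N (fst X, Exis (fst Z) \<gamma>) \<subseteq> (\<Union>l\<in>L. ext N (fst X, Exis (fst (V l)) (comp_form (fst (V l)) (fst Z) (\<xi> l) \<gamma>)))"
    using cov[unfolded cover_iff[OF Z], THEN conjunct2] fnl_eventually[OF Z X \<gamma>(2)]
   proof eventually_elim
    case (elim N)
    show ?case
    proof
     fix x assume "x \<in> ext N (fst X, Exis (fst Z) \<gamma>)"
     then obtain z where z: "(z, x) \<in> arel N Z X \<gamma>" unfolding ext_Exis by blast
     then have "z \<in> ext N Z" using elim(2) by (auto simp: fun_rel_def)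
     then obtain l v where l: "l \<in> L" "(v, z) \<in> arel N (V l) Z (\<xi> l)" using elim(1) by blast
     then have "x \<in> ext N (fst X, Exis (fst (V l)) (comp_form (fst (V l)) (fst Z) (\<xi> l) \<gamma>))"
      unfolding e[OF l(1)] using z by blast
     with l(1) show "x \<in> (\<Union>l\<in>L. ext N (fst X, Exis (fst (V l)) (comp_form (fst (V l)) (fst Z) (\<xi> l) \<gamma>)))" by blast
    qed
   qed
  qed
  then have "EV N. Range (arel N Z X \<gamma>) \<subseteq> ext N (fst X, \<psi>)"
   using prv_ext_iff[OF Exis_fics[OF X Z fnl_wf[OF Z X \<gamma>(2)]] \<psi>] by (simp add: ext_Exis)
  then show ?thesis unfolding R_def using \<gamma> f(2) by blast
 qed
 let ?B = "S.subpsh A R"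
 have B: "?B \<in> Obj S.Sh" by (rule S.subpsh_Sh[where R = R, OF A' stable Asheaf J_sieve loc])
 have "is_mono S.Sh ?B A (S.incl A R)" by (rule S.incl_mono[where R = R, OF A' stable])
 then consider "is_initial S.Sh ?B" | "is_iso S.Sh ?B A (S.incl A R)"
  using A B unfolding is_atom_def two_subobjects_def by blast
 then show ?thesis
 proof cases
  case 2
  have "R Y a" by (rule S.incl_iso[where R = R, OF A' stable 2]) (use Y a in auto)
  then obtain \<gamma> where \<gamma>: "fnl Y X \<gamma>" "code (arr Y X \<theta>) = code (arr Y X \<gamma>)"
   "EV N. Range (arel N Y X \<gamma>) \<subseteq> ext N (fst X, \<psi>)" using \<kappa>a by (auto simp: R_def)
  have "arr Y X \<theta> = arr Y X \<gamma>" by (rule code_eqD[OF Y X Hom_C_I[OF \<theta>] Hom_C_I[OF \<gamma>(1)] \<gamma>(2)])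
  then have "EV N. arel N Y X \<theta> = arel N Y X \<gamma>" unfolding arr_eq_iff[OF Y X \<theta> \<gamma>(1)] .
  then have "EV N. Range (arel N Y X \<theta>) \<subseteq> ext N (fst X, \<psi>)" using \<gamma>(3) by eventually_elim simp
  then show ?thesis using prv_ext_iff[OF Exis_fics[OF X Y fnl_wf[OF Y X \<theta>]] \<psi>] by (simp add: ext_Exis)
 next
  case 1
  \<comment> \<open>This is \<open>\<exists>x. \<theta>(y,x) \<and> \<psi>(x)\<close>, the inverse
    image of \<psi> under \<theta>; the inner \<open>conv_form\<close> moves \<psi> into the context
    \<open>fst Y @ fst X\<close>.\<close>
  define \<zeta> where "\<zeta> = Exis (fst X) (conv_form (fst Y) (fst X) (Conj \<theta> (conv_form (fst X) (fst Y) \<psi>)))"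
  have w\<psi>: "wff \<psi> (fst X @ fst Y)" using \<psi> by (simp add: fic_iff wf_append)
  have w\<theta>: "wff (Conj \<theta> (conv_form (fst X) (fst Y) \<psi>)) (fst Y @ fst X)"
   using fnl_wf[OF Y X \<theta>] wf_conv_form[OF w\<psi>] by simp
  define Z where "Z = (fst Y, \<zeta>)"
  have Z: "Z \<in> fics" unfolding Z_def \<zeta>_def by (rule Exis_fics[OF Y X wf_conv_form[OF w\<theta>]])
  have extZ: "ext N Z = {y. \<exists>x. (y, x) \<in> arel N Y X \<theta> \<and> x \<in> ext N (fst X, \<psi>)}" for N :: "('s, 'f, 'r, 'f trm set) interp"
  proof -
   have 1: "(x, y) \<in> rel N (fst X) (fst Y) \<psi> \<longleftrightarrow> x \<in> ext N (fst X, \<psi>) \<and> y \<in> tuples N (fst Y)" for x y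
    using sat_append[of \<Sigma> \<psi> "fst X" x N y] \<psi> by (auto simp: rel_iff ext_iff fic_iff tuples_length)
   have 2: "y \<in> tuples N (fst Y)" if "(y, x) \<in> arel N Y X \<theta>" for y x using that by (simp add: rel_iff)
   have "ext N Z = Range ((arel N Y X \<theta> \<inter> (rel N (fst X) (fst Y) \<psi>)\<inverse>)\<inverse>)"
    unfolding Z_def \<zeta>_def ext_Exis rel_conv_form[OF w\<theta>] rel_Conj rel_conv_form[OF w\<psi>] ..
   then show ?thesis using 1 2 by blast
  qed
  let ?js = "[0..<length (fst Y)]"
  \<comment> \<open>The inclusion of \<open>Z\<close> into \<open>Y\<close>, written as the
    projection to all coordinates.\<close>
  define i where "i = proj_form (fst Y) \<zeta> ?js"
  have m: "map ((!) (fst Y)) ?js = fst Y" by (rule map_nth)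
  have js: "set ?js \<subseteq> {..<length (fst Y)}" by auto
  have w\<zeta>: "wff \<zeta> (fst Y)" using Z by (simp add: Z_def fic_iff)
  have wi: "wff i (fst Z @ fst Y)"
   using wf_proj_form[OF w\<zeta> js] unfolding m i_def by (simp add: Z_def)
  have ri: "arel N Z Y i = Id_on (ext N Z)" for N :: "('s, 'f, 'r, 'f trm set) interp"
  proof -
   have "arel N Z Y i = {(a, map ((!) a) ?js) | a. a \<in> ext N Z}"
    using rel_proj_form[OF w\<zeta> js, of N] unfolding m i_def by (simp add: Z_def)
   moreover have "map ((!) a) ?js = a" if "a \<in> ext N Z" for a
    using ext_length[OF that] map_nth[of a] by (simp add: Z_def)
   ultimately show ?thesis by (auto simp: Id_on_iff)
  qed
  have fi: "fnl Z Y i" unfolding prv_functional_iff[OF Z Y] ri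
  proof
   show "EV N. fun_rel (ext N Z) (ext N Y) (Id_on (ext N Z))"
    using fnl_eventually[OF Y X \<theta>] by eventually_elim (auto simp: fun_rel_def extZ single_valued_def)
  qed (rule wi)
  note c = fnl_comp[OF Z Y X fi \<theta>]
  have "R Z (S.res A (arr Z Y i) a)" unfolding R_def
  proof (intro exI conjI)
   show "fnl Z X (comp_form (fst Z) (fst Y) i \<theta>)" by (rule c)
   show "tapp \<kappa> Z (S.res A (arr Z Y i) a) = code (arr Z X (comp_form (fst Z) (fst Y) i \<theta>))"
    unfolding Cmp_arr[OF Z Y X fi \<theta>, symmetric]
    using S.tapp_natural[OF \<kappa> A' y_PSh[OF X], of Z Y "arr Z Y i" a] Z Y Hom_C_I[OF fi] a \<kappa>a
     y_res[OF X Z Y Hom_C_I[OF fi] Hom_C_I[OF \<theta>]] by simp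
   show "EV N. Range (arel N Z X (comp_form (fst Z) (fst Y) i \<theta>)) \<subseteq> ext N (fst X, \<psi>)"
    using fnl_eventually[OF Y X \<theta>]
    by eventually_elim (auto simp: arel_comp_form[OF Z Y X fi \<theta>] ri extZ fun_rel_def single_valued_def)
  qed
  moreover have "S.res A (arr Z Y i) a \<in> on_ob A Z"
   using S.res_in[OF A', of Z Y "arr Z Y i" a] Z Y Hom_C_I[OF fi] a by simp
  ultimately have "S.res A (arr Z Y i) a \<in> on_ob ?B Z" using Z by (simp add: S.on_ob_subpsh)
  from initial_empty[OF 1 Z this] have "EV N. ext N Z = {}"
   using prv_ext_iff[of "fst Z" "snd Z" Falsum] Z by (simp add: fic_iff fic_fst_snd ext_def)
  then have "EV N. ext N (fst X, Conj (Exis (fst Y) \<theta>) \<psi>) \<subseteq> ext N (fst X, Falsum :: ('s, 'f, 'r, 'i) form)"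
  proof eventually_elim
   case (elim N)
   have "False" if "x \<in> ext N (fst X, Conj (Exis (fst Y) \<theta>) \<psi>)" for x
   proof -
    from that have "x \<in> ext N (fst X, Exis (fst Y) \<theta>)" "x \<in> ext N (fst X, \<psi>)" by (auto simp: ext_iff)
    then show False using elim unfolding ext_Exis extZ by blast
   qed
   then show ?case by blast
  qed
  then show ?thesis
   using prv_ext_iff[of "fst X" "Conj (Exis (fst Y) \<theta>) \<psi>" Falsum] Exis_fics[OF X Y fnl_wf[OF Y X \<theta>]] \<psi>
   by (simp add: fic_iff)
 qed
qed

text \<open>The \<open>F k\<close> are the images of a cover by arrows that come from atoms; on such
  an image \<open>atom_dichotomy\<close> decides every \<psi>.\<close>

theorem complete_decomposition:
 assumes at: "atomic_topos S.Sh" and X: "X \<in> fics"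
 obtains K F where "\<And>k. k \<in> K ==> cfm (fst X, F k)" "\<And>k. k \<in> K ==> pv (fst X) (F k) (snd X)"
  "pv (fst X) (snd X) (Disj K F)"
proof -
 obtain K Y \<theta> where cov: "cover X K Y \<theta>"
  and K: "\<And>k. k \<in> K ==> \<exists>A \<kappa> a. is_atom S.Sh A \<and> \<kappa> \<in> Hom S.PSh A (y X) \<and> a \<in> on_ob A (Y k) \<and>
   tapp \<kappa> (Y k) a = code (arr (Y k) X (\<theta> k))" using at X by (rule atom_cover) blast
 note Y = coverD(1)[OF cov] and \<theta> = coverD(2)[OF cov]
 define F where "F k = Exis (fst (Y k)) (\<theta> k)" for k
 have F: "(fst X, F k) \<in> fics" if "k \<in> K" for k
  unfolding F_def by (rule Exis_fics[OF X Y[OF that] fnl_wf[OF Y[OF that] X \<theta>[OF that]]])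
 have dich: "pv (fst X) (F k) \<psi> \<or> pv (fst X) (Conj (F k) \<psi>) Falsum" if k: "k \<in> K" and \<psi>: "(fst X, \<psi>) \<in> fics" for k \<psi>
 proof -
  obtain A \<kappa> a where "is_atom S.Sh A" "\<kappa> \<in> Hom S.PSh A (y X)" "a \<in> on_ob A (Y k)" "tapp \<kappa> (Y k) a = code (arr (Y k) X (\<theta> k))"
   using K[OF k] by blast
  then show ?thesis unfolding F_def by (intro atom_dichotomy[OF X Y[OF k] \<theta>[OF k] _ _ _ _ \<psi>])
 qed
 have FX: "pv (fst X) (F k) (snd X)" if k: "k \<in> K" for k
 proof -
  have "EV N. ext N (fst X, F k) \<subseteq> ext N X"
   using fnl_eventually[OF Y[OF k] X \<theta>[OF k]] by eventually_elim (auto simp: F_def ext_Exis fun_rel_def)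
  then show ?thesis using prv_ext_iff[OF F[OF k], of "snd X"] X by simp
 qed
 \<comment> \<open>Provably empty images satisfy the dichotomy but are not complete, so they are
   discarded.\<close>
 define K' where "K' = {k \<in> K. \<not> pv (fst X) (F k) Falsum}"
 have "pv (fst X) (snd X) (Disj K' F)"
 proof (rule ext_split[of _ _ _ K F])
  show "(fst X, snd X) \<in> fics" using X by simp
  show d: "(fst X, Disj K' F) \<in> fics" using F X by (auto simp: fic_iff fic_fst_snd K'_def)
  show "EV N. ext N (fst X, snd X) \<subseteq> (\<Union>k\<in>K. ext N (fst X, F k))"
   using cov[unfolded cover_iff[OF X], THEN conjunct2] by (simp add: F_def ext_Exis)
  fix k assume k: "k \<in> K"
  show "(fst X, F k) \<in> fics" by (rule F[OF k])
  show "EV N. ext N (fst X, F k) \<subseteq> ext N (fst X, Disj K' F)"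
  proof (cases "pv (fst X) (F k) Falsum")
   case True
   then have "EV N. ext N (fst X, F k) \<subseteq> ext N (fst X, Falsum :: ('s, 'f, 'r, 'i) form)"
    using prv_ext_iff[OF F[OF k], of Falsum] X by (simp add: fic_iff fic_fst_snd)
   then show ?thesis by eventually_elim (auto simp: ext_iff)
  next
   case False
   then have "k \<in> K'" using k by (simp add: K'_def)
   then have "ext N (fst X, F k) \<subseteq> ext N (fst X, Disj K' F)" for N :: "('s, 'f, 'r, 'f trm set) interp"
    unfolding ext_Disj by blast
   then show ?thesis by simp
  qed
 qed
 moreover have "cfm (fst X, F k)" if "k \<in> K'" for k
  using that dich F by (auto simp: complete_formula_def K'_def)
 ultimately show ?thesis using FX by (intro that[of K' F]) (auto simp: K'_def)
qed

text \<open>Two-valuedness is applied to the subterminal sheaf of \<phi>. If that sheaf is initial,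
  its section over the object \<phi> itself shows \<phi> to be contradictory; if it is everything,
  the section over \<open>Verum\<close> proves \<phi>.\<close>

lemma sentence_decided:
 assumes two: "two_valued_topos S.Sh" and \<phi>: "([], \<phi>) \<in> fics"
 shows "pv [] Verum \<phi> \<or> pv [] \<phi> Falsum"
proof -
 have "is_mono S.Sh (sentence_sheaf \<phi>) ter (S.incl ter (holds \<phi>))"
  by (rule S.incl_mono[where R = "holds \<phi>", OF ter_PSh holds_stable[OF \<phi>]])
 then consider "is_initial S.Sh (sentence_sheaf \<phi>)"
  | "is_iso S.Sh (sentence_sheaf \<phi>) ter (S.incl ter (holds \<phi>))"
  using two ter_terminal sentence_sheaf_Sh[OF \<phi>] unfolding two_valued_topos_def two_subobjects_def by blast
 then show ?thesis
 proof cases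
  case 1
  have Z: "([], \<phi>) \<in> Obj \<C>" using \<phi> by simp
  have "pv [] \<phi> \<phi>" using \<phi> by (rule Ident)
  then have "undefined \<in> on_ob (sentence_sheaf \<phi>) ([], \<phi>)"
   using \<phi> by (simp add: S.on_ob_subpsh[OF Z] ter_ob holds_def)
  from initial_empty[OF 1 \<phi> this] show ?thesis by simp
 next
  case 2
  have V: "([], Verum) \<in> fics" by (simp add: fic_iff)
  have "holds \<phi> ([], Verum) undefined"
   by (rule S.incl_iso[where R = "holds \<phi>", OF ter_PSh holds_stable[OF \<phi>] 2]) (use V in \<open>auto simp: ter_ob\<close>)
  then show ?thesis by (simp add: holds_def)
 qed
qed

end

section \<open>Models and their automorphisms\<close>

context geometric_theory
begin

lemma eval_Car:
 assumes "is_structure \<U> \<Sigma> M" "hs \<Gamma> t s" "a \<in> tuples M \<Gamma>"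
 shows "eval M a t \<in> Car M s"
 using assms(2)
proof induction
 case (1 n) then show ?case using assms(3) by (auto simp: tuples_def list_all2_conv_all_nth)
next
 case (2 f ts)
 then have "map (eval M a) ts \<in> tuples M (fdom \<Sigma> f)" by (auto simp: tuples_def list_all2_conv_all_nth)
 then show ?case using assms(1) 2(1) by (simp add: is_structure_def)
qed

lemma model_sound:
 assumes "is_model \<U> \<Sigma> \<T> M" "pv \<Gamma> \<phi> \<psi>"
 shows "ext M (\<Gamma>, \<phi>) \<subseteq> ext M (\<Gamma>, \<psi>)"
proof -
 have st: "is_structure \<U> \<Sigma> M" using assms(1) by (simp add: is_model_def)
 have "a \<in> tuples M \<Gamma> ==> sat M \<phi> a ==> sat M \<psi> a" for a
  using assms(2)
 proof (induction arbitrary: a)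
  case (Axm \<Gamma> \<phi> \<psi>)
  then have "ext M (\<Gamma>, \<phi>) \<subseteq> ext M (\<Gamma>, \<psi>)" using assms(1) by (auto simp: is_model_def)
  then show ?case using Axm by (auto simp: ext_def)
 next
  case (Subst \<Gamma> \<phi> \<psi> \<Delta> \<sigma>)
  let ?b = "map (\<lambda>n. eval M a (\<sigma> n)) [0..<length \<Gamma>]"
  have b: "?b \<in> tuples M \<Gamma>" using Subst eval_Car[OF st] by (auto simp: tuples_def list_all2_conv_all_nth)
  have wf: "wff \<phi> \<Gamma>" "wff \<psi> \<Gamma>" using prv_wf[OF Subst.hyps(1)] by (auto simp: fic_iff)
  have "sat M (subst_form \<phi> \<sigma>) a \<longleftrightarrow> sat M \<phi> ?b" "sat M (subst_form \<psi> \<sigma>) a \<longleftrightarrow> sat M \<psi> ?b"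
   by (rule sat_subst[OF wf(1)], simp, rule sat_subst[OF wf(2)], simp)
  then show ?case using Subst.IH[OF b] Subst.prems by simp
 next
  case (Eq_subst \<Gamma> \<phi> m n)
  have "sat M (subst_form \<phi> (Var(m := Var n))) a \<longleftrightarrow> sat M \<phi> a"
   by (rule sat_subst[of \<Sigma> \<phi> \<Gamma>]) (use Eq_subst in \<open>auto simp: fic_iff\<close>)
  then show ?case using Eq_subst.prems by simp
 next
  case (Exi_adj1 \<Gamma> \<psi> s \<phi>)
  have "sat M (ren Suc \<psi>) (x # a) \<longleftrightarrow> sat M \<psi> a" for x
   by (rule sat_ren[of \<Sigma> \<psi> \<Gamma>]) (use Exi_adj1 in \<open>auto simp: fic_iff\<close>)
  moreover have "x # a \<in> tuples M (s # \<Gamma>)" if "x \<in> Car M s" for x using that Exi_adj1 by (auto simp: tuples_def)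
  ultimately show ?case using Exi_adj1 by auto
 next
  case (Exi_adj2 \<Gamma> s \<phi> \<psi>)
  have wf: "wff \<psi> \<Gamma>" using prv_wf[OF Exi_adj2.hyps] by (auto simp: fic_iff)
  obtain x b where a: "a = x # b" "x \<in> Car M s" "b \<in> tuples M \<Gamma>" using Exi_adj2.prems by (auto simp: tuples_Cons)
  have "sat M (ren Suc \<psi>) (x # b) \<longleftrightarrow> sat M \<psi> b" by (rule sat_ren[OF wf]) auto
  then show ?case using Exi_adj2 a by auto
 next
  case (Frobenius \<Gamma> \<phi> s \<psi>)
  have "sat M (ren Suc \<phi>) (x # a) \<longleftrightarrow> sat M \<phi> a" for x
   by (rule sat_ren[of \<Sigma> \<phi> \<Gamma>]) (use Frobenius in \<open>auto simp: fic_iff\<close>)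
  then show ?case using Frobenius by auto
 qed auto
 then show ?thesis by (auto simp: ext_def)
qed

lemma tup_map_in:
 assumes "f \<in> automorphisms \<Sigma> M" "set \<Gamma> \<subseteq> Sorts \<Sigma>" "a \<in> tuples M \<Gamma>"
 shows "tup_map \<Gamma> f a \<in> tuples M \<Gamma>"
 using assms(2,3)
proof (induction \<Gamma> arbitrary: a)
 case (Cons s \<Gamma>)
 then obtain x b where a: "a = x # b" "x \<in> Car M s" "b \<in> tuples M \<Gamma>" by (auto simp: tuples_Cons)
 have "f s \<in> Bij (Car M s)" using assms(1) Cons.prems(1) by (auto simp: automorphisms_def)
 then have "f s x \<in> Car M s" using a(2) by (auto simp: Bij_def bij_betw_def)
 then show ?case using Cons a by (auto simp: tup_map_def tuples_Cons)
qed (simp add: tup_map_def)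

lemma tup_map_simps [simp]: "tup_map [] f a = []" "tup_map (s # \<Gamma>) f (x # a) = f s x # tup_map \<Gamma> f a"
 by (simp_all add: tup_map_def)

lemma tup_map_append: "length a = length \<Gamma> ==> tup_map (\<Gamma> @ \<Delta>) f (a @ b) = tup_map \<Gamma> f a @ tup_map \<Delta> f b"
 by (simp add: tup_map_def)

lemma eval_aut:
 assumes st: "is_structure \<U> \<Sigma> M" and f: "f \<in> automorphisms \<Sigma> M" and a: "a \<in> tuples M \<Gamma>"
  and t: "hs \<Gamma> t s"
 shows "eval M (tup_map \<Gamma> f a) t = f s (eval M a t)"
 using t
proof induction
 case (1 n) then show ?case using a tuples_length[OF a] by (simp add: tup_map_def)
next
 case (2 g ts)
 have "map (eval M (tup_map \<Gamma> f a)) ts = tup_map (fdom \<Sigma> g) f (map (eval M a) ts)"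
  using 2(2) by (auto simp: tup_map_def list_all2_conv_all_nth list_eq_iff_nth_eq)
 moreover have "map (eval M a) ts \<in> tuples M (fdom \<Sigma> g)"
  using 2(2) eval_Car[OF st _ a] by (auto simp: tuples_def list_all2_conv_all_nth)
 ultimately show ?case using f 2(1) by (simp add: automorphisms_def)
qed

lemma sat_aut:
 assumes st: "is_structure \<U> \<Sigma> M" and f: "f \<in> automorphisms \<Sigma> M"
  and "wff \<phi> \<Gamma>" "a \<in> tuples M \<Gamma>" "set \<Gamma> \<subseteq> Sorts \<Sigma>"
 shows "sat M \<phi> (tup_map \<Gamma> f a) \<longleftrightarrow> sat M \<phi> a"
 using assms(3-)
proof (induction \<phi> arbitrary: \<Gamma> a)
 case (Eql t u)
 then obtain s where s: "hs \<Gamma> t s" "hs \<Gamma> u s" by auto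
 have "s \<in> Sorts \<Sigma>" using has_sort_Sorts[OF s(1)] Eql by auto
 then have "inj_on (f s) (Car M s)" using f by (auto simp: automorphisms_def Bij_def bij_betw_def)
 then show ?case
  using eval_Car[OF st s(1) Eql.prems(2)] eval_Car[OF st s(2) Eql.prems(2)]
  by (simp add: eval_aut[OF st f Eql.prems(2) s(1)] eval_aut[OF st f Eql.prems(2) s(2)] inj_on_eq_iff)
next
 case (Rela r ts)
 have ts: "list_all2 (hs \<Gamma>) ts (rdom \<Sigma> r)" using Rela by simp
 have "map (eval M (tup_map \<Gamma> f a)) ts = tup_map (rdom \<Sigma> r) f (map (eval M a) ts)"
  using ts eval_aut[OF st f Rela.prems(2)] by (auto simp: tup_map_def list_all2_conv_all_nth list_eq_iff_nth_eq)
 moreover have "map (eval M a) ts \<in> tuples M (rdom \<Sigma> r)"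
  using ts eval_Car[OF st _ Rela.prems(2)] by (auto simp: tuples_def list_all2_conv_all_nth)
 ultimately show ?case using f Rela.prems(1) by (simp add: automorphisms_def)
next
 case (Disj I F)
 then have "sat M (F i) (tup_map \<Gamma> f a) \<longleftrightarrow> sat M (F i) a" if "i \<in> I" for i
  using that Disj.IH[of "F i" \<Gamma> a] by auto
 then show ?case by auto
next
 case (Exi s \<phi>)
 have bij: "bij_betw (f s) (Car M s) (Car M s)" using f Exi.prems by (auto simp: automorphisms_def Bij_def)
 have IH: "sat M \<phi> (f s x # tup_map \<Gamma> f a) \<longleftrightarrow> sat M \<phi> (x # a)" if "x \<in> Car M s" for x
  using Exi.IH[of "s # \<Gamma>" "x # a"] Exi.prems that by (auto simp: tuples_Cons)
 have "(\<exists>x\<in>Car M s. sat M \<phi> (x # tup_map \<Gamma> f a)) \<longleftrightarrow> (\<exists>x\<in>f s ` Car M s. sat M \<phi> (x # tup_map \<Gamma> f a))"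
  using bij by (simp add: bij_betw_def)
 then show ?case using IH by auto
qed auto

lemma Aut_mult_tup:
 assumes "f \<in> automorphisms \<Sigma> M" "set \<Gamma> \<subseteq> Sorts \<Sigma>" "a \<in> tuples M \<Gamma>"
 shows "tup_map \<Gamma> (g \<otimes>\<^bsub>Aut \<Sigma> M\<^esub> f) a = tup_map \<Gamma> g (tup_map \<Gamma> f a)"
 using assms(2,3)
proof (induction \<Gamma> arbitrary: a)
 case (Cons s \<Gamma>)
 then obtain x b where a: "a = x # b" "x \<in> Car M s" "b \<in> tuples M \<Gamma>" by (auto simp: tuples_Cons)
 then show ?case using Cons by (simp add: Aut_def compose_def)
qed simp

lemma Aut_one_tup:
 assumes "set \<Gamma> \<subseteq> Sorts \<Sigma>" "a \<in> tuples M \<Gamma>"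
 shows "tup_map \<Gamma> \<one>\<^bsub>Aut \<Sigma> M\<^esub> a = a"
 using assms
proof (induction \<Gamma> arbitrary: a)
 case (Cons s \<Gamma>)
 then obtain x b where a: "a = x # b" "x \<in> Car M s" "b \<in> tuples M \<Gamma>" by (auto simp: tuples_Cons)
 then show ?case using Cons by (simp add: Aut_def)
qed simp

lemma sig_sorts: "g \<in> Funs \<Sigma> ==> set (fdom \<Sigma> g) \<subseteq> Sorts \<Sigma>" "g \<in> Funs \<Sigma> ==> fcod \<Sigma> g \<in> Sorts \<Sigma>"
 "r \<in> Rels \<Sigma> ==> set (rdom \<Sigma> r) \<subseteq> Sorts \<Sigma>"
 using sig by (auto simp: is_signature_def)

lemma Aut_group:
 assumes st: "is_structure \<U> \<Sigma> M"
 shows "group (Aut \<Sigma> M)"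
proof (rule groupI)
 have carr: "carrier (Aut \<Sigma> M) = automorphisms \<Sigma> M" by (simp add: Aut_def)
 have mult: "g \<otimes>\<^bsub>Aut \<Sigma> M\<^esub> f = (\<lambda>s\<in>Sorts \<Sigma>. compose (Car M s) (g s) (f s))" for g f by (simp add: Aut_def)
 have one: "\<one>\<^bsub>Aut \<Sigma> M\<^esub> = (\<lambda>s\<in>Sorts \<Sigma>. \<lambda>x\<in>Car M s. x)" by (simp add: Aut_def)
 have Fun: "FunI M g a \<in> Car M (fcod \<Sigma> g)" if "g \<in> Funs \<Sigma>" "a \<in> tuples M (fdom \<Sigma> g)" for g a
  using st that by (simp add: is_structure_def)
 have bij: "f s \<in> Bij (Car M s)" if "f \<in> automorphisms \<Sigma> M" "s \<in> Sorts \<Sigma>" for f s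
  using that by (auto simp: automorphisms_def)
 have mem: "f s x \<in> Car M s" if "f \<in> automorphisms \<Sigma> M" "s \<in> Sorts \<Sigma>" "x \<in> Car M s" for f s x
  using bij[OF that(1,2)] that(3) by (auto simp: Bij_def bij_betw_def)
 have rel: "a \<in> RelI M r \<longleftrightarrow> tup_map (rdom \<Sigma> r) f a \<in> RelI M r"
  if "f \<in> automorphisms \<Sigma> M" "r \<in> Rels \<Sigma>" "a \<in> tuples M (rdom \<Sigma> r)" for f r a
  using that by (auto simp: automorphisms_def)
 have ext: "f \<in> extensional (Sorts \<Sigma>)" if "f \<in> automorphisms \<Sigma> M" for f
  using that by (auto simp: automorphisms_def PiE_def)
 have closed: "g \<otimes>\<^bsub>Aut \<Sigma> M\<^esub> f \<in> automorphisms \<Sigma> M" if g: "g \<in> automorphisms \<Sigma> M" and f: "f \<in> automorphisms \<Sigma> M" for g f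
  unfolding automorphisms_def
 proof (intro CollectI conjI ballI)
  show "g \<otimes>\<^bsub>Aut \<Sigma> M\<^esub> f \<in> (\<Pi>\<^sub>E s\<in>Sorts \<Sigma>. Bij (Car M s))"
   unfolding mult using bij[OF g] bij[OF f] by (auto intro: compose_Bij)
  fix h a assume h: "h \<in> Funs \<Sigma>" and a: "a \<in> tuples M (fdom \<Sigma> h)"
  show "(g \<otimes>\<^bsub>Aut \<Sigma> M\<^esub> f) (fcod \<Sigma> h) (FunI M h a) = FunI M h (tup_map (fdom \<Sigma> h) (g \<otimes>\<^bsub>Aut \<Sigma> M\<^esub> f) a)"
   unfolding Aut_mult_tup[OF f sig_sorts(1)[OF h] a]
   using f g h a tup_map_in[OF f sig_sorts(1)[OF h] a] sig_sorts(2)[OF h] Fun[OF h a]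
   by (simp add: mult compose_def automorphisms_def)
 next
  fix r a assume r: "r \<in> Rels \<Sigma>" and a: "a \<in> tuples M (rdom \<Sigma> r)"
  show "a \<in> RelI M r \<longleftrightarrow> tup_map (rdom \<Sigma> r) (g \<otimes>\<^bsub>Aut \<Sigma> M\<^esub> f) a \<in> RelI M r"
   unfolding Aut_mult_tup[OF f sig_sorts(3)[OF r] a]
   using rel[OF f r a] rel[OF g r tup_map_in[OF f sig_sorts(3)[OF r] a]] by simp
 qed
 then show "x \<otimes>\<^bsub>Aut \<Sigma> M\<^esub> y \<in> carrier (Aut \<Sigma> M)" if "x \<in> carrier (Aut \<Sigma> M)" "y \<in> carrier (Aut \<Sigma> M)" for x y
  using that by (simp add: carr)
 have "\<one>\<^bsub>Aut \<Sigma> M\<^esub> \<in> automorphisms \<Sigma> M" unfolding automorphisms_def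
 proof (intro CollectI conjI ballI)
  show "\<one>\<^bsub>Aut \<Sigma> M\<^esub> \<in> (\<Pi>\<^sub>E s\<in>Sorts \<Sigma>. Bij (Car M s))" unfolding one by (auto intro: id_Bij)
  fix h a assume h: "h \<in> Funs \<Sigma>" and a: "a \<in> tuples M (fdom \<Sigma> h)"
  show "\<one>\<^bsub>Aut \<Sigma> M\<^esub> (fcod \<Sigma> h) (FunI M h a) = FunI M h (tup_map (fdom \<Sigma> h) \<one>\<^bsub>Aut \<Sigma> M\<^esub> a)"
   unfolding Aut_one_tup[OF sig_sorts(1)[OF h] a] using sig_sorts(2)[OF h] Fun[OF h a] by (simp add: one)
 next
  fix r a assume r: "r \<in> Rels \<Sigma>" and a: "a \<in> tuples M (rdom \<Sigma> r)"
  show "a \<in> RelI M r \<longleftrightarrow> tup_map (rdom \<Sigma> r) \<one>\<^bsub>Aut \<Sigma> M\<^esub> a \<in> RelI M r"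
   unfolding Aut_one_tup[OF sig_sorts(3)[OF r] a] ..
 qed
 then show "\<one>\<^bsub>Aut \<Sigma> M\<^esub> \<in> carrier (Aut \<Sigma> M)" by (simp add: carr)
 show "x \<otimes>\<^bsub>Aut \<Sigma> M\<^esub> y \<otimes>\<^bsub>Aut \<Sigma> M\<^esub> z = x \<otimes>\<^bsub>Aut \<Sigma> M\<^esub> (y \<otimes>\<^bsub>Aut \<Sigma> M\<^esub> z)"
  if "x \<in> carrier (Aut \<Sigma> M)" "y \<in> carrier (Aut \<Sigma> M)" "z \<in> carrier (Aut \<Sigma> M)" for x y z
  unfolding mult using that mem[of z] by (auto simp: carr compose_def fun_eq_iff)
 show "\<one>\<^bsub>Aut \<Sigma> M\<^esub> \<otimes>\<^bsub>Aut \<Sigma> M\<^esub> x = x" if x: "x \<in> carrier (Aut \<Sigma> M)" for x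
 proof (rule extensionalityI)
  show "\<one>\<^bsub>Aut \<Sigma> M\<^esub> \<otimes>\<^bsub>Aut \<Sigma> M\<^esub> x \<in> extensional (Sorts \<Sigma>)" by (simp add: mult)
  show "x \<in> extensional (Sorts \<Sigma>)" using ext x by (simp add: carr)
  fix s assume s: "s \<in> Sorts \<Sigma>"
  have "x s \<in> extensional (Car M s)" using bij[of x s] x s by (simp add: carr Bij_def)
  then show "(\<one>\<^bsub>Aut \<Sigma> M\<^esub> \<otimes>\<^bsub>Aut \<Sigma> M\<^esub> x) s = x s"
   using s mem[of x s] x by (auto simp: mult one carr compose_def fun_eq_iff extensional_def)
 qed
 show "\<exists>y\<in>carrier (Aut \<Sigma> M). y \<otimes>\<^bsub>Aut \<Sigma> M\<^esub> x = \<one>\<^bsub>Aut \<Sigma> M\<^esub>" if "x \<in> carrier (Aut \<Sigma> M)" for x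
 proof -
  have x: "x \<in> automorphisms \<Sigma> M" using that by (simp add: carr)
  define y where "y = (\<lambda>s\<in>Sorts \<Sigma>. \<lambda>u\<in>Car M s. inv_into (Car M s) (x s) u)"
  have ybij: "y s \<in> Bij (Car M s)" if "s \<in> Sorts \<Sigma>" for s
   using restrict_inv_into_Bij[OF bij[OF x that]] that by (simp add: y_def)
  have yx: "y s (x s u) = u" and xy: "x s (y s u) = u" and ymem: "y s u \<in> Car M s" if "s \<in> Sorts \<Sigma>" "u \<in> Car M s" for s u
  proof -
   have "inj_on (x s) (Car M s)" "x s ` Car M s = Car M s" using bij[OF x that(1)] by (auto simp: Bij_def bij_betw_def)
   then show "y s (x s u) = u" "x s (y s u) = u" "y s u \<in> Car M s"
    using that mem[OF x that] by (auto simp: y_def f_inv_into_f inv_into_into)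
  qed
  have tup: "tup_map \<Gamma> y a \<in> tuples M \<Gamma> \<and> tup_map \<Gamma> x (tup_map \<Gamma> y a) = a" if "set \<Gamma> \<subseteq> Sorts \<Sigma>" "a \<in> tuples M \<Gamma>" for \<Gamma> a
   using that
  proof (induction \<Gamma> arbitrary: a)
   case (Cons s \<Gamma>)
   then obtain u b where a: "a = u # b" "u \<in> Car M s" "b \<in> tuples M \<Gamma>" by (auto simp: tuples_Cons)
   then show ?case using Cons xy[of s u] ymem[of s u] by (auto simp: tuples_Cons)
  qed simp
  have "y \<in> automorphisms \<Sigma> M" unfolding automorphisms_def
  proof (intro CollectI conjI ballI)
   show "y \<in> (\<Pi>\<^sub>E s\<in>Sorts \<Sigma>. Bij (Car M s))" using ybij by (auto simp: y_def)
   fix h a assume h: "h \<in> Funs \<Sigma>" and a: "a \<in> tuples M (fdom \<Sigma> h)"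
   let ?b = "tup_map (fdom \<Sigma> h) y a"
   have b: "?b \<in> tuples M (fdom \<Sigma> h)" "tup_map (fdom \<Sigma> h) x ?b = a" using tup[OF sig_sorts(1)[OF h] a] by auto
   have "x (fcod \<Sigma> h) (FunI M h ?b) = FunI M h a" using x h b by (simp add: automorphisms_def)
   then show "y (fcod \<Sigma> h) (FunI M h a) = FunI M h ?b" using yx[OF sig_sorts(2)[OF h] Fun[OF h b(1)]] by simp
  next
   fix r a assume r: "r \<in> Rels \<Sigma>" and a: "a \<in> tuples M (rdom \<Sigma> r)"
   let ?b = "tup_map (rdom \<Sigma> r) y a"
   have b: "?b \<in> tuples M (rdom \<Sigma> r)" "tup_map (rdom \<Sigma> r) x ?b = a" using tup[OF sig_sorts(3)[OF r] a] by auto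
   have "?b \<in> RelI M r \<longleftrightarrow> tup_map (rdom \<Sigma> r) x ?b \<in> RelI M r" using x r b(1) by (simp add: automorphisms_def)
   then show "a \<in> RelI M r \<longleftrightarrow> ?b \<in> RelI M r" using b(2) by simp
  qed
  moreover have "y \<otimes>\<^bsub>Aut \<Sigma> M\<^esub> x = \<one>\<^bsub>Aut \<Sigma> M\<^esub>"
   unfolding mult one using yx by (auto simp: compose_def fun_eq_iff)
  ultimately show ?thesis by (auto simp: carr)
 qed
qed

end

section \<open>Complete formulae as orbits in the model\<close>

locale galois_model = syntactic_site \<Sigma> \<T> \<U> code
 for \<Sigma> :: "('s, 'f, 'r) signature" and \<T> :: "('s, 'f, 'r, 'i) sequent set" and \<U> :: "'u set set"
  and code :: "('s, 'f, 'r, 'i) syn_arrow => 'u" +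
 fixes M :: "('s, 'f, 'r, 'u) interp" and \<I> :: "('s, 'f, 'r, 'i) fic set"
 assumes atomic: "atomic_topos S.Sh" and two_val: "two_valued_topos S.Sh"
  and model: "is_model \<U> \<Sigma> \<T> M"
  and \<I>_complete: "X \<in> \<I> ==> cfm X"
  and \<I>_cofinal: "cfm Y ==> \<exists>X\<in>\<I>. \<exists>\<theta>. fnl X Y \<theta>"
  and \<I>_realized: "X \<in> \<I> ==> ext M X \<noteq> {}"
  and \<I>_transitive: "X \<in> \<I> ==> a \<in> ext M X ==> b \<in> ext M X ==> \<exists>f\<in>automorphisms \<Sigma> M. tup_map (fst X) f a = b"
begin

lemma M_struct: "is_structure \<U> \<Sigma> M"
 using model by (simp add: is_model_def)

abbreviation "G \<equiv> Aut \<Sigma> M"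

lemma carrier_G: "carrier G = automorphisms \<Sigma> M"
 by (simp add: Aut_def)

lemma group_G: "group G"
 by (rule Aut_group[OF M_struct])

lemma complete_fic: "cfm X ==> X \<in> fics"
 by (auto simp: complete_formula_def)

text \<open>A complete piece of \<phi> that does not prove \<psi> excludes \<psi>, hence has no
  point in \<open>M\<close>. The sentence asserting such a point is decided; being false in
  \<open>M\<close> it is refutable, so the piece would be inconsistent.\<close>

lemma M_complete:
 assumes \<phi>: "(\<Gamma>, \<phi>) \<in> fics" and \<psi>: "(\<Gamma>, \<psi>) \<in> fics" and sub: "ext M (\<Gamma>, \<phi>) \<subseteq> ext M (\<Gamma>, \<psi>)"
 shows "pv \<Gamma> \<phi> \<psi>"
proof -
 obtain K :: "'i set" and F where K: "\<And>k. k \<in> K ==> cfm (\<Gamma>, F k)" "\<And>k. k \<in> K ==> pv \<Gamma> (F k) \<phi>"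
  "pv \<Gamma> \<phi> (Disj K F)"
  using complete_decomposition[OF atomic \<phi>] by (auto simp only: fst_conv snd_conv)
 have "pv \<Gamma> (F k) \<psi>" if k: "k \<in> K" for k
 proof (rule ccontr)
  assume n: "\<not> pv \<Gamma> (F k) \<psi>"
  have Fk: "(\<Gamma>, F k) \<in> fics" "\<not> pv \<Gamma> (F k) Falsum" using K(1)[OF k] by (auto simp: complete_formula_def)
  have "pv \<Gamma> (Conj (F k) \<psi>) Falsum" using K(1)[OF k] n \<psi> by (auto simp: complete_formula_def)
  from model_sound[OF model this] have "ext M (\<Gamma>, Conj (F k) \<psi>) = {}" by (auto simp: ext_def)
  moreover have "ext M (\<Gamma>, F k) \<subseteq> ext M (\<Gamma>, \<psi>)" using model_sound[OF model K(2)[OF k]] sub by blast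
  ultimately have empty: "ext M (\<Gamma>, F k) = {}" by (auto simp: ext_def)
  define \<xi> where "\<xi> = Exis \<Gamma> (F k)"
  have \<xi>: "([], \<xi>) \<in> fics" using Fk(1) by (simp add: \<xi>_def fic_iff wf_Exis)
  have sat\<xi>: "sat N \<xi> [] \<longleftrightarrow> ext N (\<Gamma>, F k) \<noteq> {}" for N :: "('s, 'f, 'r, 'w) interp"
   by (auto simp: \<xi>_def sat_Exis ext_def)
  from sentence_decided[OF two_val \<xi>] show False
  proof
   assume "pv [] Verum \<xi>"
   from model_sound[OF model this] have "sat M \<xi> []" by (auto simp: ext_def)
   then show False using empty by (auto simp: \<xi>_def sat_Exis ext_def)
  next
   assume "pv [] \<xi> Falsum"
   from eventually_valid[OF this] have "EV N. ext N (\<Gamma>, F k) \<subseteq> ext N (\<Gamma>, Falsum :: ('s, 'f, 'r, 'i) form)"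
    by eventually_elim (auto simp: valid_def ext_def \<xi>_def sat_Exis)
   then have "pv \<Gamma> (F k) Falsum" using prv_ext_iff[OF Fk(1), of Falsum] Fk(1) by (simp add: fic_iff)
   then show False using Fk(2) by blast
  qed
 qed
 then have "pv \<Gamma> (Disj K F) \<psi>" using \<psi> by (intro Disj_elim) auto
 with K(3) show ?thesis by (rule Cut)
qed

lemma M_prv_iff:
 assumes "(\<Gamma>, \<phi>) \<in> fics" "(\<Gamma>, \<psi>) \<in> fics"
 shows "pv \<Gamma> \<phi> \<psi> \<longleftrightarrow> ext M (\<Gamma>, \<phi>) \<subseteq> ext M (\<Gamma>, \<psi>)"
 using M_complete[OF assms] model_sound[OF model] by blast

text \<open>Lets \<open>M\<close> replace the filter in statements about definable
  relations.\<close>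

lemma M_rel_iff:
 fixes \<theta> \<theta>' :: "('s, 'f, 'r, 'i) form"
 assumes "set (\<Gamma> @ \<Delta>) \<subseteq> Sorts \<Sigma>" "wff \<theta> (\<Gamma> @ \<Delta>)" "wff \<theta>' (\<Gamma> @ \<Delta>)"
 shows "(EV N. rel N \<Gamma> \<Delta> \<theta> \<subseteq> rel N \<Gamma> \<Delta> \<theta>') \<longleftrightarrow> rel M \<Gamma> \<Delta> \<theta> \<subseteq> rel M \<Gamma> \<Delta> \<theta>'"
proof -
 have "pv (\<Gamma> @ \<Delta>) \<theta> \<theta>' \<longleftrightarrow> ext M (\<Gamma> @ \<Delta>, \<theta>) \<subseteq> ext M (\<Gamma> @ \<Delta>, \<theta>')"
  using M_prv_iff[of "\<Gamma> @ \<Delta>" \<theta> \<theta>'] assms by (simp add: fic_iff)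
 then show ?thesis using prv_rel_iff[OF assms] valid_rel[of M \<Gamma> \<Delta> \<theta> \<theta>'] by (simp add: valid_def)
qed

text \<open>Expresses functionality by inclusions between definable relations and sets, to which
  \<open>M_rel_iff\<close> and \<open>M_prv_iff\<close> apply.\<close>

lemma fun_rel_alt: "fun_rel A B r \<longleftrightarrow> r \<subseteq> A \<times> B \<and> r\<inverse> O r \<subseteq> Id_on B \<and> A \<subseteq> Range (r\<inverse>)"
 by (auto simp: fun_rel_def single_valued_def Id_on_iff)

lemma M_fnl_iff:
 assumes X: "X \<in> fics" and Y: "Y \<in> fics"
 shows "fnl X Y \<theta> \<longleftrightarrow> wff \<theta> (fst X @ fst Y) \<and> fun_rel (ext M X) (ext M Y) (arel M X Y \<theta>)"
proof (cases "wff \<theta> (fst X @ fst Y)")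
 case False
 then show ?thesis by (simp add: prv_functional_iff[OF X Y])
next
 case wf: True
 have w: "wff (snd X) (fst X)" "wff (snd Y) (fst Y)" using X Y by (simp_all add: fic_fst_snd)
 note wc = wf_conv_form[OF wf]
 note p = rel_prod_form[OF w] and c = rel_comp_form[OF wc wf, unfolded rel_conv_form[OF wf]] and i = rel_id_form[OF w(2)]
 have d: "ext N (fst X, Exis (fst Y) (conv_form (fst X) (fst Y) \<theta>)) = Range ((arel N X Y \<theta>)\<inverse>)" for N :: "('s, 'f, 'r, 'w) interp"
  unfolding ext_Exis rel_conv_form[OF wf] ..
 have "(EV N. fun_rel (ext N X) (ext N Y) (arel N X Y \<theta>)) \<longleftrightarrow>
   (EV N. arel N X Y \<theta> \<subseteq> arel N X Y (prod_form X Y)) \<and>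
   (EV N. arel N Y Y (comp_form (fst Y) (fst X) (conv_form (fst X) (fst Y) \<theta>) \<theta>) \<subseteq> arel N Y Y (id_form Y)) \<and>
   (EV N. ext N (fst X, snd X) \<subseteq> ext N (fst X, Exis (fst Y) (conv_form (fst X) (fst Y) \<theta>)))"
  unfolding eventually_conj_iff[symmetric] p c i ext_Exis rel_conv_form[OF wf] fun_rel_alt by simp
 also have "\<dots> \<longleftrightarrow> arel M X Y \<theta> \<subseteq> arel M X Y (prod_form X Y) \<and>
   arel M Y Y (comp_form (fst Y) (fst X) (conv_form (fst X) (fst Y) \<theta>) \<theta>) \<subseteq> arel M Y Y (id_form Y) \<and>
   ext M (fst X, snd X) \<subseteq> ext M (fst X, Exis (fst Y) (conv_form (fst X) (fst Y) \<theta>))"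
  unfolding M_rel_iff[OF sorts2[OF X Y] wf wf_prod_form[OF w]]
   M_rel_iff[OF sorts2[OF Y Y] wf_comp[OF X wc wf] wf_id_form[OF w(2)]]
  using prv_ext_iff[of "fst X" "snd X", OF _ Exis_fics[OF X Y wc]] M_prv_iff[of "fst X" "snd X", OF _ Exis_fics[OF X Y wc]] X
  by simp
 also have "\<dots> \<longleftrightarrow> fun_rel (ext M X) (ext M Y) (arel M X Y \<theta>)"
  unfolding p c i ext_Exis rel_conv_form[OF wf] fun_rel_alt by simp
 finally show ?thesis using wf by (simp add: prv_functional_iff[OF X Y])
qed

lemma M_arr_eq_iff:
 assumes X: "X \<in> fics" and Y: "Y \<in> fics" and \<theta>: "fnl X Y \<theta>" "fnl X Y \<theta>'"
 shows "arr X Y \<theta> = arr X Y \<theta>' \<longleftrightarrow> arel M X Y \<theta> = arel M X Y \<theta>'"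
 unfolding arr_eq_iff[OF assms] set_eq_subset[of "rel _ _ _ _"] eventually_conj_iff
  M_rel_iff[OF sorts2[OF X Y] fnl_wf[OF X Y \<theta>(1)] fnl_wf[OF X Y \<theta>(2)]]
  M_rel_iff[OF sorts2[OF X Y] fnl_wf[OF X Y \<theta>(2)] fnl_wf[OF X Y \<theta>(1)]] ..

lemma M_decompose:
 assumes "X \<in> fics"
 obtains K :: "'i set" and F where "\<And>k. k \<in> K ==> cfm (fst X, F k)" "ext M X = (\<Union>k\<in>K. ext M (fst X, F k))"
proof -
 obtain K :: "'i set" and F where K: "\<And>k. k \<in> K ==> cfm (fst X, F k)" "\<And>k. k \<in> K ==> pv (fst X) (F k) (snd X)"
  "pv (fst X) (snd X) (Disj K F)"
  by (rule complete_decomposition[OF atomic assms]) (rule that)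
 have "ext M X = (\<Union>k\<in>K. ext M (fst X, F k))"
  using model_sound[OF model K(3)] model_sound[OF model K(2)] by (auto simp: ext_Disj)
 with K(1) show ?thesis by (rule that)
qed

lemma ext_aut:
 assumes "X \<in> fics" "f \<in> automorphisms \<Sigma> M" "a \<in> ext M X"
 shows "tup_map (fst X) f a \<in> ext M X"
 using assms sat_aut[OF M_struct assms(2), of "snd X" "fst X" a] tup_map_in[OF assms(2), of "fst X" a]
 by (cases X) (auto simp: ext_iff fic_iff)

lemma rel_aut:
 assumes "X \<in> fics" "Y \<in> fics" "wff \<theta> (fst X @ fst Y)" "f \<in> automorphisms \<Sigma> M" "(a, b) \<in> arel M X Y \<theta>"
 shows "(tup_map (fst X) f a, tup_map (fst Y) f b) \<in> arel M X Y \<theta>"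
proof -
 have ab: "a \<in> tuples M (fst X)" "b \<in> tuples M (fst Y)" "sat M \<theta> (a @ b)" using assms(5) by (auto simp: rel_iff)
 have l: "length a = length (fst X)" using ab(1) by (rule tuples_length)
 have "sat M \<theta> (tup_map (fst X @ fst Y) f (a @ b))"
  using sat_aut[OF M_struct assms(4,3), of "a @ b"] ab l assms(1,2) by (simp add: tuples_append_iff fic_fst_snd)
 then show ?thesis using ab assms(1,2,4) tup_map_in[OF assms(4)] l
  by (simp add: rel_iff tup_map_append fic_fst_snd)
qed

text \<open>The image in \<open>X\<close> of a member \<open>Y\<close> of \<I> is definable and,
  \<open>Y\<close> being realized, meets \<open>ext M X\<close>; completeness of \<open>X\<close>
  makes it everything. Transitivity on the realizations of \<open>Y\<close> then passes to their
  images.\<close>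

lemma complete_orbit:
 assumes X: "cfm X"
 shows "ext M X \<noteq> {}" "a \<in> ext M X ==> b \<in> ext M X ==> \<exists>f\<in>automorphisms \<Sigma> M. tup_map (fst X) f a = b"
  "Y \<in> \<I> ==> fnl Y X \<theta> ==> b \<in> ext M X ==> \<exists>c\<in>ext M Y. (c, b) \<in> arel M Y X \<theta>"
proof -
 have Xf: "X \<in> fics" by (rule complete_fic[OF X])
 have surj: "ext M X \<noteq> {} \<and> ext M X \<subseteq> Range (arel M Y X \<theta>)" if Y: "Y \<in> \<I>" and \<theta>: "fnl Y X \<theta>" for Y \<theta>
 proof -
  have Yf: "Y \<in> fics" by (rule complete_fic[OF \<I>_complete[OF Y]])
  have f: "fun_rel (ext M Y) (ext M X) (arel M Y X \<theta>)" "wff \<theta> (fst Y @ fst X)"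
   using \<theta> by (simp_all add: M_fnl_iff[OF Yf Xf])
  obtain c where "c \<in> ext M Y" using \<I>_realized[OF Y] by blast
  then have "c \<in> Domain (arel M Y X \<theta>)" using f(1) by (auto simp: fun_rel_def)
  then obtain b where b: "(c, b) \<in> arel M Y X \<theta>" "b \<in> ext M X" using f(1) by (auto simp: fun_rel_def)
  have E: "(fst X, Exis (fst Y) \<theta>) \<in> fics" by (rule Exis_fics[OF Xf Yf f(2)])
  have "\<not> pv (fst X) (Conj (snd X) (Exis (fst Y) \<theta>)) Falsum"
  proof
   assume "pv (fst X) (Conj (snd X) (Exis (fst Y) \<theta>)) Falsum"
   from model_sound[OF model this] have "ext M X \<inter> ext M (fst X, Exis (fst Y) \<theta>) = {}" by (cases X) (auto simp: ext_iff)
   then show False using b unfolding ext_Exis by blast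
  qed
  then have "pv (fst X) (snd X) (Exis (fst Y) \<theta>)" using X E by (cases X) (auto simp: complete_formula_def)
  from model_sound[OF model this] show ?thesis using b(2) unfolding ext_Exis by auto
 qed
 obtain Y \<theta> where Y: "Y \<in> \<I>" "fnl Y X \<theta>" using \<I>_cofinal[OF X] by blast
 show "ext M X \<noteq> {}" using surj[OF Y] by blast
 show 3: "\<exists>c\<in>ext M Y. (c, b) \<in> arel M Y X \<theta>" if "Y \<in> \<I>" "fnl Y X \<theta>" "b \<in> ext M X" for Y \<theta> b
 proof -
  have Yf: "Y \<in> fics" by (rule complete_fic[OF \<I>_complete[OF that(1)]])
  have f: "fun_rel (ext M Y) (ext M X) (arel M Y X \<theta>)" using that by (simp add: M_fnl_iff[OF Yf Xf])
  show ?thesis using surj[OF that(1,2)] that(3) f by (auto simp: fun_rel_def)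
 qed
 show "\<exists>f\<in>automorphisms \<Sigma> M. tup_map (fst X) f a = b" if "a \<in> ext M X" "b \<in> ext M X"
 proof -
  have Yf: "Y \<in> fics" by (rule complete_fic[OF \<I>_complete[OF Y(1)]])
  have f: "fun_rel (ext M Y) (ext M X) (arel M Y X \<theta>)" "wff \<theta> (fst Y @ fst X)"
   using Y by (simp_all add: M_fnl_iff[OF Yf Xf])
  obtain c d where c: "c \<in> ext M Y" "(c, a) \<in> arel M Y X \<theta>" "d \<in> ext M Y" "(d, b) \<in> arel M Y X \<theta>"
   using 3[OF Y \<open>a \<in> ext M X\<close>] 3[OF Y \<open>b \<in> ext M X\<close>] by (elim bexE) (rule that)
  obtain g where g: "g \<in> automorphisms \<Sigma> M" "tup_map (fst Y) g c = d" using \<I>_transitive[OF Y(1) c(1,3)] by blast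
  have "(d, tup_map (fst X) g a) \<in> arel M Y X \<theta>" using rel_aut[OF Yf Xf f(2) g(1) c(2)] g(2) by simp
  then have "tup_map (fst X) g a = b" using c(4) f(1) by (auto simp: fun_rel_def single_valued_def)
  then show ?thesis using g(1) by blast
 qed
qed

text \<open>A complete formula defines a single orbit, so one that meets the graph of the
  equivariant map \<open>h\<close> is contained in it, and the graph is the union of these
  orbits.\<close>

lemma M_full:
 assumes X: "X \<in> fics" and Y: "Y \<in> fics" and h: "\<And>a. a \<in> ext M X ==> h a \<in> ext M Y"
  and eq: "\<And>f a. f \<in> automorphisms \<Sigma> M ==> a \<in> ext M X ==> h (tup_map (fst X) f a) = tup_map (fst Y) f (h a)"
 obtains \<theta> where "fnl X Y \<theta>" "arel M X Y \<theta> = {(a, h a) | a. a \<in> ext M X}"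
proof -
 define P :: "('s, 'f, 'r, 'i) fic" where "P = (fst X @ fst Y, Verum)"
 have P: "P \<in> fics" using X Y by (simp add: P_def fic_iff fic_fst_snd)
 obtain K :: "'i set" and F where K: "\<And>k. k \<in> K ==> cfm (fst P, F k)" "ext M P = (\<Union>k\<in>K. ext M (fst P, F k))"
  by (rule M_decompose[OF P]) (rule that)
 define K' where "K' = {k \<in> K. \<exists>a\<in>ext M X. a @ h a \<in> ext M (fst P, F k)}"
 define \<theta> where "\<theta> = Disj K' F"
 have Ff: "(fst P, F k) \<in> fics" if "k \<in> K" for k using complete_fic[OF K(1)[OF that]] .
 then have wf: "wff \<theta> (fst X @ fst Y)" by (auto simp: \<theta>_def K'_def P_def fic_iff)
 have tX: "a \<in> tuples M (fst X)" if "a \<in> ext M X" for a using that by (cases X) (simp add: ext_iff)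
 have tY: "a \<in> tuples M (fst Y)" if "a \<in> ext M Y" for a using that by (cases Y) (simp add: ext_iff)
 have r: "arel M X Y \<theta> = {(a, h a) | a. a \<in> ext M X}"
 proof (intro subset_antisym subrelI)
  fix a b assume "(a, b) \<in> arel M X Y \<theta>"
  then obtain k where k: "k \<in> K'" "(a, b) \<in> arel M X Y (F k)" by (auto simp: \<theta>_def rel_Disj)
  then have la: "length a = length (fst X)" and lb: "length b = length (fst Y)" by (auto simp: rel_iff dest: tuples_length)
  have ab: "a @ b \<in> ext M (fst P, F k)" using k(2) append_in_ext_iff[OF la, of b M "fst Y" "F k"] by (simp add: P_def)
  from k(1) obtain c where c: "k \<in> K" "c \<in> ext M X" "c @ h c \<in> ext M (fst P, F k)" by (auto simp: K'_def)
  obtain f where f: "f \<in> automorphisms \<Sigma> M" "tup_map (fst P) f (c @ h c) = a @ b"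
   using complete_orbit(2)[OF K(1)[OF c(1)] c(3) ab] by auto
  have lc: "length c = length (fst X)" by (rule tuples_length[OF tX[OF c(2)]])
  have "tup_map (fst X) f c @ tup_map (fst Y) f (h c) = a @ b" using f(2) lc by (simp add: P_def tup_map_append)
  moreover have "length (tup_map (fst X) f c) = length a" using lc la by (simp add: tup_map_def)
  ultimately have "tup_map (fst X) f c = a" "tup_map (fst Y) f (h c) = b" by auto
  then show "(a, b) \<in> {(a, h a) | a. a \<in> ext M X}" using eq[OF f(1) c(2)] ext_aut[OF X f(1) c(2)] by auto
 next
  fix a b assume "(a, b) \<in> {(a, h a) | a. a \<in> ext M X}"
  then have a: "a \<in> ext M X" "b = h a" by auto
  have la: "length a = length (fst X)" by (rule tuples_length[OF tX[OF a(1)]])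
  have "a @ b \<in> ext M P" using tX[OF a(1)] tY[OF h[OF a(1)]] a(2) by (simp add: P_def ext_iff tuples_append_iff la)
  then obtain k where k: "k \<in> K" "a @ b \<in> ext M (fst P, F k)" using K(2) by blast
  then have "k \<in> K'" using a by (auto simp: K'_def)
  moreover have "(a, b) \<in> arel M X Y (F k)" using k(2) append_in_ext_iff[OF la, of b M "fst Y" "F k"] by (simp add: P_def)
  ultimately show "(a, b) \<in> arel M X Y \<theta>" by (auto simp: \<theta>_def rel_Disj)
 qed
 have "fnl X Y \<theta>" unfolding M_fnl_iff[OF X Y] using wf h by (auto simp: r fun_rel_def single_valued_def)
 then show ?thesis using r by (rule that)
qed

text \<open>Evaluates an arrow at a tuple; the value does not depend on the representative \<theta>,
  by \<open>M_arr_eq_iff\<close>.\<close>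

definition mor :: "('s, 'f, 'r, 'i) syn_arrow => 'u list => 'u list" where
 "mor f a = (THE b. \<exists>\<theta>. fnl (fst f) (snd (snd f)) \<theta> \<and> f = arr (fst f) (snd (snd f)) \<theta> \<and>
   (a, b) \<in> arel M (fst f) (snd (snd f)) \<theta>)"

lemma mor_arr:
 assumes X: "X \<in> fics" and Y: "Y \<in> fics" and \<theta>: "fnl X Y \<theta>" and a: "a \<in> ext M X"
 shows "mor (arr X Y \<theta>) a = b \<longleftrightarrow> (a, b) \<in> arel M X Y \<theta>"
proof -
 have f: "fst (arr X Y \<theta>) = X" "snd (snd (arr X Y \<theta>)) = Y" by (simp_all add: syn_arrow_def)
 have "fun_rel (ext M X) (ext M Y) (arel M X Y \<theta>)" using \<theta> by (simp add: M_fnl_iff[OF X Y])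
 then obtain c where c: "(a, c) \<in> arel M X Y \<theta>" "\<And>b. (a, b) \<in> arel M X Y \<theta> ==> b = c"
  using a by (auto simp: fun_rel_def single_valued_def)
 have "mor (arr X Y \<theta>) a = c" unfolding mor_def f
 proof (rule the_equality)
  show "\<exists>\<theta>'. fnl X Y \<theta>' \<and> arr X Y \<theta> = arr X Y \<theta>' \<and> (a, c) \<in> arel M X Y \<theta>'" using \<theta> c(1) by blast
  show "b = c" if "\<exists>\<theta>'. fnl X Y \<theta>' \<and> arr X Y \<theta> = arr X Y \<theta>' \<and> (a, b) \<in> arel M X Y \<theta>'" for b
   using that c(2) M_arr_eq_iff[OF X Y \<theta>] by blast
 qed
 then show ?thesis using c by blast
qed

lemma mor_rel:
 assumes "X \<in> fics" "Y \<in> fics" "fnl X Y \<theta>" "a \<in> ext M X"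
 shows "(a, mor (arr X Y \<theta>) a) \<in> arel M X Y \<theta>"
 using mor_arr[OF assms] by blast

lemma mor_in:
 assumes "X \<in> fics" "Y \<in> fics" "f \<in> Hom \<C> X Y" "a \<in> ext M X"
 shows "mor f a \<in> ext M Y"
proof -
 obtain \<theta> where \<theta>: "f = arr X Y \<theta>" "fnl X Y \<theta>" using assms(3) by (rule HomE)
 then show ?thesis using mor_rel[OF assms(1,2) \<theta>(2) assms(4)] by (auto simp: M_fnl_iff[OF assms(1,2)] fun_rel_def)
qed

lemma mor_aut:
 assumes "X \<in> fics" "Y \<in> fics" "f \<in> Hom \<C> X Y" "a \<in> ext M X" "g \<in> automorphisms \<Sigma> M"
 shows "mor f (tup_map (fst X) g a) = tup_map (fst Y) g (mor f a)"
proof -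
 obtain \<theta> where \<theta>: "f = arr X Y \<theta>" "fnl X Y \<theta>" using assms(3) by (rule HomE)
 show ?thesis unfolding \<theta>(1) mor_arr[OF assms(1,2) \<theta>(2) ext_aut[OF assms(1,5,4)]]
  by (rule rel_aut[OF assms(1,2) fnl_wf[OF assms(1,2) \<theta>(2)] assms(5) mor_rel[OF assms(1,2) \<theta>(2) assms(4)]])
qed

lemma mor_Idn: "X \<in> fics ==> a \<in> ext M X ==> mor (Idn \<C> X) a = a"
 unfolding Idn_C by (subst mor_arr[OF _ _ fnl_id]) (auto simp: rel_id_form[of \<Sigma> X] fic_fst_snd)

lemma mor_Cmp:
 assumes "X \<in> fics" "Y \<in> fics" "Z \<in> fics" "f \<in> Hom \<C> X Y" "g \<in> Hom \<C> Y Z" "a \<in> ext M X"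
 shows "mor (Cmp \<C> g f) a = mor g (mor f a)"
proof -
 obtain \<theta> where \<theta>: "f = arr X Y \<theta>" "fnl X Y \<theta>" using assms(4) by (rule HomE)
 obtain \<gamma> where \<gamma>: "g = arr Y Z \<gamma>" "fnl Y Z \<gamma>" using assms(5) by (rule HomE)
 have fa: "mor f a \<in> ext M Y" by (rule mor_in[OF assms(1,2,4,6)])
 show ?thesis unfolding \<theta>(1) \<gamma>(1) Cmp_arr[OF assms(1-3) \<theta>(2) \<gamma>(2)]
   mor_arr[OF assms(1,3) fnl_comp[OF assms(1-3) \<theta>(2) \<gamma>(2)] assms(6)] arel_comp_form[OF assms(1-3) \<theta>(2) \<gamma>(2)]
  using mor_rel[OF assms(1,2) \<theta>(2) assms(6)] mor_rel[OF assms(2,3) \<gamma>(2) fa] \<theta>(1) by blast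
qed

lemma mor_inj:
 assumes "X \<in> fics" "Y \<in> fics" "f \<in> Hom \<C> X Y" "g \<in> Hom \<C> X Y" "\<And>a. a \<in> ext M X ==> mor f a = mor g a"
 shows "f = g"
proof -
 obtain \<theta> where \<theta>: "f = arr X Y \<theta>" "fnl X Y \<theta>" using assms(3) by (rule HomE)
 obtain \<gamma> where \<gamma>: "g = arr X Y \<gamma>" "fnl X Y \<gamma>" using assms(4) by (rule HomE)
 have "fun_rel (ext M X) (ext M Y) (arel M X Y \<theta>)" "fun_rel (ext M X) (ext M Y) (arel M X Y \<gamma>)"
  using \<theta> \<gamma> by (simp_all add: M_fnl_iff[OF assms(1,2)])
 moreover have "arel M X Y \<theta> \<subseteq> arel M X Y \<gamma>"
 proof (rule subrelI)
  fix a b assume ab: "(a, b) \<in> arel M X Y \<theta>"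
  then have a: "a \<in> ext M X" using calculation(1) by (auto simp: fun_rel_def)
  have "mor f a = b" unfolding \<theta>(1) mor_arr[OF assms(1,2) \<theta>(2) a] by (rule ab)
  then have "mor g a = b" using assms(5)[OF a] by simp
  then show "(a, b) \<in> arel M X Y \<gamma>" using mor_arr[OF assms(1,2) \<gamma>(2) a] \<gamma>(1) by simp
 qed
 ultimately have "arel M X Y \<theta> = arel M X Y \<gamma>" by (rule fun_rel_eq)
 then show ?thesis using M_arr_eq_iff[OF assms(1,2) \<theta>(2) \<gamma>(2)] \<theta> \<gamma> by simp
qed

lemma mor_full:
 assumes X: "X \<in> fics" and Y: "Y \<in> fics" and h: "\<And>a. a \<in> ext M X ==> h a \<in> ext M Y"
  and eq: "\<And>f a. f \<in> automorphisms \<Sigma> M ==> a \<in> ext M X ==> h (tup_map (fst X) f a) = tup_map (fst Y) f (h a)"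
 shows "\<exists>f\<in>Hom \<C> X Y. \<forall>a\<in>ext M X. mor f a = h a"
proof -
 obtain \<theta> where \<theta>: "fnl X Y \<theta>" "arel M X Y \<theta> = {(a, h a) | a. a \<in> ext M X}"
  by (rule M_full[where h = h, OF X Y h eq]) (assumption | rule that)+
 have "mor (arr X Y \<theta>) a = h a" if "a \<in> ext M X" for a
  unfolding mor_arr[OF X Y \<theta>(1) that] \<theta>(2) using that by blast
 then show ?thesis using Hom_C_I[OF \<theta>(1)] by blast
qed

text \<open>\<open>Z\<close> is the complete piece of the product of \<open>X\<close> and
  \<open>Y\<close> that contains the pair of the two points; the projections are arrows because they
  are equivariant.\<close>

lemma span:
 assumes X: "X \<in> fics" and Y: "Y \<in> fics" and x: "x \<in> ext M X" and y': "y' \<in> ext M Y"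
 shows "\<exists>Z z p q. cfm Z \<and> z \<in> ext M Z \<and> p \<in> Hom \<C> Z X \<and> q \<in> Hom \<C> Z Y \<and> mor p z = x \<and> mor q z = y'"
proof -
 define P :: "('s, 'f, 'r, 'i) fic" where "P = (fst X @ fst Y, prod_form X Y)"
 have w: "wff (snd X) (fst X)" "wff (snd Y) (fst Y)" using X Y by (simp_all add: fic_fst_snd)
 have P: "P \<in> fics" using X Y wf_prod_form[OF w] by (simp add: P_def fic_iff fic_fst_snd)
 obtain K :: "'i set" and F where K: "\<And>k. k \<in> K ==> cfm (fst P, F k)" "ext M P = (\<Union>k\<in>K. ext M (fst P, F k))"
  by (rule M_decompose[OF P]) (rule that)
 let ?c = "length (fst X)"
 have extP: "c \<in> ext M P \<longleftrightarrow> (\<exists>a b. c = a @ b \<and> a \<in> ext M X \<and> b \<in> ext M Y)" for c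
 proof
  assume c: "c \<in> ext M P"
  then have "c \<in> tuples M (fst X @ fst Y)" by (simp add: P_def ext_iff)
  then obtain a b where ab: "c = a @ b" "a \<in> tuples M (fst X)" "b \<in> tuples M (fst Y)" by (rule tuples_appendE)
  then have "(a, b) \<in> arel M X Y (prod_form X Y)"
   using c append_in_ext_iff[OF tuples_length[OF ab(2)], of b M "fst Y" "prod_form X Y"] by (simp add: P_def)
  then show "\<exists>a b. c = a @ b \<and> a \<in> ext M X \<and> b \<in> ext M Y" using ab(1) unfolding rel_prod_form[OF w] by blast
 next
  assume "\<exists>a b. c = a @ b \<and> a \<in> ext M X \<and> b \<in> ext M Y"
  then obtain a b where ab: "c = a @ b" "(a, b) \<in> arel M X Y (prod_form X Y)" "a \<in> ext M X" unfolding rel_prod_form[OF w] by blast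
  then show "c \<in> ext M P" using append_in_ext_iff[OF ext_length[OF ab(3)], of b M "fst Y" "prod_form X Y"] by (simp add: P_def)
 qed
 have "x @ y' \<in> ext M P" using x y' extP by blast
 then obtain k where k: "k \<in> K" "x @ y' \<in> ext M (fst P, F k)" using K(2) by blast
 define Z where "Z = (fst P, F k)"
 have Z: "cfm Z" "Z \<in> fics" using K(1)[OF k(1)] complete_fic by (auto simp: Z_def)
 have ZE: "\<exists>a b. c = a @ b \<and> a \<in> ext M X \<and> b \<in> ext M Y" if "c \<in> ext M Z" for c
  using that K(2) k(1) extP[of c] by (auto simp: Z_def)
 have fZ: "fst Z = fst X @ fst Y" by (simp add: Z_def P_def)
 obtain p where p: "p \<in> Hom \<C> Z X" "\<forall>c\<in>ext M Z. mor p c = take ?c c"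
 proof -
  have "take ?c c \<in> ext M X \<and> take ?c (tup_map (fst Z) f c) = tup_map (fst X) f (take ?c c)" if c: "c \<in> ext M Z" for c f
  proof -
   obtain a b where ab: "c = a @ b" "a \<in> ext M X" using ZE[OF c] by blast
   have "length a = ?c" "length (tup_map (fst X) f a) = ?c" using ext_length[OF ab(2)] by (simp_all add: tup_map_def)
   then show ?thesis using ab by (simp add: fZ tup_map_append)
  qed
  then have "\<exists>p\<in>Hom \<C> Z X. \<forall>c\<in>ext M Z. mor p c = take ?c c" by (intro mor_full[OF Z(2) X]) blast+
  then show thesis using that by blast
 qed
 obtain q where q: "q \<in> Hom \<C> Z Y" "\<forall>c\<in>ext M Z. mor q c = drop ?c c"
 proof -
  have "drop ?c c \<in> ext M Y \<and> drop ?c (tup_map (fst Z) f c) = tup_map (fst Y) f (drop ?c c)" if c: "c \<in> ext M Z" for c f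
  proof -
   obtain a b where ab: "c = a @ b" "a \<in> ext M X" "b \<in> ext M Y" using ZE[OF c] by blast
   have "length a = ?c" "length (tup_map (fst X) f a) = ?c" using ext_length[OF ab(2)] by (simp_all add: tup_map_def)
   then show ?thesis using ab by (simp add: fZ tup_map_append)
  qed
  then have "\<exists>q\<in>Hom \<C> Z Y. \<forall>c\<in>ext M Z. mor q c = drop ?c c" by (intro mor_full[OF Z(2) Y]) blast+
  then show thesis using that by blast
 qed
 have l: "length x = ?c" by (rule ext_length[OF x])
 have z: "x @ y' \<in> ext M Z" using k(2) by (simp add: Z_def)
 show ?thesis using Z(1) z p q l by (intro exI[of _ Z] exI[of _ "x @ y'"] exI[of _ p] exI[of _ q]) simp
qed

text \<open>For the converse, \<open>ext M X\<close> is a union of orbits indexed by a subset of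
  \<open>'i\<close>. By equivariance an arrow of \<open>S\<close> that hits one point of an orbit
  hits all of it, so one arrow for each orbit makes up a cover with an admissible index set.\<close>

lemma M_J_iff:
 assumes X: "X \<in> fics"
 shows "S \<in> \<J> X \<longleftrightarrow> is_sieve \<C> X S \<and>
  (\<forall>x\<in>ext M X. \<exists>Y\<in>fics. \<exists>f\<in>S \<inter> Hom \<C> Y X. \<exists>y\<in>ext M Y. mor f y = x)"
proof
 assume S: "S \<in> \<J> X"
 obtain K Y \<theta> where cov: "cover X K Y \<theta>" and KS: "\<And>k. k \<in> K ==> arr (Y k) X (\<theta> k) \<in> S" using S by (rule JE) blast
 have "ext M X \<subseteq> (\<Union>k\<in>K. Range (arel M (Y k) X (\<theta> k)))"
  using cov model_sound[OF model, of "fst X" "snd X" "Disj K (\<lambda>k. Exis (fst (Y k)) (\<theta> k))"]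
  by (simp add: cover_def ext_Disj ext_Exis)
 have "\<exists>Y\<in>fics. \<exists>f\<in>S \<inter> Hom \<C> Y X. \<exists>y\<in>ext M Y. mor f y = x" if x: "x \<in> ext M X" for x
 proof -
  obtain k y where k: "k \<in> K" "(y, x) \<in> arel M (Y k) X (\<theta> k)"
   using \<open>ext M X \<subseteq> (\<Union>k\<in>K. Range (arel M (Y k) X (\<theta> k)))\<close> x by blast
  note Yk = coverD[OF cov k(1)]
  have "y \<in> ext M (Y k)" using Yk(2) k(2) by (auto simp: M_fnl_iff[OF Yk(1) X] fun_rel_def)
  moreover have "mor (arr (Y k) X (\<theta> k)) y = x" unfolding mor_arr[OF Yk(1) X Yk(2) calculation] by (rule k(2))
  ultimately show ?thesis using Yk(1) KS[OF k(1)] Hom_C_I[OF Yk(2)] by blast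
 qed
 then show "is_sieve \<C> X S \<and> (\<forall>x\<in>ext M X. \<exists>Y\<in>fics. \<exists>f\<in>S \<inter> Hom \<C> Y X. \<exists>y\<in>ext M Y. mor f y = x)"
  using J_sieve[OF S] by blast
next
 assume *: "is_sieve \<C> X S \<and> (\<forall>x\<in>ext M X. \<exists>Y\<in>fics. \<exists>f\<in>S \<inter> Hom \<C> Y X. \<exists>y\<in>ext M Y. mor f y = x)"
 obtain K :: "'i set" and F where K: "\<And>k. k \<in> K ==> cfm (fst X, F k)" "ext M X = (\<Union>k\<in>K. ext M (fst X, F k))"
  by (rule M_decompose[OF X]) (rule that)
 have "\<forall>k\<in>K. \<exists>Y \<theta>. Y \<in> fics \<and> fnl Y X \<theta> \<and> arr Y X \<theta> \<in> S \<and> ext M (fst X, F k) \<subseteq> Range (arel M Y X \<theta>)"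
 proof
  fix k assume k: "k \<in> K"
  obtain b where b: "b \<in> ext M (fst X, F k)" using complete_orbit(1)[OF K(1)[OF k]] by blast
  then have "b \<in> ext M X" using K(2) k by blast
  then obtain Y f y where Y: "Y \<in> fics" "f \<in> S" "f \<in> Hom \<C> Y X" "y \<in> ext M Y" "mor f y = b" using * by blast
  obtain \<theta> where \<theta>: "f = arr Y X \<theta>" "fnl Y X \<theta>" using Y(3) by (rule HomE)
  have yb: "(y, b) \<in> arel M Y X \<theta>" using mor_arr[OF Y(1) X \<theta>(2) Y(4)] Y(5) \<theta>(1) by simp
  have "ext M (fst X, F k) \<subseteq> Range (arel M Y X \<theta>)"
  proof
   fix c assume "c \<in> ext M (fst X, F k)"
   from complete_orbit(2)[OF K(1)[OF k] b this] obtain g where g: "g \<in> automorphisms \<Sigma> M" "tup_map (fst X) g b = c" by auto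
   then show "c \<in> Range (arel M Y X \<theta>)" using rel_aut[OF Y(1) X fnl_wf[OF Y(1) X \<theta>(2)] g(1) yb] by auto
  qed
  then show "\<exists>Y \<theta>. Y \<in> fics \<and> fnl Y X \<theta> \<and> arr Y X \<theta> \<in> S \<and> ext M (fst X, F k) \<subseteq> Range (arel M Y X \<theta>)"
   using Y \<theta> by blast
 qed
 from bchoice[OF this] obtain Y where "\<forall>k\<in>K. \<exists>\<theta>. Y k \<in> fics \<and> fnl (Y k) X \<theta> \<and> arr (Y k) X \<theta> \<in> S \<and> ext M (fst X, F k) \<subseteq> Range (arel M (Y k) X \<theta>)" ..
 from bchoice[OF this] obtain \<theta> where \<theta>: "\<forall>k\<in>K. Y k \<in> fics \<and> fnl (Y k) X (\<theta> k) \<and> arr (Y k) X (\<theta> k) \<in> S \<and> ext M (fst X, F k) \<subseteq> Range (arel M (Y k) X (\<theta> k))" ..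
 have "pv (fst X) (snd X) (Disj K (\<lambda>k. Exis (fst (Y k)) (\<theta> k)))"
 proof (rule M_complete)
  show "(fst X, snd X) \<in> fics" using X by simp
  have "(fst X, Exis (fst (Y k)) (\<theta> k)) \<in> fics" if "k \<in> K" for k
   using \<theta> that X by (intro Exis_fics fnl_wf) auto
  then show "(fst X, Disj K (\<lambda>k. Exis (fst (Y k)) (\<theta> k))) \<in> fics" using X by (auto simp: fic_iff fic_fst_snd)
  show "ext M (fst X, snd X) \<subseteq> ext M (fst X, Disj K (\<lambda>k. Exis (fst (Y k)) (\<theta> k)))"
   unfolding ext_Disj ext_Exis prod.collapse K(2) using \<theta> by (intro UN_mono) auto
 qed
 then have "cover X K Y \<theta>" using \<theta> by (simp add: cover_def)
 then show "S \<in> \<J> X" unfolding J_iff using * \<theta> by blast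
qed

end

section \<open>Equivalences from fully faithful functors\<close>

lemma naturally_isomorphic_sym:
 assumes C: "is_category C" and D: "is_category D" and "naturally_isomorphic C D F G"
 shows "naturally_isomorphic C D G F"
proof -
 interpret C: cat C by unfold_locales (rule C)
 interpret D: cat D by unfold_locales (rule D)
 obtain \<eta> where F: "is_functor C D F" and G: "is_functor C D G" and \<eta>: "is_nat_trans C D F G \<eta>"
  and iso: "\<forall>X\<in>Obj C. \<exists>g. is_inverse_pair D (on_ob F X) (on_ob G X) (\<eta> X) g"
  using assms(3) by (auto simp: naturally_isomorphic_def is_iso_def)
 from bchoice[OF iso] obtain \<theta> where \<theta>: "\<forall>X\<in>Obj C. is_inverse_pair D (on_ob F X) (on_ob G X) (\<eta> X) (\<theta> X)" ..
 note i = \<theta>[unfolded is_inverse_pair_def, rule_format]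
 note o = is_functorD(1)[OF F] is_functorD(1)[OF G]
 have "is_nat_trans C D G F \<theta>" unfolding is_nat_trans_def
 proof (intro conjI ballI)
  show "\<theta> X \<in> Hom D (on_ob G X) (on_ob F X)" if "X \<in> Obj C" for X using i[OF that] by blast
  fix X Y f assume X: "X \<in> Obj C" and Y: "Y \<in> Obj C" and f: "f \<in> Hom C X Y"
  note h = i[OF X] i[OF Y] is_functorD(2)[OF F X Y f] is_functorD(2)[OF G X Y f] o[OF X] o[OF Y]
  have "Cmp D (on_ar F f) (\<theta> X) = Cmp D (Cmp D (Cmp D (\<theta> Y) (\<eta> Y)) (on_ar F f)) (\<theta> X)"
   using h by (simp add: D.Idn_Cmp)
  also have "\<dots> = Cmp D (Cmp D (\<theta> Y) (Cmp D (\<eta> Y) (on_ar F f))) (\<theta> X)"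
   using D.assoc[of "on_ob F X" "on_ob F Y" "on_ob G Y" "on_ob F Y"] h by simp
  also have "\<dots> = Cmp D (Cmp D (\<theta> Y) (Cmp D (on_ar G f) (\<eta> X))) (\<theta> X)"
   using is_nat_transD(2)[OF \<eta> X Y f] by simp
  also have "\<dots> = Cmp D (\<theta> Y) (Cmp D (Cmp D (on_ar G f) (\<eta> X)) (\<theta> X))"
   using h by (intro D.assoc[of "on_ob G X" "on_ob F X" "on_ob G Y" "on_ob F Y", symmetric] D.Cmp) auto
  also have "\<dots> = Cmp D (\<theta> Y) (Cmp D (on_ar G f) (Cmp D (\<eta> X) (\<theta> X)))"
   using D.assoc[of "on_ob G X" "on_ob F X" "on_ob G X" "on_ob G Y" "\<theta> X" "\<eta> X" "on_ar G f"] h by simp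
  finally show "Cmp D (on_ar F f) (\<theta> X) = Cmp D (\<theta> Y) (on_ar G f)" using h by (simp add: D.Cmp_Idn)
 qed
 moreover have "\<forall>X\<in>Obj C. is_iso D (on_ob G X) (on_ob F X) (\<theta> X)"
  using i by (auto simp: is_iso_def is_inverse_pair_def)
 ultimately show ?thesis using F G by (auto simp: naturally_isomorphic_def)
qed

lemma is_functor_id: "is_functor C C id_functor"
 by (simp add: is_functor_def id_functor_def)

lemma is_functor_comp:
 assumes F: "is_functor C D F" and G: "is_functor D E G"
 shows "is_functor C E (comp_functor G F)"
 unfolding is_functor_def comp_functor_def cfunctor.simps
proof (intro conjI ballI)
 note F1 = is_functorD(1)[OF F] and F2 = is_functorD(2)[OF F]
 show "on_ob G (on_ob F X) \<in> Obj E" if "X \<in> Obj C" for X by (rule is_functorD(1)[OF G F1[OF that]])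
 show "on_ar G (on_ar F f) \<in> Hom E (on_ob G (on_ob F X)) (on_ob G (on_ob F Y))"
  if "X \<in> Obj C" "Y \<in> Obj C" "f \<in> Hom C X Y" for X Y f
  by (rule is_functorD(2)[OF G F1[OF that(1)] F1[OF that(2)] F2[OF that]])
 show "on_ar G (on_ar F (Idn C X)) = Idn E (on_ob G (on_ob F X))" if "X \<in> Obj C" for X
  using is_functorD(3)[OF F that] is_functorD(3)[OF G F1[OF that]] by simp
 show "on_ar G (on_ar F (Cmp C g f)) = Cmp E (on_ar G (on_ar F g)) (on_ar G (on_ar F f))"
  if "X \<in> Obj C" "Y \<in> Obj C" "Z \<in> Obj C" "f \<in> Hom C X Y" "g \<in> Hom C Y Z" for X Y Z f g
  unfolding is_functorD(4)[OF F that]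
  by (rule is_functorD(4)[OF G F1[OF that(1)] F1[OF that(2)] F1[OF that(3)] F2[OF that(1,2,4)] F2[OF that(2,3,5)]])
qed

locale ff_es = D: cat D + E: cat E for D :: "('p, 'b) category" and E :: "('q, 'c) category" +
 fixes N :: "('p, 'b, 'q, 'c) cfunctor"
 assumes N: "is_functor D E N"
  and full: "A \<in> Obj D ==> B \<in> Obj D ==> g \<in> Hom E (on_ob N A) (on_ob N B) ==> \<exists>f\<in>Hom D A B. on_ar N f = g"
  and faithful: "A \<in> Obj D ==> B \<in> Obj D ==> f \<in> Hom D A B ==> f' \<in> Hom D A B ==> on_ar N f = on_ar N f' ==> f = f'"
  and es: "P \<in> Obj E ==> \<exists>A\<in>Obj D. \<exists>e e'. is_inverse_pair E (on_ob N A) P e e'"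
begin

definition qo :: "'q => 'p" where
 "qo P = (SOME A. A \<in> Obj D \<and> (\<exists>e e'. is_inverse_pair E (on_ob N A) P e e'))"

definition qe :: "'q => 'c" where
 "qe P = (SOME e. \<exists>e'. is_inverse_pair E (on_ob N (qo P)) P e e')"

lemma qo_qe:
 assumes "P \<in> Obj E"
 shows "qo P \<in> Obj D" "\<exists>e'. is_inverse_pair E (on_ob N (qo P)) P (qe P) e'"
proof -
 have "\<exists>A. A \<in> Obj D \<and> (\<exists>e e'. is_inverse_pair E (on_ob N A) P e e')" using es[OF assms] by blast
 from someI_ex[OF this] have *: "qo P \<in> Obj D \<and> (\<exists>e e'. is_inverse_pair E (on_ob N (qo P)) P e e')"
  unfolding qo_def .
 then show "qo P \<in> Obj D" by blast
 show "\<exists>e'. is_inverse_pair E (on_ob N (qo P)) P (qe P) e'"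
  unfolding qe_def by (rule someI_ex) (use * in blast)
qed

lemma qe_Hom: "P \<in> Obj E ==> qe P \<in> Hom E (on_ob N (qo P)) P"
 using qo_qe(2) by (auto simp: is_inverse_pair_def)

lemma N_ob: "A \<in> Obj D ==> on_ob N A \<in> Obj E"
 by (rule is_functorD(1)[OF N])

text \<open>The chosen isomorphism from \<open>N (qo P)\<close> to \<open>P\<close> is a universal arrow from \<open>N\<close> to \<open>P\<close>; all laws
 for the quasi-inverse are consequences.\<close>

lemma lift:
 assumes A: "A \<in> Obj D" and P: "P \<in> Obj E" and g: "g \<in> Hom E (on_ob N A) P"
 shows "\<exists>!f. f \<in> Hom D A (qo P) \<and> Cmp E (qe P) (on_ar N f) = g"
proof -
 note q = qo_qe(1)[OF P]
 obtain e' where e': "e' \<in> Hom E P (on_ob N (qo P))" "Cmp E e' (qe P) = Idn E (on_ob N (qo P))" "Cmp E (qe P) e' = Idn E P"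
  using qo_qe(2)[OF P] by (auto simp: is_inverse_pair_def)
 note e = qe_Hom[OF P]
 note NA = N_ob[OF A] and Nq = N_ob[OF q]
 have inv: "Cmp E e' (Cmp E (qe P) h) = h" if "h \<in> Hom E (on_ob N A) (on_ob N (qo P))" for h
  using E.assoc[OF NA Nq P Nq that e e'(1)] E.Idn_Cmp[OF NA Nq that] e'(2) by simp
 obtain f where f: "f \<in> Hom D A (qo P)" "on_ar N f = Cmp E e' g" using full[OF A q E.Cmp[OF NA P Nq g e'(1)]] by blast
 have "Cmp E (qe P) (on_ar N f) = g" using E.assoc[OF NA P Nq P g e'(1) e] E.Idn_Cmp[OF NA P g] e'(3) f(2) by simp
 moreover have "f' = f" if f': "f' \<in> Hom D A (qo P)" "Cmp E (qe P) (on_ar N f') = g" for f'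
  using inv[OF is_functorD(2)[OF N A q f'(1)]] f(2) f'(2) by (intro faithful[OF A q f'(1) f(1)]) simp
 ultimately show ?thesis using f(1) by blast
qed

definition quasi_inverse :: "('q, 'c, 'p, 'b) cfunctor" where
 "quasi_inverse = \<lparr>on_ob = qo, on_ar = (\<lambda>t. THE f. f \<in> Hom D (qo (cdom E t)) (qo (ccod E t)) \<and>
   Cmp E (qe (ccod E t)) (on_ar N f) = Cmp E t (qe (cdom E t)))\<rparr>"

lemma on_ob_quasi_inverse: "on_ob quasi_inverse P = qo P"
 by (simp add: quasi_inverse_def)

lemma on_ar_quasi_inverse:
 assumes P: "P \<in> Obj E" and P': "P' \<in> Obj E" and t: "t \<in> Hom E P P'"
 shows "on_ar quasi_inverse t \<in> Hom D (qo P) (qo P')"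
  "Cmp E (qe P') (on_ar N (on_ar quasi_inverse t)) = Cmp E t (qe P)"
proof -
 have "on_ar quasi_inverse t \<in> Hom D (qo P) (qo P') \<and>
  Cmp E (qe P') (on_ar N (on_ar quasi_inverse t)) = Cmp E t (qe P)"
  unfolding quasi_inverse_def cfunctor.simps E.cdom_eq[OF P P' t] E.ccod_eq[OF P P' t]
  by (rule theI') (rule lift[OF qo_qe(1)[OF P] P' E.Cmp[OF N_ob[OF qo_qe(1)[OF P]] P P' qe_Hom[OF P] t]])
 then show "on_ar quasi_inverse t \<in> Hom D (qo P) (qo P')"
  "Cmp E (qe P') (on_ar N (on_ar quasi_inverse t)) = Cmp E t (qe P)" by auto
qed

lemma lift_eqI:
 assumes "A \<in> Obj D" "P \<in> Obj E" "f \<in> Hom D A (qo P)" "f' \<in> Hom D A (qo P)"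
  "Cmp E (qe P) (on_ar N f) = Cmp E (qe P) (on_ar N f')"
 shows "f = f'"
 using lift[OF assms(1,2) E.Cmp[OF N_ob[OF assms(1)] N_ob[OF qo_qe(1)[OF assms(2)]] assms(2)
  is_functorD(2)[OF N assms(1) qo_qe(1)[OF assms(2)] assms(4)] qe_Hom[OF assms(2)]]] assms by blast

lemma qe_Cmp:
 assumes "A \<in> Obj D" "B \<in> Obj D" "P \<in> Obj E" "f \<in> Hom D A B" "g \<in> Hom D B (qo P)"
 shows "Cmp E (qe P) (on_ar N (Cmp D g f)) = Cmp E (Cmp E (qe P) (on_ar N g)) (on_ar N f)"
 unfolding is_functorD(4)[OF N assms(1,2) qo_qe(1)[OF assms(3)] assms(4,5)]
 by (rule E.assoc[of "on_ob N A" "on_ob N B" "on_ob N (qo P)" P])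
  (use assms in \<open>auto intro: N_ob qo_qe(1) qe_Hom is_functorD(2)[OF N]\<close>)

lemma is_functor_quasi_inverse: "is_functor E D quasi_inverse"
 unfolding is_functor_def on_ob_quasi_inverse
proof (intro conjI ballI)
 note [intro] = qo_qe(1) qe_Hom N_ob on_ar_quasi_inverse(1)
 show "qo P \<in> Obj D" if "P \<in> Obj E" for P using that by auto
 show "on_ar quasi_inverse t \<in> Hom D (qo P) (qo P')" if "P \<in> Obj E" "P' \<in> Obj E" "t \<in> Hom E P P'" for P P' t
  using that by (rule on_ar_quasi_inverse)
 show "on_ar quasi_inverse (Idn E P) = Idn D (qo P)" if P: "P \<in> Obj E" for P
  using P on_ar_quasi_inverse(2)[OF P P E.Idn[OF P]] qo_qe(1)[OF P]
   E.Idn_Cmp[OF N_ob[OF qo_qe(1)[OF P]] P qe_Hom[OF P]] E.Cmp_Idn[OF N_ob[OF qo_qe(1)[OF P]] P qe_Hom[OF P]]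
  by (intro lift_eqI[OF qo_qe(1)[OF P] P]) (auto simp: is_functorD(3)[OF N])
 fix P Q R t u assume P: "P \<in> Obj E" "Q \<in> Obj E" "R \<in> Obj E" "t \<in> Hom E P Q" "u \<in> Hom E Q R"
 note t = on_ar_quasi_inverse[OF P(1,2,4)] and u = on_ar_quasi_inverse[OF P(2,3,5)]
 note qP = qo_qe(1)[OF P(1)] and qQ = qo_qe(1)[OF P(2)] and qR = qo_qe(1)[OF P(3)]
 note ut = E.Cmp[OF P(1,2,3,4,5)]
 have "Cmp E (qe R) (on_ar N (Cmp D (on_ar quasi_inverse u) (on_ar quasi_inverse t))) =
   Cmp E (Cmp E u (qe Q)) (on_ar N (on_ar quasi_inverse t))"
  using qe_Cmp[OF qP qQ P(3) t(1) u(1)] u(2) by simp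
 also have "\<dots> = Cmp E u (Cmp E t (qe P))"
  using E.assoc[OF N_ob[OF qP] N_ob[OF qQ] P(2,3) is_functorD(2)[OF N qP qQ t(1)] qe_Hom[OF P(2)] P(5)] t(2) by simp
 also have "\<dots> = Cmp E (Cmp E u t) (qe P)" by (rule E.assoc[OF N_ob[OF qP] P(1-3) qe_Hom[OF P(1)] P(4,5)])
 finally show "on_ar quasi_inverse (Cmp E u t) = Cmp D (on_ar quasi_inverse u) (on_ar quasi_inverse t)"
  using on_ar_quasi_inverse[OF P(1,3) ut] D.Cmp[OF qP qQ qR t(1) u(1)]
  by (intro lift_eqI[OF qP P(3)]) auto
qed

lemma counit: "naturally_isomorphic E E (comp_functor N quasi_inverse) id_functor"
proof -
 have "is_nat_trans E E (comp_functor N quasi_inverse) id_functor qe"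
  unfolding is_nat_trans_def comp_functor_def id_functor_def
  using qe_Hom on_ar_quasi_inverse(2) by (simp add: on_ob_quasi_inverse)
 moreover have "\<forall>P\<in>Obj E. is_iso E (on_ob (comp_functor N quasi_inverse) P) (on_ob id_functor P) (qe P)"
  using qo_qe(2) by (simp add: is_iso_def comp_functor_def id_functor_def on_ob_quasi_inverse)
 ultimately show ?thesis unfolding naturally_isomorphic_def
  using is_functor_comp[OF is_functor_quasi_inverse N] is_functor_id by blast
qed

text \<open>The isomorphism \<open>\<beta> X\<close> is transposed along the universal arrow
  \<open>qe\<close>, and fullness and faithfulness of \<open>N\<close> provide the inverse. With
  \<open>H\<close> the identity this gives the unit of the equivalence; with the nerve as
  \<open>N\<close> it turns an isomorphism between Yoneda and \<open>N\<close> after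
  \<open>H\<close> into one between \<open>quasi_inverse\<close> after Yoneda and
  \<open>H\<close>.\<close>

lemma quasi_inverse_unique:
 assumes B: "is_category B" and H: "is_functor B D H" and iso: "naturally_isomorphic B E F (comp_functor N H)"
 shows "naturally_isomorphic B D (comp_functor quasi_inverse F) H"
proof (rule naturally_isomorphic_sym[OF B D.is_cat])
 from naturally_isomorphic_sym[OF B E.is_cat iso]
 obtain \<beta> where F: "is_functor B E F" and \<beta>: "is_nat_trans B E (comp_functor N H) F \<beta>"
  and inv: "\<And>X. X \<in> Obj B ==> \<exists>g. is_inverse_pair E (on_ob N (on_ob H X)) (on_ob F X) (\<beta> X) g"
  by (auto simp: naturally_isomorphic_def is_iso_def comp_functor_def)
 note HX = is_functorD(1)[OF H] and FX = is_functorD(1)[OF F]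
 have \<beta>1: "\<beta> X \<in> Hom E (on_ob N (on_ob H X)) (on_ob F X)" if "X \<in> Obj B" for X
  using is_nat_transD(1)[OF \<beta> that] by (simp add: comp_functor_def)
 have "\<forall>X\<in>Obj B. \<exists>f. f \<in> Hom D (on_ob H X) (qo (on_ob F X)) \<and> Cmp E (qe (on_ob F X)) (on_ar N f) = \<beta> X"
  using lift[OF HX FX \<beta>1] by blast
 from bchoice[OF this] obtain \<zeta> where
  \<zeta>: "X \<in> Obj B ==> \<zeta> X \<in> Hom D (on_ob H X) (qo (on_ob F X)) \<and> Cmp E (qe (on_ob F X)) (on_ar N (\<zeta> X)) = \<beta> X" for X by blast
 have "is_nat_trans B D H (comp_functor quasi_inverse F) \<zeta>"
  unfolding is_nat_trans_def comp_functor_def cfunctor.simps on_ob_quasi_inverse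
 proof (intro conjI ballI)
  show "\<zeta> X \<in> Hom D (on_ob H X) (qo (on_ob F X))" if "X \<in> Obj B" for X using \<zeta>[OF that] by blast
  fix X Y f assume X: "X \<in> Obj B" and Y: "Y \<in> Obj B" and f: "f \<in> Hom B X Y"
  note z = \<zeta>[OF X, THEN conjunct1] \<zeta>[OF Y, THEN conjunct1] \<zeta>[OF X, THEN conjunct2] \<zeta>[OF Y, THEN conjunct2]
  note Ff = is_functorD(2)[OF F X Y f] and Hf = is_functorD(2)[OF H X Y f]
  note t = on_ar_quasi_inverse[OF FX[OF X] FX[OF Y] Ff]
  note q = qo_qe(1)[OF FX[OF X]] qo_qe(1)[OF FX[OF Y]]
  have "Cmp E (qe (on_ob F Y)) (on_ar N (Cmp D (on_ar quasi_inverse (on_ar F f)) (\<zeta> X))) =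
    Cmp E (Cmp E (on_ar F f) (qe (on_ob F X))) (on_ar N (\<zeta> X))"
   using qe_Cmp[OF HX[OF X] q(1) FX[OF Y] z(1) t(1)] t(2) by simp
  also have "\<dots> = Cmp E (on_ar F f) (\<beta> X)"
   using E.assoc[OF N_ob[OF HX[OF X]] N_ob[OF q(1)] FX[OF X] FX[OF Y] is_functorD(2)[OF N HX[OF X] q(1) z(1)] qe_Hom[OF FX[OF X]] Ff] z(3)
   by simp
  also have "\<dots> = Cmp E (\<beta> Y) (on_ar N (on_ar H f))"
   using is_nat_transD(2)[OF \<beta> X Y f] by (simp add: comp_functor_def)
  also have "\<dots> = Cmp E (qe (on_ob F Y)) (on_ar N (Cmp D (\<zeta> Y) (on_ar H f)))"
   using qe_Cmp[OF HX[OF X] HX[OF Y] FX[OF Y] Hf z(2)] z(4) by simp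
  finally show "Cmp D (on_ar quasi_inverse (on_ar F f)) (\<zeta> X) = Cmp D (\<zeta> Y) (on_ar H f)"
   by (intro lift_eqI[OF HX[OF X] FX[OF Y]] D.Cmp[OF HX[OF X] q z(1) t(1)] D.Cmp[OF HX[OF X] HX[OF Y] q(2) Hf z(2)])
 qed
 moreover have "is_iso D (on_ob H X) (qo (on_ob F X)) (\<zeta> X)" if X: "X \<in> Obj B" for X
 proof -
  obtain b where b: "b \<in> Hom E (on_ob F X) (on_ob N (on_ob H X))" "Cmp E b (\<beta> X) = Idn E (on_ob N (on_ob H X))"
    "Cmp E (\<beta> X) b = Idn E (on_ob F X)"
   using inv[OF X] by (auto simp: is_inverse_pair_def)
  note o = HX[OF X] FX[OF X] qo_qe(1)[OF FX[OF X]]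
  note No = N_ob[OF o(1)] N_ob[OF o(3)]
  note z = \<zeta>[OF X, THEN conjunct1] \<zeta>[OF X, THEN conjunct2]
  note e = qe_Hom[OF o(2)] and Nz = is_functorD(2)[OF N o(1,3) z(1)]
  obtain f where f: "f \<in> Hom D (qo (on_ob F X)) (on_ob H X)" "on_ar N f = Cmp E b (qe (on_ob F X))"
   using full[OF o(3,1) E.Cmp[OF No(2) o(2) No(1) e b(1)]] by blast
  have "Cmp E (qe (on_ob F X)) (on_ar N (Cmp D (\<zeta> X) f)) = Cmp E (\<beta> X) (Cmp E b (qe (on_ob F X)))"
   using qe_Cmp[OF o(3,1,2) f(1) z(1)] z(2) f(2) by simp
  also have "\<dots> = qe (on_ob F X)"
   using E.assoc[OF No(2) o(2) No(1) o(2) e b(1) \<beta>1[OF X]] E.Idn_Cmp[OF No(2) o(2) e] b(3) by simp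
  also have "\<dots> = Cmp E (qe (on_ob F X)) (on_ar N (Idn D (qo (on_ob F X))))"
   using E.Cmp_Idn[OF No(2) o(2) e] by (simp add: is_functorD(3)[OF N o(3)])
  finally have 1: "Cmp D (\<zeta> X) f = Idn D (qo (on_ob F X))"
   by (intro lift_eqI[OF o(3,2)] D.Cmp[OF o(3,1,3) f(1) z(1)] D.Idn o(3))
  have "on_ar N (Cmp D f (\<zeta> X)) = Cmp E b (Cmp E (qe (on_ob F X)) (on_ar N (\<zeta> X)))"
   using is_functorD(4)[OF N o(1,3,1) z(1) f(1)] E.assoc[OF No o(2) No(1) Nz e b(1)] f(2) by simp
  also have "\<dots> = on_ar N (Idn D (on_ob H X))" using z(2) b(2) by (simp add: is_functorD(3)[OF N o(1)])
  finally have 2: "Cmp D f (\<zeta> X) = Idn D (on_ob H X)"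
   by (intro faithful[OF o(1,1)] D.Cmp[OF o(1,3,1) z(1) f(1)] D.Idn o(1))
  show ?thesis using 1 2 z(1) f(1) by (auto simp: is_iso_def is_inverse_pair_def)
 qed
 ultimately show "naturally_isomorphic B D H (comp_functor quasi_inverse F)"
  unfolding naturally_isomorphic_def using H is_functor_comp[OF F is_functor_quasi_inverse]
  by (auto simp: comp_functor_def on_ob_quasi_inverse)
qed

lemma equivalences: "is_equivalence E D quasi_inverse" "is_equivalence D E N"
proof -
 have "naturally_isomorphic D E N (comp_functor N id_functor)"
 proof -
  have "is_nat_trans D E N (comp_functor N id_functor) (\<lambda>A. Idn E (on_ob N A))"
   unfolding is_nat_trans_def comp_functor_def id_functor_def cfunctor.simps
   using E.Idn[OF N_ob] E.Idn_Cmp[OF N_ob N_ob is_functorD(2)[OF N]] E.Cmp_Idn[OF N_ob N_ob is_functorD(2)[OF N]]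
   by simp
  moreover have "is_iso E (on_ob N A) (on_ob N A) (Idn E (on_ob N A))" if "A \<in> Obj D" for A
   using N_ob[OF that] E.Idn_Cmp E.Idn unfolding is_iso_def is_inverse_pair_def by blast
  ultimately show ?thesis using N is_functor_comp[OF is_functor_id N] by (auto simp: naturally_isomorphic_def comp_functor_def id_functor_def)
 qed
 from quasi_inverse_unique[OF D.is_cat is_functor_id this]
 have "naturally_isomorphic D D (comp_functor quasi_inverse N) id_functor" .
 then show "is_equivalence E D quasi_inverse" "is_equivalence D E N"
  unfolding is_equivalence_def using D.is_cat E.is_cat N is_functor_quasi_inverse counit by blast+
qed

end

section \<open>Continuous actions as sheaves on a site of homogeneous sets\<close>

text \<open>A \<open>group_action\<close> is a homomorphism into \<open>BijGroup A\<close>, whose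
  elements are extensional bijections; this explains the clause on
  \<open>extensional\<close>.\<close>

lemma group_action_iff:
 "group_action G A \<alpha> \<longleftrightarrow> group G \<and> (\<forall>g\<in>carrier G. \<alpha> g \<in> extensional A) \<and> (\<forall>g\<in>carrier G. \<forall>x\<in>A. \<alpha> g x \<in> A) \<and>
  (\<forall>x\<in>A. \<alpha> \<one>\<^bsub>G\<^esub> x = x) \<and> (\<forall>g\<in>carrier G. \<forall>h\<in>carrier G. \<forall>x\<in>A. \<alpha> (g \<otimes>\<^bsub>G\<^esub> h) x = \<alpha> g (\<alpha> h x))"
 (is "_ \<longleftrightarrow> ?r")
proof
 assume a: "group_action G A \<alpha>"
 then interpret group_action G A \<alpha> .
 have "group G" using group_hom by (rule group_hom.axioms)
 then show ?r
 proof (intro conjI ballI)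
  show "\<alpha> g \<in> extensional A" if "g \<in> carrier G" for g using bij_prop0[OF that] by (simp add: Bij_def)
  show "\<alpha> \<one>\<^bsub>G\<^esub> x = x" if "x \<in> A" for x using that by (simp add: id_eq_one[symmetric])
 qed (blast intro: element_image composition_rule)+
next
 assume r: ?r
 interpret group G using r by blast
 have inv: "\<alpha> (inv\<^bsub>G\<^esub> g) (\<alpha> g x) = x" "\<alpha> g (\<alpha> (inv\<^bsub>G\<^esub> g) x) = x" if "g \<in> carrier G" "x \<in> A" for g x
 proof -
  have "\<alpha> (inv\<^bsub>G\<^esub> g) (\<alpha> g x) = \<alpha> (inv\<^bsub>G\<^esub> g \<otimes>\<^bsub>G\<^esub> g) x" "\<alpha> g (\<alpha> (inv\<^bsub>G\<^esub> g) x) = \<alpha> (g \<otimes>\<^bsub>G\<^esub> inv\<^bsub>G\<^esub> g) x"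
   using r that inv_closed[OF that(1)] by metis+
  then show "\<alpha> (inv\<^bsub>G\<^esub> g) (\<alpha> g x) = x" "\<alpha> g (\<alpha> (inv\<^bsub>G\<^esub> g) x) = x"
   using r that by simp_all
 qed
 have bij: "\<alpha> g \<in> Bij A" if g: "g \<in> carrier G" for g
 proof -
  have "bij_betw (\<alpha> g) A A"
   by (rule bij_betw_byWitness[where f' = "\<alpha> (inv\<^bsub>G\<^esub> g)"]) (use inv[OF g] r g inv_closed[OF g] in auto)
  then show ?thesis using r g by (auto simp: Bij_def)
 qed
 have "\<alpha> \<in> hom G (BijGroup A)"
 proof (rule homI)
  fix g h assume gh: "g \<in> carrier G" "h \<in> carrier G"
  have "\<alpha> (g \<otimes>\<^bsub>G\<^esub> h) = compose A (\<alpha> g) (\<alpha> h)"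
   by (rule extensionalityI[of _ A]) (use r gh m_closed[OF gh] in \<open>auto simp: compose_def\<close>)
  then show "\<alpha> (g \<otimes>\<^bsub>G\<^esub> h) = \<alpha> g \<otimes>\<^bsub>BijGroup A\<^esub> \<alpha> h" using bij gh by (simp add: BijGroup_def)
 qed (use bij in \<open>simp add: BijGroup_def\<close>)
 then show "group_action G A \<alpha>"
  using r group_BijGroup[of A] by (simp add: group_action_def group_hom_def group_hom_axioms_def)
qed

lemma equivariant_iff:
 "equivariant G A B h \<longleftrightarrow> h \<in> fst A \<rightarrow> fst B \<and> (\<forall>g\<in>carrier G. \<forall>x\<in>fst A. h (snd A g x) = snd B g (h x))"
 by (simp add: equivariant_def split: prod.split)

lemma Cont_Hom: "Hom (Cont \<U> G \<tau>) A B = {(A, h, B) | h. h \<in> extensional (fst A) \<and> equivariant G A B h}"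
 and Cont_Idn: "Idn (Cont \<U> G \<tau>) A = (A, \<lambda>x\<in>fst A. x, A)"
 and Cont_Cmp: "Cmp (Cont \<U> G \<tau>) (B, k, D) (A, h, B') = (A, compose (fst A) k h, D)"
 by (simp_all add: Cont_def)

lemma is_category_Cont: "is_category (Cont \<U> G \<tau>)" (is "is_category ?C")
proof -
 have act: "snd A g x \<in> fst A" if "A \<in> Obj ?C" "g \<in> carrier G" "x \<in> fst A" for A g x
  using that by (auto simp: Cont_def continuous_gset_def group_action_iff)
 have cmp: "compose (fst X) k h \<in> extensional (fst X) \<and> equivariant G X Z (compose (fst X) k h)"
  if "X \<in> Obj ?C" "equivariant G X Y h" "equivariant G Y Z k" for X Y Z h k
  using that act by (auto simp: equivariant_iff compose_def Pi_iff)
 have ext: "compose S f (\<lambda>x\<in>S. x) = f" if "f \<in> extensional S" for S and f :: "'b => 'b"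
  using that by (auto simp: compose_def extensional_def fun_eq_iff)
 have ext': "compose S (\<lambda>y\<in>T. y) f = f" if "f \<in> extensional S" "f \<in> S \<rightarrow> T" for S T and f :: "'b => 'b"
  using that by (auto simp: compose_def extensional_def fun_eq_iff)
 show ?thesis unfolding is_category_def
 proof (intro conjI ballI)
  fix X assume "X \<in> Obj ?C"
  then show "Idn ?C X \<in> Hom ?C X X" using act by (auto simp: Cont_Hom Cont_Idn equivariant_iff)
 next
  fix X Y Z f g assume X: "X \<in> Obj ?C" and "f \<in> Hom ?C X Y" "g \<in> Hom ?C Y Z"
  then obtain h k where "f = (X, h, Y)" "equivariant G X Y h" "g = (Y, k, Z)" "equivariant G Y Z k" by (auto simp: Cont_Hom)
  then show "Cmp ?C g f \<in> Hom ?C X Z" using cmp[OF X, of Y h Z k] by (simp add: Cont_Hom Cont_Cmp)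
 next
  fix X Y f assume "f \<in> Hom ?C X Y"
  then show "Cmp ?C f (Idn ?C X) = f" "Cmp ?C (Idn ?C Y) f = f"
   by (auto simp: Cont_Hom Cont_Idn Cont_Cmp equivariant_iff ext ext')
 next
  fix W X Y Z f g h assume "f \<in> Hom ?C W X" "g \<in> Hom ?C X Y" "h \<in> Hom ?C Y Z"
  then show "Cmp ?C h (Cmp ?C g f) = Cmp ?C (Cmp ?C h g) f"
   by (auto simp: Cont_Hom Cont_Cmp equivariant_iff compose_def fun_eq_iff Pi_iff)
 next
  fix X Y X' Y' show "Hom ?C X Y \<inter> Hom ?C X' Y' \<noteq> {} --> X = X' \<and> Y = Y'"
   by (auto simp: Cont_Hom)
 qed
qed

text \<open>\<open>E\<close> abstracts from the realizations of formulae in the model. The axioms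
  \<open>stab\<close> and \<open>base\<close> tie the topology to stabilizers of points of
  homogeneous fibres, and \<open>transversal\<close> bounds the number of orbits of a fibre, which
  keeps the sets of equivariant maps small.\<close>

locale fibre_functor = site C J \<U> + universe K \<U> + group G
 for C :: "('o, 'a) category" and J and \<U> :: "'u set set" and K :: "'k itself" and G :: "'g monoid" (structure) +
 fixes \<B> :: "'g set set" and \<tau> :: "'g topology"
  and E :: "'o => 'e set" and act :: "'o => 'g => 'e => 'e" and mor :: "'a => 'e => 'e"
 assumes act_in: "X \<in> Obj C ==> g \<in> carrier G ==> x \<in> E X ==> act X g x \<in> E X"
  and act_one: "X \<in> Obj C ==> x \<in> E X ==> act X \<one> x = x"
  and act_mult: "X \<in> Obj C ==> g \<in> carrier G ==> h \<in> carrier G ==> x \<in> E X ==> act X (g \<otimes> h) x = act X g (act X h x)"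
  and mor_in: "X \<in> Obj C ==> Y \<in> Obj C ==> f \<in> Hom C X Y ==> x \<in> E X ==> mor f x \<in> E Y"
  and mor_act: "X \<in> Obj C ==> Y \<in> Obj C ==> f \<in> Hom C X Y ==> g \<in> carrier G ==> x \<in> E X ==>
   mor f (act X g x) = act Y g (mor f x)"
  and mor_Idn: "X \<in> Obj C ==> x \<in> E X ==> mor (Idn C X) x = x"
  and mor_Cmp: "X \<in> Obj C ==> Y \<in> Obj C ==> Z \<in> Obj C ==> f \<in> Hom C X Y ==> f' \<in> Hom C Y Z ==> x \<in> E X ==>
   mor (Cmp C f' f) x = mor f' (mor f x)"
  and mor_inj: "X \<in> Obj C ==> Y \<in> Obj C ==> f \<in> Hom C X Y ==> f' \<in> Hom C X Y ==> (\<And>x. x \<in> E X ==> mor f x = mor f' x) ==> f = f'"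
  and span: "X \<in> Obj C ==> Y \<in> Obj C ==> x \<in> E X ==> y \<in> E Y ==>
   \<exists>Z\<in>Obj C. \<exists>z\<in>E Z. \<exists>p\<in>Hom C Z X. \<exists>q\<in>Hom C Z Y. mor p z = x \<and> mor q z = y \<and>
    (\<forall>v\<in>E Z. \<forall>w\<in>E Z. \<exists>g\<in>carrier G. act Z g v = w)"
  and J_iff: "X \<in> Obj C ==> S \<in> J X \<longleftrightarrow> is_sieve C X S \<and> (\<forall>x\<in>E X. \<exists>Y\<in>Obj C. \<exists>f\<in>S \<inter> Hom C Y X. \<exists>y\<in>E Y. mor f y = x)"
  and stab: "X \<in> Obj C ==> x \<in> E X ==> \<exists>H\<in>\<B>. \<forall>g\<in>H. act X g x = x"
  and base: "H \<in> \<B> ==> \<exists>X\<in>Obj C. \<exists>x\<in>E X. (\<forall>v\<in>E X. \<forall>w\<in>E X. \<exists>g\<in>carrier G. act X g v = w) \<and> H = {g \<in> carrier G. act X g x = x}"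
  and small_fibre: "X \<in> Obj C ==> small (E X)"
  and small_Obj: "Obj C \<lesssim> (UNIV :: 'k set)"
  and transversal: "X \<in> Obj C ==> \<exists>R\<subseteq>E X. R \<lesssim> (UNIV :: 'k set) \<and> (\<forall>x\<in>E X. \<exists>r\<in>R. \<exists>g\<in>carrier G. act X g r = x)"
  and continuous: "continuous_gset G \<tau> (A :: 'u set, \<alpha>) \<longleftrightarrow> group_action G A \<alpha> \<and> (\<forall>x\<in>A. \<exists>H\<in>\<B>. \<forall>g\<in>H. \<alpha> g x = x)"
begin

abbreviation "Ct \<equiv> Cont \<U> G \<tau>"

definition homogeneous :: "'o => bool" where
 "homogeneous X \<longleftrightarrow> (\<forall>v\<in>E X. \<forall>w\<in>E X. \<exists>g\<in>carrier G. act X g v = w)"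

text \<open>Equivariance spreads equality at \<open>z\<close> over the single orbit
  \<open>E Z\<close>.\<close>

lemma agree:
 assumes "Z \<in> Obj C" "X \<in> Obj C" "homogeneous Z" "f \<in> Hom C Z X" "f' \<in> Hom C Z X" "z \<in> E Z" "mor f z = mor f' z"
 shows "f = f'"
proof (rule mor_inj[OF assms(1,2,4,5)])
 fix x assume "x \<in> E Z"
 then obtain g where g: "g \<in> carrier G" "act Z g z = x" using assms(3,6) by (auto simp: homogeneous_def)
 show "mor f x = mor f' x"
  using mor_act[OF assms(1,2,4) g(1) assms(6)] mor_act[OF assms(1,2,5) g(1) assms(6)] assms(7) g(2) by simp
qed

lemma spanE:
 assumes "X \<in> Obj C" "Y \<in> Obj C" "x \<in> E X" "y \<in> E Y"
 obtains Z z p q where "Z \<in> Obj C" "homogeneous Z" "z \<in> E Z" "p \<in> Hom C Z X" "q \<in> Hom C Z Y" "mor p z = x" "mor q z = y"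
 using span[OF assms] unfolding homogeneous_def by blast

lemma Ct_Obj: "A \<in> Obj Ct \<longleftrightarrow> fst A \<in> \<U> \<and> snd A \<in> extensional (carrier G) \<and> group_action G (fst A) (snd A) \<and>
  (\<forall>x\<in>fst A. \<exists>H\<in>\<B>. \<forall>g\<in>H. snd A g x = x)"
 by (cases A) (simp add: Cont_def continuous)

lemma Ct_act:
 assumes "A \<in> Obj Ct"
 shows "g \<in> carrier G ==> x \<in> fst A ==> snd A g x \<in> fst A" "x \<in> fst A ==> snd A \<one> x = x"
  "g \<in> carrier G ==> h \<in> carrier G ==> x \<in> fst A ==> snd A (g \<otimes> h) x = snd A g (snd A h x)"
 using assms by (simp_all add: Ct_Obj group_action_iff)

definition eqv :: "'o => ('g, 'u) gset => ('e => 'u) set" where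
 "eqv X A = {h \<in> E X \<rightarrow>\<^sub>E fst A. \<forall>g\<in>carrier G. \<forall>x\<in>E X. h (act X g x) = snd A g (h x)}"

text \<open>An equivariant map is determined by its values on the representatives \<open>R\<close>
  of the orbits.\<close>

lemma small_eqv:
 assumes X: "X \<in> Obj C" and A: "A \<in> Obj Ct"
 shows "small (eqv X A)"
proof -
 obtain R where R: "R \<subseteq> E X" "R \<lesssim> (UNIV :: 'k set)" "\<forall>x\<in>E X. \<exists>r\<in>R. \<exists>g\<in>carrier G. act X g r = x"
  using transversal[OF X] by blast
 have "inj_on (\<lambda>h. restrict h R) (eqv X A)"
 proof (rule inj_onI)
  fix h h' assume h: "h \<in> eqv X A" "h' \<in> eqv X A" and e: "restrict h R = restrict h' R"
  show "h = h'"
  proof (rule extensionalityI[of _ "E X"])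
   fix x assume "x \<in> E X"
   then obtain r g where r: "r \<in> R" "g \<in> carrier G" "act X g r = x" using R(3) by blast
   have "h r = h' r" using fun_cong[OF e, of r] r(1) by simp
   moreover have "h (act X g r) = snd A g (h r)" "h' (act X g r) = snd A g (h' r)" using h r(1,2) R(1) by (auto simp: eqv_def)
   ultimately show "h x = h' x" using r(3) by simp
  qed (use h in \<open>auto simp: eqv_def PiE_def\<close>)
 qed
 moreover have "(\<lambda>h. restrict h R) ` eqv X A \<subseteq> R \<rightarrow>\<^sub>E fst A" using R(1) by (auto simp: eqv_def PiE_def Pi_def)
 ultimately have "eqv X A \<lesssim> (R \<rightarrow>\<^sub>E fst A)"
  unfolding lepoll_def by (intro exI[of _ "\<lambda>h. restrict h R"] conjI)
 moreover have "fst A \<in> \<U>" using A by (simp add: Ct_Obj)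
 ultimately show ?thesis using small_lepoll[OF small_funs[OF R(2) small_U]] by blast
qed

text \<open>Sections of the nerve have to be elements of \<open>'u\<close>, so equivariant maps are
  coded: \<open>mk\<close> encodes, \<open>el\<close> decodes, and \<open>nv_eqI\<close> compares
  sections pointwise.\<close>

definition mk :: "'o => ('g, 'u) gset => ('e => 'u) => 'u" where
 "mk X A h = cod (eqv X A) (restrict h (E X))"

definition el :: "'o => ('g, 'u) gset => 'u => 'e => 'u" where
 "el X A = inv_into (eqv X A) (cod (eqv X A))"

definition nv :: "('g, 'u) gset => ('o, 'a, 'u) presheaf" where
 "nv A = mkpsh C (\<lambda>X. cod (eqv X A) ` eqv X A) (\<lambda>f s. mk (cdom C f) A (\<lambda>w. el (ccod C f) A s (mor f w)))"

lemma nv_ob: "X \<in> Obj C ==> on_ob (nv A) X = cod (eqv X A) ` eqv X A"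
 by (simp add: nv_def on_ob_mkpsh)

lemma mk:
 assumes X: "X \<in> Obj C" and A: "A \<in> Obj Ct" and h: "\<And>x. x \<in> E X ==> h x \<in> fst A"
  "\<And>g x. g \<in> carrier G ==> x \<in> E X ==> h (act X g x) = snd A g (h x)"
 shows "mk X A h \<in> on_ob (nv A) X" "x \<in> E X ==> el X A (mk X A h) x = h x"
proof -
 have r: "restrict h (E X) \<in> eqv X A" using h act_in[OF X] by (simp add: eqv_def)
 then show "mk X A h \<in> on_ob (nv A) X" by (simp add: nv_ob[OF X] mk_def)
 show "el X A (mk X A h) x = h x" if "x \<in> E X"
  using that unfolding el_def mk_def by (simp add: inv_into_f_f[OF cod(1)[OF small_eqv[OF X A]] r])
qed

lemma el_eqv: "X \<in> Obj C ==> s \<in> on_ob (nv A) X ==> el X A s \<in> eqv X A"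
 unfolding nv_ob el_def by (rule inv_into_into)

lemma el:
 assumes "X \<in> Obj C" "s \<in> on_ob (nv A) X" "x \<in> E X"
 shows "el X A s x \<in> fst A" "g \<in> carrier G ==> el X A s (act X g x) = snd A g (el X A s x)"
 using el_eqv[OF assms(1,2)] assms(3) by (auto simp: eqv_def)

lemma nv_eqI:
 assumes X: "X \<in> Obj C" and s: "s \<in> on_ob (nv A) X" "t \<in> on_ob (nv A) X" and e: "\<And>x. x \<in> E X ==> el X A s x = el X A t x"
 shows "s = t"
proof -
 have "el X A s = el X A t"
  using el_eqv[OF X s(1)] el_eqv[OF X s(2)] e by (intro extensionalityI[of _ "E X"]) (auto simp: eqv_def PiE_def)
 then show ?thesis using s unfolding el_def nv_ob[OF X] using inv_into_injective by metis
qed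

lemma res_nv:
 assumes "W \<in> Obj C" "Z \<in> Obj C" "f \<in> Hom C W Z" "A \<in> Obj Ct" "s \<in> on_ob (nv A) Z"
 shows "mk W A (\<lambda>w. el Z A s (mor f w)) \<in> on_ob (nv A) W"
  "w \<in> E W ==> el W A (mk W A (\<lambda>w. el Z A s (mor f w))) w = el Z A s (mor f w)"
 using mk[OF assms(1,4), of "\<lambda>w. el Z A s (mor f w)"] el[OF assms(2,5) mor_in[OF assms(1-3)]] mor_act[OF assms(1-3)] by auto

lemma nv_PSh:
 assumes A: "A \<in> Obj Ct"
 shows "nv A \<in> Obj PSh"
 unfolding nv_def
proof (rule mkpsh_PSh)
 show "cod (eqv X A) ` eqv X A \<in> \<U>" if "X \<in> Obj C" for X by (rule cod(2)[OF small_eqv[OF that A]])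
 note m = nv_ob[symmetric]
 show "mk (cdom C g) A (\<lambda>w. el (ccod C g) A s (mor g w)) \<in> cod (eqv W A) ` eqv W A"
  if "W \<in> Obj C" "Z \<in> Obj C" "g \<in> Hom C W Z" "s \<in> cod (eqv Z A) ` eqv Z A" for W Z g s
  using res_nv(1)[OF that(1-3) A] that(4) by (simp add: nv_ob that cdom_eq[OF that(1-3)] ccod_eq[OF that(1-3)])
 show "mk (cdom C (Idn C X)) A (\<lambda>w. el (ccod C (Idn C X)) A s (mor (Idn C X) w)) = s"
  if X: "X \<in> Obj C" and s: "s \<in> cod (eqv X A) ` eqv X A" for X s
  using s unfolding cdom_eq[OF X X Idn[OF X]] ccod_eq[OF X X Idn[OF X]] m[OF X]
  by (intro nv_eqI[OF X res_nv(1)[OF X X Idn[OF X] A]]) (auto simp: res_nv(2)[OF X X Idn[OF X] A] mor_Idn[OF X])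
 show "mk (cdom C (Cmp C g h)) A (\<lambda>w. el (ccod C (Cmp C g h)) A s (mor (Cmp C g h) w)) =
   mk (cdom C h) A (\<lambda>w. el (ccod C h) A (mk (cdom C g) A (\<lambda>w. el (ccod C g) A s (mor g w))) (mor h w))"
  if o: "V \<in> Obj C" "W \<in> Obj C" "Z \<in> Obj C" and g: "g \<in> Hom C W Z" and h: "h \<in> Hom C V W"
   and s: "s \<in> cod (eqv Z A) ` eqv Z A" for V W Z g h s
 proof -
  note gh = Cmp[OF o h g]
  have s: "s \<in> on_ob (nv A) Z" using s by (simp add: nv_ob o)
  note t = res_nv[OF o(2,3) g A s]
  show ?thesis unfolding cdom_eq[OF o(1,3) gh] ccod_eq[OF o(1,3) gh] cdom_eq[OF o(1,2) h] ccod_eq[OF o(1,2) h]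
    cdom_eq[OF o(2,3) g] ccod_eq[OF o(2,3) g]
   by (rule nv_eqI[OF o(1) res_nv(1)[OF o(1,3) gh A s] res_nv(1)[OF o(1,2) h A t(1)]])
    (simp add: res_nv(2)[OF o(1,3) gh A s] res_nv(2)[OF o(1,2) h A t(1)] t(2) mor_in[OF o(1,2) h] mor_Cmp[OF o h g])
 qed
qed

lemma el_res:
 assumes "W \<in> Obj C" "Z \<in> Obj C" "f \<in> Hom C W Z" "A \<in> Obj Ct" "s \<in> on_ob (nv A) Z" "w \<in> E W"
 shows "el W A (res (nv A) f s) w = el Z A s (mor f w)"
proof -
 have "res (nv A) f s = mk W A (\<lambda>w. el Z A s (mor f w))"
  unfolding nv_def using assms by (subst res_mkpsh[OF assms(1-3)]) (simp_all add: nv_ob cdom_eq[OF assms(1-3)] ccod_eq[OF assms(1-3)])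
 then show ?thesis using res_nv(2)[OF assms] by simp
qed

text \<open>Joint surjectivity of a covering sieve prescribes a value at each point
  \<open>x\<close>. Two prescriptions are compared on a span over the two points above
  \<open>x\<close>; its composites to \<open>X\<close> coincide by \<open>agree\<close>, so matching
  applies.\<close>

lemma nv_sheaf:
 assumes A: "A \<in> Obj Ct"
 shows "is_sheaf C J (nv A)"
 unfolding is_sheaf_def
proof (intro ballI allI impI)
 fix X S \<xi> assume X: "X \<in> Obj C" and S: "S \<in> J X" and \<xi>: "matching_family C (nv A) X S \<xi>"
 have sieve: "is_sieve C X S" and cov: "\<And>x. x \<in> E X ==> \<exists>Y\<in>Obj C. \<exists>f\<in>S \<inter> Hom C Y X. \<exists>y\<in>E Y. mor f y = x"
  using S J_iff[OF X] by auto
 have \<xi>_in: "\<xi> f \<in> on_ob (nv A) Y" if "Y \<in> Obj C" "f \<in> S" "f \<in> Hom C Y X" for Y f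
  using \<xi> that by (auto simp: matching_family_def)
 have \<xi>_res: "res (nv A) g (\<xi> f) = \<xi> (Cmp C f g)" if "Y \<in> Obj C" "Z \<in> Obj C" "f \<in> S" "f \<in> Hom C Y X" "g \<in> Hom C Z Y" for Y Z f g
  using \<xi> that by (auto simp: matching_family_def)
 define R where "R x u \<longleftrightarrow> (\<exists>Y\<in>Obj C. \<exists>f\<in>S \<inter> Hom C Y X. \<exists>y\<in>E Y. mor f y = x \<and> u = el Y A (\<xi> f) y)" for x u
 have R_unique: "u = u'" if "R x u" "R x u'" for x u u'
 proof -
  obtain Y f y where y: "Y \<in> Obj C" "f \<in> S" "f \<in> Hom C Y X" "y \<in> E Y" "mor f y = x" "u = el Y A (\<xi> f) y"
   using \<open>R x u\<close> by (auto simp: R_def)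
  obtain Y' f' y' where y': "Y' \<in> Obj C" "f' \<in> S" "f' \<in> Hom C Y' X" "y' \<in> E Y'" "mor f' y' = x" "u' = el Y' A (\<xi> f') y'"
   using \<open>R x u'\<close> by (auto simp: R_def)
  obtain Z z p q where z: "Z \<in> Obj C" "homogeneous Z" "z \<in> E Z" "p \<in> Hom C Z Y" "q \<in> Hom C Z Y'" "mor p z = y" "mor q z = y'"
   using y(1) y'(1) y(4) y'(4) by (rule spanE)
  have "Cmp C f p = Cmp C f' q"
   by (rule agree[OF z(1) X z(2) Cmp[OF z(1) y(1) X z(4) y(3)] Cmp[OF z(1) y'(1) X z(5) y'(3)] z(3)])
    (simp add: mor_Cmp[OF z(1) y(1) X z(4) y(3) z(3)] mor_Cmp[OF z(1) y'(1) X z(5) y'(3) z(3)] z(6,7) y(5) y'(5))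
  then have "res (nv A) p (\<xi> f) = res (nv A) q (\<xi> f')"
   using \<xi>_res[OF y(1) z(1) y(2,3) z(4)] \<xi>_res[OF y'(1) z(1) y'(2,3) z(5)] by simp
  then show ?thesis
   using el_res[OF z(1) y(1) z(4) A \<xi>_in[OF y(1-3)] z(3)] el_res[OF z(1) y'(1) z(5) A \<xi>_in[OF y'(1-3)] z(3)] z(6,7) y(6) y'(6)
   by simp
 qed
 define h where "h x = (THE u. R x u)" for x
 have h: "R x u ==> h x = u" for x u unfolding h_def using R_unique by (intro the_equality)
 have R_ex: "\<exists>u. R x u" if "x \<in> E X" for x using cov[OF that] unfolding R_def by blast
 have R_in: "u \<in> fst A \<and> (\<forall>g\<in>carrier G. R (act X g x) (snd A g u))" if "R x u" for x u
 proof -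
  obtain Y f y where y: "Y \<in> Obj C" "f \<in> S" "f \<in> Hom C Y X" "y \<in> E Y" "mor f y = x" "u = el Y A (\<xi> f) y"
   using \<open>R x u\<close> by (auto simp: R_def)
  have "R (act X g x) (snd A g u)" if g: "g \<in> carrier G" for g
   unfolding R_def using y mor_act[OF y(1) X y(3) g y(4)] el(2)[OF y(1) \<xi>_in[OF y(1-3)] y(4) g] act_in[OF y(1) g y(4)]
   by (intro bexI[of _ Y] bexI[of _ f] bexI[of _ "act Y g y"]) auto
  then show ?thesis using el(1)[OF y(1) \<xi>_in[OF y(1-3)] y(4)] y(6) by blast
 qed
 have hA: "h x \<in> fst A" "g \<in> carrier G ==> h (act X g x) = snd A g (h x)" if x: "x \<in> E X" for g x
 proof -
  obtain u where u: "R x u" using R_ex[OF x] by blast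
  then show "h x \<in> fst A" "g \<in> carrier G ==> h (act X g x) = snd A g (h x)" using R_in[OF u] h[OF u] h by auto
 qed
 have m: "mk X A h \<in> on_ob (nv A) X" "\<And>x. x \<in> E X ==> el X A (mk X A h) x = h x" using mk[OF X A, of h] hA by blast+
 show "\<exists>!s. s \<in> on_ob (nv A) X \<and> (\<forall>f\<in>S. res (nv A) f s = \<xi> f)"
 proof (intro ex1I conjI ballI)
  show "mk X A h \<in> on_ob (nv A) X" by (rule m(1))
  fix f assume f: "f \<in> S"
  then obtain Y where Y: "Y \<in> Obj C" "f \<in> Hom C Y X" using sieve by (auto simp: is_sieve_def)
  show "res (nv A) f (mk X A h) = \<xi> f"
  proof (rule nv_eqI[OF Y(1) res_in[OF nv_PSh[OF A] Y(1) X Y(2) m(1)] \<xi>_in[OF Y(1) f Y(2)]])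
   fix y assume y: "y \<in> E Y"
   have "R (mor f y) (el Y A (\<xi> f) y)" using Y f y by (auto simp: R_def)
   then show "el Y A (res (nv A) f (mk X A h)) y = el Y A (\<xi> f) y"
    using el_res[OF Y(1) X Y(2) A m(1) y] m(2)[OF mor_in[OF Y(1) X Y(2) y]] h by simp
  qed
 next
  fix t assume t: "t \<in> on_ob (nv A) X \<and> (\<forall>f\<in>S. res (nv A) f t = \<xi> f)"
  show "t = mk X A h"
  proof (rule nv_eqI[OF X _ m(1)])
   fix x assume x: "x \<in> E X"
   obtain Y f y where y: "Y \<in> Obj C" "f \<in> S" "f \<in> Hom C Y X" "y \<in> E Y" "mor f y = x" using cov[OF x] by blast
   have "R x (el Y A (\<xi> f) y)" using y by (auto simp: R_def)
   then show "el X A t x = el X A (mk X A h) x"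
    using el_res[OF y(1) X y(3) A _ y(4), of t] t y(2,5) h m(2)[OF x] by simp
  qed (use t in blast)
 qed
qed

lemma nv_Sh: "A \<in> Obj Ct ==> nv A \<in> Obj Sh"
 using nv_PSh nv_sheaf by (simp add: Sh_Obj)

text \<open>A member of the base fixes \<open>c\<close>, and it is the stabilizer of a point
  \<open>x\<close> of a homogeneous fibre; the orbit map from \<open>x\<close> to \<open>c\<close>
  is therefore a section of the nerve through \<open>c\<close>.\<close>

lemma point:
 assumes A: "A \<in> Obj Ct" and c: "c \<in> fst A"
 shows "\<exists>X\<in>Obj C. \<exists>x\<in>E X. \<exists>s\<in>on_ob (nv A) X. el X A s x = c"
proof -
 obtain H where H: "H \<in> \<B>" "\<forall>g\<in>H. snd A g c = c" using A c by (auto simp: Ct_Obj)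
 obtain X x where X: "X \<in> Obj C" "x \<in> E X" "\<forall>v\<in>E X. \<forall>w\<in>E X. \<exists>g\<in>carrier G. act X g v = w" "H = {g \<in> carrier G. act X g x = x}"
  using base[OF H(1)] by blast
 \<comment> \<open>Sends \<open>act X g x\<close> to \<open>snd A g c\<close>; two choices of
   \<open>g\<close> differ by an element of \<open>H\<close>, which fixes \<open>c\<close>.\<close>
 define h where "h v = snd A (SOME g. g \<in> carrier G \<and> act X g x = v) c" for v
 have h: "h (act X g x) = snd A g c" if g: "g \<in> carrier G" for g
 proof -
  define k where "k = (SOME k. k \<in> carrier G \<and> act X k x = act X g x)"
  have k: "k \<in> carrier G \<and> act X k x = act X g x" unfolding k_def by (rule someI[of _ g]) (use g in blast)
  have "act X (inv g \<otimes> k) x = act X (inv g) (act X g x)" using act_mult[OF X(1) inv_closed[OF g] _ X(2), of k] k by simp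
  also have "\<dots> = x" using act_mult[OF X(1) inv_closed[OF g] g X(2)] g act_one[OF X(1,2)] by simp
  finally have "snd A (inv g \<otimes> k) c = c" using H(2) X(4) g k by auto
  then have "snd A g (snd A (inv g \<otimes> k) c) = snd A g c" by simp
  then have "snd A (g \<otimes> (inv g \<otimes> k)) c = snd A g c" using Ct_act(3)[OF A g _ c, of "inv g \<otimes> k"] g k by simp
  then have "snd A k c = snd A g c" using g k by (simp add: m_assoc[symmetric])
  then show ?thesis by (simp add: h_def k_def)
 qed
 have orb: "\<exists>g\<in>carrier G. v = act X g x" if "v \<in> E X" for v using bspec[OF bspec[OF X(3,2)] that] by metis
 have hA: "h v \<in> fst A" "g \<in> carrier G ==> h (act X g v) = snd A g (h v)" if v: "v \<in> E X" for g v
 proof -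
  obtain k where k: "k \<in> carrier G" "v = act X k x" using orb[OF v] by blast
  show "h v \<in> fst A" using h[OF k(1)] Ct_act(1)[OF A k(1) c] k(2) by simp
  show "h (act X g v) = snd A g (h v)" if g: "g \<in> carrier G"
   using h[OF m_closed[OF g k(1)]] h[OF k(1)] act_mult[OF X(1) g k(1) X(2)] Ct_act(3)[OF A g k(1) c] k(2) by simp
 qed
 have "el X A (mk X A h) x = c" using mk(2)[OF X(1) A hA X(2)] h[OF one_closed] act_one[OF X(1,2)] Ct_act(2)[OF A c] by simp
 then show ?thesis using mk(1)[OF X(1) A hA] X(1,2) by blast
qed

definition nerve :: "(('g, 'u) gset, ('g, 'u) gset \<times> ('u => 'u) \<times> ('g, 'u) gset, ('o, 'a, 'u) presheaf, ('o, 'a, 'u) presheaf_map) cfunctor" where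
 "nerve = \<lparr>on_ob = nv, on_ar = (\<lambda>(A, h, B). mkmap C (nv A) (nv B) (\<lambda>X s. mk X B (\<lambda>x. h (el X A s x))))\<rparr>"

lemma on_ob_nerve: "on_ob nerve = nv"
 by (simp add: nerve_def)

lemma nerve_ar:
 assumes A: "A \<in> Obj Ct" and B: "B \<in> Obj Ct" and h: "equivariant G A B h"
 shows "on_ar nerve (A, h, B) \<in> Hom PSh (nv A) (nv B)"
  "X \<in> Obj C ==> s \<in> on_ob (nv A) X ==> x \<in> E X ==> el X B (tapp (on_ar nerve (A, h, B)) X s) x = h (el X A s x)"
proof -
 have m: "mk X B (\<lambda>x. h (el X A s x)) \<in> on_ob (nv B) X" "x \<in> E X ==> el X B (mk X B (\<lambda>x. h (el X A s x))) x = h (el X A s x)"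
  if "X \<in> Obj C" "s \<in> on_ob (nv A) X" for X s x
  using mk[OF that(1) B, of "\<lambda>x. h (el X A s x)"] el[OF that] h by (auto simp: equivariant_iff Pi_iff)
 show "el X B (tapp (on_ar nerve (A, h, B)) X s) x = h (el X A s x)" if "X \<in> Obj C" "s \<in> on_ob (nv A) X" "x \<in> E X"
  using m[OF that(1,2)] that by (simp add: nerve_def tapp_mkmap)
 have "mkmap C (nv A) (nv B) (\<lambda>X s. mk X B (\<lambda>x. h (el X A s x))) \<in> Hom PSh (nv A) (nv B)"
 proof (rule mkmap_Hom[OF nv_PSh[OF A] nv_PSh[OF B] m(1)])
  fix W Z g s assume o: "W \<in> Obj C" "Z \<in> Obj C" "g \<in> Hom C W Z" and s: "s \<in> on_ob (nv A) Z"
  note rs = res_in[OF nv_PSh[OF A] o s]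
  show "mk W B (\<lambda>x. h (el W A (res (nv A) g s) x)) = res (nv B) g (mk Z B (\<lambda>x. h (el Z A s x)))"
   by (rule nv_eqI[OF o(1) m(1)[OF o(1) rs] res_in[OF nv_PSh[OF B] o m(1)[OF o(2) s]]])
    (simp add: m(2)[OF o(1) rs] el_res[OF o A s] el_res[OF o B m(1)[OF o(2) s]] m(2)[OF o(2) s] mor_in[OF o])
 qed
 then show "on_ar nerve (A, h, B) \<in> Hom PSh (nv A) (nv B)" by (simp add: nerve_def)
qed

lemma is_functor_nerve: "is_functor Ct Sh nerve"
 unfolding is_functor_def on_ob_nerve Sh_simps
proof (intro conjI ballI)
 show "nv A \<in> Obj Sh" if "A \<in> Obj Ct" for A by (rule nv_Sh[OF that])
 show "on_ar nerve f \<in> Hom PSh (nv A) (nv B)" if "A \<in> Obj Ct" "B \<in> Obj Ct" "f \<in> Hom Ct A B" for A B f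
  using that nerve_ar(1)[OF that(1,2)] by (auto simp: Cont_Hom)
 interpret PSh: cat PSh by unfold_locales (rule is_category_PSh)
 interpret Ct: cat Ct by unfold_locales (rule is_category_Cont)
 show "on_ar nerve (Idn Ct A) = Idn PSh (nv A)" if A: "A \<in> Obj Ct" for A
 proof -
  have e: "equivariant G A A (\<lambda>x\<in>fst A. x)" using Ct_act(1)[OF A] by (simp add: equivariant_iff)
  show ?thesis unfolding Cont_Idn
  proof (rule PSh_Hom_eqI[OF nerve_ar(1)[OF A A e] PSh.Idn[OF nv_PSh[OF A]]])
   fix Z s assume Z: "Z \<in> Obj C" and s: "s \<in> on_ob (nv A) Z"
   show "tapp (on_ar nerve (A, \<lambda>x\<in>fst A. x, A)) Z s = tapp (Idn PSh (nv A)) Z s"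
    unfolding tapp_Idn[OF Z s]
    by (rule nv_eqI[OF Z tapp_in[OF nerve_ar(1)[OF A A e] Z s] s]) (simp add: nerve_ar(2)[OF A A e Z s] el(1)[OF Z s])
  qed
 qed
 show "on_ar nerve (Cmp Ct g f) = Cmp PSh (on_ar nerve g) (on_ar nerve f)"
  if A: "A \<in> Obj Ct" and B: "B \<in> Obj Ct" and D: "D \<in> Obj Ct" and f: "f \<in> Hom Ct A B" and g: "g \<in> Hom Ct B D" for A B D f g
 proof -
  obtain h k where h: "f = (A, h, B)" "equivariant G A B h" and k: "g = (B, k, D)" "equivariant G B D k"
   using f g by (auto simp: Cont_Hom)
  have e: "equivariant G A D (compose (fst A) k h)" using Ct.Cmp[OF A B D f g] by (simp add: h(1) k(1) Cont_Cmp Cont_Hom)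
  note nh = nerve_ar[OF A B h(2)] and nk = nerve_ar[OF B D k(2)]
  show ?thesis unfolding h(1) k(1) Cont_Cmp
  proof (rule PSh_Hom_eqI[OF nerve_ar(1)[OF A D e] PSh.Cmp[OF nv_PSh[OF A] nv_PSh[OF B] nv_PSh[OF D] nh(1) nk(1)]])
   fix Z s assume Z: "Z \<in> Obj C" and s: "s \<in> on_ob (nv A) Z"
   note t = tapp_in[OF nh(1) Z s]
   show "tapp (on_ar nerve (A, compose (fst A) k h, D)) Z s = tapp (Cmp PSh (on_ar nerve (B, k, D)) (on_ar nerve (A, h, B))) Z s"
    unfolding tapp_Cmp[OF nh(1) nk(1) Z s]
    by (rule nv_eqI[OF Z tapp_in[OF nerve_ar(1)[OF A D e] Z s] tapp_in[OF nk(1) Z t]])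
     (simp add: nerve_ar(2)[OF A D e Z s] nk(2)[OF Z t] nh(2)[OF Z s] el(1)[OF Z s] compose_eq)
  qed
 qed
qed

lemma nerve_faithful:
 assumes A: "A \<in> Obj Ct" and B: "B \<in> Obj Ct" and f: "f \<in> Hom Ct A B" "f' \<in> Hom Ct A B" and e: "on_ar nerve f = on_ar nerve f'"
 shows "f = f'"
proof -
 obtain h h' where h: "f = (A, h, B)" "equivariant G A B h" "h \<in> extensional (fst A)"
  and h': "f' = (A, h', B)" "equivariant G A B h'" "h' \<in> extensional (fst A)"
  using f by (auto simp: Cont_Hom)
 have "h = h'"
 proof (rule extensionalityI[OF h(3) h'(3)])
  fix c assume "c \<in> fst A"
  then obtain X x s where x: "X \<in> Obj C" "x \<in> E X" "s \<in> on_ob (nv A) X" "el X A s x = c" using point[OF A] by blast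
  show "h c = h' c" using nerve_ar(2)[OF A B h(2) x(1,3,2)] nerve_ar(2)[OF A B h'(2) x(1,3,2)] e x(4) h(1) h'(1) by simp
 qed
 then show ?thesis using h(1) h'(1) by simp
qed

text \<open>The image of \<open>c\<close> is the value of \<open>t\<close> at any section through
  \<open>c\<close>, which exists by \<open>point\<close>. Two such sections become equal on a
  homogeneous span, and naturality of \<open>t\<close> makes the values agree.\<close>

lemma nerve_full:
 assumes A: "A \<in> Obj Ct" and B: "B \<in> Obj Ct" and t: "t \<in> Hom PSh (nv A) (nv B)"
 shows "\<exists>f\<in>Hom Ct A B. on_ar nerve f = t"
proof -
 define R where "R c d \<longleftrightarrow> (\<exists>X\<in>Obj C. \<exists>x\<in>E X. \<exists>s\<in>on_ob (nv A) X. el X A s x = c \<and> d = el X B (tapp t X s) x)" for c d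
 have R_unique: "d = d'" if "R c d" "R c d'" for c d d'
 proof -
  obtain X x s where x: "X \<in> Obj C" "x \<in> E X" "s \<in> on_ob (nv A) X" "el X A s x = c" "d = el X B (tapp t X s) x"
   using \<open>R c d\<close> by (auto simp: R_def)
  obtain Y y u where y: "Y \<in> Obj C" "y \<in> E Y" "u \<in> on_ob (nv A) Y" "el Y A u y = c" "d' = el Y B (tapp t Y u) y"
   using \<open>R c d'\<close> by (auto simp: R_def)
  obtain Z z p q where z: "Z \<in> Obj C" "homogeneous Z" "z \<in> E Z" "p \<in> Hom C Z X" "q \<in> Hom C Z Y" "mor p z = x" "mor q z = y"
   using x(1) y(1) x(2) y(2) by (rule spanE)
  note rp = res_in[OF nv_PSh[OF A] z(1) x(1) z(4) x(3)] and rq = res_in[OF nv_PSh[OF A] z(1) y(1) z(5) y(3)]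
  have e: "el Z A (res (nv A) p s) z = el Z A (res (nv A) q u) z"
   using el_res[OF z(1) x(1) z(4) A x(3) z(3)] el_res[OF z(1) y(1) z(5) A y(3) z(3)] z(6,7) x(4) y(4) by simp
  \<comment> \<open>Equality at the point \<open>z\<close> spreads over the homogeneous
    fibre.\<close>
  have "res (nv A) p s = res (nv A) q u"
  proof (rule nv_eqI[OF z(1) rp rq])
   fix v assume "v \<in> E Z"
   then obtain g where g: "g \<in> carrier G" "act Z g z = v" using z(2,3) by (auto simp: homogeneous_def)
   show "el Z A (res (nv A) p s) v = el Z A (res (nv A) q u) v"
    using el(2)[OF z(1) rp z(3) g(1)] el(2)[OF z(1) rq z(3) g(1)] e g(2)[symmetric] by simp
  qed
  then have "res (nv B) p (tapp t X s) = res (nv B) q (tapp t Y u)"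
   using tapp_natural[OF t nv_PSh[OF A] nv_PSh[OF B] z(1) x(1) z(4) x(3)] tapp_natural[OF t nv_PSh[OF A] nv_PSh[OF B] z(1) y(1) z(5) y(3)]
   by simp
  then show ?thesis
   using el_res[OF z(1) x(1) z(4) B tapp_in[OF t x(1,3)] z(3)] el_res[OF z(1) y(1) z(5) B tapp_in[OF t y(1,3)] z(3)] z(6,7) x(5) y(5)
   by simp
 qed
 define h where "h = (\<lambda>c\<in>fst A. THE d. R c d)"
 have h: "h c = d" if "R c d" "c \<in> fst A" for c d using that R_unique by (auto simp: h_def)
 have hc: "h c \<in> fst B \<and> (\<forall>g\<in>carrier G. h (snd A g c) = snd B g (h c))" if c: "c \<in> fst A" for c
 proof -
  obtain X x s where x: "X \<in> Obj C" "x \<in> E X" "s \<in> on_ob (nv A) X" "el X A s x = c" using point[OF A c] by blast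
  note ts = tapp_in[OF t x(1,3)]
  have 1: "h c = el X B (tapp t X s) x" using x c by (intro h) (auto simp: R_def)
  have "h (snd A g c) = snd B g (h c)" if g: "g \<in> carrier G" for g
  proof -
   have "el X A s (act X g x) = snd A g c" using el(2)[OF x(1,3,2) g] x(4) by simp
   then have "h (snd A g c) = el X B (tapp t X s) (act X g x)"
    using x act_in[OF x(1) g x(2)] Ct_act(1)[OF A g c] by (intro h) (auto simp: R_def)
   then show ?thesis using el(2)[OF x(1) ts x(2) g] 1 by simp
  qed
  then show ?thesis using el(1)[OF x(1) ts x(2)] 1 by simp
 qed
 then have e: "equivariant G A B h" by (auto simp: equivariant_iff)
 have "on_ar nerve (A, h, B) = t"
 proof (rule PSh_Hom_eqI[OF nerve_ar(1)[OF A B e] t])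
  fix Z s assume Z: "Z \<in> Obj C" and s: "s \<in> on_ob (nv A) Z"
  show "tapp (on_ar nerve (A, h, B)) Z s = tapp t Z s"
  proof (rule nv_eqI[OF Z tapp_in[OF nerve_ar(1)[OF A B e] Z s] tapp_in[OF t Z s]])
   fix x assume x: "x \<in> E Z"
   have "h (el Z A s x) = el Z B (tapp t Z s) x" using Z s x el(1)[OF Z s x] by (intro h) (auto simp: R_def)
   then show "el Z B (tapp (on_ar nerve (A, h, B)) Z s) x = el Z B (tapp t Z s) x" using nerve_ar(2)[OF A B e Z s x] by simp
  qed
 qed
 moreover have "(A, h, B) \<in> Hom Ct A B" using e by (auto simp: Cont_Hom h_def)
 ultimately show ?thesis by blast
qed

end

section \<open>Essential surjectivity of the nerve\<close>

context fibre_functor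
begin

text \<open>The set with action is the colimit of \<open>P\<close> over the category of elements of the fibres,
 represented by triples \<open>(X, a, s)\<close> with \<open>a \<in> E X\<close> and \<open>s \<in> P X\<close>.\<close>

lemma nerve_es:
 assumes P: "P \<in> Obj Sh"
 shows "\<exists>A\<in>Obj Ct. \<exists>e e'. is_inverse_pair Sh (nv A) P e e'"
proof -
 have PP: "P \<in> Obj PSh" and sheaf: "is_sheaf C J P" using P by (simp_all add: Sh_Obj)
 define T where "T = Sigma (Obj C) (\<lambda>X. E X \<times> on_ob P X)"
 \<comment> \<open>Two triples are identified if the restrictions of their sections to one
   homogeneous object over both agree. By \<open>span\<close> and \<open>agree\<close> this one-step
   relation is already transitive, so no chains are needed to describe the colimit.\<close>
 define rl where "rl u v \<longleftrightarrow> (case u of (X, a, s) => case v of (Y, b, t) => \<exists>W\<in>Obj C. \<exists>w\<in>E W. \<exists>f\<in>Hom C W X. \<exists>g\<in>Hom C W Y.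
  homogeneous W \<and> mor f w = a \<and> mor g w = b \<and> res P f s = res P g t)" for u v
 have rlI: "rl (X, a, s) (Y, b, t)" if "W \<in> Obj C" "homogeneous W" "w \<in> E W" "f \<in> Hom C W X" "g \<in> Hom C W Y" "mor f w = a" "mor g w = b"
  "res P f s = res P g t" for X a s Y b t W w f g
  unfolding rl_def using that by blast
 have rlE: thesis if "rl (X, a, s) (Y, b, t)" "\<And>W w f g. W \<in> Obj C ==> homogeneous W ==> w \<in> E W ==> f \<in> Hom C W X ==> g \<in> Hom C W Y ==>
   mor f w = a ==> mor g w = b ==> res P f s = res P g t ==> thesis" for X a s Y b t thesis
  using that unfolding rl_def by blast
 define r where "r = {(u, v). u \<in> T \<and> v \<in> T \<and> rl u v}"
 have "equiv T r"
 proof (rule equivI)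
  show "r \<subseteq> T \<times> T" by (auto simp: r_def)
  show "refl_on T r"
  proof (rule refl_onI)
   fix u assume "u \<in> T"
   then obtain X a s where u: "u = (X, a, s)" "X \<in> Obj C" "a \<in> E X" "s \<in> on_ob P X" by (auto simp: T_def)
   obtain Z z p q where z: "Z \<in> Obj C" "homogeneous Z" "z \<in> E Z" "p \<in> Hom C Z X" "q \<in> Hom C Z X" "mor p z = a" "mor q z = a"
    using u(2,2,3,3) by (rule spanE)
   show "(u, u) \<in> r" using \<open>u \<in> T\<close> rlI[OF z(1-4,4,6,6) refl] u(1) by (simp add: r_def)
  qed
  show "sym r"
  proof (rule symI)
   fix u v assume "(u, v) \<in> r"
   then show "(v, u) \<in> r" by (cases u; cases v) (auto simp: r_def elim!: rlE intro: rlI)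
  qed
  show "trans r"
  proof (rule transI)
   fix u u' u'' assume u: "(u, u') \<in> r" "(u', u'') \<in> r"
   then obtain X a s X' a' s' X'' a'' s'' where e: "u = (X, a, s)" "u' = (X', a', s')" "u'' = (X'', a'', s'')"
    and o: "X \<in> Obj C" "X' \<in> Obj C" "X'' \<in> Obj C" and s: "s \<in> on_ob P X" "s' \<in> on_ob P X'" "s'' \<in> on_ob P X''"
    by (auto simp: r_def T_def)
   have "rl (X, a, s) (X', a', s')" "rl (X', a', s') (X'', a'', s'')" using u e by (auto simp: r_def)
   then obtain W w f g V v f' g' where W: "W \<in> Obj C" "homogeneous W" "w \<in> E W" "f \<in> Hom C W X" "g \<in> Hom C W X'" "mor f w = a" "mor g w = a'"
     "res P f s = res P g s'"
    and V: "V \<in> Obj C" "homogeneous V" "v \<in> E V" "f' \<in> Hom C V X'" "g' \<in> Hom C V X''" "mor f' v = a'" "mor g' v = a''" "res P f' s' = res P g' s''"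
    by (elim rlE) (rule that)
   \<comment> \<open>A span over \<open>w\<close> and \<open>v\<close>. Both of these lie above
     \<open>a'\<close>, so the two composites to \<open>X'\<close> coincide by
     \<open>agree\<close>.\<close>
   obtain Z z p q where z: "Z \<in> Obj C" "homogeneous Z" "z \<in> E Z" "p \<in> Hom C Z W" "q \<in> Hom C Z V" "mor p z = w" "mor q z = v"
    using W(1) V(1) W(3) V(3) by (rule spanE)
   note gp = Cmp[OF z(1) W(1) o(2) z(4) W(5)] and f'q = Cmp[OF z(1) V(1) o(2) z(5) V(4)]
    and fp = Cmp[OF z(1) W(1) o(1) z(4) W(4)] and g'q = Cmp[OF z(1) V(1) o(3) z(5) V(5)]
   have "Cmp C g p = Cmp C f' q"
    by (rule agree[OF z(1) o(2) z(2) gp f'q z(3)])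
     (simp add: mor_Cmp[OF z(1) W(1) o(2) z(4) W(5) z(3)] mor_Cmp[OF z(1) V(1) o(2) z(5) V(4) z(3)] z(6,7) W(7) V(6))
   then have "res P (Cmp C f p) s = res P (Cmp C g' q) s''"
    using res_Cmp[OF PP z(1) W(1) o(1) W(4) z(4) s(1)] res_Cmp[OF PP z(1) W(1) o(2) W(5) z(4) s(2)]
     res_Cmp[OF PP z(1) V(1) o(2) V(4) z(5) s(2)] res_Cmp[OF PP z(1) V(1) o(3) V(5) z(5) s(3)] W(8) V(8) by simp
   then have "rl (X, a, s) (X'', a'', s'')"
    by (intro rlI[OF z(1-3) fp g'q])
     (simp_all add: mor_Cmp[OF z(1) W(1) o(1) z(4) W(4) z(3)] mor_Cmp[OF z(1) V(1) o(3) z(5) V(5) z(3)] z(6,7) W(6) V(7))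
   then show "(u, u'') \<in> r" using u e by (auto simp: r_def)
  qed
 qed
 \<comment> \<open>Classes of triples are coded in \<open>'u\<close>; this is possible because
   \<open>T\<close> is small.\<close>
 define k where "k u = cod (T // r) (r `` {u})" for u
 have "small T" unfolding T_def by (intro small_Sigma[OF small_Obj] small_times small_fibre small_U ob_U[OF PP])
 moreover have q: "T // r = (\<lambda>u. r `` {u}) ` T" by (auto simp: quotient_def)
 ultimately have small: "small (T // r)" by (simp add: small_image)
 have kU: "k ` T \<in> \<U>" using cod(2)[OF small] unfolding q by (simp add: k_def q image_image)
 have k_eq: "k u = k v \<longleftrightarrow> rl u v" if "u \<in> T" "v \<in> T" for u v
 proof -
  have "k u = k v \<longleftrightarrow> r `` {u} = r `` {v}"
   unfolding k_def using that by (intro inj_on_eq_iff[OF cod(1)[OF small]]) (auto simp: q)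
  then show ?thesis using eq_equiv_class_iff[OF \<open>equiv T r\<close> that] that by (simp add: r_def)
 qed
 have TI: "(X, a, s) \<in> T" if "X \<in> Obj C" "a \<in> E X" "s \<in> on_ob P X" for X a s using that by (simp add: T_def)
 have k_res: "k (W, w, res P f s) = k (X, mor f w, s)"
  if o: "W \<in> Obj C" "X \<in> Obj C" "f \<in> Hom C W X" and w: "w \<in> E W" and s: "s \<in> on_ob P X" for W X f w s
 proof -
  obtain Z z p q where z: "Z \<in> Obj C" "homogeneous Z" "z \<in> E Z" "p \<in> Hom C Z W" "q \<in> Hom C Z W" "mor p z = w" "mor q z = w"
   using o(1,1) w w by (rule spanE)
  have "rl (W, w, res P f s) (X, mor f w, s)"
   by (rule rlI[OF z(1-4) Cmp[OF z(1) o(1,2) z(4) o(3)] z(6)])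
    (simp_all add: mor_Cmp[OF z(1) o(1,2) z(4) o(3) z(3)] z(6) res_Cmp[OF PP z(1) o(1,2,3) z(4) s])
  then show ?thesis using k_eq[OF TI[OF o(1) w res_in[OF PP o s]] TI[OF o(2) mor_in[OF o w] s]] by simp
 qed
 \<comment> \<open>The group moves the point of a triple and keeps its object and section; the next
   fact shows that the representative picked by \<open>inv_into\<close> does not matter.\<close>
 define \<alpha> where "\<alpha> = (\<lambda>g\<in>carrier G. \<lambda>u\<in>k ` T. case inv_into T k u of (X, a, s) => k (X, act X g a, s))"
 have \<alpha>: "\<alpha> g (k (X, a, s)) = k (X, act X g a, s)" if g: "g \<in> carrier G" and X: "X \<in> Obj C" "a \<in> E X" "s \<in> on_ob P X" for g X a s
 proof -
  note t = TI[OF X]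
  obtain Y b t where Y: "inv_into T k (k (X, a, s)) = (Y, b, t)" by (cases "inv_into T k (k (X, a, s))") auto
  have "(Y, b, t) \<in> T" "k (Y, b, t) = k (X, a, s)"
   using inv_into_into[of "k (X, a, s)" k T] f_inv_into_f[of "k (X, a, s)" k T] \<open>(X, a, s) \<in> T\<close> Y by auto
  then have Y': "Y \<in> Obj C" "b \<in> E Y" "t \<in> on_ob P Y" "rl (Y, b, t) (X, a, s)" using k_eq TI[OF X] by (auto simp: T_def)
  obtain W w f f' where W: "W \<in> Obj C" "homogeneous W" "w \<in> E W" "f \<in> Hom C W Y" "f' \<in> Hom C W X" "mor f w = b" "mor f' w = a"
    "res P f t = res P f' s"
   using Y'(4) by (rule rlE)
  have "rl (Y, act Y g b, t) (X, act X g a, s)"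
   by (rule rlI[OF W(1,2) act_in[OF W(1) g W(3)] W(4,5) _ _ W(8)])
    (simp_all add: mor_act[OF W(1) Y'(1) W(4) g W(3)] mor_act[OF W(1) X(1) W(5) g W(3)] W(6,7))
  then have "k (Y, act Y g b, t) = k (X, act X g a, s)" using k_eq TI act_in g X Y' by simp
  then show ?thesis using g t Y by (simp add: \<alpha>_def)
 qed
 define A where "A = (k ` T, \<alpha>)"
 have A: "A \<in> Obj Ct" unfolding Ct_Obj group_action_iff
 proof (intro conjI ballI)
  show "fst A \<in> \<U>" using kU by (simp add: A_def)
  show "snd A \<in> extensional (carrier G)" by (simp add: A_def \<alpha>_def)
  show "group G" by (rule is_group)
  show "snd A g \<in> extensional (fst A)" if "g \<in> carrier G" for g using that by (simp add: A_def \<alpha>_def)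
  fix u assume "u \<in> fst A"
  then obtain X a s where u: "u = k (X, a, s)" "X \<in> Obj C" "a \<in> E X" "s \<in> on_ob P X" by (auto simp: A_def T_def)
  show "snd A g u \<in> fst A" if "g \<in> carrier G" for g using \<alpha>[OF that u(2-4)] TI[OF u(2) act_in[OF u(2) that u(3)] u(4)] u(1) by (simp add: A_def)
  show "snd A \<one> u = u" using \<alpha>[OF one_closed u(2-4)] act_one[OF u(2,3)] u(1) by (simp add: A_def)
  show "snd A (g \<otimes> h) u = snd A g (snd A h u)" if "g \<in> carrier G" "h \<in> carrier G" for g h
   using \<alpha>[OF m_closed[OF that] u(2-4)] \<alpha>[OF that(2) u(2-4)] \<alpha>[OF that(1) u(2) act_in[OF u(2) that(2) u(3)] u(4)] act_mult[OF u(2) that u(3)] u(1)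
   by (simp add: A_def)
  obtain H where H: "H \<in> \<B>" "\<forall>g\<in>H. act X g a = a" using stab[OF u(2,3)] by blast
  have "H \<subseteq> carrier G" using base[OF H(1)] by blast
  then have "\<forall>g\<in>H. snd A g u = u" using H(2) \<alpha>[OF _ u(2-4)] u(1) by (auto simp: A_def)
  then show "\<exists>H\<in>\<B>. \<forall>g\<in>H. snd A g u = u" using H(1) by blast
 qed
 have m: "mk X A (\<lambda>a. k (X, a, s)) \<in> on_ob (nv A) X" "\<And>x. x \<in> E X ==> el X A (mk X A (\<lambda>a. k (X, a, s))) x = k (X, x, s)"
  if X: "X \<in> Obj C" and s: "s \<in> on_ob P X" for X s
  using mk[OF X A, of "\<lambda>a. k (X, a, s)"] TI[OF X _ s] \<alpha>[OF _ X _ s] by (auto simp: A_def)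
 \<comment> \<open>Injectivity uses the uniqueness half of the sheaf condition: if all classes
   agree, the sieve on which the two sections coincide is covering.\<close>
 have k_inj: "s = t" if X: "X \<in> Obj C" and s: "s \<in> on_ob P X" and t: "t \<in> on_ob P X" and e: "\<And>a. a \<in> E X ==> k (X, a, s) = k (X, a, t)" for X s t
 proof -
  define S where "S = {f. \<exists>Y\<in>Obj C. f \<in> Hom C Y X \<and> res P f s = res P f t}"
  have "is_sieve C X S" unfolding is_sieve_def
  proof (intro conjI ballI)
   fix Y Z f g assume "Y \<in> Obj C" "Z \<in> Obj C" "f \<in> S \<inter> Hom C Y X" "g \<in> Hom C Z Y"
   then show "Cmp C f g \<in> S"
    using Cmp[of Z Y X g f] res_Cmp[OF PP, of Z Y X f g] X s t unfolding S_def by auto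
  qed (auto simp: S_def)
  moreover have "\<exists>Y\<in>Obj C. \<exists>f\<in>S \<inter> Hom C Y X. \<exists>y\<in>E Y. mor f y = a" if a: "a \<in> E X" for a
  proof -
   obtain W w f g where W: "W \<in> Obj C" "homogeneous W" "w \<in> E W" "f \<in> Hom C W X" "g \<in> Hom C W X" "mor f w = a" "mor g w = a" "res P f s = res P g t"
    using e[OF a] k_eq[OF TI[OF X a s] TI[OF X a t]] by (auto elim: rlE)
   \<comment> \<open>The two legs provided by \<open>rl\<close> have the same target and the same
     value at \<open>w\<close>, so they are one arrow.\<close>
   have "f = g" using agree[OF W(1) X W(2,4,5,3)] W(6,7) by simp
   then show ?thesis using W unfolding S_def by blast
  qed
  ultimately have S: "S \<in> J X" using J_iff[OF X] by blast
  have "matching_family C P X S (\<lambda>f. res P f s)" unfolding matching_family_def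
   using res_in[OF PP _ X _ s] res_Cmp[OF PP _ _ X _ _ s] by auto
  then have "\<exists>!u. u \<in> on_ob P X \<and> (\<forall>f\<in>S. res P f u = res P f s)" using sheaf X S by (simp add: is_sheaf_def)
  then obtain u where u: "\<And>v. v \<in> on_ob P X \<and> (\<forall>f\<in>S. res P f v = res P f s) ==> v = u" by (elim ex1E) blast
  have "s = u" by (rule u) (use s in simp)
  moreover have "t = u" by (rule u) (use t in \<open>simp add: S_def\<close>)
  ultimately show "s = t" by simp
 qed
 \<comment> \<open>Surjectivity uses amalgamation: \<open>Q W f t\<close> says that \<open>t\<close>
   represents \<open>u\<close> along \<open>f\<close>. Such \<open>t\<close> exist on a covering
   sieve and are unique by \<open>k_inj\<close>, so they form a matching family of
   \<open>P\<close>.\<close>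
 have k_surj: "\<exists>s\<in>on_ob P X. mk X A (\<lambda>a. k (X, a, s)) = u" if X: "X \<in> Obj C" and u: "u \<in> on_ob (nv A) X" for X u
 proof -
  define Q where "Q W f t \<longleftrightarrow> t \<in> on_ob P W \<and> (\<forall>w\<in>E W. el X A u (mor f w) = k (W, w, t))" for W f t
  have Q_unique: "t = t'" if "W \<in> Obj C" "Q W f t" "Q W f t'" for W f t t' by (rule k_inj[OF that(1)]) (use that in \<open>auto simp: Q_def\<close>)
  define S where "S = {f. \<exists>W\<in>Obj C. f \<in> Hom C W X \<and> (\<exists>t. Q W f t)}"
  define \<xi> where "\<xi> f = (THE t. Q (cdom C f) f t)" for f
  have SQ: "Q W f (\<xi> f)" if "W \<in> Obj C" "f \<in> S" "f \<in> Hom C W X" for W f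
  proof -
   obtain W' t where "W' \<in> Obj C" "f \<in> Hom C W' X" "Q W' f t" using \<open>f \<in> S\<close> by (auto simp: S_def)
   then have "Q W f t" using Hom_disj[OF that(1) X _ X that(3)] by blast
   then show ?thesis unfolding \<xi>_def cdom_eq[OF that(1) X that(3)] by (rule theI) (rule Q_unique[OF that(1) _ \<open>Q W f t\<close>])
  qed
  have Q_res: "Q Z (Cmp C f g) (res P g t)" if o: "Z \<in> Obj C" "W \<in> Obj C" and f: "f \<in> Hom C W X" and g: "g \<in> Hom C Z W" and Q: "Q W f t" for Z W f g t
   using Q res_in[OF PP o g] k_res[OF o g] mor_Cmp[OF o X g f] mor_in[OF o g] by (simp add: Q_def)
  have "is_sieve C X S" unfolding is_sieve_def
  proof (intro conjI ballI)
   fix Y Z f g assume a: "Y \<in> Obj C" "Z \<in> Obj C" "f \<in> S \<inter> Hom C Y X" "g \<in> Hom C Z Y"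
   then have f: "f \<in> S" "f \<in> Hom C Y X" by auto
   show "Cmp C f g \<in> S" using Q_res[OF a(2,1) f(2) a(4) SQ[OF a(1) f]] Cmp[OF a(2,1) X a(4) f(2)] a(2) unfolding S_def by blast
  qed (auto simp: S_def)
  moreover have cov: "\<exists>Y\<in>Obj C. \<exists>f\<in>S \<inter> Hom C Y X. \<exists>y\<in>E Y. mor f y = a" if a: "a \<in> E X" for a
  proof -
   have "el X A u a \<in> k ` T" using el(1)[OF X u a] by (simp add: A_def)
   then obtain Y b t where Y: "Y \<in> Obj C" "b \<in> E Y" "t \<in> on_ob P Y" "el X A u a = k (Y, b, t)" by (auto simp: T_def)
   obtain Z z p q where z: "Z \<in> Obj C" "homogeneous Z" "z \<in> E Z" "p \<in> Hom C Z X" "q \<in> Hom C Z Y" "mor p z = a" "mor q z = b"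
    using X Y(1) a Y(2) by (rule spanE)
   note rq = res_in[OF PP z(1) Y(1) z(5) Y(3)]
   have 0: "el X A u (mor p z) = k (Z, z, res P q t)" using k_res[OF z(1) Y(1) z(5,3) Y(3)] z(6,7) Y(4) by simp
   have "el X A u (mor p w) = k (Z, w, res P q t)" if w: "w \<in> E Z" for w
   proof -
    obtain g where g: "g \<in> carrier G" "act Z g z = w" using z(2,3) w by (auto simp: homogeneous_def)
    then show ?thesis using mor_act[OF z(1) X z(4) g(1) z(3)] el(2)[OF X u mor_in[OF z(1) X z(4,3)] g(1)] 0 \<alpha>[OF g(1) z(1,3) rq]
     by (simp add: A_def)
   qed
   then have "Q Z p (res P q t)" using rq by (simp add: Q_def)
   then show ?thesis using z(1,3,4,6) unfolding S_def by blast
  qed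
  ultimately have S: "S \<in> J X" using J_iff[OF X] by blast
  have "matching_family C P X S \<xi>" unfolding matching_family_def
  proof (intro conjI ballI)
   show "\<xi> f \<in> on_ob P Y" if "Y \<in> Obj C" "f \<in> S \<inter> Hom C Y X" for Y f using SQ[of Y f] that by (simp add: Q_def)
   fix Y Z f g assume a: "Y \<in> Obj C" "Z \<in> Obj C" "f \<in> S \<inter> Hom C Y X" "g \<in> Hom C Z Y"
   then have f: "f \<in> S" "f \<in> Hom C Y X" by auto
   note q = Q_res[OF a(2,1) f(2) a(4) SQ[OF a(1) f]] and c = Cmp[OF a(2,1) X a(4) f(2)]
   have "Cmp C f g \<in> S" using q c a(2) unfolding S_def by blast
   from Q_unique[OF a(2) q SQ[OF a(2) this c]] show "res P g (\<xi> f) = \<xi> (Cmp C f g)" .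
  qed
  then have "\<exists>!s. s \<in> on_ob P X \<and> (\<forall>f\<in>S. res P f s = \<xi> f)" using sheaf X S by (simp add: is_sheaf_def)
  then obtain s where s: "s \<in> on_ob P X" "\<forall>f\<in>S. res P f s = \<xi> f" by blast
  have "mk X A (\<lambda>a. k (X, a, s)) = u"
  proof (rule nv_eqI[OF X m(1)[OF X s(1)] u])
   fix a assume a: "a \<in> E X"
   obtain Y f y where y: "Y \<in> Obj C" "f \<in> S" "f \<in> Hom C Y X" "y \<in> E Y" "mor f y = a" using cov[OF a] by blast
   show "el X A (mk X A (\<lambda>a. k (X, a, s))) a = el X A u a"
    using m(2)[OF X s(1) a] k_res[OF y(1) X y(3,4) s(1)] s(2) SQ[OF y(1-3)] y(2,4,5) by (auto simp: Q_def)
  qed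
  then show ?thesis using s(1) by blast
 qed
 have "is_iso PSh P (nv A) (mkmap C P (nv A) (\<lambda>X s. mk X A (\<lambda>a. k (X, a, s))))"
 proof (rule mkmap_iso[OF PP nv_PSh[OF A]])
  fix X assume X: "X \<in> Obj C"
  show "bij_betw (\<lambda>s. mk X A (\<lambda>a. k (X, a, s))) (on_ob P X) (on_ob (nv A) X)"
  proof (intro bij_betw_imageI inj_onI subset_antisym subsetI)
   fix s t assume st: "s \<in> on_ob P X" "t \<in> on_ob P X" and e: "mk X A (\<lambda>a. k (X, a, s)) = mk X A (\<lambda>a. k (X, a, t))"
   show "s = t" by (rule k_inj[OF X st]) (use m(2)[OF X st(1)] m(2)[OF X st(2)] e in simp)
  qed (use m(1)[OF X] k_surj[OF X] in \<open>blast+\<close>)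
 next
  fix W Z g s assume o: "W \<in> Obj C" "Z \<in> Obj C" "g \<in> Hom C W Z" and s: "s \<in> on_ob P Z"
  show "mk W A (\<lambda>a. k (W, a, res P g s)) = res (nv A) g (mk Z A (\<lambda>a. k (Z, a, s)))"
   by (rule nv_eqI[OF o(1) m(1)[OF o(1) res_in[OF PP o s]] res_in[OF nv_PSh[OF A] o m(1)[OF o(2) s]]])
    (simp add: m(2)[OF o(1) res_in[OF PP o s]] el_res[OF o A m(1)[OF o(2) s]] m(2)[OF o(2) s] mor_in[OF o] k_res[OF o _ s])
 qed
 then show ?thesis using A unfolding is_iso_def is_inverse_pair_def Sh_simps by blast
qed

sublocale nerve: ff_es Ct Sh nerve
proof
 show "is_category Ct" by (rule is_category_Cont)
 show "is_category Sh" by (rule is_category_Sh)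
qed (use is_functor_nerve nerve_full nerve_faithful nerve_es in \<open>auto simp: on_ob_nerve Sh_simps\<close>)

end

section \<open>The topology of an algebraic base\<close>

context
 fixes G :: "'g monoid" (structure) and \<B> :: "'g set set"
 assumes base: "algebraic_base G \<B>"
begin

interpretation group G using base by (simp add: algebraic_base_def)

lemma base_mem:
 assumes "H \<in> \<B>"
 shows "subgroup H G" "h \<in> H ==> h \<in> carrier G" "\<one> \<in> H" "h \<in> H ==> h' \<in> H ==> h \<otimes> h' \<in> H" "h \<in> H ==> inv h \<in> H"
proof -
 show *: "subgroup H G" using base assms by (simp add: algebraic_base_def)
 then show "h \<in> H ==> h \<in> carrier G" "\<one> \<in> H" "h \<in> H ==> h' \<in> H ==> h \<otimes> h' \<in> H" "h \<in> H ==> inv h \<in> H"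
  by (auto dest: subgroup.mem_carrier intro: subgroup.one_closed subgroup.m_closed subgroup.m_inv_closed)
qed

lemma base_conj: "H \<in> \<B> ==> g \<in> carrier G ==> (\<lambda>h. g \<otimes> h \<otimes> inv g) ` H \<in> \<B>"
 using base by (simp add: algebraic_base_def)

text \<open>The open sets are the unions of left cosets of members of \<B>.\<close>

definition base_open :: "'g set => bool" where
 "base_open V \<longleftrightarrow> V \<subseteq> carrier G \<and> (\<forall>x\<in>V. \<exists>H\<in>\<B>. (\<lambda>h. x \<otimes> h) ` H \<subseteq> V)"

lemma istopology_base_open: "istopology base_open"
 unfolding istopology_def
proof (intro conjI allI impI)
 fix S T assume ST: "base_open S" "base_open T"
 show "base_open (S \<inter> T)" unfolding base_open_def
 proof (intro conjI ballI)
  show "S \<inter> T \<subseteq> carrier G" using ST by (auto simp: base_open_def)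
  fix x assume "x \<in> S \<inter> T"
  then obtain H K where H: "H \<in> \<B>" "(\<lambda>h. x \<otimes> h) ` H \<subseteq> S" "K \<in> \<B>" "(\<lambda>h. x \<otimes> h) ` K \<subseteq> T"
   using ST unfolding base_open_def by blast
  obtain L where "L \<in> \<B>" "L \<subseteq> H \<inter> K" using base H(1,3) unfolding algebraic_base_def by blast
  then show "\<exists>H\<in>\<B>. (\<lambda>h. x \<otimes> h) ` H \<subseteq> S \<inter> T" using H by blast
 qed
next
 fix \<K> assume "\<forall>V\<in>\<K>. base_open V"
 then show "base_open (\<Union> \<K>)" unfolding base_open_def by (meson Union_iff Union_least Union_upper subset_trans)
qed

lemma openin_coset:
 assumes "H \<in> \<B>" "x \<in> carrier G"
 shows "base_open ((\<lambda>h. x \<otimes> h) ` H)"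
 unfolding base_open_def
proof (intro conjI ballI)
 show "(\<lambda>h. x \<otimes> h) ` H \<subseteq> carrier G" using assms base_mem(2) by auto
 fix y assume "y \<in> (\<lambda>h. x \<otimes> h) ` H"
 then obtain h where h: "h \<in> H" "y = x \<otimes> h" by blast
 have "(\<lambda>h. y \<otimes> h) ` H \<subseteq> (\<lambda>h. x \<otimes> h) ` H"
 proof (rule image_subsetI)
  fix k assume k: "k \<in> H"
  show "y \<otimes> k \<in> (\<lambda>h. x \<otimes> h) ` H"
   using h assms k base_mem(4)[OF assms(1) h(1) k] base_mem(2)[OF assms(1)] by (auto simp: m_assoc)
 qed
 then show "\<exists>H'\<in>\<B>. (\<lambda>h. y \<otimes> h) ` H' \<subseteq> (\<lambda>h. x \<otimes> h) ` H" using assms(1) by blast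
qed

text \<open>Closure of the base under conjugation makes the operations continuous: the product of
  \<open>x (y H y^-1)\<close> and \<open>y H\<close> lies in \<open>x y H\<close>, and the inverses
  of the elements of \<open>x (x^-1 H x)\<close> lie in \<open>x^-1 H\<close>.\<close>

lemma topological_group_base_open:
 "topological_group G (topology base_open)" "nbhd_basis_at (topology base_open) \<one> \<B>"
proof -
 have op: "openin (topology base_open) V \<longleftrightarrow> base_open V" for V using istopology_base_open by (simp add: topology_inverse')
 have "base_open (carrier G)" using base base_mem(2) by (fastforce simp: base_open_def algebraic_base_def)
 then have top: "topspace (topology base_open) = carrier G"
  unfolding topspace_def op by (auto simp: base_open_def)
 have self: "x \<in> (\<lambda>h. x \<otimes> h) ` H" if "H \<in> \<B>" "x \<in> carrier G" for x H using base_mem(3)[OF that(1)] that(2) by force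
 have "continuous_map (prod_topology (topology base_open) (topology base_open)) (topology base_open) (\<lambda>(x, y). x \<otimes> y)"
  unfolding continuous_map_def openin_prod_topology_alt op topspace_prod_topology top
 proof (intro conjI allI impI)
  fix V x y assume V: "base_open V" and xy: "(x, y) \<in> {z \<in> carrier G \<times> carrier G. (case z of (x, y) => x \<otimes> y) \<in> V}"
  then obtain H where H: "H \<in> \<B>" "(\<lambda>h. x \<otimes> y \<otimes> h) ` H \<subseteq> V" by (auto simp: base_open_def)
  have x: "x \<in> carrier G" and y: "y \<in> carrier G" using xy by auto
  note K = base_conj[OF H(1) y]
  have "x \<otimes> (y \<otimes> h \<otimes> inv y) \<otimes> (y \<otimes> h') \<in> V" if "h \<in> H" "h' \<in> H" for h h'
  proof -
   have c: "h \<in> carrier G" "h' \<in> carrier G" using that base_mem(2)[OF H(1)] by auto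
   have "x \<otimes> (y \<otimes> h \<otimes> inv y) \<otimes> (y \<otimes> h') = x \<otimes> y \<otimes> h \<otimes> (inv y \<otimes> y) \<otimes> h'" using x y c by (simp only: m_assoc m_closed inv_closed)
   then have "x \<otimes> (y \<otimes> h \<otimes> inv y) \<otimes> (y \<otimes> h') = x \<otimes> y \<otimes> (h \<otimes> h')" using x y c by (simp add: m_assoc)
   then show ?thesis using H(2) base_mem(4)[OF H(1) that] by auto
  qed
  then show "\<exists>S T. base_open S \<and> base_open T \<and> x \<in> S \<and> y \<in> T \<and> S \<times> T \<subseteq> {z \<in> carrier G \<times> carrier G. (case z of (x, y) => x \<otimes> y) \<in> V}"
   using openin_coset[OF K x] openin_coset[OF H(1) y] self[OF K x] self[OF H(1) y] x y base_mem(2)[OF H(1)]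
   by (intro exI[of _ "(\<lambda>h. x \<otimes> h) ` (\<lambda>h. y \<otimes> h \<otimes> inv y) ` H"] exI[of _ "(\<lambda>h. y \<otimes> h) ` H"]) auto
 qed auto
 moreover have "continuous_map (topology base_open) (topology base_open) (\<lambda>x. inv x)"
  unfolding continuous_map_def op top
 proof (intro conjI allI impI)
  fix V assume V: "base_open V"
  show "base_open {x \<in> carrier G. inv x \<in> V}" unfolding base_open_def
  proof (intro conjI ballI)
   fix x assume "x \<in> {x \<in> carrier G. inv x \<in> V}"
   then obtain H where x: "x \<in> carrier G" and H: "H \<in> \<B>" "(\<lambda>h. inv x \<otimes> h) ` H \<subseteq> V" using V by (auto simp: base_open_def)
   have "x \<otimes> (inv x \<otimes> h \<otimes> inv (inv x)) \<in> {x \<in> carrier G. inv x \<in> V}" if h: "h \<in> H" for h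
   proof -
    have c: "h \<in> carrier G" using h base_mem(2)[OF H(1)] by auto
    have "x \<otimes> (inv x \<otimes> h \<otimes> inv (inv x)) = x \<otimes> inv x \<otimes> h \<otimes> x" using x c by (simp only: m_assoc m_closed inv_closed inv_inv)
    then have "x \<otimes> (inv x \<otimes> h \<otimes> inv (inv x)) = h \<otimes> x" using x c by simp
    moreover have "inv x \<otimes> inv h \<in> V" using H(2) base_mem(5)[OF H(1) h] by auto
    ultimately show ?thesis using x c by (simp add: inv_mult_group)
   qed
   then show "\<exists>H\<in>\<B>. (\<lambda>h. x \<otimes> h) ` H \<subseteq> {x \<in> carrier G. inv x \<in> V}"
    by (intro bexI[OF _ base_conj[OF H(1) inv_closed[OF x]]]) blast
  qed auto
 qed auto
 ultimately show "topological_group G (topology base_open)" using top by (simp add: topological_group_def is_group)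
 show "nbhd_basis_at (topology base_open) \<one> \<B>" unfolding nbhd_basis_at_def op
 proof (intro conjI ballI allI impI)
  fix H assume H: "H \<in> \<B>"
  have "(\<lambda>h. \<one> \<otimes> h) ` H = H" using base_mem(2)[OF H] by (auto simp: image_iff)
  then show "\<exists>U. base_open U \<and> \<one> \<in> U \<and> U \<subseteq> H" using openin_coset[OF H one_closed] base_mem(3)[OF H] by auto
 next
  fix U assume U: "base_open U \<and> \<one> \<in> U"
  then obtain H where H: "H \<in> \<B>" "(\<lambda>h. \<one> \<otimes> h) ` H \<subseteq> U" unfolding base_open_def by blast
  have "(\<lambda>h. \<one> \<otimes> h) ` H = H" using base_mem(2)[OF H(1)] by (auto simp: image_iff)
  then show "\<exists>H\<in>\<B>. H \<subseteq> U" using H by auto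
 qed
qed

text \<open>Left translations are continuous, so the neighbourhoods of every point are determined by
  those of the identity.\<close>

lemma topological_group_openin:
 assumes \<tau>: "topological_group G \<tau>" "nbhd_basis_at \<tau> \<one> \<B>"
 shows "openin \<tau> V \<longleftrightarrow> base_open V"
proof -
 have top: "topspace \<tau> = carrier G" and mult: "continuous_map (prod_topology \<tau> \<tau>) \<tau> (\<lambda>(x, y). x \<otimes> y)"
  using \<tau>(1) by (auto simp: topological_group_def)
 have translate: "openin \<tau> {y \<in> carrier G. x \<otimes> y \<in> V}" if "x \<in> carrier G" "openin \<tau> V" for x V
 proof -
  have "continuous_map \<tau> (prod_topology \<tau> \<tau>) (\<lambda>y. (x, y))"
   using that(1) top by (intro continuous_map_pairedI) auto
  from continuous_map_compose[OF this mult] have "continuous_map \<tau> \<tau> (\<lambda>y. x \<otimes> y)" by (simp add: o_def)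
  from openin_continuous_map_preimage[OF this that(2)] show ?thesis by (simp add: top)
 qed
 show ?thesis
 proof
  assume V: "openin \<tau> V"
  show "base_open V" unfolding base_open_def
  proof (intro conjI ballI)
   show sub: "V \<subseteq> carrier G" using openin_subset[OF V] top by simp
   fix x assume x: "x \<in> V"
   then have xc: "x \<in> carrier G" using sub by auto
   have "\<one> \<in> {y \<in> carrier G. x \<otimes> y \<in> V}" using x xc by simp
   then obtain H where "H \<in> \<B>" "H \<subseteq> {y \<in> carrier G. x \<otimes> y \<in> V}"
    using \<tau>(2) translate[OF xc V] unfolding nbhd_basis_at_def by blast
   then show "\<exists>H\<in>\<B>. (\<lambda>h. x \<otimes> h) ` H \<subseteq> V" by (intro bexI[of _ H]) auto
  qed
 next
  assume V: "base_open V"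
  show "openin \<tau> V"
  proof (subst openin_subopen, intro ballI)
   fix x assume "x \<in> V"
   then obtain H where x: "x \<in> carrier G" and H: "H \<in> \<B>" "(\<lambda>h. x \<otimes> h) ` H \<subseteq> V" using V unfolding base_open_def by blast
   obtain U where U: "openin \<tau> U" "\<one> \<in> U" "U \<subseteq> H" using \<tau>(2) H(1) unfolding nbhd_basis_at_def by blast
   have "y \<in> V" if "y \<in> carrier G" "inv x \<otimes> y \<in> U" for y
   proof -
    have "x \<otimes> (inv x \<otimes> y) \<in> V" using that U(3) H(2) by auto
    then show ?thesis using x that(1) by (simp add: m_assoc[symmetric])
   qed
   then show "\<exists>T. openin \<tau> T \<and> x \<in> T \<and> T \<subseteq> V"
    using translate[OF inv_closed[OF x] U(1)] x U(2) by (intro exI[of _ "{y \<in> carrier G. inv x \<otimes> y \<in> U}"]) auto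
  qed
 qed
qed

lemma base_topology_ex1: "\<exists>!\<tau>. topological_group G \<tau> \<and> nbhd_basis_at \<tau> \<one> \<B>"
 using topological_group_base_open topological_group_openin by (intro ex1I[of _ "topology base_open"]) (auto simp: topology_eq)

text \<open>As \<open>A\<close> is discrete, continuity at \<open>(\<one>, x)\<close> gives a member
  of the base that fixes \<open>x\<close>; conversely, the orbit map of \<open>x\<close> is constant
  on the left cosets of such a member.\<close>

lemma continuous_gset_iff:
 "continuous_gset G (base_topology G \<B>) (A, \<alpha>) \<longleftrightarrow> group_action G A \<alpha> \<and> (\<forall>x\<in>A. \<exists>H\<in>\<B>. \<forall>g\<in>H. \<alpha> g x = x)"
proof (cases "group_action G A \<alpha>")
 case True
 note act = True[unfolded group_action_iff]
 let ?\<tau> = "base_topology G \<B>"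
 have \<tau>: "topological_group G ?\<tau>" "nbhd_basis_at ?\<tau> \<one> \<B>"
  using theI'[OF base_topology_ex1] by (auto simp: base_topology_def)
 note op = topological_group_openin[OF \<tau>]
 have top: "topspace ?\<tau> = carrier G" using \<tau>(1) by (simp add: topological_group_def)
 have "continuous_map (prod_topology ?\<tau> (discrete_topology A)) (discrete_topology A) (\<lambda>(g, x). \<alpha> g x) \<longleftrightarrow>
  (\<forall>x\<in>A. \<exists>H\<in>\<B>. \<forall>g\<in>H. \<alpha> g x = x)" (is "?c \<longleftrightarrow> ?s")
 proof
  assume c: ?c
  show ?s
  proof
   fix x assume x: "x \<in> A"
   let ?V = "{z \<in> carrier G \<times> A. (case z of (g, x) => \<alpha> g x) \<in> {x}}"
   have V: "openin (prod_topology ?\<tau> (discrete_topology A)) ?V"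
    using openin_continuous_map_preimage[OF c, of "{x}"] x by (simp add: top)
   have "(\<one>, x) \<in> ?V" using act x by simp
   from V[unfolded openin_prod_topology_alt, rule_format, OF this]
   obtain U S where U: "openin ?\<tau> U" "\<one> \<in> U" "x \<in> S" "U \<times> S \<subseteq> ?V" by (elim exE conjE)
   obtain H where H: "H \<in> \<B>" "H \<subseteq> U" using \<tau>(2) U(1,2) unfolding nbhd_basis_at_def by blast
   have "\<alpha> g x = x" if "g \<in> H" for g
   proof -
    have "(g, x) \<in> ?V" using U(3,4) H(2) that by blast
    then show ?thesis by simp
   qed
   then show "\<exists>H\<in>\<B>. \<forall>g\<in>H. \<alpha> g x = x" using H(1) by blast
  qed
 next
  assume s: ?s
  show ?c unfolding continuous_map_def openin_prod_topology_alt op topspace_prod_topology topspace_discrete_topology top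
  proof (intro conjI allI impI)
   fix S g x assume gx: "(g, x) \<in> {z \<in> carrier G \<times> A. (case z of (g, x) => \<alpha> g x) \<in> S}"
   then obtain H where H: "H \<in> \<B>" "\<forall>h\<in>H. \<alpha> h x = x" and g: "g \<in> carrier G" "x \<in> A" "\<alpha> g x \<in> S" using s by auto
   have "\<alpha> (g \<otimes> h) x = \<alpha> g x" if "h \<in> H" for h using act g H(2) that base_mem(2)[OF H(1) that] by simp
   moreover have "g \<in> (\<lambda>h. g \<otimes> h) ` H" using base_mem(3)[OF H(1)] g(1) by force
   ultimately show "\<exists>U T. base_open U \<and> openin (discrete_topology A) T \<and> g \<in> U \<and> x \<in> T \<and>
     U \<times> T \<subseteq> {z \<in> carrier G \<times> A. (case z of (g, x) => \<alpha> g x) \<in> S}"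
    using openin_coset[OF H(1) g(1)] g base_mem(2)[OF H(1)]
    by (intro exI[of _ "(\<lambda>h. g \<otimes> h) ` H"] exI[of _ "{x}"]) auto
  qed (use act in auto)
 qed
 then show ?thesis using True by (simp add: continuous_gset_def)
qed (simp add: continuous_gset_def)

end

section \<open>The topos of continuous actions of the automorphism group\<close>

lemma is_functor_full_subcat: "is_functor C D F ==> is_functor (full_subcat C S) D F"
 unfolding is_functor_def full_subcat_simps by blast

lemma equivariant_inv_into:
 assumes h: "equivariant G A B h" and bij: "bij_betw h (fst A) (fst B)"
  and act: "\<And>g x. g \<in> carrier G ==> x \<in> fst A ==> snd A g x \<in> fst A"
 shows "equivariant G B A (inv_into (fst A) h)"
 unfolding equivariant_iff
proof (intro conjI ballI)
 show "inv_into (fst A) h \<in> fst B \<rightarrow> fst A" using bij_betw_inv_into[OF bij] by (auto simp: bij_betw_def)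
 fix g y assume g: "g \<in> carrier G" and "y \<in> fst B"
 then obtain x where x: "x \<in> fst A" "y = h x" using bij by (auto simp: bij_betw_def)
 have "snd B g y = h (snd A g x)" using h g x by (simp add: equivariant_iff)
 then show "inv_into (fst A) h (snd B g y) = snd A g (inv_into (fst A) h y)"
  using x act[OF g x(1)] bij by (simp add: bij_betw_def)
qed

lemma Cont_iso:
 assumes A: "A \<in> Obj (Cont \<U> G \<tau>)" and h: "equivariant G A B h" "bij_betw h (fst A) (fst B)"
 shows "is_inverse_pair (Cont \<U> G \<tau>) A B (A, restrict h (fst A), B) (B, restrict (inv_into (fst A) h) (fst B), A)"
proof -
 have act: "snd A g x \<in> fst A" if "g \<in> carrier G" "x \<in> fst A" for g x
  using A that by (auto simp: Cont_def continuous_gset_def group_action_iff)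
 note i = equivariant_inv_into[OF h act]
 have B: "snd B g y \<in> fst B" if g: "g \<in> carrier G" and "y \<in> fst B" for g y
 proof -
  obtain x where "x \<in> fst A" "y = h x" using h(2) \<open>y \<in> fst B\<close> by (auto simp: bij_betw_def)
  then have "snd B g y = h (snd A g x)" using h(1) g by (simp add: equivariant_iff)
  then show ?thesis using act[OF g \<open>x \<in> fst A\<close>] h(2) by (auto simp: bij_betw_def)
 qed
 have "equivariant G A B (restrict h (fst A))" using h(1) act by (auto simp: equivariant_iff)
 moreover have "equivariant G B A (restrict (inv_into (fst A) h) (fst B))" using i B by (auto simp: equivariant_iff)
 moreover have "compose (fst A) (restrict (inv_into (fst A) h) (fst B)) (restrict h (fst A)) = (\<lambda>x\<in>fst A. x)"
  "compose (fst B) (restrict h (fst A)) (restrict (inv_into (fst A) h) (fst B)) = (\<lambda>x\<in>fst B. x)"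
  using h(2) by (auto simp: compose_def fun_eq_iff bij_betw_def f_inv_into_f inv_into_into)
 ultimately show ?thesis by (simp add: is_inverse_pair_def Cont_Hom Cont_Idn Cont_Cmp)
qed

section \<open>Stabilizers of realized tuples, and the model as a fibre functor\<close>

context galois_model
begin

abbreviation "\<B> \<equiv> stabilizer_base \<Sigma> M \<I>"
abbreviation "\<tau> \<equiv> base_topology G \<B>"
abbreviation "\<C>\<^sub>I \<equiv> full_subcat \<C> \<I>"
abbreviation "\<Y> \<equiv> yoneda code \<C>"

lemma fic_sorts: "X \<in> fics ==> set (fst X) \<subseteq> Sorts \<Sigma>"
 by (cases X) (simp add: fic_iff)

lemma ext_tuples: "a \<in> ext M X ==> a \<in> tuples M (fst X)"
 by (cases X) (simp add: ext_iff)

lemma \<I>_fics: "X \<in> \<I> ==> X \<in> fics"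
 by (rule complete_fic[OF \<I>_complete])

lemma base_iff: "H \<in> \<B> \<longleftrightarrow> (\<exists>X\<in>\<I>. \<exists>a\<in>ext M X. H = {g \<in> carrier G. tup_map (fst X) g a = a})"
proof
 assume "H \<in> \<B>"
 then obtain \<Gamma> \<phi> a where "(\<Gamma>, \<phi>) \<in> \<I>" "a \<in> ext M (\<Gamma>, \<phi>)" "H = {g \<in> carrier G. tup_map (fst (\<Gamma>, \<phi>)) g a = a}"
  unfolding stabilizer_base_def tuple_stabilizer_def carrier_G fst_conv by blast
 then show "\<exists>X\<in>\<I>. \<exists>a\<in>ext M X. H = {g \<in> carrier G. tup_map (fst X) g a = a}" by blast
next
 assume "\<exists>X\<in>\<I>. \<exists>a\<in>ext M X. H = {g \<in> carrier G. tup_map (fst X) g a = a}"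
 then obtain X a where "X \<in> \<I>" "a \<in> ext M X" "H = tuple_stabilizer \<Sigma> M (fst X) a"
  unfolding tuple_stabilizer_def carrier_G by blast
 then show "H \<in> \<B>" unfolding stabilizer_base_def by (cases X) auto
qed

lemma act_mult:
 assumes "X \<in> fics" "g \<in> carrier G" "h \<in> carrier G" "a \<in> ext M X"
 shows "tup_map (fst X) (g \<otimes>\<^bsub>G\<^esub> h) a = tup_map (fst X) g (tup_map (fst X) h a)"
 using Aut_mult_tup[OF _ fic_sorts ext_tuples, of h X a] assms by (simp add: carrier_G)

lemma act_one: "X \<in> fics ==> a \<in> ext M X ==> tup_map (fst X) \<one>\<^bsub>G\<^esub> a = a"
 by (rule Aut_one_tup[OF fic_sorts ext_tuples])

lemma act_in: "X \<in> fics ==> g \<in> carrier G ==> a \<in> ext M X ==> tup_map (fst X) g a \<in> ext M X"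
 using ext_aut by (simp add: carrier_G)

lemma act_inv:
 assumes X: "X \<in> fics" and g: "g \<in> carrier G" and a: "a \<in> ext M X"
 shows "tup_map (fst X) (inv\<^bsub>G\<^esub> g) (tup_map (fst X) g a) = a"
 using act_mult[OF X group.inv_closed[OF group_G g] g a] act_one[OF X a] group.l_inv[OF group_G g] by simp

lemma mor_act:
 assumes "X \<in> fics" "Y \<in> fics" "f \<in> Hom \<C> X Y" "g \<in> carrier G" "a \<in> ext M X"
 shows "mor f (tup_map (fst X) g a) = tup_map (fst Y) g (mor f a)"
 using mor_aut[OF assms(1-3,5)] assms(4) by (simp add: carrier_G)

text \<open>The complete object found by \<open>span\<close> receives an arrow from a member of
  \<I>, and \<open>complete_orbit\<close> lifts the point along it.\<close>

lemma span_\<I>: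
 assumes X: "X \<in> fics" and Y: "Y \<in> fics" and a: "a \<in> ext M X" and b: "b \<in> ext M Y"
 shows "\<exists>W\<in>\<I>. \<exists>c\<in>ext M W. \<exists>p\<in>Hom \<C> W X. \<exists>q\<in>Hom \<C> W Y. mor p c = a \<and> mor q c = b"
proof -
 obtain Z z p q where Z: "cfm Z" "z \<in> ext M Z" "p \<in> Hom \<C> Z X" "q \<in> Hom \<C> Z Y" "mor p z = a" "mor q z = b"
  using span[OF X Y a b] by blast
 obtain W \<theta> where W: "W \<in> \<I>" "fnl W Z \<theta>" using \<I>_cofinal[OF Z(1)] by blast
 obtain c where c: "c \<in> ext M W" "(c, z) \<in> arel M W Z \<theta>" using complete_orbit(3)[OF Z(1) W Z(2)] by blast
 have Wf: "W \<in> fics" and Zf: "Z \<in> fics" using \<I>_fics[OF W(1)] complete_fic[OF Z(1)] by auto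
 have f: "arr W Z \<theta> \<in> Hom \<C> W Z" by (rule Hom_C_I[OF W(2)])
 have "mor (arr W Z \<theta>) c = z" using mor_arr[OF Wf Zf W(2) c(1)] c(2) by simp
 then have "mor (Cmp \<C> p (arr W Z \<theta>)) c = a" "mor (Cmp \<C> q (arr W Z \<theta>)) c = b"
  using mor_Cmp[OF Wf Zf X f Z(3) c(1)] mor_Cmp[OF Wf Zf Y f Z(4) c(1)] Z(5,6) by auto
 then show ?thesis using W(1) c(1) S.Cmp[of W Z X _ p] S.Cmp[of W Z Y _ q] Wf Zf X Y f Z(3,4) by (metis Obj_C)
qed

text \<open>Stabilizers grow along arrows; combined with \<open>span_\<I>\<close> this gives the
  intersection property of the base and the axiom \<open>stab\<close>.\<close>

lemma base_mor:
 assumes W: "W \<in> \<I>" and X: "X \<in> fics" and c: "c \<in> ext M W" and p: "p \<in> Hom \<C> W X" and g: "g \<in> carrier G" "tup_map (fst W) g c = c"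
 shows "tup_map (fst X) g (mor p c) = mor p c"
 using mor_act[OF \<I>_fics[OF W] X p g(1) c] g(2) by simp

text \<open>Two stabilizers contain the stabilizer of a point that arrows send to both tuples, and
  the conjugate by \<open>g\<close> of the stabilizer of \<open>a\<close> is the stabilizer of the
  translate of \<open>a\<close> by \<open>g\<close>.\<close>

lemma algebraic_base: "algebraic_base G \<B>"
 unfolding algebraic_base_def
proof (intro conjI ballI)
 interpret group G by (rule group_G)
 show "group G" by (rule group_G)
 \<comment> \<open>The empty tuple realizes \<open>Verum\<close> in the empty context;
   \<open>span_\<I>\<close> then yields a realized member of \<I>, so the base is not empty.\<close>
 have V: "([], Verum) \<in> fics" "[] \<in> ext M ([], Verum :: ('s, 'f, 'r, 'i) form)" by (simp_all add: fic_iff ext_iff)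
 show "\<B> \<noteq> {}" using span_\<I>[OF V(1,1,2,2)] base_iff by blast
 fix H assume "H \<in> \<B>"
 then obtain X a where X: "X \<in> \<I>" "a \<in> ext M X" and H: "H = {g \<in> carrier G. tup_map (fst X) g a = a}" unfolding base_iff by blast
 note Xf = \<I>_fics[OF X(1)]
 show "subgroup H G"
 proof (rule subgroupI)
  show "H \<noteq> {}" using act_one[OF Xf X(2)] by (auto simp: H)
  show "inv\<^bsub>G\<^esub> g \<in> H" if "g \<in> H" for g using that act_inv[OF Xf _ X(2), of g] by (auto simp: H)
  show "g \<otimes>\<^bsub>G\<^esub> h \<in> H" if "g \<in> H" "h \<in> H" for g h using that act_mult[OF Xf _ _ X(2), of g h] by (auto simp: H)
 qed (auto simp: H)
 show "\<exists>L\<in>\<B>. L \<subseteq> H \<inter> K" if K': "K \<in> \<B>" for K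
 proof -
  obtain Y b where Y: "Y \<in> \<I>" "b \<in> ext M Y" and K: "K = {g \<in> carrier G. tup_map (fst Y) g b = b}" using K' unfolding base_iff by blast
  obtain W c p q where W: "W \<in> \<I>" "c \<in> ext M W" "p \<in> Hom \<C> W X" "q \<in> Hom \<C> W Y" "mor p c = a" "mor q c = b"
   using span_\<I>[OF Xf \<I>_fics[OF Y(1)] X(2) Y(2)] by blast
  have "{g \<in> carrier G. tup_map (fst W) g c = c} \<subseteq> H \<inter> K"
   using base_mor[OF W(1) Xf W(2,3)] base_mor[OF W(1) \<I>_fics[OF Y(1)] W(2,4)] W(5,6) by (auto simp: H K)
  moreover have "{g \<in> carrier G. tup_map (fst W) g c = c} \<in> \<B>" using W(1,2) base_iff by blast
  ultimately show ?thesis by blast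
 qed
 show "(\<lambda>h. g \<otimes>\<^bsub>G\<^esub> h \<otimes>\<^bsub>G\<^esub> inv\<^bsub>G\<^esub> g) ` H \<in> \<B>" if g: "g \<in> carrier G" for g
 proof -
  note ga = act_in[OF Xf g X(2)] and ig = inv_closed[OF g]
  have "(\<lambda>h. g \<otimes>\<^bsub>G\<^esub> h \<otimes>\<^bsub>G\<^esub> inv\<^bsub>G\<^esub> g) ` H = {k \<in> carrier G. tup_map (fst X) k (tup_map (fst X) g a) = tup_map (fst X) g a}" (is "?L = ?R")
  proof (intro subset_antisym subsetI)
   fix k assume "k \<in> ?L"
   then obtain h where h: "h \<in> carrier G" "tup_map (fst X) h a = a" "k = g \<otimes>\<^bsub>G\<^esub> h \<otimes>\<^bsub>G\<^esub> inv\<^bsub>G\<^esub> g" by (auto simp: H)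
   then show "k \<in> ?R" using act_mult[OF Xf _ ig ga, of "g \<otimes>\<^bsub>G\<^esub> h"] act_mult[OF Xf g h(1) X(2)] act_inv[OF Xf g X(2)] g by simp
  next
   fix k assume k: "k \<in> ?R"
   let ?h = "inv\<^bsub>G\<^esub> g \<otimes>\<^bsub>G\<^esub> (k \<otimes>\<^bsub>G\<^esub> g)"
   have "?h \<in> H" using k act_mult[OF Xf ig _ X(2), of "k \<otimes>\<^bsub>G\<^esub> g"] act_mult[OF Xf _ g X(2), of k] act_inv[OF Xf g X(2)] g
    by (simp add: H)
   moreover have "k = g \<otimes>\<^bsub>G\<^esub> ?h \<otimes>\<^bsub>G\<^esub> inv\<^bsub>G\<^esub> g"
   proof -
    have "g \<otimes>\<^bsub>G\<^esub> ?h \<otimes>\<^bsub>G\<^esub> inv\<^bsub>G\<^esub> g = g \<otimes>\<^bsub>G\<^esub> inv\<^bsub>G\<^esub> g \<otimes>\<^bsub>G\<^esub> k \<otimes>\<^bsub>G\<^esub> (g \<otimes>\<^bsub>G\<^esub> inv\<^bsub>G\<^esub> g)"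
     using k g by (simp only: m_assoc m_closed inv_closed mem_Collect_eq)
    then show ?thesis using k g by simp
   qed
   ultimately show "k \<in> ?L" by blast
  qed
  then show ?thesis using X(1) ga base_iff by blast
 qed
qed

lemma small_tuples: "set \<Gamma> \<subseteq> Sorts \<Sigma> ==> small (tuples M \<Gamma>)"
proof (induction \<Gamma>)
 case Nil
 have "{[] :: 'u list} \<lesssim> (UNIV :: ('s, 'f, 'r, 'i) form set)" unfolding lepoll_def by (intro exI[of _ "\<lambda>_. undefined"]) simp
 then show ?case unfolding tuples_Nil by (rule small_index)
next
 case (Cons s \<Gamma>)
 have "tuples M (s # \<Gamma>) = (\<lambda>(x, b). x # b) ` (Car M s \<times> tuples M \<Gamma>)" by (auto simp: tuples_Cons)
 moreover have "small (Car M s)" using M_struct Cons.prems by (intro small_U) (simp add: is_structure_def)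
 ultimately show ?case using Cons by (simp add: small_image small_times)
qed

text \<open>A context is itself coded as a formula, namely a chain of quantifiers in front of
  \<open>Verum\<close>, so there are no more formulae-in-context than formulae.\<close>

lemma fics_lepoll: "fics \<lesssim> (UNIV :: ('s, 'f, 'r, 'i) form set)"
proof -
 have *: "foldr Exi \<Gamma> Verum = foldr Exi \<Delta> (Verum :: ('s, 'f, 'r, 'i) form) ==> \<Gamma> = \<Delta>" for \<Gamma> \<Delta>
 proof (induction \<Gamma> arbitrary: \<Delta>)
  case Nil then show ?case by (cases \<Delta>) auto
 next
  case (Cons s \<Gamma>) then show ?case by (cases \<Delta>) auto
 qed
 define h :: "('s, 'f, 'r, 'i) fic => ('s, 'f, 'r, 'i) form" where "h = (\<lambda>(\<Gamma>, \<phi>). Conj (foldr Exi \<Gamma> Verum) \<phi>)"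
 have "inj h" unfolding h_def by (rule injI) (clarsimp, erule *)
 then have "inj_on h fics" by (rule inj_on_subset) simp
 then show ?thesis unfolding lepoll_def by (intro exI[of _ h] conjI) simp_all
qed

text \<open>One point is taken from each complete piece; the pieces are indexed by a subset of
  \<open>'i\<close>, which embeds into the formulae by
  \<open>i \<mapsto> Disj {i} (\<lambda>_. Verum)\<close>.\<close>

lemma transversal:
 assumes X: "X \<in> fics"
 shows "\<exists>R\<subseteq>ext M X. R \<lesssim> (UNIV :: ('s, 'f, 'r, 'i) form set) \<and> (\<forall>x\<in>ext M X. \<exists>r\<in>R. \<exists>g\<in>carrier G. tup_map (fst X) g r = x)"
proof -
 obtain K :: "'i set" and F where K: "\<And>k. k \<in> K ==> cfm (fst X, F k)" "ext M X = (\<Union>k\<in>K. ext M (fst X, F k))"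
  by (rule M_decompose[OF X]) (rule that)
 have "\<forall>k\<in>K. \<exists>r. r \<in> ext M (fst X, F k)" using complete_orbit(1)[OF K(1)] by blast
 from bchoice[OF this] obtain r where r: "\<forall>k\<in>K. r k \<in> ext M (fst X, F k)" ..
 have "r ` K \<lesssim> K" by (rule image_lepoll)
 moreover have "K \<lesssim> (UNIV :: ('s, 'f, 'r, 'i) form set)"
  unfolding lepoll_def by (intro exI[of _ "\<lambda>i. Disj {i} (\<lambda>_. Verum)"] conjI inj_onI) auto
 ultimately have "r ` K \<lesssim> (UNIV :: ('s, 'f, 'r, 'i) form set)" by (rule lepoll_trans)
 moreover have "\<exists>r\<in>r ` K. \<exists>g\<in>carrier G. tup_map (fst X) g r = x" if x: "x \<in> ext M X" for x
 proof -
  obtain k where k: "k \<in> K" "x \<in> ext M (fst X, F k)" using x K(2) by blast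
  have "r k \<in> ext M (fst X, F k)" using r k(1) by blast
  from complete_orbit(2)[OF K(1)[OF k(1)] this k(2)] show ?thesis using k(1) by (auto simp: carrier_G)
 qed
 moreover have "r ` K \<subseteq> ext M X" using r K(2) by blast
 ultimately show ?thesis by blast
qed

lemma homogeneous_\<I>: "X \<in> \<I> ==> \<forall>v\<in>ext M X. \<forall>w\<in>ext M X. \<exists>g\<in>carrier G. tup_map (fst X) g v = w"
 using \<I>_transitive by (simp add: carrier_G)

text \<open>The equivalence of toposes draws on logic only through this interpretation.\<close>

sublocale F: fibre_functor \<C> \<J> \<U> "TYPE(('s, 'f, 'r, 'i) form)" G \<B> \<tau> "ext M" "\<lambda>X. tup_map (fst X)" mor
proof (intro fibre_functor.intro fibre_functor_axioms.intro)
 show "site \<C> \<U>" by unfold_locales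
 show "universe TYPE(('s, 'f, 'r, 'i) form) \<U>" by unfold_locales
 show "group G" by (rule group_G)
 fix X Y :: "('s, 'f, 'r, 'i) fic" and f x y' g
 show "\<exists>Z\<in>Obj \<C>. \<exists>z\<in>ext M Z. \<exists>p\<in>Hom \<C> Z X. \<exists>q\<in>Hom \<C> Z Y. mor p z = x \<and> mor q z = y' \<and>
   (\<forall>v\<in>ext M Z. \<forall>w\<in>ext M Z. \<exists>g\<in>carrier G. tup_map (fst Z) g v = w)"
  if o: "X \<in> Obj \<C>" "Y \<in> Obj \<C>" "x \<in> ext M X" "y' \<in> ext M Y"
 proof -
  obtain W c p q where "W \<in> \<I>" "c \<in> ext M W" "p \<in> Hom \<C> W X" "q \<in> Hom \<C> W Y" "mor p c = x" "mor q c = y'"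
   using span_\<I>[of X Y x y'] o unfolding Obj_C by blast
  then show ?thesis using homogeneous_\<I> \<I>_fics Obj_C by blast
 qed
 show "\<exists>H\<in>\<B>. \<forall>g\<in>H. tup_map (fst X) g x = x" if X: "X \<in> Obj \<C>" "x \<in> ext M X"
 proof -
  obtain W c p where W: "W \<in> \<I>" "c \<in> ext M W" "p \<in> Hom \<C> W X" "mor p c = x"
   using span_\<I>[of X X x x] X unfolding Obj_C by blast
  have "{g \<in> carrier G. tup_map (fst W) g c = c} \<in> \<B>" using W(1,2) base_iff by blast
  then show ?thesis using base_mor[OF W(1) _ W(2,3)] W(4) X(1) by (intro bexI) auto
 qed
 show "\<exists>X\<in>Obj \<C>. \<exists>x\<in>ext M X. (\<forall>v\<in>ext M X. \<forall>w\<in>ext M X. \<exists>g\<in>carrier G. tup_map (fst X) g v = w) \<and>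
   H = {g \<in> carrier G. tup_map (fst X) g x = x}" if "H \<in> \<B>" for H
  using that homogeneous_\<I> \<I>_fics unfolding base_iff Obj_C by blast
 show "small (ext M X)" if "X \<in> Obj \<C>"
  using that by (intro small_subset[OF small_tuples[OF fic_sorts]]) (auto dest: ext_tuples)
 show "S \<in> \<J> X \<longleftrightarrow> is_sieve \<C> X S \<and> (\<forall>x\<in>ext M X. \<exists>Y\<in>Obj \<C>. \<exists>f\<in>S \<inter> Hom \<C> Y X. \<exists>y\<in>ext M Y. mor f y = x)"
  if "X \<in> Obj \<C>" for S using M_J_iff[of X S] that by simp
 show "Obj \<C> \<lesssim> (UNIV :: ('s, 'f, 'r, 'i) form set)" using fics_lepoll by simp
 show "continuous_gset G \<tau> (A, \<alpha>) \<longleftrightarrow> group_action G A \<alpha> \<and> (\<forall>x\<in>A. \<exists>H\<in>\<B>. \<forall>g\<in>H. \<alpha> g x = x)" for A :: "'u set" and \<alpha>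
  by (rule continuous_gset_iff[OF algebraic_base])
qed (use act_in act_one act_mult mor_in mor_act mor_Idn mor_Cmp mor_inj transversal in \<open>simp_all\<close>)

section \<open>Realizations as continuous sets with action, and their comparison with
  representables\<close>

context
 fixes tup :: "'u list => 'u"
 assumes inj_tup: "inj tup"
begin

abbreviation gs :: "('s, 'f, 'r, 'i) fic => ('s => 'u => 'u, 'u) gset" where
 "gs \<equiv> ext_gset tup \<Sigma> M"

abbreviation untup :: "'u => 'u list" where
 "untup \<equiv> inv_into UNIV tup"

lemma untup: "untup (tup a) = a"
 by (rule inv_into_f_f[OF inj_tup UNIV_I])

lemma gs_fst: "fst (gs X) = tup ` ext M X"
 by (simp add: ext_gset_def)

lemma gs_act: "g \<in> carrier G ==> a \<in> ext M X ==> snd (gs X) g (tup a) = tup (tup_map (fst X) g a)"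
 by (simp add: ext_gset_def carrier_G untup)

lemma gs_Ct:
 assumes X: "X \<in> fics"
 shows "gs X \<in> Obj F.Ct"
 unfolding F.Ct_Obj group_action_iff
proof (intro conjI ballI)
 have "small (ext M X)" using F.small_fibre[of X] X by simp
 then show "fst (gs X) \<in> \<U>" unfolding gs_fst U_iff_small by (rule small_image)
 show "snd (gs X) \<in> extensional (carrier G)" by (simp add: ext_gset_def carrier_G)
 show "snd (gs X) g \<in> extensional (fst (gs X))" if "g \<in> carrier G" for g using that by (simp add: ext_gset_def carrier_G)
 show "group G" by (rule group_G)
 fix u assume "u \<in> fst (gs X)"
 then obtain a where a: "a \<in> ext M X" "u = tup a" by (auto simp: gs_fst)
 show "snd (gs X) g u \<in> fst (gs X)" if "g \<in> carrier G" for g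
  using that a act_in[OF X that a(1)] by (simp add: gs_act gs_fst)
 show "snd (gs X) \<one>\<^bsub>G\<^esub> u = u" using a act_one[OF X a(1)] group.is_monoid[OF group_G] by (simp add: gs_act monoid.one_closed)
 show "snd (gs X) (g \<otimes>\<^bsub>G\<^esub> h) u = snd (gs X) g (snd (gs X) h u)" if "g \<in> carrier G" "h \<in> carrier G" for g h
  using that a act_mult[OF X that a(1)] act_in[OF X that(2) a(1)] group.is_monoid[OF group_G] by (simp add: gs_act monoid.m_closed)
 obtain H where H: "H \<in> \<B>" "\<forall>g\<in>H. tup_map (fst X) g a = a" using F.stab[of X a] X a(1) by auto
 moreover have "H \<subseteq> carrier G" using H(1) unfolding base_iff by blast
 ultimately have "snd (gs X) g u = u" if "g \<in> H" for g using that a gs_act[of g a X] by auto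
 then show "\<exists>H\<in>\<B>. \<forall>g\<in>H. snd (gs X) g u = u" using H(1) by blast
qed

definition ext_functor :: "(('s, 'f, 'r, 'i) fic, ('s, 'f, 'r, 'i) syn_arrow, ('s => 'u => 'u, 'u) gset,
  ('s => 'u => 'u, 'u) gset \<times> ('u => 'u) \<times> ('s => 'u => 'u, 'u) gset) cfunctor" where
 "ext_functor = \<lparr>on_ob = gs, on_ar = (\<lambda>f. (gs (fst f), \<lambda>u\<in>tup ` ext M (fst f). tup (mor f (untup u)), gs (snd (snd f))))\<rparr>"

lemma on_ob_ext_functor: "on_ob ext_functor = gs"
 by (simp add: ext_functor_def)

lemma on_ar_ext_functor:
 assumes "X \<in> fics" "Y \<in> fics" "f \<in> Hom \<C> X Y"
 shows "on_ar ext_functor f = (gs X, \<lambda>u\<in>tup ` ext M X. tup (mor f (untup u)), gs Y)"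
  "equivariant G (gs X) (gs Y) (\<lambda>u\<in>tup ` ext M X. tup (mor f (untup u)))"
  "on_ar ext_functor f \<in> Hom F.Ct (gs X) (gs Y)"
proof -
 obtain \<theta> where "f = arr X Y \<theta>" using assms(3) by (rule HomE)
 then show 1: "on_ar ext_functor f = (gs X, \<lambda>u\<in>tup ` ext M X. tup (mor f (untup u)), gs Y)"
  by (simp add: ext_functor_def syn_arrow_def)
 show 2: "equivariant G (gs X) (gs Y) (\<lambda>u\<in>tup ` ext M X. tup (mor f (untup u)))"
  using mor_in[OF assms] act_in[OF assms(1)] by (auto simp: equivariant_iff gs_fst gs_act untup mor_act[OF assms])
 show "on_ar ext_functor f \<in> Hom F.Ct (gs X) (gs Y)" using 2 by (simp add: 1 Cont_Hom gs_fst)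
qed

lemma is_functor_ext_functor: "is_functor \<C>\<^sub>I F.Ct ext_functor"
 unfolding is_functor_def on_ob_ext_functor full_subcat_simps Obj_C
proof (intro conjI ballI)
 fix X assume "X \<in> fics \<inter> \<I>"
 then have X: "X \<in> fics" by simp
 show "gs X \<in> Obj F.Ct" by (rule gs_Ct[OF X])
 have I: "Idn \<C> X \<in> Hom \<C> X X" using S.Idn[of X] X by simp
 show "on_ar ext_functor (Idn \<C> X) = Idn F.Ct (gs X)"
  unfolding on_ar_ext_functor(1)[OF X X I] Cont_Idn gs_fst using mor_Idn[OF X] by (auto simp: untup fun_eq_iff)
 fix Y assume "Y \<in> fics \<inter> \<I>"
 then have Y: "Y \<in> fics" by simp
 show "on_ar ext_functor f \<in> Hom F.Ct (gs X) (gs Y)" if "f \<in> Hom \<C> X Y" for f by (rule on_ar_ext_functor(3)[OF X Y that])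
 fix Z f g assume "Z \<in> fics \<inter> \<I>" and f: "f \<in> Hom \<C> X Y" and g: "g \<in> Hom \<C> Y Z"
 then have Z: "Z \<in> fics" by simp
 have gf: "Cmp \<C> g f \<in> Hom \<C> X Z" using S.Cmp[of X Y Z f g] X Y Z f g by simp
 show "on_ar ext_functor (Cmp \<C> g f) = Cmp F.Ct (on_ar ext_functor g) (on_ar ext_functor f)"
  unfolding on_ar_ext_functor(1)[OF X Z gf] on_ar_ext_functor(1)[OF X Y f] on_ar_ext_functor(1)[OF Y Z g] Cont_Cmp
  using mor_Cmp[OF X Y Z f g] mor_in[OF X Y f] by (auto simp: untup fun_eq_iff compose_def gs_fst)
qed

text \<open>The orbit-stabilizer bijection: \<kappa> sends \<open>u\<close> to the set of
  automorphisms that move \<open>a\<close> to \<open>u\<close>, which is a left coset of the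
  stabilizer of \<open>a\<close>.\<close>

lemma gs_coset:
 assumes X: "X \<in> \<I>" and a: "a \<in> ext M X"
 shows "gset_iso G (gs X) (coset_gset G {g \<in> carrier G. tup_map (fst X) g a = a})"
proof -
 let ?H = "{g \<in> carrier G. tup_map (fst X) g a = a}"
 note Xf = \<I>_fics[OF X]
 define \<kappa> where "\<kappa> u = {g \<in> carrier G. tup (tup_map (fst X) g a) = u}" for u
 have \<kappa>: "\<kappa> (tup (tup_map (fst X) g a)) = g <#\<^bsub>G\<^esub> ?H" if g: "g \<in> carrier G" for g
 proof (intro subset_antisym subsetI)
  fix k assume "k \<in> \<kappa> (tup (tup_map (fst X) g a))"
  then have k: "k \<in> carrier G" "tup_map (fst X) k a = tup_map (fst X) g a" using inj_tup by (auto simp: \<kappa>_def inj_eq)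
  have "inv\<^bsub>G\<^esub> g \<otimes>\<^bsub>G\<^esub> k \<in> ?H" using act_mult[OF Xf F.inv_closed[OF g] k(1) a] act_inv[OF Xf g a] k g by simp
  moreover have "k = g \<otimes>\<^bsub>G\<^esub> (inv\<^bsub>G\<^esub> g \<otimes>\<^bsub>G\<^esub> k)" using g k(1) by (simp add: F.m_assoc[symmetric])
  ultimately show "k \<in> g <#\<^bsub>G\<^esub> ?H" unfolding l_coset_def by blast
 next
  fix k assume "k \<in> g <#\<^bsub>G\<^esub> ?H"
  then obtain h where h: "h \<in> carrier G" "tup_map (fst X) h a = a" "k = g \<otimes>\<^bsub>G\<^esub> h" by (auto simp: l_coset_def)
  then show "k \<in> \<kappa> (tup (tup_map (fst X) g a))" using act_mult[OF Xf g h(1) a] g by (simp add: \<kappa>_def)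
 qed
 have orb: "\<exists>g\<in>carrier G. u = tup (tup_map (fst X) g a)" if u: "u \<in> tup ` ext M X" for u
 proof -
  obtain b where b: "b \<in> ext M X" "u = tup b" using u by blast
  obtain g where "g \<in> carrier G" "tup_map (fst X) g a = b" using homogeneous_\<I>[OF X] a b(1) by blast
  then show ?thesis using b(2) by blast
 qed
 have "equivariant G (gs X) (coset_gset G ?H) \<kappa>" unfolding equivariant_iff gs_fst
 proof (intro conjI ballI)
  show "\<kappa> \<in> tup ` ext M X \<rightarrow> fst (coset_gset G ?H)"
  proof
   fix u assume "u \<in> tup ` ext M X"
   then obtain g where "g \<in> carrier G" "u = tup (tup_map (fst X) g a)" using orb by blast
   then show "\<kappa> u \<in> fst (coset_gset G ?H)" by (auto simp: \<kappa> coset_gset_def LCOSETS_def)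
  qed
  fix k u assume k: "k \<in> carrier G" and "u \<in> tup ` ext M X"
  then obtain g where g: "g \<in> carrier G" "u = tup (tup_map (fst X) g a)" using orb by blast
  have "snd (gs X) k u = tup (tup_map (fst X) (k \<otimes>\<^bsub>G\<^esub> g) a)"
   using gs_act[OF k act_in[OF Xf g(1) a]] act_mult[OF Xf k g(1) a] g(2) by simp
  then have "\<kappa> (snd (gs X) k u) = (k \<otimes>\<^bsub>G\<^esub> g) <#\<^bsub>G\<^esub> ?H" using \<kappa>[OF F.m_closed[OF k g(1)]] by simp
  also have "\<dots> = k <#\<^bsub>G\<^esub> (g <#\<^bsub>G\<^esub> ?H)" using F.lcos_m_assoc[of ?H k g] k g(1) by auto
  also have "\<dots> = snd (coset_gset G ?H) k (\<kappa> u)" using k g by (auto simp: \<kappa> coset_gset_def LCOSETS_def)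
  finally show "\<kappa> (snd (gs X) k u) = snd (coset_gset G ?H) k (\<kappa> u)" .
 qed
 moreover have "bij_betw \<kappa> (fst (gs X)) (fst (coset_gset G ?H))" unfolding gs_fst
 proof (intro bij_betw_imageI inj_onI subset_antisym subsetI)
  fix u v assume "u \<in> tup ` ext M X" and e: "\<kappa> u = \<kappa> v"
  then obtain g where "g \<in> carrier G" "u = tup (tup_map (fst X) g a)" using orb by blast
  then have "g \<in> \<kappa> u" by (simp add: \<kappa>_def)
  then show "u = v" using e by (auto simp: \<kappa>_def)
 next
  fix c assume "c \<in> \<kappa> ` tup ` ext M X"
  then show "c \<in> fst (coset_gset G ?H)" using orb \<kappa> by (fastforce simp: coset_gset_def LCOSETS_def)
 next
  fix c assume "c \<in> fst (coset_gset G ?H)"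
  then obtain g where g: "g \<in> carrier G" "c = g <#\<^bsub>G\<^esub> ?H" by (auto simp: coset_gset_def LCOSETS_def)
  have "c = \<kappa> (tup (tup_map (fst X) g a))" using \<kappa>[OF g(1)] g(2) by simp
  then show "c \<in> \<kappa> ` tup ` ext M X" using act_in[OF Xf g(1) a] by blast
 qed
 ultimately show ?thesis unfolding gset_iso_def by blast
qed

abbreviation "CtI \<equiv> Cont_I \<U> \<Sigma> M \<I> \<tau>"

lemma CtI_simps: "Obj CtI = Obj F.Ct \<inter> {A. \<exists>H\<in>\<B>. gset_iso G A (coset_gset G H)}" "Hom CtI = Hom F.Ct" "Idn CtI = Idn F.Ct" "Cmp CtI = Cmp F.Ct"
 by (simp_all add: Cont_I_def)

lemma gs_CtI:
 assumes X: "X \<in> \<I>"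
 shows "gs X \<in> Obj CtI"
proof -
 obtain a where a: "a \<in> ext M X" using \<I>_realized[OF X] by blast
 have "{g \<in> carrier G. tup_map (fst X) g a = a} \<in> \<B>" unfolding base_iff by (rule bexI[OF _ X]) (rule bexI[OF refl a])
 then have "\<exists>H\<in>\<B>. gset_iso G (gs X) (coset_gset G H)" by (rule bexI[rotated]) (rule gs_coset[OF X a])
 then show ?thesis unfolding CtI_simps using gs_Ct[OF \<I>_fics[OF X]] by (intro IntI CollectI)
qed

text \<open>Fullness and faithfulness are \<open>mor_full\<close> and \<open>mor_inj\<close>. An
  object of \<open>CtI\<close> is isomorphic to the coset space of the stabilizer of a realized
  tuple, hence to a realization by \<open>gs_coset\<close>.\<close>

lemma ext_functor_ff_es: "ff_es \<C>\<^sub>I CtI ext_functor"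
proof
 show "is_category \<C>\<^sub>I" by (rule is_category_full_subcat[OF is_category_C])
 show "is_category CtI" unfolding Cont_I_def by (rule is_category_full_subcat[OF is_category_Cont])
 show "is_functor \<C>\<^sub>I CtI ext_functor"
  using is_functor_ext_functor gs_CtI unfolding is_functor_def CtI_simps(2-4) on_ob_ext_functor by simp
next
 fix X Y t assume "X \<in> Obj \<C>\<^sub>I" "Y \<in> Obj \<C>\<^sub>I" "t \<in> Hom CtI (on_ob ext_functor X) (on_ob ext_functor Y)"
 then have X: "X \<in> fics" and Y: "Y \<in> fics" and "t \<in> Hom F.Ct (gs X) (gs Y)" by (simp_all add: CtI_simps on_ob_ext_functor)
 then obtain h where h: "t = (gs X, h, gs Y)" "h \<in> extensional (tup ` ext M X)" "equivariant G (gs X) (gs Y) h"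
  by (auto simp: Cont_Hom gs_fst)
 have hin: "h (tup a) \<in> tup ` ext M Y" if "a \<in> ext M X" for a using h(3) that by (auto simp: equivariant_iff gs_fst)
 have "untup (h (tup a)) \<in> ext M Y" "tup (untup (h (tup a))) = h (tup a)" if a: "a \<in> ext M X" for a
  using hin[OF a] by (auto simp: untup)
 note hu = this
 have "untup (h (tup (tup_map (fst X) g a))) = tup_map (fst Y) g (untup (h (tup a)))"
  if g: "g \<in> automorphisms \<Sigma> M" and a: "a \<in> ext M X" for g a
 proof -
  have g': "g \<in> carrier G" using g by (simp add: carrier_G)
  have "h (snd (gs X) g (tup a)) = snd (gs Y) g (h (tup a))" using h(3) g' a by (simp add: equivariant_iff gs_fst)
  also have "\<dots> = tup (tup_map (fst Y) g (untup (h (tup a))))" using gs_act[OF g' hu(1)[OF a]] hu(2)[OF a] by simp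
  finally show ?thesis by (simp add: gs_act[OF g' a] untup)
 qed
 from mor_full[OF X Y hu(1) this] obtain f where f: "f \<in> Hom \<C> X Y" "\<forall>a\<in>ext M X. mor f a = untup (h (tup a))" by blast
 have "(\<lambda>u\<in>tup ` ext M X. tup (mor f (untup u))) = h"
  by (rule extensionalityI[OF _ h(2)]) (use f(2) hu(2) untup in auto)
 then have "on_ar ext_functor f = t" using on_ar_ext_functor(1)[OF X Y f(1)] h(1) by simp
 then show "\<exists>f\<in>Hom \<C>\<^sub>I X Y. on_ar ext_functor f = t" using f(1) by auto
next
 fix X Y f f' assume "X \<in> Obj \<C>\<^sub>I" "Y \<in> Obj \<C>\<^sub>I" "f \<in> Hom \<C>\<^sub>I X Y" "f' \<in> Hom \<C>\<^sub>I X Y"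
  and e: "on_ar ext_functor f = on_ar ext_functor f'"
 then have X: "X \<in> fics" and Y: "Y \<in> fics" and f: "f \<in> Hom \<C> X Y" "f' \<in> Hom \<C> X Y" by simp_all
 have e': "(\<lambda>u\<in>tup ` ext M X. tup (mor f (untup u))) = (\<lambda>u\<in>tup ` ext M X. tup (mor f' (untup u)))"
  using e by (simp add: on_ar_ext_functor(1)[OF X Y f(1)] on_ar_ext_functor(1)[OF X Y f(2)])
 have "mor f a = mor f' a" if "a \<in> ext M X" for a
  using fun_cong[OF e', of "tup a"] that inj_tup by (simp add: untup inj_eq)
 then show "f = f'" by (rule mor_inj[OF X Y f])
next
 fix A assume "A \<in> Obj CtI"
 then obtain H where A: "A \<in> Obj F.Ct" and H: "H \<in> \<B>" "gset_iso G A (coset_gset G H)" by (auto simp: CtI_simps)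
 obtain X a where X: "X \<in> \<I>" "a \<in> ext M X" "H = {g \<in> carrier G. tup_map (fst X) g a = a}" using H(1) unfolding base_iff by blast
 obtain k where k: "equivariant G A (coset_gset G H) k" "bij_betw k (fst A) (fst (coset_gset G H))" using H(2) unfolding gset_iso_def by blast
 obtain l where l: "equivariant G (gs X) (coset_gset G H) l" "bij_betw l (fst (gs X)) (fst (coset_gset G H))"
  using gs_coset[OF X(1,2)] X(3) unfolding gset_iso_def by blast
 note ki = equivariant_inv_into[OF k F.Ct_act(1)[OF A]]
 have "equivariant G (gs X) A (inv_into (fst A) k \<circ> l)" using l(1) ki by (auto simp: equivariant_iff Pi_iff)
 moreover have "bij_betw (inv_into (fst A) k \<circ> l) (fst (gs X)) (fst A)" by (rule bij_betw_trans[OF l(2) bij_betw_inv_into[OF k(2)]])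
 ultimately have "\<exists>e e'. is_inverse_pair F.Ct (gs X) A e e'" using Cont_iso[OF gs_Ct[OF \<I>_fics[OF X(1)]]] by blast
 then have "\<exists>e e'. is_inverse_pair CtI (on_ob ext_functor X) A e e'"
  unfolding is_inverse_pair_def CtI_simps on_ob_ext_functor .
 moreover have "X \<in> Obj \<C>\<^sub>I" using X(1) \<I>_fics[OF X(1)] by simp
 ultimately show "\<exists>X\<in>Obj \<C>\<^sub>I. \<exists>e e'. is_inverse_pair CtI (on_ob ext_functor X) A e e'" by blast
qed

lemma yoneda_Hom:
 assumes X: "X \<in> fics" and Y: "Y \<in> fics" and f: "f \<in> Hom \<C> X Y"
 shows "on_ar \<Y> f \<in> Hom S.PSh (y X) (y Y)"
  "Z \<in> fics ==> h \<in> Hom \<C> Z X ==> tapp (on_ar \<Y> f) Z (code h) = code (Cmp \<C> f h)"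
proof -
 have o: "X \<in> Obj \<C>" "Y \<in> Obj \<C>" using X Y by simp_all
 note ar = S.on_ar_yoneda[OF inj_code o f]
 show "on_ar \<Y> f \<in> Hom S.PSh (y X) (y Y)"
  unfolding ar by (rule S.yar_Hom[OF inj_code o y_PSh[OF X] y_PSh[OF Y] f])
 show "tapp (on_ar \<Y> f) Z (code h) = code (Cmp \<C> f h)" if "Z \<in> fics" "h \<in> Hom \<C> Z X"
  unfolding ar using S.tapp_yar[OF inj_code o(1) _ that(2)] that(1) by simp
qed

lemma is_functor_yoneda: "is_functor \<C> S.Sh \<Y>"
proof -
 interpret P: cat S.PSh by unfold_locales (rule S.is_category_PSh)
 have ob: "on_ob \<Y> X = y X" if "X \<in> fics" for X using S.on_ob_yoneda[OF inj_code, of X] that by simp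
 have I: "Idn \<C> X \<in> Hom \<C> X X" if "X \<in> fics" for X using S.Idn[of X] that by simp
 show ?thesis unfolding is_functor_def S.Sh_simps Obj_C
 proof (intro conjI ballI)
  show "on_ob \<Y> X \<in> Obj S.Sh" if "X \<in> fics" for X using y_Sh[OF that] ob[OF that] by simp
  show "on_ar \<Y> f \<in> Hom S.PSh (on_ob \<Y> X) (on_ob \<Y> Y)"
   if "X \<in> fics" "Y \<in> fics" "f \<in> Hom \<C> X Y" for X Y f
   using yoneda_Hom(1)[OF that] ob that by simp
  show "on_ar \<Y> (Idn \<C> X) = Idn S.PSh (on_ob \<Y> X)" if X: "X \<in> fics" for X
   unfolding ob[OF X]
  proof (rule S.PSh_Hom_eqI[OF yoneda_Hom(1)[OF X X I[OF X]] P.Idn[OF y_PSh[OF X]]])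
   fix Z s assume Z: "Z \<in> Obj \<C>" and s: "s \<in> on_ob (y X) Z"
   then obtain h where h: "h \<in> Hom \<C> Z X" "s = code h" using y_ob[of Z X] by auto
   show "tapp (on_ar \<Y> (Idn \<C> X)) Z s = tapp (Idn S.PSh (y X)) Z s"
    using S.tapp_Idn[OF Z s] yoneda_Hom(2)[OF X X I[OF X] _ h(1)] S.Idn_Cmp[OF Z _ h(1)] Z X h(2) by simp
  qed
  show "on_ar \<Y> (Cmp \<C> g f) = Cmp S.PSh (on_ar \<Y> g) (on_ar \<Y> f)"
   if X: "X \<in> fics" and Y: "Y \<in> fics" and W: "W \<in> fics" and f: "f \<in> Hom \<C> X Y" and g: "g \<in> Hom \<C> Y W" for X Y W f g
  proof -
   have o: "X \<in> Obj \<C>" "Y \<in> Obj \<C>" "W \<in> Obj \<C>" using X Y W by simp_all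
   note gf = S.Cmp[OF o f g] and yf = yoneda_Hom[OF X Y f] and yg = yoneda_Hom[OF Y W g]
   show ?thesis
   proof (rule S.PSh_Hom_eqI[OF yoneda_Hom(1)[OF X W gf] P.Cmp[OF y_PSh[OF X] y_PSh[OF Y] y_PSh[OF W] yf(1) yg(1)]])
    fix Z s assume Z: "Z \<in> Obj \<C>" and s: "s \<in> on_ob (y X) Z"
    then obtain h where h: "h \<in> Hom \<C> Z X" "s = code h" using y_ob[of Z X] by auto
    have Zf: "Z \<in> fics" using Z by simp
    show "tapp (on_ar \<Y> (Cmp \<C> g f)) Z s = tapp (Cmp S.PSh (on_ar \<Y> g) (on_ar \<Y> f)) Z s"
     unfolding S.tapp_Cmp[OF yf(1) yg(1) Z s]
     unfolding h(2) yoneda_Hom(2)[OF X W gf Zf h(1)] yf(2)[OF Zf h(1)] yg(2)[OF Zf S.Cmp[OF Z o(1,2) h(1) f]]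
     using S.assoc[OF Z o h(1) f g] by simp
   qed
  qed
 qed
qed

text \<open>By \<open>mor_inj\<close> and \<open>mor_full\<close> the arrows from \<open>Z\<close>
  to \<open>X\<close> correspond to the equivariant maps between the realizations, and these are the
  sections over \<open>Z\<close> of the nerve of \<open>gs X\<close>.\<close>

lemma yoneda_nerve: "naturally_isomorphic \<C>\<^sub>I S.Sh \<Y> (comp_functor F.nerve ext_functor)"
proof -
 let ?B = \<C>\<^sub>I
 have BI: "X \<in> fics" "X \<in> Obj \<C>" if "X \<in> Obj ?B" for X using that by simp_all
 have yF: "is_functor ?B S.Sh \<Y>" by (rule is_functor_full_subcat[OF is_functor_yoneda])
 have ob: "on_ob \<Y> X = y X" if "X \<in> fics" for X using S.on_ob_yoneda[OF inj_code, of X] that by simp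
 define dec where "dec = inv_into (arrows \<C>) code"
 have dec: "dec (code f) = f" if "X \<in> fics" "Z \<in> fics" "f \<in> Hom \<C> Z X" for X Z f
  unfolding dec_def using S.dec[OF inj_code, of Z X f] that by simp
 \<comment> \<open>Decodes an arrow from \<open>Z\<close> to \<open>X\<close> and codes its action
   on the realizations as a section of the nerve.\<close>
 define t where "t X Z u = F.mk Z (gs X) (\<lambda>z. tup (mor (dec u) z))" for X Z u
 have t: "t X Z (code f) \<in> on_ob (F.nv (gs X)) Z" "z \<in> ext M Z ==> F.el Z (gs X) (t X Z (code f)) z = tup (mor f z)"
  if X: "X \<in> fics" and Z: "Z \<in> fics" and f: "f \<in> Hom \<C> Z X" for X Z f z
 proof -
  have Z': "Z \<in> Obj \<C>" using Z by simp
  have "tup (mor f z) \<in> fst (gs X)" if "z \<in> ext M Z" for z using mor_in[OF Z X f that] by (simp add: gs_fst)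
  moreover have "tup (mor f (tup_map (fst Z) g z)) = snd (gs X) g (tup (mor f z))" if "g \<in> carrier G" "z \<in> ext M Z" for g z
   using mor_act[OF Z X f that] gs_act[OF that(1) mor_in[OF Z X f that(2)]] by simp
  ultimately show "t X Z (code f) \<in> on_ob (F.nv (gs X)) Z" "z \<in> ext M Z ==> F.el Z (gs X) (t X Z (code f)) z = tup (mor f z)"
   unfolding t_def dec[OF X Z f] using F.mk[OF Z' gs_Ct[OF X], of "\<lambda>z. tup (mor f z)"] by blast+
 qed
 have nat: "t X W (S.res (y X) g s) = S.res (F.nv (gs X)) g (t X Z s)"
  if X: "X \<in> fics" and o: "W \<in> Obj \<C>" "Z \<in> Obj \<C>" "g \<in> Hom \<C> W Z" and s: "s \<in> on_ob (y X) Z" for X W Z g s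
 proof -
  have W: "W \<in> fics" and Z: "Z \<in> fics" and X': "X \<in> Obj \<C>" using o X by simp_all
  obtain f where f: "f \<in> Hom \<C> Z X" "s = code f" using s y_ob[OF Z, of X] by auto
  note fg = S.Cmp[OF o(1,2) X' o(3) f(1)] and A = gs_Ct[OF X]
  note tf = t[OF X Z f(1)]
  show ?thesis unfolding f(2) y_res[OF X W Z o(3) f(1)]
   by (rule F.nv_eqI[OF o(1) t(1)[OF X W fg] S.res_in[OF F.nv_PSh[OF A] o tf(1)]])
    (simp add: t(2)[OF X W fg] F.el_res[OF o A tf(1)] tf(2) mor_in[OF W Z o(3)] mor_Cmp[OF W Z X o(3) f(1)])
 qed
 have bij: "bij_betw (t X Z) (on_ob (y X) Z) (on_ob (F.nv (gs X)) Z)" if X: "X \<in> fics" and Z': "Z \<in> Obj \<C>" for X Z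
 proof -
  have Z: "Z \<in> fics" using Z' by simp
  show ?thesis
  proof (intro bij_betw_imageI inj_onI subset_antisym subsetI)
   fix s s' assume "s \<in> on_ob (y X) Z" "s' \<in> on_ob (y X) Z" and e: "t X Z s = t X Z s'"
   then obtain f f' where f: "f \<in> Hom \<C> Z X" "s = code f" "f' \<in> Hom \<C> Z X" "s' = code f'" using y_ob[OF Z, of X] by auto
   have "mor f z = mor f' z" if z: "z \<in> ext M Z" for z
    using t(2)[OF X Z f(1) z] t(2)[OF X Z f(3) z] e f(2,4) inj_tup by (simp add: inj_eq)
   then have "f = f'" by (rule mor_inj[OF Z X f(1,3)])
   then show "s = s'" using f(2,4) by simp
  next
   fix u assume "u \<in> t X Z ` on_ob (y X) Z"
   then show "u \<in> on_ob (F.nv (gs X)) Z" using y_ob[OF Z, of X] t(1)[OF X Z] by auto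
  next
   fix u assume u: "u \<in> on_ob (F.nv (gs X)) Z"
   have hu: "untup (F.el Z (gs X) u z) \<in> ext M X" "tup (untup (F.el Z (gs X) u z)) = F.el Z (gs X) u z" if z: "z \<in> ext M Z" for z
    using F.el(1)[OF Z' u z] by (auto simp: gs_fst untup)
   have "untup (F.el Z (gs X) u (tup_map (fst Z) g z)) = tup_map (fst X) g (untup (F.el Z (gs X) u z))"
    if g: "g \<in> automorphisms \<Sigma> M" and z: "z \<in> ext M Z" for g z
   proof -
    have g': "g \<in> carrier G" using g by (simp add: carrier_G)
    show ?thesis using F.el(2)[OF Z' u z g'] gs_act[OF g' hu(1)[OF z]] hu(2)[OF z] untup by simp
   qed
   from mor_full[OF Z X hu(1) this] obtain f where f: "f \<in> Hom \<C> Z X" "\<forall>z\<in>ext M Z. mor f z = untup (F.el Z (gs X) u z)" by blast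
   have "t X Z (code f) = u"
    by (rule F.nv_eqI[OF Z' t(1)[OF X Z f(1)] u]) (simp add: t(2)[OF X Z f(1)] f(2) hu(2))
   then show "u \<in> t X Z ` on_ob (y X) Z" using y_ob[OF Z, of X] f(1) by blast
  qed
 qed
 define \<alpha> where "\<alpha> X = mkmap \<C> (y X) (F.nv (gs X)) (t X)" for X
 have \<alpha>_iso: "is_iso S.PSh (y X) (F.nv (gs X)) (\<alpha> X)" if X: "X \<in> fics" for X
  unfolding \<alpha>_def by (rule S.mkmap_iso[OF y_PSh[OF X] F.nv_PSh[OF gs_Ct[OF X]] bij[OF X] nat[OF X]])
 have \<alpha>: "\<alpha> X \<in> Hom S.PSh (y X) (F.nv (gs X))" if "X \<in> fics" for X using \<alpha>_iso[OF that] by (auto simp: is_iso_def is_inverse_pair_def)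
 interpret P: cat S.PSh by unfold_locales (rule S.is_category_PSh)
 have "is_nat_trans ?B S.Sh \<Y> (comp_functor F.nerve ext_functor) \<alpha>"
  unfolding is_nat_trans_def S.Sh_simps comp_functor_def cfunctor.simps F.on_ob_nerve on_ob_ext_functor
 proof (intro conjI ballI)
  show "\<alpha> X \<in> Hom S.PSh (on_ob \<Y> X) (F.nv (gs X))" if "X \<in> Obj ?B" for X
   using \<alpha>[OF BI(1)[OF that]] ob[OF BI(1)[OF that]] by simp
  fix X Y f assume X: "X \<in> Obj ?B" and Y: "Y \<in> Obj ?B" and "f \<in> Hom ?B X Y"
  then have f: "f \<in> Hom \<C> X Y" by simp
  note Xf = BI(1)[OF X] and Yf = BI(1)[OF Y]
  note A = gs_Ct[OF Xf] and B = gs_Ct[OF Yf]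
  note ar = on_ar_ext_functor[OF Xf Yf f] and yf = yoneda_Hom[OF Xf Yf f]
  note n = F.nerve_ar[OF A B ar(2), folded ar(1)]
  show "Cmp S.PSh (on_ar F.nerve (on_ar ext_functor f)) (\<alpha> X) = Cmp S.PSh (\<alpha> Y) (on_ar \<Y> f)"
  proof (rule S.PSh_Hom_eqI[OF P.Cmp[OF y_PSh[OF Xf] F.nv_PSh[OF A] F.nv_PSh[OF B] \<alpha>[OF Xf] n(1)]
     P.Cmp[OF y_PSh[OF Xf] y_PSh[OF Yf] F.nv_PSh[OF B] yf(1) \<alpha>[OF Yf]]])
   fix Z s assume Z: "Z \<in> Obj \<C>" and s: "s \<in> on_ob (y X) Z"
   have Zf: "Z \<in> fics" using Z by simp
   obtain h where h: "h \<in> Hom \<C> Z X" "s = code h" using s y_ob[OF Zf, of X] by auto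
   note th = t[OF Xf Zf h(1)] and fh = S.Cmp[OF Z BI(2)[OF X] BI(2)[OF Y] h(1) f]
   have \<alpha>s: "tapp (\<alpha> X) Z s = t X Z (code h)" unfolding \<alpha>_def using S.tapp_mkmap[OF Z s] h(2) by simp
   have ys: "code (Cmp \<C> f h) \<in> on_ob (y Y) Z" using fh y_ob[OF Zf, of Y] by simp
   have \<alpha>y: "tapp (\<alpha> Y) Z (code (Cmp \<C> f h)) = t Y Z (code (Cmp \<C> f h))" unfolding \<alpha>_def by (rule S.tapp_mkmap[OF Z ys])
   have "tapp (on_ar F.nerve (on_ar ext_functor f)) Z (t X Z (code h)) = t Y Z (code (Cmp \<C> f h))"
   proof (rule F.nv_eqI[OF Z S.tapp_in[OF n(1) Z th(1)] t(1)[OF Yf Zf fh]])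
    fix z assume z: "z \<in> ext M Z"
    show "F.el Z (gs Y) (tapp (on_ar F.nerve (on_ar ext_functor f)) Z (t X Z (code h))) z = F.el Z (gs Y) (t Y Z (code (Cmp \<C> f h))) z"
     unfolding n(2)[OF Z th(1) z] th(2)[OF z] t(2)[OF Yf Zf fh z] mor_Cmp[OF Zf Xf Yf h(1) f z]
     using mor_in[OF Zf Xf h(1) z] by (simp add: untup)
   qed
   then show "tapp (Cmp S.PSh (on_ar F.nerve (on_ar ext_functor f)) (\<alpha> X)) Z s = tapp (Cmp S.PSh (\<alpha> Y) (on_ar \<Y> f)) Z s"
    unfolding S.tapp_Cmp[OF \<alpha>[OF Xf] n(1) Z s] S.tapp_Cmp[OF yf(1) \<alpha>[OF Yf] Z s] \<alpha>s
    unfolding h(2) yf(2)[OF Zf h(1)] \<alpha>y .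
  qed
 qed
 moreover have "\<forall>X\<in>Obj ?B. is_iso S.Sh (on_ob \<Y> X) (on_ob (comp_functor F.nerve ext_functor) X) (\<alpha> X)"
  using \<alpha>_iso BI(1) ob by (simp add: S.is_iso_Sh comp_functor_def F.on_ob_nerve on_ob_ext_functor)
 ultimately show ?thesis unfolding naturally_isomorphic_def
  using yF is_functor_comp[OF is_functor_ext_functor F.is_functor_nerve] by blast
qed

lemma ext_functor_graph:
 assumes X: "X \<in> fics" and Y: "Y \<in> fics" and \<theta>: "fnl X Y \<theta>" and a: "a \<in> ext M X"
 shows "app (on_ar ext_functor (arr X Y \<theta>)) (tup a) = tup b \<longleftrightarrow> a @ b \<in> ext M (fst X @ fst Y, \<theta>)"
 using on_ar_ext_functor(1)[OF X Y Hom_C_I[OF \<theta>]] a inj_tup mor_arr[OF X Y \<theta> a, of b]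
  append_in_ext_iff[OF ext_length[OF a], of b M "fst Y" \<theta>]
 by (simp add: app_def untup inj_eq)

text \<open>\<Phi> is the quasi-inverse of the nerve, and \<open>quasi_inverse_unique\<close>
  applied to \<open>yoneda_nerve\<close> identifies its composite with Yoneda. \<Psi> is
  \<open>ext_functor\<close> itself, so the clauses on objects and on graphs hold literally and not
  just up to isomorphism.\<close>

lemma representation:
 "\<exists>\<Phi> \<Psi>. is_equivalence S.Sh F.Ct \<Phi> \<and> is_equivalence \<C>\<^sub>I CtI \<Psi> \<and>
   naturally_isomorphic \<C>\<^sub>I F.Ct (comp_functor \<Phi> \<Y>) \<Psi> \<and>
   (\<forall>X\<in>\<I>. on_ob \<Psi> X = gs X) \<and>
   (\<forall>X\<in>\<I>. \<forall>Y\<in>\<I>. \<forall>\<theta>. fnl X Y \<theta> -->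
    (\<forall>a\<in>ext M X. \<forall>b\<in>ext M Y. app (on_ar \<Psi> (arr X Y \<theta>)) (tup a) = tup b \<longleftrightarrow> a @ b \<in> ext M (fst X @ fst Y, \<theta>)))"
proof (intro exI conjI ballI allI impI)
 show "is_equivalence S.Sh F.Ct F.nerve.quasi_inverse" by (rule F.nerve.equivalences(1))
 show "is_equivalence \<C>\<^sub>I CtI ext_functor" by (rule ff_es.equivalences(2)[OF ext_functor_ff_es])
 show "naturally_isomorphic \<C>\<^sub>I F.Ct (comp_functor F.nerve.quasi_inverse \<Y>) ext_functor"
  by (rule F.nerve.quasi_inverse_unique[OF is_category_full_subcat[OF is_category_C] is_functor_ext_functor yoneda_nerve])
 show "on_ob ext_functor X = gs X" for X by (simp add: on_ob_ext_functor)
 fix X Y \<theta> a b assume "X \<in> \<I>" "Y \<in> \<I>" "fnl X Y \<theta>" "a \<in> ext M X"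
 then show "app (on_ar ext_functor (arr X Y \<theta>)) (tup a) = tup b \<longleftrightarrow> a @ b \<in> ext M (fst X @ fst Y, \<theta>)"
  by (intro ext_functor_graph \<I>_fics)
qed

end

end

theorem theorem3p1:
  fixes \<Sigma> :: "('s, 'f, 'r) signature"
    and \<T> :: "('s, 'f, 'r, 'i) sequent set"
    and \<I> :: "('s, 'f, 'r, 'i) fic set"
    and \<U> :: "'u set set"
    and M :: "('s, 'f, 'r, 'u) interp"
    and tup :: "'u list \<Rightarrow> 'u"
    and code :: "('s, 'f, 'r, 'i) syn_arrow \<Rightarrow> 'u"
  defines "\<C> \<equiv> syn_cat \<Sigma> \<T>"
    and "\<E> \<equiv> classifying_topos \<U> \<Sigma> \<T>"
    and "G \<equiv> Aut \<Sigma> M"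
    and "\<tau> \<equiv> base_topology (Aut \<Sigma> M) (stabilizer_base \<Sigma> M \<I>)"
  assumes "is_signature \<Sigma>" and "is_theory \<Sigma> \<T>"
    and "ample_index TYPE('i) \<Sigma>"
    and "set_universe TYPE(('s, 'f, 'r, 'i) form) \<U>"
    and "inj tup"
    and "inj_on code (\<Union>X\<in>Obj \<C>. \<Union>Y\<in>Obj \<C>. Hom \<C> X Y)"
    and "atomic_complete_theory \<U> \<Sigma> \<T>"
    and "\<forall>X\<in>\<I>. complete_formula \<Sigma> \<T> X"
    and "\<forall>Y. complete_formula \<Sigma> \<T> Y \<longrightarrow> (\<exists>X\<in>\<I>. \<exists>\<theta>. prv_functional \<Sigma> \<T> X Y \<theta>)"
    and "is_model \<U> \<Sigma> \<T> M"
    and "\<forall>X\<in>\<I>. ext M X \<noteq> {}"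
    and "\<forall>X\<in>\<I>. \<forall>a\<in>ext M X. \<forall>b\<in>ext M X. \<exists>f\<in>carrier G. tup_map (fst X) f a = b"
  shows "algebraic_base G (stabilizer_base \<Sigma> M \<I>) \<and>
    (\<exists>!\<tau>'. topological_group G \<tau>' \<and> nbhd_basis_at \<tau>' \<one>\<^bsub>G\<^esub> (stabilizer_base \<Sigma> M \<I>)) \<and>
    (\<exists>\<Phi> \<Psi>.
       is_equivalence \<E> (Cont \<U> G \<tau>) \<Phi> \<and>
       is_equivalence (full_subcat \<C> \<I>) (Cont_I \<U> \<Sigma> M \<I> \<tau>) \<Psi> \<and>
       naturally_isomorphic (full_subcat \<C> \<I>) (Cont \<U> G \<tau>) (comp_functor \<Phi> (yoneda code \<C>)) \<Psi> \<and>
       (\<forall>X\<in>\<I>. on_ob \<Psi> X = ext_gset tup \<Sigma> M X) \<and>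
       (\<forall>X\<in>\<I>. \<forall>Y\<in>\<I>. \<forall>\<theta>. prv_functional \<Sigma> \<T> X Y \<theta> \<longrightarrow>
          (\<forall>a\<in>ext M X. \<forall>b\<in>ext M Y.
             app (on_ar \<Psi> (syn_arrow \<Sigma> \<T> X Y \<theta>)) (tup a) = tup b \<longleftrightarrow>
             a @ b \<in> ext M (fst X @ fst Y, \<theta>))))"
proof -
  interpret galois_model \<Sigma> \<T> \<U> code M \<I>
  proof unfold_locales
    show "\<exists>x y :: ('s, 'f, 'r, 'i) form. x \<noteq> y" by (intro exI[of _ Verum] exI[of _ Falsum]) (simp add: Falsum_def)
    show "infinite (UNIV :: 'i set)" using assms by (simp add: ample_index_def)
    show "inj_on code (arrows (syn_cat \<Sigma> \<T>))" using assms by (simp add: arrows_def)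
    show "atomic_topos (sheaf_cat \<U> (syn_cat \<Sigma> \<T>) (syn_topology \<Sigma> \<T>))"
      "two_valued_topos (sheaf_cat \<U> (syn_cat \<Sigma> \<T>) (syn_topology \<Sigma> \<T>))"
      using assms by (simp_all add: atomic_complete_theory_def classifying_topos_def)
    show "\<exists>f\<in>automorphisms \<Sigma> M. tup_map (fst X) f a = b" if "X \<in> \<I>" "a \<in> ext M X" "b \<in> ext M X" for X a b
      using assms that by (simp add: Aut_def)
  qed (use assms in blast)+
  show ?thesis
    unfolding \<E>_def classifying_topos_def \<C>_def G_def \<tau>_def
    using algebraic_base base_topology_ex1[OF algebraic_base] representation[OF \<open>inj tup\<close>] by blast
qed

end
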